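(* Let $\Lambda$ be a finite dimensional algebra over a field $k$. Let $T$ be a basic two-term silting complex in $\mathsf{K}^{\rm b}(\mathsf{proj}\,\Lambda)$, with decomposition $T=T_\lambda\oplus T_\rho$ such that there is a triangle $\Lambda\to T'\to T''\to\Lambda[1]$ in $\mathsf{K}^{\rm b}(\mathsf{proj}\,\Lambda)$ with $\mathsf{add}\,T'=\mathsf{add}\,T_\lambda$ and $\mathsf{add}\,T''=\mathsf{add}\,T_\rho$. Consider an $\mathbb R$-linear form $\theta$ defined by $$\theta=\sum_X a_X\langle X,-\rangle : K_0(\mathsf{mod}\,\Lambda)\otimes_{\mathbb Z}\mathbb R\to\mathbb R,$$ where $X$ runs over all indecomposable direct summands of $T_\rho$ and $a_X$ is an arbitrary positive real number for each $X$. Then $$\mathcal W^T:=\mathsf{Fac}\,\mathrm H^0(T)\cap \mathrm H^0(T_\rho)^{\perp}$$ is the $\theta$-semistable subcategory of $\mathsf{mod}\,\Lambda$.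
   Context: $\mathsf{mod}\,\Lambda$ (resp. $\mathsf{proj}\,\Lambda$) is the category of finitely generated right $\Lambda$-modules (resp. projective right $\Lambda$-modules); $\mathsf{K}^{\rm b}(\mathsf{proj}\,\Lambda)$ is the bounded homotopy category and $\mathsf D^{\rm b}(\mathsf{mod}\,\Lambda)$ the bounded derived category. $\mathrm H^i$ denotes $i$-th cohomology. $\mathsf{add}\,M$ consists of direct summands of finite direct sums of copies of $M$; $\mathsf{Fac}\,M$ consists of factor modules of finite direct sums of copies of $M$. $N^{\perp}=\{M\in\mathsf{mod}\,\Lambda\mid\mathrm{Hom}_\Lambda(N,M)=0\}$ for a module $N$. A complex $P\in\mathsf{K}^{\rm b}(\mathsf{proj}\,\Lambda)$ is presilting if $\mathrm{Hom}(P,P[i])=0$ for all $i>0$, and silting if moreover the smallest subcategory of $\mathsf{K}^{\rm b}(\mathsf{proj}\,\Lambda)$ containing $P$ and closed under shifts, cones and direct summands is all of $\mathsf{K}^{\rm b}(\mathsf{proj}\,\Lambda)$. It is two-term if $P^i=0$ for all $i\neq 0,-1$, and basic if its indecomposable direct summands are pairwise non-isomorphic. For every basic two-term silting complex $T$, a decomposition $T=T_\lambda\oplus T_\rho$ with a triangle as in the claim is known to exist. The Euler form is $\langle P,M\rangle=\sum_{i\in\mathbb Z}(-1)^i\dim_k\mathrm{Hom}_{\mathsf D^{\rm b}(\mathsf{mod}\,\Lambda)}(P,M[i])$ for $P\in\mathsf{K}^{\rm b}(\mathsf{proj}\,\Lambda)$, $M\in\mathsf D^{\rm b}(\mathsf{mod}\,\Lambda)$;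 it induces a $\mathbb Z$-linear form $\langle P,-\rangle:K_0(\mathsf{mod}\,\Lambda)\to\mathbb Z$, extended $\mathbb R$-linearly. For an $\mathbb R$-linear form $\theta$ on $K_0(\mathsf{mod}\,\Lambda)\otimes_{\mathbb Z}\mathbb R$, a module $M\in\mathsf{mod}\,\Lambda$ is $\theta$-semistable if $\theta(M)=0$ and $\theta(L)\le0$ for every submodule $L$ of $M$; the $\theta$-semistable subcategory is the full subcategory of all $\theta$-semistable modules. *)

theory Defs
  imports
    "HOL-Algebra.AbelCoset"
    "HOL-Library.Poly_Mapping"
    "HOL-Library.Groups_Big_Fun"
    "Jordan_Normal_Form.VS_Connect"
begin

section \<open>Algebras and right modules\<close>

text \<open>The sort \<open>{ring, monoid_mult}\<close> is that of associative rings with unit; unlike \<open>ring_1\<close>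
  it does not exclude the zero ring.\<close>

locale fd_algebra = vector_space scale
  for scale :: "'k::field \<Rightarrow> 'a::{ring,monoid_mult} \<Rightarrow> 'a" +
  assumes scale_mult_left: "scale c (x * y) = scale c x * y"
    and scale_mult_right: "scale c (x * y) = x * scale c y"
    and finite_dim: "\<exists>B. finite B \<and> span B = UNIV"

text \<open>Right modules are stored in the \<open>module\<close> record of \<open>HOL-Algebra\<close>; \<open>a \<odot>\<^bsub>M\<^esub> x\<close> stands for
  the right action $x \cdot a$, so that \<open>(a * b) \<odot> x = b \<odot> (a \<odot> x)\<close>.  The fields \<open>mult\<close> and
  \<open>one\<close> of the record are never used.\<close>

locale right_module = abelian_group M
  for M :: "('a::{ring,monoid_mult}, 'm) module" (structure) +
  assumes act_closed: "x \<in> carrier M \<Longrightarrow> a \<odot> x \<in> carrier M"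
    and act_add: "\<lbrakk>x \<in> carrier M; y \<in> carrier M\<rbrakk> \<Longrightarrow> a \<odot> (x \<oplus> y) = a \<odot> x \<oplus> a \<odot> y"
    and add_act: "x \<in> carrier M \<Longrightarrow> (a + b) \<odot> x = a \<odot> x \<oplus> b \<odot> x"
    and mult_act: "x \<in> carrier M \<Longrightarrow> (a * b) \<odot> x = b \<odot> (a \<odot> x)"
    and one_act: "x \<in> carrier M \<Longrightarrow> 1 \<odot> x = x"

definition rsubmodule :: "'m set \<Rightarrow> ('a::{ring,monoid_mult}, 'm) module \<Rightarrow> bool" where
  "rsubmodule N M \<longleftrightarrow> additive_subgroup N M \<and> (\<forall>a. \<forall>x\<in>N. a \<odot>\<^bsub>M\<^esub> x \<in> N)"

definition fin_gen :: "('a::{ring,monoid_mult}, 'm) module \<Rightarrow> bool" where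
  "fin_gen M \<longleftrightarrow> (\<exists>S. finite S \<and> S \<subseteq> carrier M \<and>
     (\<forall>N. rsubmodule N M \<and> S \<subseteq> N \<longrightarrow> N = carrier M))"

definition fg_module :: "('a::{ring,monoid_mult}, 'm) module \<Rightarrow> bool" where
  "fg_module M \<longleftrightarrow> right_module M \<and> fin_gen M"

definition rhom :: "('a::{ring,monoid_mult}, 'm) module \<Rightarrow> ('a, 'n) module \<Rightarrow> ('m \<Rightarrow> 'n) set" where
  "rhom M N = {f. (\<forall>x\<in>carrier M. f x \<in> carrier N) \<and>
     (\<forall>x\<in>carrier M. \<forall>y\<in>carrier M. f (x \<oplus>\<^bsub>M\<^esub> y) = f x \<oplus>\<^bsub>N\<^esub> f y) \<and>
     (\<forall>a. \<forall>x\<in>carrier M. f (a \<odot>\<^bsub>M\<^esub> x) = a \<odot>\<^bsub>N\<^esub> f x)}"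

text \<open>The objects of $\mathsf{mod}\,\Lambda$ are the finitely generated modules whose elements
  are sequences in \<open>\<Lambda>\<close>.  A module with $n$ generators is a quotient of $\Lambda^n$, so every
  finitely generated module, over any element type, is isomorphic to one of these
  (lemma \<open>mod_cat_universal\<close> below).\<close>

type_synonym 'a obj = "('a, nat \<Rightarrow> 'a) module"

definition mod_cat :: "('a::{ring,monoid_mult}) obj set" where
  "mod_cat = {M. fg_module M}"

lemma (in right_module) rsubmodule_lin_comb:
  assumes s: "set s \<subseteq> carrier M"
  shows "rsubmodule (range (\<lambda>c. \<Oplus>i\<in>{..<length s}. c i \<odot> s ! i)) M"
    and "set s \<subseteq> range (\<lambda>c. \<Oplus>i\<in>{..<length s}. c i \<odot> s ! i)"
proof -
  let ?E = "\<lambda>c. \<Oplus>i\<in>{..<length s}. c i \<odot> s ! i"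
  have s_in: "s ! i \<in> carrier M" if "i < length s" for i
    using that s by auto
  have F: "(\<lambda>i. c i \<odot> s ! i) \<in> {..<length s} \<rightarrow> carrier M" for c
    using s_in by (auto intro: act_closed)
  have zero_act: "0 \<odot> x = \<zero>" if x: "x \<in> carrier M" for x
  proof -
    have c: "0 \<odot> x \<in> carrier M" using x by (rule act_closed)
    have "0 \<odot> x = 0 \<odot> x \<oplus> 0 \<odot> x" using add_act[OF x, of 0 0] by (simp only: add_0_left)
    thus ?thesis using add.l_cancel_one'[OF c c] by (rule iffD1[rotated])
  qed
  have act_zero: "b \<odot> \<zero> = \<zero>" for b
  proof -
    have c: "b \<odot> \<zero> \<in> carrier M" by (intro act_closed zero_closed)
    have "b \<odot> \<zero> = b \<odot> \<zero> \<oplus> b \<odot> \<zero>"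
      using act_add[of \<zero> \<zero> b] by (simp only: zero_closed l_zero)
    thus ?thesis using add.l_cancel_one'[OF c c] by (rule iffD1[rotated])
  qed
  have E_in: "?E c \<in> carrier M" for c
    using F by (rule finsum_closed)
  have E_add: "?E c \<oplus> ?E d = ?E (\<lambda>i. c i + d i)" for c d
  proof -
    have "?E (\<lambda>i. c i + d i) = (\<Oplus>i\<in>{..<length s}. c i \<odot> s ! i \<oplus> d i \<odot> s ! i)"
      by (rule finsum_cong') (use s_in in \<open>auto intro: act_closed simp: add_act\<close>)
    thus ?thesis using finsum_addf[OF F F] by simp
  qed
  have E_act: "b \<odot> ?E c = ?E (\<lambda>i. c i * b)" for b c
  proof -
    have "b \<odot> (\<Oplus>i\<in>A. c i \<odot> s ! i) = (\<Oplus>i\<in>A. (c i * b) \<odot> s ! i)"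
      if "finite A" "A \<subseteq> {..<length s}" for A
      using that
    proof (induction A rule: finite_induct)
      case empty
      show ?case by (simp add: act_zero)
    next
      case (insert j A)
      have g: "(\<lambda>i. c i \<odot> s ! i) \<in> A \<rightarrow> carrier M" for c
        using insert.prems s_in by (auto intro: act_closed)
      have j: "s ! j \<in> carrier M" using insert.prems s_in by auto
      have "b \<odot> (\<Oplus>i\<in>insert j A. c i \<odot> s ! i) = b \<odot> (c j \<odot> s ! j \<oplus> (\<Oplus>i\<in>A. c i \<odot> s ! i))"
        using insert.hyps g[of c] j by (simp add: finsum_insert act_closed)
      also have "\<dots> = b \<odot> (c j \<odot> s ! j) \<oplus> b \<odot> (\<Oplus>i\<in>A. c i \<odot> s ! i)"
        using g[of c] j by (intro act_add act_closed finsum_closed)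
      also have "\<dots> = (c j * b) \<odot> s ! j \<oplus> (\<Oplus>i\<in>A. (c i * b) \<odot> s ! i)"
        using insert.IH insert.prems j by (simp only: mult_act) simp
      also have "\<dots> = (\<Oplus>i\<in>insert j A. (c i * b) \<odot> s ! i)"
        using insert.hyps g[of "\<lambda>i. c i * b"] j by (simp add: finsum_insert act_closed)
      finally show ?case .
    qed
    thus ?thesis by simp
  qed
  have E_zero: "?E (\<lambda>_. 0) = \<zero>"
  proof -
    have "?E (\<lambda>_. 0) = (\<Oplus>i\<in>{..<length s}. \<zero>)"
      by (rule finsum_cong') (use s_in in \<open>auto simp: zero_act\<close>)
    thus ?thesis by simp
  qed
  have E_neg: "\<ominus> ?E c = ?E (\<lambda>i. - c i)" for c
    by (rule minus_equality) (use E_in in \<open>auto simp: E_add E_zero\<close>)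
  show "rsubmodule (range ?E) M"
    unfolding rsubmodule_def
  proof (intro conjI allI ballI)
    show "additive_subgroup (range ?E) M"
    proof (intro additive_subgroup.intro add.subgroupI)
      show "range ?E \<subseteq> carrier M" using E_in by auto
      show "range ?E \<noteq> {}" by auto
      show "x \<oplus> y \<in> range ?E" if "x \<in> range ?E" "y \<in> range ?E" for x y
        using that E_add by auto
      show "\<ominus> x \<in> range ?E" if "x \<in> range ?E" for x
        using that E_neg by auto
    qed
    show "b \<odot> x \<in> range ?E" if "x \<in> range ?E" for b x
      using that E_act by auto
  qed
  show "set s \<subseteq> range ?E"
  proof
    fix x assume "x \<in> set s"
    then obtain j where j: "j < length s" "x = s ! j" by (auto simp: in_set_conv_nth)
    have "?E (\<lambda>i. if i = j then 1 else 0) = (\<Oplus>i\<in>{..<length s}. if j = i then s ! i else \<zero>)"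
      by (rule finsum_cong') (use s_in in \<open>auto simp: zero_act one_act\<close>)
    also have "\<dots> = x"
      using j s_in by (simp add: finsum_singleton Pi_def)
    finally have "x = ?E (\<lambda>i. if i = j then 1 else 0)" by (rule sym)
    thus "x \<in> range ?E" by (rule range_eqI[where f = ?E and x = "\<lambda>i. if i = j then 1 else 0"])
  qed
qed

lemma mod_cat_universal:
  fixes M :: "('a::{ring,monoid_mult}, 'm) module" (structure)
  assumes "fg_module M"
  shows "\<exists>N\<in>mod_cat. \<exists>f\<in>rhom M N. bij_betw f (carrier M) (carrier N)"
proof -
  interpret right_module M using assms by (simp add: fg_module_def)
  have "fin_gen M" using assms by (simp add: fg_module_def)
  then obtain S where *: "finite S \<and> S \<subseteq> carrier M \<and>
      (\<forall>N. rsubmodule N M \<and> S \<subseteq> N \<longrightarrow> N = carrier M)"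
    unfolding fin_gen_def by (elim exE)
  from * have S: "finite S" "S \<subseteq> carrier M" by simp_all
  have gen: "N = carrier M" if "rsubmodule N M" "S \<subseteq> N" for N
    using * that by simp
  obtain s where s: "set s = S" using S finite_list by blast
  let ?E = "\<lambda>c. \<Oplus>i\<in>{..<length s}. c i \<odot> s ! i"
  have E: "range ?E = carrier M"
  proof (rule gen)
    show "rsubmodule (range ?E) M" using S s by (intro rsubmodule_lin_comb(1)) simp
    have "set s \<subseteq> range ?E" using S s by (intro rsubmodule_lin_comb(2)) simp
    thus "S \<subseteq> range ?E" using s by simp
  qed
  define f where "f x = (SOME c. ?E c = x)" for x
  define g where "g y = ?E y" for y
  have gf: "g (f x) = x" if "x \<in> carrier M" for x
  proof -
    from that E have "x \<in> range ?E" by simp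
    hence "\<exists>c. ?E c = x" by blast
    thus ?thesis unfolding f_def g_def by (rule someI_ex)
  qed
  define N :: "'a obj" where "N = \<lparr>carrier = f ` carrier M, mult = undefined, one = undefined,
    zero = f \<zero>, add = \<lambda>x y. f (g x \<oplus> g y), smult = \<lambda>a x. f (a \<odot> g x)\<rparr>"
  have N_simps: "carrier N = f ` carrier M" "zero N = f \<zero>"
    "add N x y = f (g x \<oplus> g y)" "smult N a x = f (a \<odot> g x)" for x y a
    by (auto simp: N_def)
  have inj: "inj_on f (carrier M)" by (rule inj_on_inverseI[of _ g]) (rule gf)
  have ab: "abelian_group N"
  proof (rule abelian_groupI)
    show "\<zero>\<^bsub>N\<^esub> \<in> carrier N" by (simp add: N_simps)
    fix x assume "x \<in> carrier N"
    then obtain x' where x: "x' \<in> carrier M" "x = f x'" by (auto simp: N_simps)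
    show "\<zero>\<^bsub>N\<^esub> \<oplus>\<^bsub>N\<^esub> x = x" using x by (simp add: N_simps gf)
    show "\<exists>y\<in>carrier N. y \<oplus>\<^bsub>N\<^esub> x = \<zero>\<^bsub>N\<^esub>"
      using x by (intro bexI[of _ "f (\<ominus> x')"]) (simp_all add: N_simps gf l_neg)
    fix y assume "y \<in> carrier N"
    then obtain y' where y: "y' \<in> carrier M" "y = f y'" by (auto simp: N_simps)
    show "x \<oplus>\<^bsub>N\<^esub> y \<in> carrier N" using x y by (simp add: N_simps gf)
    show "x \<oplus>\<^bsub>N\<^esub> y = y \<oplus>\<^bsub>N\<^esub> x" using x y a_comm[of x' y'] by (simp add: N_simps gf)
    fix z assume "z \<in> carrier N"
    then obtain z' where z: "z' \<in> carrier M" "z = f z'" by (auto simp: N_simps)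
    show "x \<oplus>\<^bsub>N\<^esub> y \<oplus>\<^bsub>N\<^esub> z = x \<oplus>\<^bsub>N\<^esub> (y \<oplus>\<^bsub>N\<^esub> z)"
      using x y z by (simp add: N_simps gf a_assoc)
  qed
  interpret N: right_module N
  proof (intro right_module.intro ab right_module_axioms.intro)
    fix b c x assume "x \<in> carrier N"
    then obtain x' where x: "x' \<in> carrier M" "x = f x'" by (auto simp: N_simps)
    show "b \<odot>\<^bsub>N\<^esub> x \<in> carrier N" using x by (simp add: N_simps gf act_closed)
    show "(b + c) \<odot>\<^bsub>N\<^esub> x = b \<odot>\<^bsub>N\<^esub> x \<oplus>\<^bsub>N\<^esub> c \<odot>\<^bsub>N\<^esub> x"
      using x by (simp add: N_simps gf act_closed add_act)
    show "(b * c) \<odot>\<^bsub>N\<^esub> x = c \<odot>\<^bsub>N\<^esub> (b \<odot>\<^bsub>N\<^esub> x)"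
      using x by (simp add: N_simps gf act_closed mult_act)
    show "1 \<odot>\<^bsub>N\<^esub> x = x"
      using x by (simp add: N_simps gf one_act)
    fix y assume "y \<in> carrier N"
    then obtain y' where y: "y' \<in> carrier M" "y = f y'" by (auto simp: N_simps)
    show "b \<odot>\<^bsub>N\<^esub> (x \<oplus>\<^bsub>N\<^esub> y) = b \<odot>\<^bsub>N\<^esub> x \<oplus>\<^bsub>N\<^esub> b \<odot>\<^bsub>N\<^esub> y"
      using x y by (simp add: N_simps gf act_closed act_add)
  qed
  have hom: "f \<in> rhom M N"
    by (auto simp: rhom_def N_simps gf)
  have "fin_gen N"
    unfolding fin_gen_def
  proof (intro exI[of _ "f ` S"] conjI allI impI)
    show "finite (f ` S)" "f ` S \<subseteq> carrier N" using S by (auto simp: N_simps)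
    fix K assume K: "rsubmodule K N \<and> f ` S \<subseteq> K"
    then interpret K: additive_subgroup K N by (simp add: rsubmodule_def)
    define K' where "K' = {x \<in> carrier M. f x \<in> K}"
    have "rsubmodule K' M"
      unfolding rsubmodule_def
    proof (intro conjI allI ballI)
      show "additive_subgroup K' M"
      proof (intro additive_subgroup.intro add.subgroupI)
        show "K' \<subseteq> carrier M" by (auto simp: K'_def)
        show "K' \<noteq> {}" using K.zero_closed by (auto simp: K'_def N_simps)
        show "x \<oplus> y \<in> K'" if "x \<in> K'" "y \<in> K'" for x y
          using that K.a_closed[of "f x" "f y"] by (auto simp: K'_def N_simps gf)
        show "\<ominus> x \<in> K'" if x: "x \<in> K'" for x
        proof -
          have xM: "x \<in> carrier M" "f x \<in> K" using x by (auto simp: K'_def)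
          have "\<ominus>\<^bsub>N\<^esub> f x = f (\<ominus> x)"
            by (rule N.minus_equality) (use xM in \<open>auto simp: N_simps gf l_neg\<close>)
          moreover have "\<ominus>\<^bsub>N\<^esub> f x \<in> K"
            using K.a_subgroup xM(2) unfolding a_inv_def by (rule subgroup.m_inv_closed)
          ultimately show ?thesis using xM by (simp add: K'_def)
        qed
      qed
      show "b \<odot> x \<in> K'" if "x \<in> K'" for b x
      proof -
        have "b \<odot>\<^bsub>N\<^esub> f x \<in> K" using that K by (auto simp: K'_def rsubmodule_def)
        thus ?thesis using that by (auto simp: K'_def N_simps gf act_closed)
      qed
    qed
    moreover have "S \<subseteq> K'" using K S by (auto simp: K'_def)
    ultimately have "K' = carrier M" by (rule gen)
    thus "K = carrier N" using K.a_subset by (auto simp: K'_def N_simps)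
  qed
  hence "N \<in> mod_cat"
    using N.right_module_axioms by (simp add: mod_cat_def fg_module_def)
  moreover have "bij_betw f (carrier M) (carrier N)"
    using inj by (simp add: bij_betw_def N_simps(1))
  ultimately show ?thesis using hom by blast
qed

definition short_exact ::
  "('a::{ring,monoid_mult}) obj \<Rightarrow> 'a obj \<Rightarrow> 'a obj \<Rightarrow> bool" where
  "short_exact L M N \<longleftrightarrow> L \<in> mod_cat \<and> M \<in> mod_cat \<and> N \<in> mod_cat \<and>
     (\<exists>f\<in>rhom L M. \<exists>g\<in>rhom M N. inj_on f (carrier L) \<and> g ` carrier M = carrier N \<and>
        f ` carrier L = {x \<in> carrier M. g x = \<zero>\<^bsub>N\<^esub>})"

definition projective :: "('a::{ring,monoid_mult}) obj \<Rightarrow> bool" where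
  "projective P \<longleftrightarrow> P \<in> mod_cat \<and>
     (\<forall>M\<in>mod_cat. \<forall>N\<in>mod_cat. \<forall>g\<in>rhom M N. g ` carrier M = carrier N \<longrightarrow>
        (\<forall>f\<in>rhom P N. \<exists>h\<in>rhom P M. \<forall>x\<in>carrier P. g (h x) = f x))"

definition zero_mod :: "('a::{ring,monoid_mult}) obj" where
  "zero_mod = \<lparr>carrier = {\<lambda>_. 0}, mult = undefined, one = undefined, zero = \<lambda>_. 0,
     add = \<lambda>_ _ _. 0, smult = \<lambda>_ _ _. 0\<rparr>"

text \<open>$\Lambda$ as a right module over itself, an element being stored at position 0 of a
  sequence.\<close>

definition regular :: "('a::{ring,monoid_mult}) obj" where
  "regular = \<lparr>carrier = {x. \<forall>n>0. x n = 0}, mult = undefined, one = undefined, zero = \<lambda>_. 0,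
     add = \<lambda>x y n. x n + y n, smult = \<lambda>a x n. x n * a\<rparr>"

text \<open>Pairs of sequences are coded as sequences by interleaving.\<close>

definition pr1 :: "(nat \<Rightarrow> 'a) \<Rightarrow> nat \<Rightarrow> 'a" where "pr1 z = (\<lambda>n. z (2 * n))"
definition pr2 :: "(nat \<Rightarrow> 'a) \<Rightarrow> nat \<Rightarrow> 'a" where "pr2 z = (\<lambda>n. z (2 * n + 1))"
definition pair :: "(nat \<Rightarrow> 'a) \<Rightarrow> (nat \<Rightarrow> 'a) \<Rightarrow> nat \<Rightarrow> 'a" where
  "pair x y = (\<lambda>n. if even n then x (n div 2) else y (n div 2))"

definition dsum :: "('a::{ring,monoid_mult}) obj \<Rightarrow> 'a obj \<Rightarrow> 'a obj" where
  "dsum M N = \<lparr>carrier = {z. pr1 z \<in> carrier M \<and> pr2 z \<in> carrier N},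
     mult = undefined, one = undefined, zero = pair \<zero>\<^bsub>M\<^esub> \<zero>\<^bsub>N\<^esub>,
     add = \<lambda>z w. pair (pr1 z \<oplus>\<^bsub>M\<^esub> pr1 w) (pr2 z \<oplus>\<^bsub>N\<^esub> pr2 w),
     smult = \<lambda>a z. pair (a \<odot>\<^bsub>M\<^esub> pr1 z) (a \<odot>\<^bsub>N\<^esub> pr2 z)\<rparr>"

definition mpow :: "nat \<Rightarrow> ('a::{ring,monoid_mult}, 'm) module \<Rightarrow> ('a, nat \<Rightarrow> 'm) module" where
  "mpow n M = \<lparr>carrier = {x. (\<forall>i<n. x i \<in> carrier M) \<and> (\<forall>i\<ge>n. x i = \<zero>\<^bsub>M\<^esub>)},
     mult = undefined, one = undefined, zero = \<lambda>_. \<zero>\<^bsub>M\<^esub>,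
     add = \<lambda>x y i. if i < n then x i \<oplus>\<^bsub>M\<^esub> y i else \<zero>\<^bsub>M\<^esub>,
     smult = \<lambda>a x i. if i < n then a \<odot>\<^bsub>M\<^esub> x i else \<zero>\<^bsub>M\<^esub>\<rparr>"

definition quot_mod ::
  "('a::{ring,monoid_mult}, 'm) module \<Rightarrow> 'm set \<Rightarrow> ('a, 'm set) module" where
  "quot_mod M N = \<lparr>carrier = a_rcosets\<^bsub>M\<^esub> N, mult = undefined, one = undefined, zero = N,
     add = set_add M, smult = \<lambda>a A. \<Union>x\<in>A. N +>\<^bsub>M\<^esub> (a \<odot>\<^bsub>M\<^esub> x)\<rparr>"

definition Fac :: "('a::{ring,monoid_mult}, 'm) module \<Rightarrow> 'a obj set" where
  "Fac N = {M \<in> mod_cat. \<exists>n. \<exists>f\<in>rhom (mpow n N) M. f ` carrier (mpow n N) = carrier M}"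

definition perp :: "('a::{ring,monoid_mult}, 'm) module \<Rightarrow> 'a obj set" where
  "perp N = {M \<in> mod_cat. \<forall>f\<in>rhom N M. \<forall>x\<in>carrier N. f x = \<zero>\<^bsub>M\<^esub>}"


section \<open>Complexes\<close>

record 'a cpx =
  cobj :: "int \<Rightarrow> 'a obj"
  cdiff :: "int \<Rightarrow> (nat \<Rightarrow> 'a) \<Rightarrow> (nat \<Rightarrow> 'a)"

type_synonym 'a cmap = "int \<Rightarrow> (nat \<Rightarrow> 'a) \<Rightarrow> (nat \<Rightarrow> 'a)"

definition is_complex :: "('a::{ring,monoid_mult}) cpx \<Rightarrow> bool" where
  "is_complex X \<longleftrightarrow> (\<forall>i. cobj X i \<in> mod_cat \<and> cdiff X i \<in> rhom (cobj X i) (cobj X (i + 1)) \<and>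
     (\<forall>x\<in>carrier (cobj X i). cdiff X (i + 1) (cdiff X i x) = \<zero>\<^bsub>cobj X (i + 2)\<^esub>))"

definition zero_at :: "('a::{ring,monoid_mult}) cpx \<Rightarrow> int \<Rightarrow> bool" where
  "zero_at X i \<longleftrightarrow> carrier (cobj X i) = {\<zero>\<^bsub>cobj X i\<^esub>}"

definition Cb_mod :: "('a::{ring,monoid_mult}) cpx set" where
  "Cb_mod = {X. is_complex X \<and> finite {i. \<not> zero_at X i}}"

definition Kb_proj :: "('a::{ring,monoid_mult}) cpx set" where
  "Kb_proj = {X \<in> Cb_mod. \<forall>i. projective (cobj X i)}"

definition shift :: "int \<Rightarrow> ('a::{ring,monoid_mult}) cpx \<Rightarrow> 'a cpx" where
  "shift n X = \<lparr>cobj = \<lambda>i. cobj X (i + n),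
     cdiff = \<lambda>i x. if even n then cdiff X (i + n) x
                   else \<ominus>\<^bsub>cobj X (i + n + 1)\<^esub> cdiff X (i + n) x\<rparr>"

definition stalk :: "('a::{ring,monoid_mult}) obj \<Rightarrow> 'a cpx" where
  "stalk M = \<lparr>cobj = \<lambda>i. if i = 0 then M else zero_mod, cdiff = \<lambda>i _. if i = -1 then \<zero>\<^bsub>M\<^esub> else (\<lambda>_. 0)\<rparr>"

definition zero_cpx :: "('a::{ring,monoid_mult}) cpx" where
  "zero_cpx = stalk zero_mod"

definition csum :: "('a::{ring,monoid_mult}) cpx \<Rightarrow> 'a cpx \<Rightarrow> 'a cpx" where
  "csum X Y = \<lparr>cobj = \<lambda>i. dsum (cobj X i) (cobj Y i),
     cdiff = \<lambda>i z. pair (cdiff X i (pr1 z)) (cdiff Y i (pr2 z))\<rparr>"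

definition csum_list :: "('a::{ring,monoid_mult}) cpx list \<Rightarrow> 'a cpx" where
  "csum_list Xs = foldr csum Xs zero_cpx"

definition chom :: "('a::{ring,monoid_mult}) cpx \<Rightarrow> 'a cpx \<Rightarrow> 'a cmap set" where
  "chom X Y = {f. \<forall>i. f i \<in> rhom (cobj X i) (cobj Y i) \<and>
     (\<forall>x\<in>carrier (cobj X i). f (i + 1) (cdiff X i x) = cdiff Y i (f i x))}"

definition comp_map :: "'a cmap \<Rightarrow> 'a cmap \<Rightarrow> 'a cmap" (infixl \<open>\<circ>\<^sub>c\<close> 55) where
  "g \<circ>\<^sub>c f = (\<lambda>i x. g i (f i x))"

definition id_map :: "'a cmap" where "id_map = (\<lambda>_ x. x)"

definition zero_map :: "('a::{ring,monoid_mult}) cpx \<Rightarrow> 'a cmap" where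
  "zero_map Y = (\<lambda>i _. \<zero>\<^bsub>cobj Y i\<^esub>)"

definition add_map :: "('a::{ring,monoid_mult}) cpx \<Rightarrow> 'a cmap \<Rightarrow> 'a cmap \<Rightarrow> 'a cmap" where
  "add_map Y f g = (\<lambda>i x. f i x \<oplus>\<^bsub>cobj Y i\<^esub> g i x)"

text \<open>The $k$-structure of a right $\Lambda$-module is $c\,x = x \cdot (c\,1)$.\<close>

definition scale_map ::
  "('k::field \<Rightarrow> 'a::{ring,monoid_mult} \<Rightarrow> 'a) \<Rightarrow> 'a cpx \<Rightarrow> 'k \<Rightarrow> 'a cmap \<Rightarrow> 'a cmap" where
  "scale_map scale Y c f = (\<lambda>i x. scale c 1 \<odot>\<^bsub>cobj Y i\<^esub> f i x)"

definition homotopic ::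
  "('a::{ring,monoid_mult}) cpx \<Rightarrow> 'a cpx \<Rightarrow> 'a cmap \<Rightarrow> 'a cmap \<Rightarrow> bool" where
  "homotopic X Y f g \<longleftrightarrow> (\<exists>h. (\<forall>i. h i \<in> rhom (cobj X i) (cobj Y (i - 1))) \<and>
     (\<forall>i. \<forall>x\<in>carrier (cobj X i).
        f i x \<ominus>\<^bsub>cobj Y i\<^esub> g i x = cdiff Y (i - 1) (h i x) \<oplus>\<^bsub>cobj Y i\<^esub> h (i + 1) (cdiff X i x)))"

text \<open>Isomorphisms, direct summands etc. of complexes are those of the homotopy category.\<close>

definition K_iso :: "('a::{ring,monoid_mult}) cpx \<Rightarrow> 'a cpx \<Rightarrow> 'a cmap \<Rightarrow> bool" where
  "K_iso X Y f \<longleftrightarrow> f \<in> chom X Y \<and>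
     (\<exists>g\<in>chom Y X. homotopic X X (g \<circ>\<^sub>c f) id_map \<and> homotopic Y Y (f \<circ>\<^sub>c g) id_map)"

definition K_isomorphic :: "('a::{ring,monoid_mult}) cpx \<Rightarrow> 'a cpx \<Rightarrow> bool" (infix \<open>\<simeq>\<^sub>K\<close> 50) where
  "X \<simeq>\<^sub>K Y \<longleftrightarrow> (\<exists>f. K_iso X Y f)"

definition summand :: "('a::{ring,monoid_mult}) cpx \<Rightarrow> 'a cpx \<Rightarrow> bool" where
  "summand X Y \<longleftrightarrow> X \<in> Kb_proj \<and> (\<exists>Z\<in>Kb_proj. csum X Z \<simeq>\<^sub>K Y)"

definition add_cat :: "('a::{ring,monoid_mult}) cpx \<Rightarrow> 'a cpx set" where
  "add_cat Y = {X. \<exists>n. summand X (csum_list (replicate n Y))}"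

definition indecomposable :: "('a::{ring,monoid_mult}) cpx \<Rightarrow> bool" where
  "indecomposable X \<longleftrightarrow> X \<in> Kb_proj \<and> \<not> X \<simeq>\<^sub>K zero_cpx \<and>
     (\<forall>A\<in>Kb_proj. \<forall>B\<in>Kb_proj. X \<simeq>\<^sub>K csum A B \<longrightarrow> A \<simeq>\<^sub>K zero_cpx \<or> B \<simeq>\<^sub>K zero_cpx)"

definition basic :: "('a::{ring,monoid_mult}) cpx \<Rightarrow> bool" where
  "basic X \<longleftrightarrow> (\<forall>Xs. (\<forall>Y\<in>set Xs. indecomposable Y) \<and> X \<simeq>\<^sub>K csum_list Xs \<longrightarrow>
     (\<forall>i<length Xs. \<forall>j<length Xs. i \<noteq> j \<longrightarrow> \<not> Xs ! i \<simeq>\<^sub>K Xs ! j))"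

definition two_term :: "('a::{ring,monoid_mult}) cpx \<Rightarrow> bool" where
  "two_term X \<longleftrightarrow> (\<forall>i. i \<noteq> 0 \<and> i \<noteq> -1 \<longrightarrow> zero_at X i)"

text \<open>Mapping cone: $C(f)^i = X^{i+1} \oplus Y^i$ with differential
  $(x, y) \mapsto (-dx, f x + dy)$.\<close>

definition cone :: "('a::{ring,monoid_mult}) cpx \<Rightarrow> 'a cpx \<Rightarrow> 'a cmap \<Rightarrow> 'a cpx" where
  "cone X Y f = \<lparr>cobj = \<lambda>i. dsum (cobj X (i + 1)) (cobj Y i),
     cdiff = \<lambda>i z. pair (\<ominus>\<^bsub>cobj X (i + 2)\<^esub> cdiff X (i + 1) (pr1 z))
                        (f (i + 1) (pr1 z) \<oplus>\<^bsub>cobj Y (i + 1)\<^esub> cdiff Y i (pr2 z))\<rparr>"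

definition cone_in :: "('a::{ring,monoid_mult}) cpx \<Rightarrow> 'a cmap" where
  "cone_in X = (\<lambda>i y. pair \<zero>\<^bsub>cobj X (i + 1)\<^esub> y)"

definition cone_out :: "'a cmap" where
  "cone_out = (\<lambda>i z. pr1 z)"

definition dist_triangle :: "('a::{ring,monoid_mult}) cpx \<Rightarrow> 'a cpx \<Rightarrow> 'a cpx \<Rightarrow>
    'a cmap \<Rightarrow> 'a cmap \<Rightarrow> 'a cmap \<Rightarrow> bool" where
  "dist_triangle X Y Z u v w \<longleftrightarrow>
     X \<in> Kb_proj \<and> Y \<in> Kb_proj \<and> Z \<in> Kb_proj \<and>
     u \<in> chom X Y \<and> v \<in> chom Y Z \<and> w \<in> chom Z (shift 1 X) \<and>
     (\<exists>X'\<in>Kb_proj. \<exists>Y'\<in>Kb_proj. \<exists>f\<in>chom X' Y'. \<exists>a b c.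
        K_iso X X' a \<and> K_iso Y Y' b \<and> K_iso Z (cone X' Y' f) c \<and>
        homotopic X Y' (b \<circ>\<^sub>c u) (f \<circ>\<^sub>c a) \<and>
        homotopic Y (cone X' Y' f) (c \<circ>\<^sub>c v) (cone_in X' \<circ>\<^sub>c b) \<and>
        homotopic Z (shift 1 X') ((\<lambda>i. a (i + 1)) \<circ>\<^sub>c w) (cone_out \<circ>\<^sub>c c))"

text \<open>Closure under isomorphism is the case \<open>Z = 0\<close> of closure under direct summands.\<close>

inductive_set thick :: "('a::{ring,monoid_mult}) cpx \<Rightarrow> 'a cpx set" for P where
  base: "P \<in> thick P"
| shift: "X \<in> thick P \<Longrightarrow> shift n X \<in> thick P"
| cone: "\<lbrakk>X \<in> thick P; Y \<in> thick P; f \<in> chom X Y\<rbrakk> \<Longrightarrow> cone X Y f \<in> thick P"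
| summand: "\<lbrakk>Y \<in> thick P; summand X Y\<rbrakk> \<Longrightarrow> X \<in> thick P"

definition presilting :: "('a::{ring,monoid_mult}) cpx \<Rightarrow> bool" where
  "presilting P \<longleftrightarrow> P \<in> Kb_proj \<and>
     (\<forall>i>0. \<forall>f\<in>chom P (shift i P). homotopic P (shift i P) f (zero_map (shift i P)))"

definition silting :: "('a::{ring,monoid_mult}) cpx \<Rightarrow> bool" where
  "silting P \<longleftrightarrow> presilting P \<and> thick P = Kb_proj"

definition cocycles :: "int \<Rightarrow> ('a::{ring,monoid_mult}) cpx \<Rightarrow> (nat \<Rightarrow> 'a) set" where
  "cocycles i X = {x \<in> carrier (cobj X i). cdiff X i x = \<zero>\<^bsub>cobj X (i + 1)\<^esub>}"

definition coboundaries :: "int \<Rightarrow> ('a::{ring,monoid_mult}) cpx \<Rightarrow> (nat \<Rightarrow> 'a) set" where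
  "coboundaries i X = cdiff X (i - 1) ` carrier (cobj X (i - 1))"

definition cohom :: "int \<Rightarrow> ('a::{ring,monoid_mult}) cpx \<Rightarrow> ('a, (nat \<Rightarrow> 'a) set) module" where
  "cohom i X = quot_mod ((cobj X i)\<lparr>carrier := cocycles i X\<rparr>) (coboundaries i X)"

definition cohom_map :: "int \<Rightarrow> ('a::{ring,monoid_mult}) cpx \<Rightarrow> 'a cmap \<Rightarrow>
    (nat \<Rightarrow> 'a) set \<Rightarrow> (nat \<Rightarrow> 'a) set" where
  "cohom_map i Y f A = (\<Union>x\<in>A. coboundaries i Y +>\<^bsub>cobj Y i\<^esub> f i x)"

definition quasi_iso :: "('a::{ring,monoid_mult}) cpx \<Rightarrow> 'a cpx \<Rightarrow> 'a cmap \<Rightarrow> bool" where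
  "quasi_iso X Y f \<longleftrightarrow> f \<in> chom X Y \<and>
     (\<forall>i. bij_betw (cohom_map i Y f) (carrier (cohom i X)) (carrier (cohom i Y)))"


section \<open>Morphisms in the bounded derived category\<close>

text \<open>$\mathsf{D}^{\rm b}(\mathsf{mod}\,\Lambda)$ is the localisation of the homotopy category of
  \<open>Cb_mod\<close> at the quasi-isomorphisms: morphisms $X \to Y$ are classes of roofs
  $X \xleftarrow{s} Z \xrightarrow{f} Y$ with $s$ a quasi-isomorphism.  Two roofs have
  representatives with the same $s$, and their sum is then computed on the right legs.\<close>

type_synonym 'a roof = "'a cpx \<times> 'a cmap \<times> 'a cmap"

definition roofs :: "('a::{ring,monoid_mult}) cpx \<Rightarrow> 'a cpx \<Rightarrow> 'a roof set" where
  "roofs X Y = {(Z, s, f). Z \<in> Cb_mod \<and> quasi_iso Z X s \<and> f \<in> chom Z Y}"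

definition roof_rel :: "('a::{ring,monoid_mult}) cpx \<Rightarrow> 'a cpx \<Rightarrow> ('a roof \<times> 'a roof) set" where
  "roof_rel X Y = {((Z, s, f), (Z', s', f')).
     (Z, s, f) \<in> roofs X Y \<and> (Z', s', f') \<in> roofs X Y \<and>
     (\<exists>W\<in>Cb_mod. \<exists>u\<in>chom W Z. \<exists>v\<in>chom W Z'. quasi_iso W X (s \<circ>\<^sub>c u) \<and>
        homotopic W X (s \<circ>\<^sub>c u) (s' \<circ>\<^sub>c v) \<and> homotopic W Y (f \<circ>\<^sub>c u) (f' \<circ>\<^sub>c v))}"

definition Hom_D :: "('k::field \<Rightarrow> 'a::{ring,monoid_mult} \<Rightarrow> 'a) \<Rightarrow> 'a cpx \<Rightarrow> 'a cpx \<Rightarrow>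
    ('k, 'a roof set) module" where
  "Hom_D scale X Y = \<lparr>carrier = roofs X Y // roof_rel X Y, mult = undefined, one = undefined,
     zero = roof_rel X Y `` {(X, id_map, zero_map Y)},
     add = \<lambda>A B. \<Union>{roof_rel X Y `` {(Z, s, add_map Y f g)} | Z s f g.
                       (Z, s, f) \<in> A \<and> (Z, s, g) \<in> B},
     smult = \<lambda>c A. \<Union>{roof_rel X Y `` {(Z, s, scale_map scale Y c f)} | Z s f. (Z, s, f) \<in> A}\<rparr>"

definition euler ::
  "('k::field \<Rightarrow> 'a::{ring,monoid_mult} \<Rightarrow> 'a) \<Rightarrow> 'a cpx \<Rightarrow> 'a cpx \<Rightarrow> int" where
  "euler scale P M = Sum_any (\<lambda>i::int. (if even i then 1 else - 1) *
     int (vectorspace.dim (class_ring :: 'k ring) (Hom_D scale P (shift i M))))"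


section \<open>The real Grothendieck group and semistability\<close>

text \<open>$K_0(\mathsf{mod}\,\Lambda) \otimes_{\mathbb Z} \mathbb R$ is presented as a real vector space
  by the generators and relations that present $K_0(\mathsf{mod}\,\Lambda)$ as an abelian group:
  formal real combinations of modules, modulo the span of the $[M] - [L] - [N]$ for
  short exact sequences $0 \to L \to M \to N \to 0$.\<close>

inductive_set K0_relations :: "(('a::{ring,monoid_mult}) obj \<Rightarrow>\<^sub>0 real) set" where
  zero: "0 \<in> K0_relations"
| step: "\<lbrakk>v \<in> K0_relations; short_exact L M N\<rbrakk> \<Longrightarrow>
    v + Poly_Mapping.single M r - Poly_Mapping.single L r - Poly_Mapping.single N r
      \<in> K0_relations"

definition K0_equiv :: "((('a::{ring,monoid_mult}) obj \<Rightarrow>\<^sub>0 real) \<times> ('a obj \<Rightarrow>\<^sub>0 real)) set" where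
  "K0_equiv = {(v, w). Poly_Mapping.keys v \<subseteq> mod_cat \<and> Poly_Mapping.keys w \<subseteq> mod_cat \<and>
     v - w \<in> K0_relations}"

type_synonym 'a K0_elem = "('a obj \<Rightarrow>\<^sub>0 real) set"

definition K0_real :: "('a::{ring,monoid_mult}) K0_elem set" where
  "K0_real = {v. Poly_Mapping.keys v \<subseteq> mod_cat} // K0_equiv"

definition K0_class :: "('a::{ring,monoid_mult}) obj \<Rightarrow> 'a K0_elem" where
  "K0_class M = K0_equiv `` {Poly_Mapping.single M 1}"

definition euler_form ::
  "('k::field \<Rightarrow> 'a::{ring,monoid_mult} \<Rightarrow> 'a) \<Rightarrow> 'a cpx \<Rightarrow> 'a K0_elem \<Rightarrow> real" where
  "euler_form scale P c = (THE r. \<forall>v\<in>c.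
     r = (\<Sum>M\<in>Poly_Mapping.keys v. Poly_Mapping.lookup v M * real_of_int (euler scale P (stalk M))))"

definition semistable :: "('a K0_elem \<Rightarrow> real) \<Rightarrow> ('a::{ring,monoid_mult}) obj set" where
  "semistable \<theta> = {M \<in> mod_cat. \<theta> (K0_class M) = 0 \<and>
     (\<forall>L. rsubmodule L M \<longrightarrow> \<theta> (K0_class (M\<lparr>carrier := L\<rparr>)) \<le> 0)}"

definition W_cat :: "('a::{ring,monoid_mult}) cpx \<Rightarrow> 'a cpx \<Rightarrow> 'a obj set" where
  "W_cat T Tr = Fac (cohom 0 T) \<inter> perp (cohom 0 Tr)"

text \<open>Representatives of the isomorphism classes of indecomposable direct summands of \<open>X\<close>
  (a finite set by the Krull-Schmidt theorem).\<close>

definition indec_summands :: "('a::{ring,monoid_mult}) cpx \<Rightarrow> 'a cpx set \<Rightarrow> bool" where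
  "indec_summands X I \<longleftrightarrow> finite I \<and> (\<forall>Y\<in>I. indecomposable Y \<and> summand Y X) \<and>
     (\<forall>Y. indecomposable Y \<and> summand Y X \<longrightarrow> (\<exists>!Z. Z \<in> I \<and> Y \<simeq>\<^sub>K Z))"

end

theory Submission
  imports Defs
begin

text \<open>
  For a summand \<open>X\<close> of a two-term complex, only \<open>Hom(X, M)\<close> and \<open>Hom(X, M[1])\<close> contribute to the Euler
  form on a module \<open>M\<close>, so
  $$\theta(M) = \sum_X a_X\,(\dim \mathrm{Hom}(X, M) - \dim \mathrm{Hom}(X, M[1]))$$
  with \<open>X\<close> running over the indecomposable summands of $T_\rho$.  The two conditions that define $\mathcal{W}^T$
  kill both contributions: presilting gives $\mathrm{Hom}(T, M[1]) = 0$ for \<open>M\<close> in $\mathsf{Fac}\,\mathrm{H}^0(T)$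
  (\<open>trace_sub_vanish\<close>), and \<open>M\<close> in $\mathrm{H}^0(T_\rho)^\perp$ means $\mathrm{Hom}(T_\rho, M) = 0$ (\<open>perp_cohom_iff\<close>).  Hence
  $\theta(M) = 0$.  For a submodule \<open>L\<close> of \<open>M\<close> the spaces $\mathrm{Hom}(X, L)$ still vanish, only the negative terms
  survive, and $\theta(L) \le 0$.

  Conversely let \<open>M\<close> be semistable, \<open>L\<close> the trace of $\mathrm{H}^0(T)$ in \<open>M\<close>, and \<open>N = M / L\<close>.  Then $\mathrm{Hom}(T, L[1]) = 0$
  and $\mathrm{Hom}(T, N) = 0$ (\<open>trace_quotient_vanish\<close>), so $\theta$ is a sum of nonnegative terms on \<open>L\<close> and of nonpositive
  terms on \<open>N\<close>.  Semistability gives $\theta(L) \le 0$, so all terms on \<open>L\<close> vanish because the coefficients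
  are positive; additivity then gives $\theta(N) = 0$, so all terms on \<open>N\<close> vanish too.  Thus
  $\mathrm{Hom}(T_\rho, L) = 0$ and $\mathrm{Hom}(T_\rho, N[1]) = 0$.  The triangle places $\mathrm{Hom}(\Lambda, N) = N$ between
  $\mathrm{Hom}(T', N) = 0$ and $\mathrm{Hom}(T'', N[1]) = 0$ (\<open>hom_vanish_cone\<close>), so \<open>N = 0\<close> and \<open>M = L\<close> lies in $\mathcal{W}^T$.

  Three facts support this argument.  Morphisms out of a bounded complex of projectives in the derived
  category are homotopy classes of chain maps, because such complexes map trivially to acyclic ones; so
  their dimensions can be read off from the complex \<open>Hom(X, M)\<close> (\<open>Hom_D_stalk\<close>).  The Euler form is
  the alternating sum of the dimensions of its terms and therefore additive on short exact sequences, which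
  makes it a function on the Grothendieck group (\<open>euler_exact\<close>, \<open>euler_form_class\<close>).  And vanishing of
  morphisms out of a complex is decided by its indecomposable summands (\<open>hom_vanish_indec_summands\<close>).
\<close>

section \<open>Finite-dimensional vector spaces\<close>

definition fin_dim_space :: "('k::field, 'v) module \<Rightarrow> bool" where
  "fin_dim_space V \<longleftrightarrow> vectorspace class_ring V \<and> vectorspace.fin_dim class_ring V"

definition vdim :: "('k::field, 'v) module \<Rightarrow> nat" where
  "vdim V = vectorspace.dim (class_ring :: 'k ring) V"

lemma vectorspaceI:
  fixes V :: "('k::field, 'v) module"
  assumes "\<zero>\<^bsub>V\<^esub> \<in> carrier V"
    and "\<And>x y. x \<in> carrier V \<Longrightarrow> y \<in> carrier V \<Longrightarrow> x \<oplus>\<^bsub>V\<^esub> y \<in> carrier V"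
    and "\<And>c x. x \<in> carrier V \<Longrightarrow> c \<odot>\<^bsub>V\<^esub> x \<in> carrier V"
    and "\<And>x y. x \<in> carrier V \<Longrightarrow> y \<in> carrier V \<Longrightarrow> x \<oplus>\<^bsub>V\<^esub> y = y \<oplus>\<^bsub>V\<^esub> x"
    and "\<And>x y z. x \<in> carrier V \<Longrightarrow> y \<in> carrier V \<Longrightarrow> z \<in> carrier V \<Longrightarrow>
      (x \<oplus>\<^bsub>V\<^esub> y) \<oplus>\<^bsub>V\<^esub> z = x \<oplus>\<^bsub>V\<^esub> (y \<oplus>\<^bsub>V\<^esub> z)"
    and "\<And>x. x \<in> carrier V \<Longrightarrow> x \<oplus>\<^bsub>V\<^esub> \<zero>\<^bsub>V\<^esub> = x"
    and "\<And>x. x \<in> carrier V \<Longrightarrow> x \<oplus>\<^bsub>V\<^esub> (- 1) \<odot>\<^bsub>V\<^esub> x = \<zero>\<^bsub>V\<^esub>"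
    and "\<And>c d x. x \<in> carrier V \<Longrightarrow> (c * d) \<odot>\<^bsub>V\<^esub> x = c \<odot>\<^bsub>V\<^esub> (d \<odot>\<^bsub>V\<^esub> x)"
    and "\<And>x. x \<in> carrier V \<Longrightarrow> 1 \<odot>\<^bsub>V\<^esub> x = x"
    and "\<And>c d x. x \<in> carrier V \<Longrightarrow> (c + d) \<odot>\<^bsub>V\<^esub> x = c \<odot>\<^bsub>V\<^esub> x \<oplus>\<^bsub>V\<^esub> d \<odot>\<^bsub>V\<^esub> x"
    and "\<And>c x y. x \<in> carrier V \<Longrightarrow> y \<in> carrier V \<Longrightarrow>
      c \<odot>\<^bsub>V\<^esub> (x \<oplus>\<^bsub>V\<^esub> y) = c \<odot>\<^bsub>V\<^esub> x \<oplus>\<^bsub>V\<^esub> c \<odot>\<^bsub>V\<^esub> y"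
  shows "vectorspace class_ring V"
proof (rule vs_criteria[OF class_field])
  show "\<forall>v\<in>carrier V. \<exists>w\<in>carrier V. v \<oplus>\<^bsub>V\<^esub> w = \<zero>\<^bsub>V\<^esub>"
    using assms(3,7) by blast
qed (simp_all only: partial_object.simps monoid.simps ring.simps UNIV_I,
  use assms(1-6,8-) in \<open>simp_all del: ball_simps\<close>)

text \<open>The morphism spaces of the derived category are reached only through a surjection from an explicit
  space of homomorphisms; the vector space axioms are carried over along it.\<close>

lemma vectorspace_image:
  fixes V :: "('k::field, 'v) module" and W :: "('k, 'w) module"
  assumes V: "vectorspace class_ring V" and f: "f ` carrier V = carrier W"
    and add: "\<And>x y. x \<in> carrier V \<Longrightarrow> y \<in> carrier V \<Longrightarrow> f (x \<oplus>\<^bsub>V\<^esub> y) = f x \<oplus>\<^bsub>W\<^esub> f y"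
    and act: "\<And>c x. x \<in> carrier V \<Longrightarrow> f (c \<odot>\<^bsub>V\<^esub> x) = c \<odot>\<^bsub>W\<^esub> f x"
    and zero: "f \<zero>\<^bsub>V\<^esub> = \<zero>\<^bsub>W\<^esub>"
  shows "vectorspace class_ring W"
proof -
  interpret V: vectorspace class_ring V by (rule V)
  have fV: "f x \<in> carrier W" if "x \<in> carrier V" for x using that f by auto
  have act_c: "c \<odot>\<^bsub>V\<^esub> x \<in> carrier V" if "x \<in> carrier V" for c x
    using that V.smult_closed[of c x] by simp
  have act_neg: "x \<oplus>\<^bsub>V\<^esub> (- 1) \<odot>\<^bsub>V\<^esub> x = \<zero>\<^bsub>V\<^esub>" if x: "x \<in> carrier V" for x
    using V.smult_l_minus[of 1 x] V.smult_one[of x] x V.M.r_neg[of x] by (simp add: class_ring_simps)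
  have sur: "\<exists>x'\<in>carrier V. x = f x'" if "x \<in> carrier W" for x using that f by auto
  show ?thesis
  proof (rule vectorspaceI)
    show "\<zero>\<^bsub>W\<^esub> \<in> carrier W" using fV[of "\<zero>\<^bsub>V\<^esub>"] zero by simp
  next
    fix x assume "x \<in> carrier W"
    then obtain x' where x: "x' \<in> carrier V" "x = f x'" using sur by blast
    show "c \<odot>\<^bsub>W\<^esub> x \<in> carrier W" for c
      using x act_c fV by (simp flip: act)
    show "x \<oplus>\<^bsub>W\<^esub> \<zero>\<^bsub>W\<^esub> = x" using x by (simp flip: add zero)
    show "x \<oplus>\<^bsub>W\<^esub> (- 1) \<odot>\<^bsub>W\<^esub> x = \<zero>\<^bsub>W\<^esub>" using x act_c by (simp add: act_neg zero flip: add act)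
    show "(c * d) \<odot>\<^bsub>W\<^esub> x = c \<odot>\<^bsub>W\<^esub> (d \<odot>\<^bsub>W\<^esub> x)" for c d
      using x act_c V.smult_assoc1[of c d x'] by (simp flip: act)
    show "1 \<odot>\<^bsub>W\<^esub> x = x" using x V.smult_one[of x'] by (simp flip: act)
    show "(c + d) \<odot>\<^bsub>W\<^esub> x = c \<odot>\<^bsub>W\<^esub> x \<oplus>\<^bsub>W\<^esub> d \<odot>\<^bsub>W\<^esub> x" for c d
      using x act_c V.smult_l_distr[of c d x'] by (simp flip: act add)
    fix y assume "y \<in> carrier W"
    then obtain y' where y: "y' \<in> carrier V" "y = f y'" using sur by blast
    show "x \<oplus>\<^bsub>W\<^esub> y \<in> carrier W" using x y fV by (simp flip: add)
    show "x \<oplus>\<^bsub>W\<^esub> y = y \<oplus>\<^bsub>W\<^esub> x" using x y V.M.a_comm[of x' y'] by (simp flip: add)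
    show "c \<odot>\<^bsub>W\<^esub> (x \<oplus>\<^bsub>W\<^esub> y) = c \<odot>\<^bsub>W\<^esub> x \<oplus>\<^bsub>W\<^esub> c \<odot>\<^bsub>W\<^esub> y" for c
      using x y act_c V.smult_r_distr[of c x' y'] by (simp flip: act add)
    fix z assume "z \<in> carrier W"
    then obtain z' where z: "z' \<in> carrier V" "z = f z'" using sur by blast
    show "x \<oplus>\<^bsub>W\<^esub> y \<oplus>\<^bsub>W\<^esub> z = x \<oplus>\<^bsub>W\<^esub> (y \<oplus>\<^bsub>W\<^esub> z)"
      using x y z V.M.a_assoc[of x' y' z'] by (simp flip: add)
  qed
qed

lemma rank_nullity_sum:
  fixes V :: "('k::field, 'v) module" and W :: "('k, 'w) module"
  assumes V: "fin_dim_space V" and W: "vectorspace class_ring W" and f: "f ` carrier V = carrier W"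
    and add: "\<And>x y. x \<in> carrier V \<Longrightarrow> y \<in> carrier V \<Longrightarrow> f (x \<oplus>\<^bsub>V\<^esub> y) = f x \<oplus>\<^bsub>W\<^esub> f y"
    and act: "\<And>c x. x \<in> carrier V \<Longrightarrow> f (c \<odot>\<^bsub>V\<^esub> x) = c \<odot>\<^bsub>W\<^esub> f x"
  shows "fin_dim_space W" "vdim V = vdim W + vdim (V\<lparr>carrier := {x \<in> carrier V. f x = \<zero>\<^bsub>W\<^esub>}\<rparr>)"
proof -
  interpret V: vectorspace class_ring V using V by (simp add: fin_dim_space_def)
  interpret W: vectorspace class_ring W by (rule W)
  interpret linear_map class_ring V W f
    by unfold_locales (use f add act in \<open>auto simp: LinearCombinations.module_hom_def\<close>)
  have fd: "V.fin_dim" using V by (simp add: fin_dim_space_def)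
  show "fin_dim_space W" using surj_fin_dim[OF fd f] W by (simp add: fin_dim_space_def)
  show "vdim V = vdim W + vdim (V\<lparr>carrier := {x \<in> carrier V. f x = \<zero>\<^bsub>W\<^esub>}\<rparr>)"
    using rank_nullity[OF fd] surj_imp_imT_carrier[OF f] by (simp add: vdim_def ker_def)
qed

lemma vs_subspaceI:
  fixes V :: "('k::field, 'v) module"
  assumes V: "vectorspace class_ring V" and "U \<subseteq> carrier V" "\<zero>\<^bsub>V\<^esub> \<in> U"
    and "\<And>x y. x \<in> U \<Longrightarrow> y \<in> U \<Longrightarrow> x \<oplus>\<^bsub>V\<^esub> y \<in> U"
    and "\<And>c x. x \<in> U \<Longrightarrow> c \<odot>\<^bsub>V\<^esub> x \<in> U"
  shows "VectorSpace.subspace class_ring U V"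
  by (intro VectorSpace.subspace.intro V LinearCombinations.submodule.intro)
    (use assms in \<open>auto simp: vectorspace_def\<close>)

lemma vectorspace_subspace:
  assumes "VectorSpace.subspace class_ring U V"
  shows "vectorspace class_ring (V\<lparr>carrier := U\<rparr>)"
  using assms vectorspace.subspace_is_vs VectorSpace.subspace.vs by blast

text \<open>A largest linearly independent subset of the subspace is a basis of it and remains independent in
  the whole space; if it has as many elements as the whole space has dimensions, it spans everything.\<close>

lemma fin_dim_subspace:
  fixes V :: "('k::field, 'v) module"
  assumes V: "fin_dim_space V" and U: "VectorSpace.subspace class_ring U V"
  shows "fin_dim_space (V\<lparr>carrier := U\<rparr>)" "vdim (V\<lparr>carrier := U\<rparr>) \<le> vdim V"
    "vdim (V\<lparr>carrier := U\<rparr>) = vdim V \<Longrightarrow> U = carrier V"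
proof -
  interpret V: vectorspace class_ring V using V by (simp add: fin_dim_space_def)
  have fd: "V.fin_dim" using V by (simp add: fin_dim_space_def)
  have sub: "LinearCombinations.submodule class_ring U V" using U by (simp add: VectorSpace.subspace_def)
  hence UV: "U \<subseteq> carrier V" by (simp add: LinearCombinations.submodule_def)
  interpret U: vectorspace class_ring "V\<lparr>carrier := U\<rparr>" by (rule vectorspace_subspace[OF U])
  have li: "U.lin_dep S = V.lin_dep S" and span: "U.span S = V.span S" if "S \<subseteq> U" for S
    using V.span_li_not_depend[OF that sub] by simp_all
  have bd: "finite S \<and> card S \<le> V.dim" if "S \<subseteq> U \<and> \<not> U.lin_dep S" for S
    using that li[of S] V.li_le_dim[OF fd, of S] UV by blast
  have "\<exists>A. finite A \<and> maximal A (\<lambda>S. S \<subseteq> U \<and> \<not> U.lin_dep S)"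
  proof (rule maximal_exists[where B = "{}"])
    show "\<And>A. A \<subseteq> U \<and> \<not> U.lin_dep A \<Longrightarrow> finite A \<and> card A \<le> V.dim" using bd by blast
    show "{} \<subseteq> U \<and> \<not> U.lin_dep {}" by (simp add: U.lin_dep_def)
  qed
  then obtain A where A': "finite A \<and> maximal A (\<lambda>S. S \<subseteq> U \<and> \<not> U.lin_dep S)"
    by (elim exE)
  have cU: "carrier (V\<lparr>carrier := U\<rparr>) = U" by simp
  have A: "finite A" "maximal A (\<lambda>S. S \<subseteq> carrier (V\<lparr>carrier := U\<rparr>) \<and> \<not> U.lin_dep S)"
    unfolding cU by (rule conjunct1[OF A'], rule conjunct2[OF A'])
  have basis: "U.basis A" by (rule U.max_li_is_basis[OF A(2)])
  have AU: "A \<subseteq> U" "\<not> U.lin_dep A" "U.span A = U"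
    using basis unfolding U.basis_def cU by blast+
  have dimU: "U.dim = card A" using U.dim_basis[OF A(1) basis] .
  show "fin_dim_space (V\<lparr>carrier := U\<rparr>)"
    unfolding fin_dim_space_def U.fin_dim_def
    using U.vectorspace_axioms A(1) AU by (intro conjI exI[of _ A]) simp_all
  show "vdim (V\<lparr>carrier := U\<rparr>) \<le> vdim V"
    using bd[of A] AU dimU by (simp add: vdim_def)
  assume "vdim (V\<lparr>carrier := U\<rparr>) = vdim V"
  hence "V.dim \<le> card A" using dimU by (simp add: vdim_def)
  hence "V.basis A" using V.dim_li_is_basis[OF fd A(1)] AU li[OF AU(1)] UV by blast
  hence "V.span A = carrier V" by (simp add: V.basis_def)
  thus "U = carrier V" using span[OF AU(1)] AU(3) by simp
qed

lemma vdim_eq_0: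
  fixes V :: "('k::field, 'v) module"
  assumes V: "fin_dim_space V"
  shows "vdim V = 0 \<longleftrightarrow> carrier V = {\<zero>\<^bsub>V\<^esub>}"
proof -
  interpret V: vectorspace class_ring V using V by (simp add: fin_dim_space_def)
  have fd: "V.fin_dim" using V by (simp add: fin_dim_space_def)
  obtain B where B: "finite B" "V.basis B" using V.finite_basis_exists[OF fd] by blast
  have d: "vdim V = card B" using V.dim_basis[OF B] by (simp add: vdim_def)
  show ?thesis
  proof
    assume "vdim V = 0"
    hence "B = {}" using d B by simp
    thus "carrier V = {\<zero>\<^bsub>V\<^esub>}" using B V.span_empty by (simp add: V.basis_def)
  next
    assume "carrier V = {\<zero>\<^bsub>V\<^esub>}"
    hence "V.gen_set {}" using V.span_empty by simp
    thus "vdim V = 0" using V.gen_ge_dim[of "{}"] by (simp add: vdim_def)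
  qed
qed

lemma vdim_iso:
  fixes V :: "('k::field, 'v) module" and W :: "('k, 'w) module"
  assumes V: "fin_dim_space V" and W: "vectorspace class_ring W" and f: "bij_betw f (carrier V) (carrier W)"
    and add: "\<And>x y. x \<in> carrier V \<Longrightarrow> y \<in> carrier V \<Longrightarrow> f (x \<oplus>\<^bsub>V\<^esub> y) = f x \<oplus>\<^bsub>W\<^esub> f y"
    and act: "\<And>c x. x \<in> carrier V \<Longrightarrow> f (c \<odot>\<^bsub>V\<^esub> x) = c \<odot>\<^bsub>W\<^esub> f x"
  shows "fin_dim_space W" "vdim V = vdim W"
proof -
  interpret V: vectorspace class_ring V using V by (simp add: fin_dim_space_def)
  interpret W: vectorspace class_ring W by (rule W)
  have im: "f ` carrier V = carrier W" and inj: "inj_on f (carrier V)" using f by (auto simp: bij_betw_def)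
  have fc: "f x \<in> carrier W" if "x \<in> carrier V" for x using im that by auto
  have "f \<zero>\<^bsub>V\<^esub> = \<zero>\<^bsub>W\<^esub>" using add[of "\<zero>\<^bsub>V\<^esub>" "\<zero>\<^bsub>V\<^esub>"] fc[of "\<zero>\<^bsub>V\<^esub>"] W.M.add.l_cancel_one' by simp
  hence K: "{x \<in> carrier V. f x = \<zero>\<^bsub>W\<^esub>} = {\<zero>\<^bsub>V\<^esub>}"
    using V.M.zero_closed by (auto intro: inj_onD[OF inj])
  have s: "VectorSpace.subspace class_ring {\<zero>\<^bsub>V\<^esub>} V"
  proof (rule vs_subspaceI[OF V.vectorspace_axioms])
    show "c \<odot>\<^bsub>V\<^esub> x \<in> {\<zero>\<^bsub>V\<^esub>}" if "x \<in> {\<zero>\<^bsub>V\<^esub>}" for c x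
      using that V.smult_r_null[of c] by (simp only: singleton_iff partial_object.simps UNIV_I)
    show "x \<oplus>\<^bsub>V\<^esub> y \<in> {\<zero>\<^bsub>V\<^esub>}" if "x \<in> {\<zero>\<^bsub>V\<^esub>}" "y \<in> {\<zero>\<^bsub>V\<^esub>}" for x y
      using that V.M.r_zero[OF V.M.zero_closed] by (simp only: singleton_iff)
  qed (use V.M.zero_closed in blast)+
  have k0: "fin_dim_space (V\<lparr>carrier := {\<zero>\<^bsub>V\<^esub>}\<rparr>)" by (rule fin_dim_subspace(1)[OF V s])
  have "carrier (V\<lparr>carrier := {\<zero>\<^bsub>V\<^esub>}\<rparr>) = {\<zero>\<^bsub>V\<lparr>carrier := {\<zero>\<^bsub>V\<^esub>}\<rparr>\<^esub>}"
    by simp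
  hence d0: "vdim (V\<lparr>carrier := {\<zero>\<^bsub>V\<^esub>}\<rparr>) = 0" using vdim_eq_0[OF k0] by blast
  show "fin_dim_space W" by (rule rank_nullity_sum(1)[OF V W im add act])
  show "vdim V = vdim W" using rank_nullity_sum(2)[OF V W im add act] unfolding K d0 by linarith
qed

text \<open>Preimages of a finite spanning set of the image, together with a finite spanning set of the kernel,
  span \<open>V\<close>.\<close>

lemma fin_dim_extension:
  fixes V :: "('k::field, 'v) module" and W :: "('k, 'w) module"
  assumes V: "vectorspace class_ring V" and W: "fin_dim_space W"
    and f: "\<And>x. x \<in> carrier V \<Longrightarrow> f x \<in> carrier W"
    and add: "\<And>x y. x \<in> carrier V \<Longrightarrow> y \<in> carrier V \<Longrightarrow> f (x \<oplus>\<^bsub>V\<^esub> y) = f x \<oplus>\<^bsub>W\<^esub> f y"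
    and act: "\<And>c x. x \<in> carrier V \<Longrightarrow> f (c \<odot>\<^bsub>V\<^esub> x) = c \<odot>\<^bsub>W\<^esub> f x"
    and ker: "fin_dim_space (V\<lparr>carrier := {x \<in> carrier V. f x = \<zero>\<^bsub>W\<^esub>}\<rparr>)"
  shows "fin_dim_space V"
proof -
  interpret V: vectorspace class_ring V by (rule V)
  interpret W: vectorspace class_ring W using W by (simp add: fin_dim_space_def)
  interpret linear_map class_ring V W f
    by unfold_locales (use f add act in \<open>auto simp: LinearCombinations.module_hom_def\<close>)
  have kerT: "kerT = {x \<in> carrier V. f x = \<zero>\<^bsub>W\<^esub>}" by (simp add: ker_def)
  have imT: "imT = f ` carrier V" by (simp add: im_def)
  interpret K: vectorspace class_ring "V\<lparr>carrier := kerT\<rparr>"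
    by (rule V.subspace_is_vs[OF kerT_is_subspace])
  interpret U: vectorspace class_ring "W\<lparr>carrier := imT\<rparr>"
    by (rule W.subspace_is_vs[OF imT_is_subspace])
  have "K.fin_dim" using ker unfolding fin_dim_space_def kerT by blast
  then obtain C where C: "finite C" "C \<subseteq> kerT" "K.span C = kerT"
    by (auto simp: K.fin_dim_def)
  have "U.fin_dim" using fin_dim_subspace(1)[OF W imT_is_subspace] unfolding fin_dim_space_def by blast
  then obtain A where A0: "finite A" "A \<subseteq> carrier (W.vs imT)" "U.span A = carrier (W.vs imT)"
    unfolding U.fin_dim_def by blast
  have A: "finite A" "A \<subseteq> f ` carrier V" "U.span A = imT"
    using A0 imT by (simp_all only: W.carrier_vs_is_self)
  obtain A' where A': "finite A'" "A' \<subseteq> carrier V" "A = f ` A'"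
    using finite_subset_image[OF A(1,2)] by blast
  have CV: "C \<subseteq> carrier V" using C(2) kerT by auto
  define Y where "Y = V.span (A' \<union> C)"
  have AC: "A' \<union> C \<subseteq> carrier V" using A'(2) CV by blast
  have Ysub: "LinearCombinations.submodule class_ring Y V"
    unfolding Y_def by (rule V.span_is_submodule[OF AC])
  have Yin: "A' \<union> C \<subseteq> Y" unfolding Y_def by (rule V.in_own_span[OF AC])
  have Y: "Y \<subseteq> carrier V" "\<zero>\<^bsub>V\<^esub> \<in> Y" "\<And>x y. x \<in> Y \<Longrightarrow> y \<in> Y \<Longrightarrow> x \<oplus>\<^bsub>V\<^esub> y \<in> Y"
    "\<And>c x. x \<in> Y \<Longrightarrow> c \<odot>\<^bsub>V\<^esub> x \<in> Y"
    using Ysub by (auto simp: LinearCombinations.submodule_def)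
  have YV: "x \<in> carrier V" if "x \<in> Y" for x using that Y(1) by blast
  have "LinearCombinations.submodule class_ring (f ` Y) W"
  proof -
    have "VectorSpace.subspace class_ring (f ` Y) W"
    proof (rule vs_subspaceI[OF W.vectorspace_axioms])
      show "f ` Y \<subseteq> carrier W" using YV f by auto
      show "\<zero>\<^bsub>W\<^esub> \<in> f ` Y" using Y(2) f0_is_0 by (metis image_eqI)
      show "x \<oplus>\<^bsub>W\<^esub> y \<in> f ` Y" if "x \<in> f ` Y" "y \<in> f ` Y" for x y
      proof -
        from that obtain x' y' where *: "x' \<in> Y" "x = f x'" "y' \<in> Y" "y = f y'" by blast
        have "x \<oplus>\<^bsub>W\<^esub> y = f (x' \<oplus>\<^bsub>V\<^esub> y')" unfolding *(2,4) by (rule add[symmetric, OF YV YV]) fact+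
        thus ?thesis using Y(3)[OF *(1,3)] by blast
      qed
      show "c \<odot>\<^bsub>W\<^esub> x \<in> f ` Y" if "x \<in> f ` Y" for c x
      proof -
        from that obtain x' where *: "x' \<in> Y" "x = f x'" by blast
        have "c \<odot>\<^bsub>W\<^esub> x = f (c \<odot>\<^bsub>V\<^esub> x')" unfolding *(2) by (rule act[symmetric, OF YV]) fact
        thus ?thesis using Y(4)[OF *(1)] by blast
      qed
    qed
    thus ?thesis by (simp add: VectorSpace.subspace_def)
  qed
  moreover have "A \<subseteq> f ` Y" unfolding A'(3) using Yin by blast
  ultimately have WY: "W.span A \<subseteq> f ` Y" by (intro W.span_is_subset)
  have UW: "U.span A = W.span A"
    using W.span_li_not_depend(1)[of A imT] A0(2) imT_is_subspace
    unfolding VectorSpace.subspace_def W.carrier_vs_is_self by blast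
  have fY: "f ` carrier V \<subseteq> f ` Y"
    using WY trans[OF sym[OF UW] trans[OF A(3) imT]] by (rule ord_eq_le_trans[rotated, OF _ sym])
  have "V.span C \<subseteq> Y" using Yin Ysub by (intro V.span_is_subset) auto
  moreover have "K.span C = V.span C"
    using V.span_li_not_depend(1)[of C kerT] C(2) kerT_is_subspace by (simp add: VectorSpace.subspace_def)
  ultimately have kY: "kerT \<subseteq> Y" using C(3) by simp
  have "carrier V \<subseteq> Y"
  proof
    fix x assume x: "x \<in> carrier V"
    then obtain y where y: "y \<in> Y" "f x = f y" using fY by blast
    have yV: "y \<in> carrier V" using y Y by blast
    have "f (x \<ominus>\<^bsub>V\<^esub> y) = \<zero>\<^bsub>W\<^esub>" using T_minus[OF x yV] y f[OF yV] by (simp add: W.M.minus_eq W.M.r_neg)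
    hence "x \<ominus>\<^bsub>V\<^esub> y \<in> Y" using kY x yV by (auto simp: kerT)
    hence "(x \<ominus>\<^bsub>V\<^esub> y) \<oplus>\<^bsub>V\<^esub> y \<in> Y" using Y(3) y by blast
    thus "x \<in> Y" using x yV by (simp add: V.M.minus_eq V.M.a_assoc V.M.l_neg)
  qed
  hence "V.span (A' \<union> C) = carrier V" using Y(1) by (auto simp: Y_def)
  thus ?thesis unfolding fin_dim_space_def V.fin_dim_def
    using V.vectorspace_axioms A' C CV by (intro conjI exI[of _ "A' \<union> C"]) simp_all
qed

lemma fin_dim_trivial:
  assumes V: "vectorspace class_ring V" and c: "carrier V = {\<zero>\<^bsub>V\<^esub>}"
  shows "fin_dim_space V"
proof -
  interpret V: vectorspace class_ring V by (rule V)
  show ?thesis unfolding fin_dim_space_def V.fin_dim_def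
    using V.vectorspace_axioms c V.span_empty by (intro conjI exI[of _ "{}"]) simp_all
qed


section \<open>Right modules\<close>

context right_module
begin

lemma zero_act: "x \<in> carrier M \<Longrightarrow> 0 \<odot> x = \<zero>"
  using add_act[of x 0 0] act_closed[of x 0] by simp

lemma act_zero: "b \<odot> \<zero> = \<zero>"
  using act_add[of \<zero> \<zero> b] act_closed[of \<zero> b] by simp

lemma minus_one_act:
  assumes "x \<in> carrier M" shows "(- 1) \<odot> x = \<ominus> x"
proof -
  have "(- 1) \<odot> x \<oplus> x = 0 \<odot> x"
    using add_act[OF assms, of "- 1" 1] one_act[OF assms] by simp
  thus ?thesis using assms by (simp add: zero_act act_closed minus_equality)
qed

lemma act_neg: "x \<in> carrier M \<Longrightarrow> a \<odot> (\<ominus> x) = \<ominus> (a \<odot> x)"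
  using mult_act[of x "- 1" a] mult_act[of x a "- 1"] act_closed[of x a]
  by (simp flip: minus_one_act)

text \<open>Closure under negation is automatic, as \<open>- x\<close> is the result of the action of \<open>- 1\<close>.\<close>

lemma rsubmoduleI:
  assumes "L \<subseteq> carrier M" "\<zero> \<in> L" "\<And>x y. x \<in> L \<Longrightarrow> y \<in> L \<Longrightarrow> x \<oplus> y \<in> L"
    "\<And>a x. x \<in> L \<Longrightarrow> a \<odot> x \<in> L"
  shows "rsubmodule L M"
  unfolding rsubmodule_def
proof (intro conjI allI ballI additive_subgroup.intro add.subgroupI)
  show "\<ominus> x \<in> L" if "x \<in> L" for x using that assms(1,4) by (auto simp flip: minus_one_act)
qed (use assms in auto)

lemma rsubmoduleD:
  assumes "rsubmodule L M"
  shows "L \<subseteq> carrier M" "\<zero> \<in> L" "\<And>x y. x \<in> L \<Longrightarrow> y \<in> L \<Longrightarrow> x \<oplus> y \<in> L"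
    "\<And>a x. x \<in> L \<Longrightarrow> a \<odot> x \<in> L" "\<And>x. x \<in> L \<Longrightarrow> \<ominus> x \<in> L"
    "\<And>x y. x \<in> L \<Longrightarrow> y \<in> L \<Longrightarrow> x \<ominus> y \<in> L"
proof -
  interpret L: additive_subgroup L M using assms by (simp add: rsubmodule_def)
  show "L \<subseteq> carrier M" "\<zero> \<in> L" "\<And>x y. x \<in> L \<Longrightarrow> y \<in> L \<Longrightarrow> x \<oplus> y \<in> L"
    using L.a_subset L.zero_closed L.a_closed by auto
  show act: "\<And>a x. x \<in> L \<Longrightarrow> a \<odot> x \<in> L" using assms by (simp add: rsubmodule_def)
  show "\<ominus> x \<in> L" if "x \<in> L" for x
    using act[OF that, of "- 1"] that L.a_subset by (auto simp: minus_one_act)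
  thus "x \<ominus> y \<in> L" if "x \<in> L" "y \<in> L" for x y
    using that L.a_closed by (simp add: minus_eq)
qed

lemma rsubmodule_carrier: "rsubmodule (carrier M) M"
  by (rule rsubmoduleI) (auto intro: act_closed)

lemma rsubmodule_zero: "rsubmodule {\<zero>} M"
  by (rule rsubmoduleI) (auto simp: act_zero)

lemma right_module_sub:
  assumes "rsubmodule L M"
  shows "right_module (M\<lparr>carrier := L\<rparr>)"
proof (intro right_module.intro right_module_axioms.intro abelian_groupI)
  note L = rsubmoduleD[OF assms]
  show "\<exists>y\<in>carrier (M\<lparr>carrier := L\<rparr>). y \<oplus>\<^bsub>M\<lparr>carrier := L\<rparr>\<^esub> x = \<zero>\<^bsub>M\<lparr>carrier := L\<rparr>\<^esub>"
    if "x \<in> carrier (M\<lparr>carrier := L\<rparr>)" for x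
    using that L by (intro bexI[of _ "\<ominus> x"]) (auto simp: l_neg)
qed (use rsubmoduleD[OF assms] in \<open>auto simp: a_ac subset_iff act_add add_act mult_act one_act\<close>)

end

lemma rhomI:
  assumes "\<And>x. x \<in> carrier M \<Longrightarrow> f x \<in> carrier N"
    "\<And>x y. x \<in> carrier M \<Longrightarrow> y \<in> carrier M \<Longrightarrow> f (x \<oplus>\<^bsub>M\<^esub> y) = f x \<oplus>\<^bsub>N\<^esub> f y"
    "\<And>a x. x \<in> carrier M \<Longrightarrow> f (a \<odot>\<^bsub>M\<^esub> x) = a \<odot>\<^bsub>N\<^esub> f x"
  shows "f \<in> rhom M N"
  using assms by (auto simp: rhom_def)

lemma rhom_closed: "f \<in> rhom M N \<Longrightarrow> x \<in> carrier M \<Longrightarrow> f x \<in> carrier N"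
  and rhom_add: "f \<in> rhom M N \<Longrightarrow> x \<in> carrier M \<Longrightarrow> y \<in> carrier M \<Longrightarrow>
    f (x \<oplus>\<^bsub>M\<^esub> y) = f x \<oplus>\<^bsub>N\<^esub> f y"
  and rhom_act: "f \<in> rhom M N \<Longrightarrow> x \<in> carrier M \<Longrightarrow> f (a \<odot>\<^bsub>M\<^esub> x) = a \<odot>\<^bsub>N\<^esub> f x"
  by (auto simp: rhom_def)

lemma rhom_zero:
  assumes "right_module M" "right_module N" "f \<in> rhom M N"
  shows "f \<zero>\<^bsub>M\<^esub> = \<zero>\<^bsub>N\<^esub>"
proof -
  interpret M: right_module M by fact
  interpret N: right_module N by fact
  show ?thesis using rhom_act[OF assms(3), of "\<zero>\<^bsub>M\<^esub>" 0] rhom_closed[OF assms(3), of "\<zero>\<^bsub>M\<^esub>"]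
    by (simp add: M.act_zero N.zero_act)
qed

lemma rhom_neg:
  assumes "right_module M" "right_module N" "f \<in> rhom M N" "x \<in> carrier M"
  shows "f (\<ominus>\<^bsub>M\<^esub> x) = \<ominus>\<^bsub>N\<^esub> f x"
proof -
  interpret M: right_module M by fact
  interpret N: right_module N by fact
  show ?thesis using rhom_act[OF assms(3,4), of "- 1"] rhom_closed[OF assms(3,4)] assms(4)
    by (simp add: M.minus_one_act N.minus_one_act)
qed

lemma rhom_minus:
  assumes "right_module M" "right_module N" "f \<in> rhom M N" "x \<in> carrier M" "y \<in> carrier M"
  shows "f (x \<ominus>\<^bsub>M\<^esub> y) = f x \<ominus>\<^bsub>N\<^esub> f y"
proof -
  interpret M: right_module M by fact
  show ?thesis using assms rhom_add[OF assms(3,4), of "\<ominus>\<^bsub>M\<^esub> y"] rhom_neg[OF assms(1-3,5)]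
    by (simp add: a_minus_def)
qed

lemma rhom_id: "(\<lambda>x. x) \<in> rhom M M"
  by (simp add: rhom_def)

lemma rhom_comp: "f \<in> rhom M N \<Longrightarrow> g \<in> rhom N P \<Longrightarrow> (\<lambda>x. g (f x)) \<in> rhom M P"
  by (auto simp: rhom_def)

lemma rhom_zero_fun: "right_module N \<Longrightarrow> (\<lambda>_. \<zero>\<^bsub>N\<^esub>) \<in> rhom M N"
proof -
  assume "right_module N" then interpret right_module N .
  show ?thesis by (rule rhomI) (auto simp: act_zero)
qed

lemma rhom_add_fun:
  assumes "right_module N" "f \<in> rhom M N" "g \<in> rhom M N"
  shows "(\<lambda>x. f x \<oplus>\<^bsub>N\<^esub> g x) \<in> rhom M N"
proof -
  interpret N: right_module N by fact
  show ?thesis using assms(2,3)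
    by (intro rhomI) (auto simp: rhom_closed rhom_add rhom_act N.act_add N.a_ac)
qed

lemma rhom_neg_fun:
  assumes "right_module N" "f \<in> rhom M N"
  shows "(\<lambda>x. \<ominus>\<^bsub>N\<^esub> f x) \<in> rhom M N"
proof -
  interpret N: right_module N by fact
  show ?thesis using assms(2)
    by (intro rhomI) (auto simp: rhom_closed rhom_add rhom_act N.act_neg N.minus_add)
qed

lemma rhom_minus_fun:
  assumes "right_module N" "f \<in> rhom M N" "g \<in> rhom M N"
  shows "(\<lambda>x. f x \<ominus>\<^bsub>N\<^esub> g x) \<in> rhom M N"
  unfolding a_minus_def using assms by (intro rhom_add_fun rhom_neg_fun)

lemma rhom_into_sub:
  "f \<in> rhom M N \<Longrightarrow> (\<And>x. x \<in> carrier M \<Longrightarrow> f x \<in> L) \<Longrightarrow> f \<in> rhom M (N\<lparr>carrier := L\<rparr>)"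
  by (simp add: rhom_def)

lemma rhom_from_sub: "f \<in> rhom M (N\<lparr>carrier := L\<rparr>) \<Longrightarrow> L \<subseteq> carrier N \<Longrightarrow> f \<in> rhom M N"
  by (auto simp: rhom_def)

lemma rhom_restrict: "f \<in> rhom M N \<Longrightarrow> L \<subseteq> carrier M \<Longrightarrow> f \<in> rhom (M\<lparr>carrier := L\<rparr>) N"
  by (simp add: rhom_def subset_iff)

lemma rsubmodule_image:
  assumes "right_module M" "right_module N" "f \<in> rhom M N" "rsubmodule K M"
  shows "rsubmodule (f ` K) N"
proof -
  interpret M: right_module M by fact
  interpret N: right_module N by fact
  note K = M.rsubmoduleD[OF assms(4)]
  have K1: "x \<in> carrier M" if "x \<in> K" for x using that K by auto
  show ?thesis
  proof (rule N.rsubmoduleI)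
    show "f ` K \<subseteq> carrier N" using K1 assms(3) by (auto simp: rhom_closed)
    show "\<zero>\<^bsub>N\<^esub> \<in> f ` K" using K rhom_zero[OF assms(1-3)] by force
    show "x \<oplus>\<^bsub>N\<^esub> y \<in> f ` K" if "x \<in> f ` K" "y \<in> f ` K" for x y
      using that K K1 assms(3) by (auto simp flip: rhom_add)
    show "a \<odot>\<^bsub>N\<^esub> x \<in> f ` K" if "x \<in> f ` K" for a x
      using that K K1 assms(3) by (auto simp flip: rhom_act)
  qed
qed

lemma rsubmodule_kernel:
  assumes "right_module M" "right_module N" "f \<in> rhom M N"
  shows "rsubmodule {x \<in> carrier M. f x = \<zero>\<^bsub>N\<^esub>} M"
proof -
  interpret M: right_module M by fact
  interpret N: right_module N by fact
  show ?thesis using assms(3) rhom_zero[OF assms]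
    by (intro M.rsubmoduleI) (auto simp: rhom_add rhom_act N.act_zero M.act_closed)
qed

lemma rsubmodule_sum:
  assumes "right_module M" "rsubmodule K M" "rsubmodule L M"
  shows "rsubmodule {x \<oplus>\<^bsub>M\<^esub> y | x y. x \<in> K \<and> y \<in> L} M"
proof -
  interpret M: right_module M by fact
  note K = M.rsubmoduleD[OF assms(2)] and L = M.rsubmoduleD[OF assms(3)]
  have K1: "x \<in> carrier M" if "x \<in> K" for x using that K by auto
  have L1: "x \<in> carrier M" if "x \<in> L" for x using that L by auto
  show ?thesis
  proof (rule M.rsubmoduleI)
    show "\<zero>\<^bsub>M\<^esub> \<in> {x \<oplus>\<^bsub>M\<^esub> y | x y. x \<in> K \<and> y \<in> L}"
      using K(2) L(2) by (auto intro!: exI[of _ "\<zero>\<^bsub>M\<^esub>"])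
  next
    fix u v
    assume "u \<in> {x \<oplus>\<^bsub>M\<^esub> y | x y. x \<in> K \<and> y \<in> L}" "v \<in> {x \<oplus>\<^bsub>M\<^esub> y | x y. x \<in> K \<and> y \<in> L}"
    then obtain x y x' y' where *: "u = x \<oplus>\<^bsub>M\<^esub> y" "v = x' \<oplus>\<^bsub>M\<^esub> y'" "x \<in> K" "y \<in> L" "x' \<in> K" "y' \<in> L"
      by blast
    hence "u \<oplus>\<^bsub>M\<^esub> v = (x \<oplus>\<^bsub>M\<^esub> x') \<oplus>\<^bsub>M\<^esub> (y \<oplus>\<^bsub>M\<^esub> y')" using K1 L1 by (simp add: M.a_ac)
    thus "u \<oplus>\<^bsub>M\<^esub> v \<in> {x \<oplus>\<^bsub>M\<^esub> y | x y. x \<in> K \<and> y \<in> L}" using * K(3) L(3) by blast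
  next
    fix a u
    assume "u \<in> {x \<oplus>\<^bsub>M\<^esub> y | x y. x \<in> K \<and> y \<in> L}"
    then obtain x y where *: "u = x \<oplus>\<^bsub>M\<^esub> y" "x \<in> K" "y \<in> L" by blast
    hence "a \<odot>\<^bsub>M\<^esub> u = a \<odot>\<^bsub>M\<^esub> x \<oplus>\<^bsub>M\<^esub> a \<odot>\<^bsub>M\<^esub> y" using K1 L1 by (simp add: M.act_add)
    thus "a \<odot>\<^bsub>M\<^esub> u \<in> {x \<oplus>\<^bsub>M\<^esub> y | x y. x \<in> K \<and> y \<in> L}" using * K(4) L(4) by blast
  qed (use K1 L1 in auto)
qed

lemma mod_catD: "M \<in> mod_cat \<Longrightarrow> right_module M" "M \<in> mod_cat \<Longrightarrow> fin_gen M"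
  by (auto simp: mod_cat_def fg_module_def)

lemma fin_gen_image:
  assumes M: "right_module M" and N: "right_module N" and f: "f \<in> rhom M N"
    and sur: "f ` carrier M = carrier N" and fg: "fin_gen M"
  shows "fin_gen N"
proof -
  interpret M: right_module M by fact
  interpret N: right_module N by fact
  from fg obtain S where S: "finite S" "S \<subseteq> carrier M"
    and gen: "\<And>K. rsubmodule K M \<Longrightarrow> S \<subseteq> K \<Longrightarrow> K = carrier M" by (auto simp: fin_gen_def)
  show ?thesis unfolding fin_gen_def
  proof (intro exI[of _ "f ` S"] conjI allI impI)
    show "f ` S \<subseteq> carrier N" using S f by (auto simp: rhom_closed)
    fix K assume K: "rsubmodule K N \<and> f ` S \<subseteq> K"
    have "rsubmodule {x \<in> carrier M. f x \<in> K} M"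
      using K N.rsubmoduleD[of K] f rhom_zero[OF M N f]
      by (intro M.rsubmoduleI) (auto simp: rhom_add rhom_act M.act_closed)
    hence "{x \<in> carrier M. f x \<in> K} = carrier M" using K S by (intro gen) auto
    hence "carrier N \<subseteq> K" unfolding sur[symmetric] by blast
    thus "K = carrier N" using K N.rsubmoduleD(1)[of K] by auto
  qed (use S in auto)
qed

section \<open>The underlying vector space of a module\<close>

context fd_algebra
begin

text \<open>The scalars sit in the centre of \<open>\<Lambda>\<close>, so acting by them is a module endomorphism.\<close>

lemma scalar_central: "scale c 1 * x = x * scale c 1"
  by (metis mult_1_left mult_1_right scale_mult_left scale_mult_right)

lemma scale_as_mult: "scale c x = x * scale c 1"
  by (metis mult_1_right scale_mult_right)

text \<open>Restriction of scalars along \<open>c \<mapsto> c \<cdot> 1\<close> from the field to the algebra.\<close>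

definition kmod :: "('a, 'm) module \<Rightarrow> ('k, 'm) module" where
  "kmod M = \<lparr>carrier = carrier M, mult = undefined, one = undefined, zero = \<zero>\<^bsub>M\<^esub>,
     add = add M, smult = \<lambda>c x. scale c 1 \<odot>\<^bsub>M\<^esub> x\<rparr>"

lemma kmod_simps [simp]:
  "carrier (kmod M) = carrier M" "\<zero>\<^bsub>kmod M\<^esub> = \<zero>\<^bsub>M\<^esub>" "add (kmod M) = add M"
  "c \<odot>\<^bsub>kmod M\<^esub> x = scale c 1 \<odot>\<^bsub>M\<^esub> x" "(kmod M)\<lparr>carrier := L\<rparr> = kmod (M\<lparr>carrier := L\<rparr>)"
  by (simp_all add: kmod_def)

lemma kmod_vectorspace:
  assumes "right_module M" shows "vectorspace class_ring (kmod M)"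
proof -
  interpret M: right_module M by fact
  show ?thesis
  proof (rule vectorspaceI)
    fix x assume x: "x \<in> carrier (kmod M)"
    show "x \<oplus>\<^bsub>kmod M\<^esub> (- 1) \<odot>\<^bsub>kmod M\<^esub> x = \<zero>\<^bsub>kmod M\<^esub>"
      using x by (simp add: M.minus_one_act M.r_neg)
    show "(c * d) \<odot>\<^bsub>kmod M\<^esub> x = c \<odot>\<^bsub>kmod M\<^esub> (d \<odot>\<^bsub>kmod M\<^esub> x)" for c d
    proof -
      have "scale (c * d) 1 = scale d 1 * scale c 1"
        by (metis mult.commute scale_as_mult scale_scale)
      thus ?thesis using x by (simp add: M.mult_act)
    qed
  qed (auto simp: M.act_closed M.a_ac M.act_add M.add_act M.one_act scale_left_distrib)
qed

lemma kmod_subspace: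
  assumes "right_module M" "rsubmodule L M"
  shows "VectorSpace.subspace class_ring L (kmod M)"
  using right_module.rsubmoduleD[OF assms]
  by (intro vs_subspaceI kmod_vectorspace assms) auto

text \<open>The span of the finitely many elements \<open>s \<cdot> b\<close>, with \<open>s\<close> a generator of the module and \<open>b\<close> from a
  finite spanning set of the algebra, is closed under the action and contains the generators.\<close>

lemma kmod_fin_dim:
  assumes M: "right_module M" and fg: "fin_gen M"
  shows "fin_dim_space (kmod M)"
proof -
  interpret M: right_module M by fact
  interpret V: vectorspace class_ring "kmod M" by (rule kmod_vectorspace[OF M])
  obtain B where B: "finite B" "span B = UNIV"
    using finite_dim by auto
  from fg obtain S where S: "finite S" "S \<subseteq> carrier M"
    and gen: "\<And>K. rsubmodule K M \<Longrightarrow> S \<subseteq> K \<Longrightarrow> K = carrier M" by (auto simp: fin_gen_def)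
  define G where "G = (\<lambda>(b, s). b \<odot>\<^bsub>M\<^esub> s) ` (B \<times> S)"
  have G: "finite G" "G \<subseteq> carrier (kmod M)" using B S by (auto simp: G_def M.act_closed)
  define U where "U = V.span G"
  have sub: "LinearCombinations.submodule class_ring U (kmod M)"
    unfolding U_def by (rule V.span_is_submodule[OF G(2)])
  have U: "U \<subseteq> carrier M" "\<zero>\<^bsub>M\<^esub> \<in> U" "\<And>x y. x \<in> U \<Longrightarrow> y \<in> U \<Longrightarrow> x \<oplus>\<^bsub>M\<^esub> y \<in> U"
    "\<And>c x. x \<in> U \<Longrightarrow> scale c 1 \<odot>\<^bsub>M\<^esub> x \<in> U"
    using sub by (auto simp: LinearCombinations.submodule_def)
  have GU: "G \<subseteq> U" unfolding U_def by (rule V.in_own_span[OF G(2)])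
  have act_gen: "l \<odot>\<^bsub>M\<^esub> s \<in> U" if s: "s \<in> S" for l s
  proof -
    have sM: "s \<in> carrier M" using s S by auto
    have "l \<in> span B" using B by simp
    thus ?thesis
    proof (induction rule: span_induct_alt)
      case base thus ?case using sM U by (simp add: M.zero_act)
    next
      case (step c b y)
      have "b \<odot>\<^bsub>M\<^esub> s \<in> U" using GU step s by (auto simp: G_def)
      hence "scale c b \<odot>\<^bsub>M\<^esub> s \<in> U" using U(4)[of _ c] sM
        by (simp add: scale_as_mult[of c b] M.mult_act)
      thus ?case using U sM step by (simp add: M.add_act)
    qed
  qed
  have act_U: "l \<odot>\<^bsub>M\<^esub> x \<in> U" if x: "x \<in> U" for l x
  proof -
    let ?K = "{x \<in> carrier M. l \<odot>\<^bsub>M\<^esub> x \<in> U}"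
    have "VectorSpace.subspace class_ring ?K (kmod M)"
    proof (rule vs_subspaceI[OF V.vectorspace_axioms])
      fix c x assume x: "x \<in> ?K"
      have "l \<odot>\<^bsub>M\<^esub> (scale c 1 \<odot>\<^bsub>M\<^esub> x) = scale c 1 \<odot>\<^bsub>M\<^esub> (l \<odot>\<^bsub>M\<^esub> x)"
        using x by (simp add: scalar_central flip: M.mult_act)
      thus "c \<odot>\<^bsub>kmod M\<^esub> x \<in> ?K" using x U by (auto simp: M.act_closed)
    qed (use U in \<open>auto simp: M.act_zero M.act_add M.act_closed\<close>)
    hence "LinearCombinations.submodule class_ring ?K (kmod M)"
      by (simp add: VectorSpace.subspace_def)
    moreover have "G \<subseteq> ?K" using S act_gen
      by (auto simp: G_def M.act_closed subset_iff simp flip: M.mult_act)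
    ultimately have "U \<subseteq> ?K" unfolding U_def by (intro V.span_is_subset)
    thus ?thesis using x by auto
  qed
  have "rsubmodule U M" using U act_U by (intro M.rsubmoduleI) auto
  moreover have "S \<subseteq> U" using act_gen[of _ 1] S by (auto simp: M.one_act subset_iff)
  ultimately have "U = carrier M" by (rule gen)
  thus ?thesis using G V.vectorspace_axioms unfolding fin_dim_space_def V.fin_dim_def U_def
    by (intro conjI exI[of _ G]) simp_all
qed

lemma fin_gen_kmod:
  assumes M: "right_module M" and fd: "fin_dim_space (kmod M)"
  shows "fin_gen M"
proof -
  interpret M: right_module M by fact
  interpret V: vectorspace class_ring "kmod M" by (rule kmod_vectorspace[OF M])
  from fd obtain A where A: "finite A" "A \<subseteq> carrier M" "V.span A = carrier M"
    by (auto simp: fin_dim_space_def V.fin_dim_def)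
  show ?thesis unfolding fin_gen_def
  proof (intro exI[of _ A] conjI allI impI A)
    fix K assume K: "rsubmodule K M \<and> A \<subseteq> K"
    have "LinearCombinations.submodule class_ring K (kmod M)"
      using kmod_subspace[OF M] K by (simp add: VectorSpace.subspace_def)
    hence "carrier M \<subseteq> K" using V.span_is_subset[of A K] K A(3) by simp
    thus "K = carrier M" using K M.rsubmoduleD(1)[of K] by auto
  qed
qed

text \<open>Dimension takes the place of the Noetherian property: a subspace of a finite-dimensional space has a
  finite spanning set, which generates the submodule.\<close>

lemma mod_cat_sub:
  fixes M :: "'a obj"
  assumes "M \<in> mod_cat" "rsubmodule L M"
  shows "M\<lparr>carrier := L\<rparr> \<in> mod_cat"
proof -
  note M = mod_catD[OF assms(1)]
  have "fin_dim_space (kmod (M\<lparr>carrier := L\<rparr>))"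
    using fin_dim_subspace(1)[OF kmod_fin_dim[OF M] kmod_subspace[OF M(1) assms(2)]] by simp
  moreover have "right_module (M\<lparr>carrier := L\<rparr>)" by (rule right_module.right_module_sub[OF M(1) assms(2)])
  ultimately show ?thesis by (auto simp: mod_cat_def fg_module_def intro: fin_gen_kmod)
qed

text \<open>Strictly monotone in \<open>L\<close> by \<open>subdim_mono\<close>; it makes two maximality arguments terminate, for the trace of
  a complex in a module and for the decomposition into indecomposables.\<close>

definition subdim :: "('a, 'm) module \<Rightarrow> 'm set \<Rightarrow> nat" where
  "subdim M L = vdim (kmod (M\<lparr>carrier := L\<rparr>))"

lemma subdim_mono:
  fixes M :: "'a obj"
  assumes M: "M \<in> mod_cat" and L: "rsubmodule L M" "rsubmodule K M" "K \<subseteq> L"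
  shows "subdim M K \<le> subdim M L" "subdim M K = subdim M L \<Longrightarrow> K = L"
proof -
  have N: "M\<lparr>carrier := L\<rparr> \<in> mod_cat" by (rule mod_cat_sub[OF M L(1)])
  interpret M: right_module M by (rule mod_catD[OF M])
  interpret N: right_module "M\<lparr>carrier := L\<rparr>" by (rule mod_catD[OF N])
  have K: "rsubmodule K (M\<lparr>carrier := L\<rparr>)"
    by (rule N.rsubmoduleI) (use M.rsubmoduleD[OF L(2)] L(3) in auto)
  note * = fin_dim_subspace[OF kmod_fin_dim[OF mod_catD[OF N]] kmod_subspace[OF mod_catD(1)[OF N] K]]
  show "subdim M K \<le> subdim M L" "subdim M K = subdim M L \<Longrightarrow> K = L" using *(2,3) by (simp_all add: subdim_def)
qed

end

section \<open>Spaces of module homomorphisms\<close>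

lemma rhom_eqI:
  assumes P: "right_module P" and M: "right_module M" and fg: "f \<in> rhom P M" "g \<in> rhom P M"
    and gen: "\<And>K. rsubmodule K P \<Longrightarrow> S \<subseteq> K \<Longrightarrow> K = carrier P"
    and S: "S \<subseteq> carrier P" "\<And>s. s \<in> S \<Longrightarrow> f s = g s" and x: "x \<in> carrier P"
  shows "f x = g x"
proof -
  interpret P: right_module P by fact
  interpret M: right_module M by fact
  have "rsubmodule {x \<in> carrier P. f x = g x} P"
    using rhom_zero[OF P M fg(1)] rhom_zero[OF P M fg(2)] fg
    by (intro P.rsubmoduleI) (auto simp: rhom_add rhom_act P.act_closed)
  hence "{x \<in> carrier P. f x = g x} = carrier P" using S by (intro gen) auto
  thus ?thesis using x by blast
qed

definition extend0 :: "('a::{ring,monoid_mult}, 'm) module \<Rightarrow> ('a, 'n) module \<Rightarrow> ('m \<Rightarrow> 'n) \<Rightarrow> 'm \<Rightarrow> 'n" where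
  "extend0 P M f = (\<lambda>x. if x \<in> carrier P then f x else \<zero>\<^bsub>M\<^esub>)"

text \<open>An element of \<open>rhom\<close> is arbitrary outside the carrier.  Fixing the value zero there lets each
  homomorphism be represented once, which the dimension of the space of homomorphisms requires.\<close>

definition homs :: "('a::{ring,monoid_mult}, 'm) module \<Rightarrow> ('a, 'n) module \<Rightarrow> ('m \<Rightarrow> 'n) set" where
  "homs P M = {f \<in> rhom P M. \<forall>x. x \<notin> carrier P \<longrightarrow> f x = \<zero>\<^bsub>M\<^esub>}"

lemma extend0_simp [simp]: "x \<in> carrier P \<Longrightarrow> extend0 P M f x = f x"
  and extend0_out: "x \<notin> carrier P \<Longrightarrow> extend0 P M f x = \<zero>\<^bsub>M\<^esub>"
  by (simp_all add: extend0_def)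

lemma rhom_cong:
  assumes "right_module P" "f \<in> rhom P M" "\<And>x. x \<in> carrier P \<Longrightarrow> g x = f x"
  shows "g \<in> rhom P M"
proof -
  interpret right_module P by fact
  show ?thesis using assms(2,3) act_closed by (auto simp: rhom_def)
qed

lemma extend0_homs: "right_module P \<Longrightarrow> f \<in> rhom P M \<Longrightarrow> extend0 P M f \<in> homs P M"
  by (auto simp: homs_def extend0_out intro: rhom_cong)

lemma homs_rhom: "f \<in> homs P M \<Longrightarrow> f \<in> rhom P M"
  by (simp add: homs_def)

lemma homs_eqI:
  "f \<in> homs P M \<Longrightarrow> g \<in> homs P M \<Longrightarrow> (\<And>x. x \<in> carrier P \<Longrightarrow> f x = g x) \<Longrightarrow> f = g"
  by (rule ext) (metis (mono_tags, lifting) homs_def mem_Collect_eq)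

context fd_algebra
begin

definition hom_space :: "('a, 'm) module \<Rightarrow> ('a, 'n) module \<Rightarrow> ('k, 'm \<Rightarrow> 'n) module" where
  "hom_space P M = \<lparr>carrier = homs P M, mult = undefined, one = undefined, zero = \<lambda>_. \<zero>\<^bsub>M\<^esub>,
     add = \<lambda>f g x. f x \<oplus>\<^bsub>M\<^esub> g x, smult = \<lambda>c f x. scale c 1 \<odot>\<^bsub>M\<^esub> f x\<rparr>"

lemma hom_space_simps [simp]:
  "carrier (hom_space P M) = homs P M" "\<zero>\<^bsub>hom_space P M\<^esub> = (\<lambda>_. \<zero>\<^bsub>M\<^esub>)"
  "f \<oplus>\<^bsub>hom_space P M\<^esub> g = (\<lambda>x. f x \<oplus>\<^bsub>M\<^esub> g x)" "c \<odot>\<^bsub>hom_space P M\<^esub> f = (\<lambda>x. scale c 1 \<odot>\<^bsub>M\<^esub> f x)"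
  by (simp_all add: hom_space_def)

lemma rhom_scale:
  assumes "right_module M" "f \<in> rhom P M"
  shows "(\<lambda>x. scale c 1 \<odot>\<^bsub>M\<^esub> f x) \<in> rhom P M"
proof -
  interpret M: right_module M by fact
  show ?thesis using assms(2)
    by (intro rhomI) (auto simp: rhom_closed rhom_add rhom_act M.act_closed M.act_add
        scalar_central simp flip: M.mult_act)
qed

lemma hom_space_vectorspace:
  assumes M: "right_module M" shows "vectorspace class_ring (hom_space P M)"
proof -
  interpret M: right_module M by fact
  have cl: "f x \<in> carrier M" if "f \<in> homs P M" for f x
    using that by (cases "x \<in> carrier P") (auto simp: homs_def rhom_closed)
  have cd: "scale (c * d) 1 = scale d 1 * scale c 1" for c d
    by (metis mult.commute scale_as_mult scale_scale)
  show ?thesis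
    by (rule vectorspaceI)
      (auto simp: homs_def M M.act_zero M.minus_one_act M.r_neg rhom_zero_fun rhom_add_fun rhom_scale
        intro!: ext M.a_comm M.a_assoc
        dest: cl[unfolded homs_def, OF CollectI, OF conjI]
        simp: cl M.act_closed M.act_add M.add_act M.one_act M.mult_act scale_left_distrib cd)
qed

lemma hom_space_subspace:
  assumes M: "right_module M" and U: "U \<subseteq> homs P M" "(\<lambda>_. \<zero>\<^bsub>M\<^esub>) \<in> U"
    "\<And>f g. f \<in> U \<Longrightarrow> g \<in> U \<Longrightarrow> (\<lambda>x. f x \<oplus>\<^bsub>M\<^esub> g x) \<in> U"
    "\<And>c f. f \<in> U \<Longrightarrow> (\<lambda>x. scale c 1 \<odot>\<^bsub>M\<^esub> f x) \<in> U"
  shows "VectorSpace.subspace class_ring U (hom_space P M)"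
  by (rule vs_subspaceI[OF hom_space_vectorspace[OF M]]) (use U in auto)

text \<open>Evaluation at one generator of \<open>P\<close> after the other: each evaluation takes values in the
  finite-dimensional space \<open>M\<close>, and its kernel vanishes at one generator more, until only zero is left.\<close>

lemma hom_space_fin_dim:
  assumes P: "right_module P" "fin_gen P" and M: "right_module M" "fin_gen M"
  shows "fin_dim_space (hom_space P M)"
proof -
  interpret P: right_module P by fact
  interpret M: right_module M by fact
  from P(2) obtain S where S: "finite S" "S \<subseteq> carrier P"
    and gen: "\<And>K. rsubmodule K P \<Longrightarrow> S \<subseteq> K \<Longrightarrow> K = carrier P" by (auto simp: fin_gen_def)
  define H where "H A = (hom_space P M)\<lparr>carrier := {f \<in> homs P M. \<forall>s\<in>A. f s = \<zero>\<^bsub>M\<^esub>}\<rparr>" for A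
  have Hv: "vectorspace class_ring (H A)" for A
    unfolding H_def
    by (intro vectorspace_subspace hom_space_subspace M)
      (auto simp: homs_def M.act_zero rhom_zero_fun rhom_add_fun rhom_scale M)
  have H0: "fin_dim_space (H S)"
  proof (rule fin_dim_trivial[OF Hv])
    have "f = (\<lambda>_. \<zero>\<^bsub>M\<^esub>)" if f: "f \<in> homs P M" "\<And>s. s \<in> S \<Longrightarrow> f s = \<zero>\<^bsub>M\<^esub>" for f
    proof (rule homs_eqI[OF f(1)])
      show z: "(\<lambda>_. \<zero>\<^bsub>M\<^esub>) \<in> homs P M" by (simp add: homs_def rhom_zero_fun M)
      show "f x = \<zero>\<^bsub>M\<^esub>" if x: "x \<in> carrier P" for x
        by (rule rhom_eqI[OF P(1) M(1) homs_rhom[OF f(1)] homs_rhom[OF z] gen S(2) _ x]) (use f in auto)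
    qed
    thus "carrier (H S) = {\<zero>\<^bsub>H S\<^esub>}" by (auto simp: H_def homs_def rhom_zero_fun M)
  qed
  have step: "fin_dim_space (H A)" if A: "fin_dim_space (H (insert s A))" "s \<in> carrier P" for s A
  proof (rule fin_dim_extension[where f = "\<lambda>f. f s" and W = "kmod M"])
    have "{f \<in> carrier (H A). f s = \<zero>\<^bsub>kmod M\<^esub>} = {f \<in> homs P M. \<forall>t\<in>insert s A. f t = \<zero>\<^bsub>M\<^esub>}"
      by (auto simp: H_def)
    thus "fin_dim_space ((H A)\<lparr>carrier := {f \<in> carrier (H A). f s = \<zero>\<^bsub>kmod M\<^esub>}\<rparr>)"
      using A(1) by (simp add: H_def)
  qed (use A(2) in \<open>auto simp: Hv kmod_fin_dim M\<close>, auto simp: H_def homs_def rhom_closed)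
  have "fin_dim_space (H (S - A))" if "finite A" "A \<subseteq> S" for A
    using that
  proof (induction A rule: finite_induct)
    case empty thus ?case using H0 by simp
  next
    case (insert s A)
    have "insert s (S - insert s A) = S - A" using insert by auto
    moreover have "fin_dim_space (H (S - A))" using insert by simp
    ultimately have "fin_dim_space (H (insert s (S - insert s A)))" by simp
    thus ?case by (rule step) (use insert S in auto)
  qed
  from this[OF S(1)] have "fin_dim_space (H {})" by simp
  thus ?thesis by (simp add: H_def hom_space_def)
qed

text \<open>Projectivity makes composition with \<open>M \<rightarrow> N\<close> surjective on homomorphisms from \<open>P\<close>; its kernel consists of
  the maps into the image of \<open>L\<close>, hence of the homomorphisms to \<open>L\<close>.\<close>

lemma vdim_hom_space_exact:
  assumes P: "projective P" and LMN: "short_exact L M N"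
  shows "vdim (hom_space P M) = vdim (hom_space P L) + vdim (hom_space P N)"
proof -
  have mc: "P \<in> mod_cat" "L \<in> mod_cat" "M \<in> mod_cat" "N \<in> mod_cat"
    using P LMN by (auto simp: projective_def short_exact_def)
  interpret P: right_module P by (rule mod_catD[OF mc(1)])
  interpret L: right_module L by (rule mod_catD[OF mc(2)])
  interpret M: right_module M by (rule mod_catD[OF mc(3)])
  interpret N: right_module N by (rule mod_catD[OF mc(4)])
  note rm = P.right_module_axioms L.right_module_axioms M.right_module_axioms N.right_module_axioms
  obtain f g where f: "f \<in> rhom L M" "inj_on f (carrier L)" and g: "g \<in> rhom M N" "g ` carrier M = carrier N"
    and fg: "f ` carrier L = {x \<in> carrier M. g x = \<zero>\<^bsub>N\<^esub>}"
    using LMN by (auto simp: short_exact_def)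
  have PM: "fin_dim_space (hom_space P M)" and PL: "fin_dim_space (hom_space P L)" using mod_catD mc by (auto intro!: hom_space_fin_dim)
  define F where "F \<phi> = extend0 P N (\<lambda>x. g (\<phi> x))" for \<phi> :: "(nat \<Rightarrow> 'a) \<Rightarrow> nat \<Rightarrow> 'a"
  have FP: "F \<phi> \<in> homs P N" if "\<phi> \<in> homs P M" for \<phi>
    unfolding F_def by (rule extend0_homs[OF rm(1) rhom_comp[OF homs_rhom[OF that] g(1)]])
  have sur: "F ` homs P M = homs P N"
  proof (intro equalityI subsetI)
    fix \<psi> assume \<psi>: "\<psi> \<in> homs P N"
    have "\<exists>h\<in>rhom P M. \<forall>x\<in>carrier P. g (h x) = \<psi> x"
      using P mc g homs_rhom[OF \<psi>] by (simp add: projective_def)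
    then obtain \<phi> where \<phi>: "\<phi> \<in> rhom P M" "\<And>x. x \<in> carrier P \<Longrightarrow> g (\<phi> x) = \<psi> x" by blast
    have e: "extend0 P M \<phi> \<in> homs P M" by (rule extend0_homs[OF rm(1) \<phi>(1)])
    have "F (extend0 P M \<phi>) = \<psi>" by (rule homs_eqI[OF FP[OF e] \<psi>]) (simp add: F_def \<phi>)
    thus "\<psi> \<in> F ` homs P M" using e by blast
  qed (use FP in auto)
  have sur': "F ` carrier (hom_space P M) = carrier (hom_space P N)" using sur by simp
  have Fadd: "F (a \<oplus>\<^bsub>hom_space P M\<^esub> b) = F a \<oplus>\<^bsub>hom_space P N\<^esub> F b"
    if "a \<in> carrier (hom_space P M)" "b \<in> carrier (hom_space P M)" for a b
    using that g(1) by (auto simp: F_def extend0_def rhom_add homs_def rhom_closed)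
  have Fact: "F (c \<odot>\<^bsub>hom_space P M\<^esub> a) = c \<odot>\<^bsub>hom_space P N\<^esub> F a" if "a \<in> carrier (hom_space P M)" for a c
    using that g(1) by (auto simp: F_def extend0_def rhom_act homs_def rhom_closed N.act_zero)
  define K where "K = {\<phi> \<in> carrier (hom_space P M). F \<phi> = \<zero>\<^bsub>hom_space P N\<^esub>}"
  have rn: "vdim (hom_space P M) = vdim (hom_space P N) + vdim ((hom_space P M)\<lparr>carrier := K\<rparr>)"
    unfolding K_def
    by (rule rank_nullity_sum(2)[OF PM hom_space_vectorspace[OF rm(4)]]) (fact sur', erule (1) Fadd, erule Fact)
  have Keq: "K = {\<phi> \<in> homs P M. \<forall>x\<in>carrier P. \<phi> x \<in> f ` carrier L}"
  proof -
    have "F \<phi> = (\<lambda>_. \<zero>\<^bsub>N\<^esub>) \<longleftrightarrow> (\<forall>x\<in>carrier P. \<phi> x \<in> f ` carrier L)" if "\<phi> \<in> homs P M" for \<phi>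
      using homs_rhom[OF that] unfolding fg F_def extend0_def fun_eq_iff by (auto simp: rhom_closed)
    thus ?thesis by (auto simp: K_def)
  qed
  have Kv: "vectorspace class_ring ((hom_space P M)\<lparr>carrier := K\<rparr>)"
  proof (rule vectorspace_subspace, rule hom_space_subspace[OF rm(3)])
    note k = M.rsubmoduleD[OF rsubmodule_image[OF rm(2,3) f(1) L.rsubmodule_carrier]]
    show "K \<subseteq> homs P M" by (auto simp: Keq)
    show "(\<lambda>_. \<zero>\<^bsub>M\<^esub>) \<in> K" using k(2) by (auto simp: Keq homs_def rhom_zero_fun rm)
    show "(\<lambda>x. a x \<oplus>\<^bsub>M\<^esub> b x) \<in> K" if "a \<in> K" "b \<in> K" for a b
      using that k(3) unfolding Keq homs_def by (simp add: rhom_add_fun rm)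
    show "(\<lambda>x. scale c 1 \<odot>\<^bsub>M\<^esub> a x) \<in> K" if "a \<in> K" for a c
      using that k(4) unfolding Keq homs_def by (simp add: rhom_scale rm M.act_zero)
  qed
  have "vdim (hom_space P L) = vdim ((hom_space P M)\<lparr>carrier := K\<rparr>)"
  proof (rule vdim_iso(2)[OF PL Kv])
    let ?G = "\<lambda>\<psi>. extend0 P M (\<lambda>x. f (\<psi> x))"
    have G: "?G \<psi> \<in> K" if "\<psi> \<in> homs P L" for \<psi>
      using homs_rhom[OF that] extend0_homs[OF rm(1) rhom_comp[OF homs_rhom[OF that] f(1)]]
      unfolding Keq by (auto simp: rhom_closed)
    show "bij_betw ?G (carrier (hom_space P L)) (carrier ((hom_space P M)\<lparr>carrier := K\<rparr>))"
    proof (rule bij_betw_imageI)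
      show "inj_on ?G (carrier (hom_space P L))"
      proof (rule inj_onI)
        fix a b assume ab: "a \<in> carrier (hom_space P L)" "b \<in> carrier (hom_space P L)" "?G a = ?G b"
        show "a = b"
        proof (rule homs_eqI[of _ P L])
          fix x assume x: "x \<in> carrier P"
          have "f (a x) = f (b x)" using fun_cong[OF ab(3), of x] x by simp
          thus "a x = b x" using ab x f(2) by (auto dest!: homs_rhom simp: rhom_closed inj_on_def)
        qed (use ab in auto)
      qed
      have "\<phi> \<in> ?G ` homs P L" if \<phi>: "\<phi> \<in> K" for \<phi>
      proof -
        define \<psi> where "\<psi> = extend0 P L (\<lambda>x. inv_into (carrier L) f (\<phi> x))"
        have f\<psi>: "f (\<psi> x) = \<phi> x" and \<psi>c: "\<psi> x \<in> carrier L" if "x \<in> carrier P" for x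
          using that \<phi> by (auto simp: \<psi>_def Keq f_inv_into_f inv_into_into)
        have ph: "\<phi> \<in> rhom P M" using \<phi> by (auto simp: Keq homs_def)
        have "\<psi> \<in> rhom P L"
        proof (rule rhomI)
          fix x assume x: "x \<in> carrier P"
          show "\<psi> x \<in> carrier L" by (rule \<psi>c[OF x])
          have "f (\<psi> (a \<odot>\<^bsub>P\<^esub> x)) = f (a \<odot>\<^bsub>L\<^esub> \<psi> x)" for a
            using x ph f(1) f\<psi>[of x] f\<psi>[of "a \<odot>\<^bsub>P\<^esub> x"] \<psi>c[of x] by (simp add: rhom_act P.act_closed)
          thus "\<psi> (a \<odot>\<^bsub>P\<^esub> x) = a \<odot>\<^bsub>L\<^esub> \<psi> x" for a
            using inj_onD[OF f(2)] x \<psi>c by (simp add: P.act_closed L.act_closed)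
          fix y assume y: "y \<in> carrier P"
          have "f (\<psi> (x \<oplus>\<^bsub>P\<^esub> y)) = f (\<psi> x \<oplus>\<^bsub>L\<^esub> \<psi> y)"
            using x y ph f(1) f\<psi> \<psi>c by (simp add: rhom_add)
          thus "\<psi> (x \<oplus>\<^bsub>P\<^esub> y) = \<psi> x \<oplus>\<^bsub>L\<^esub> \<psi> y"
            using inj_onD[OF f(2)] x y \<psi>c by simp
        qed
        hence h: "\<psi> \<in> homs P L" by (simp add: homs_def \<psi>_def extend0_out)
        have "\<phi> = ?G \<psi>"
          by (rule homs_eqI[of _ P M]) (use \<phi> G[OF h] f\<psi> in \<open>auto simp: Keq\<close>)
        thus ?thesis using h by blast
      qed
      thus "?G ` carrier (hom_space P L) = carrier ((hom_space P M)\<lparr>carrier := K\<rparr>)" using G by auto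
    qed
  qed (use f(1) in \<open>auto simp: extend0_def homs_def rhom_closed rhom_add rhom_act M.act_zero\<close>)
  thus ?thesis using rn by simp
qed

end

section \<open>Direct sums and quotients\<close>

text \<open>Many different modules occur in one computation below, so the laws of abelian groups are used as
  conditional rewrite rules whose premise is the module, instead of interpreting a locale for each.\<close>

lemma right_module_abelian_group: "right_module M \<Longrightarrow> abelian_group M" "right_module M \<Longrightarrow> abelian_monoid M"
  by (simp_all add: right_module_def abelian_group_def)

lemmas ag_closed = abelian_monoid.a_closed[OF right_module_abelian_group(2)] abelian_monoid.zero_closed[OF right_module_abelian_group(2)]
  abelian_group.a_inv_closed[OF right_module_abelian_group(1)] abelian_group.minus_closed[OF right_module_abelian_group(1)]
  right_module.act_closed

lemmas ag_ac = abelian_monoid.a_assoc[OF right_module_abelian_group(2)] abelian_monoid.a_comm[OF right_module_abelian_group(2)]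
  abelian_monoid.a_lcomm[OF right_module_abelian_group(2)]

lemma (in right_module) neg_zero: "\<ominus> \<zero> = \<zero>"
  using minus_equality[of \<zero> \<zero>] by simp

lemmas ag_simps = abelian_monoid.l_zero[OF right_module_abelian_group(2)] abelian_monoid.r_zero[OF right_module_abelian_group(2)]
  abelian_group.r_neg[OF right_module_abelian_group(1)] abelian_group.l_neg[OF right_module_abelian_group(1)]
  abelian_group.minus_add[OF right_module_abelian_group(1)] abelian_group.minus_minus[OF right_module_abelian_group(1)]
  right_module.neg_zero abelian_group.r_neg1[OF right_module_abelian_group(1)]
  abelian_group.r_neg2[OF right_module_abelian_group(1)] 

lemma ag_minus_iff:
  assumes "right_module M" "x \<in> carrier M" "y \<in> carrier M" "z \<in> carrier M"
  shows "x \<ominus>\<^bsub>M\<^esub> y = z \<longleftrightarrow> x = z \<oplus>\<^bsub>M\<^esub> y"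
proof -
  interpret right_module M by fact
  show ?thesis using assms(2-) by (auto simp: minus_eq a_assoc r_neg l_neg)
qed

lemma ag_minus_self: "right_module M \<Longrightarrow> x \<in> carrier M \<Longrightarrow> x \<ominus>\<^bsub>M\<^esub> x = \<zero>\<^bsub>M\<^esub>"
  using abelian_group.r_neg[OF right_module_abelian_group(1)] by (simp add: a_minus_def)

lemma ag_minus_zero: "right_module M \<Longrightarrow> x \<in> carrier M \<Longrightarrow> x \<ominus>\<^bsub>M\<^esub> \<zero>\<^bsub>M\<^esub> = x"
  by (simp add: a_minus_def ag_simps ag_closed)

lemma ag_eq_if_minus_zero:
  "right_module M \<Longrightarrow> x \<in> carrier M \<Longrightarrow> y \<in> carrier M \<Longrightarrow> x \<ominus>\<^bsub>M\<^esub> y = \<zero>\<^bsub>M\<^esub> \<Longrightarrow> x = y"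
  using ag_minus_iff[of M x y "\<zero>\<^bsub>M\<^esub>"] by (simp add: ag_simps ag_closed)

lemma ag_add_sub:
  "right_module M \<Longrightarrow> x \<in> carrier M \<Longrightarrow> y \<in> carrier M \<Longrightarrow> x \<oplus>\<^bsub>M\<^esub> y \<oplus>\<^bsub>M\<^esub> \<ominus>\<^bsub>M\<^esub> x = y"
  using ag_minus_iff[of M "x \<oplus>\<^bsub>M\<^esub> y" x y] by (simp add: a_minus_def ag_ac ag_closed)

lemma pr_pair [simp]: "pr1 (pair x y) = x" "pr2 (pair x y) = y" "pair (pr1 z) (pr2 z) = z"
  by (auto simp: pr1_def pr2_def pair_def fun_eq_iff)

lemma pair_eq_iff [simp]: "pair x y = pair x' y' \<longleftrightarrow> x = x' \<and> y = y'"
  by (metis pr_pair(1,2))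

lemma dsum_simps [simp]:
  "z \<in> carrier (dsum M N) \<longleftrightarrow> pr1 z \<in> carrier M \<and> pr2 z \<in> carrier N"
  "\<zero>\<^bsub>dsum M N\<^esub> = pair \<zero>\<^bsub>M\<^esub> \<zero>\<^bsub>N\<^esub>"
  "z \<oplus>\<^bsub>dsum M N\<^esub> w = pair (pr1 z \<oplus>\<^bsub>M\<^esub> pr1 w) (pr2 z \<oplus>\<^bsub>N\<^esub> pr2 w)"
  "a \<odot>\<^bsub>dsum M N\<^esub> z = pair (a \<odot>\<^bsub>M\<^esub> pr1 z) (a \<odot>\<^bsub>N\<^esub> pr2 z)"
  by (simp_all add: dsum_def)

lemma dsum_right_module:
  assumes "right_module M" "right_module N"
  shows "right_module (dsum M N)"
proof -
  interpret M: right_module M by fact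
  interpret N: right_module N by fact
  show ?thesis
  proof (intro right_module.intro right_module_axioms.intro abelian_groupI)
    fix z assume "z \<in> carrier (dsum M N)"
    thus "\<exists>w\<in>carrier (dsum M N). w \<oplus>\<^bsub>dsum M N\<^esub> z = \<zero>\<^bsub>dsum M N\<^esub>"
      by (intro bexI[of _ "pair (\<ominus>\<^bsub>M\<^esub> pr1 z) (\<ominus>\<^bsub>N\<^esub> pr2 z)"]) (auto simp: M.l_neg N.l_neg)
  qed (auto simp: M.a_ac N.a_ac M.act_closed N.act_closed M.act_add N.act_add M.add_act N.add_act
      M.mult_act N.mult_act M.one_act N.one_act)
qed

lemma dsum_neg:
  assumes "right_module M" "right_module N" "z \<in> carrier (dsum M N)"
  shows "\<ominus>\<^bsub>dsum M N\<^esub> z = pair (\<ominus>\<^bsub>M\<^esub> pr1 z) (\<ominus>\<^bsub>N\<^esub> pr2 z)"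
proof -
  interpret D: right_module "dsum M N" by (rule dsum_right_module[OF assms(1,2)])
  show ?thesis using assms by (intro D.minus_equality) (auto simp: ag_simps ag_closed)
qed

lemma dsum_minus:
  assumes "right_module M" "right_module N" "z \<in> carrier (dsum M N)" "w \<in> carrier (dsum M N)"
  shows "z \<ominus>\<^bsub>dsum M N\<^esub> w = pair (pr1 z \<ominus>\<^bsub>M\<^esub> pr1 w) (pr2 z \<ominus>\<^bsub>N\<^esub> pr2 w)"
  unfolding a_minus_def using assms by (simp add: dsum_neg)

lemma rhom_pr: "pr1 \<in> rhom (dsum M N) M" "pr2 \<in> rhom (dsum M N) N"
  by (auto intro!: rhomI)

lemma rhom_in:
  assumes "right_module M" "right_module N"
  shows "(\<lambda>x. pair x \<zero>\<^bsub>N\<^esub>) \<in> rhom M (dsum M N)" "(\<lambda>y. pair \<zero>\<^bsub>M\<^esub> y) \<in> rhom N (dsum M N)"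
  using assms by (auto intro!: rhomI simp: ag_simps ag_closed right_module.act_zero)

lemma rhom_pair:
  "f \<in> rhom P M \<Longrightarrow> g \<in> rhom P N \<Longrightarrow> (\<lambda>x. pair (f x) (g x)) \<in> rhom P (dsum M N)"
  by (auto intro!: rhomI simp: rhom_closed rhom_add rhom_act)

lemma rhom_copair:
  assumes "right_module P" "f \<in> rhom M P" "g \<in> rhom N P"
  shows "(\<lambda>z. f (pr1 z) \<oplus>\<^bsub>P\<^esub> g (pr2 z)) \<in> rhom (dsum M N) P"
  by (rule rhom_add_fun[OF assms(1)]) (use assms rhom_comp rhom_pr in blast)+

lemma dsum_mod_cat:
  assumes "M \<in> mod_cat" "N \<in> mod_cat"
  shows "dsum M N \<in> mod_cat"
proof -
  interpret M: right_module M using assms mod_catD by blast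
  interpret N: right_module N using assms mod_catD by blast
  interpret D: right_module "dsum M N" by (rule dsum_right_module) unfold_locales
  obtain S where S: "finite S" "S \<subseteq> carrier M"
    and genS: "\<And>K. rsubmodule K M \<Longrightarrow> S \<subseteq> K \<Longrightarrow> K = carrier M"
    using mod_catD(2)[OF assms(1)] by (auto simp: fin_gen_def)
  obtain T where T: "finite T" "T \<subseteq> carrier N"
    and genT: "\<And>K. rsubmodule K N \<Longrightarrow> T \<subseteq> K \<Longrightarrow> K = carrier N"
    using mod_catD(2)[OF assms(2)] by (auto simp: fin_gen_def)
  let ?G = "(\<lambda>x. pair x \<zero>\<^bsub>N\<^esub>) ` S \<union> (\<lambda>y. pair \<zero>\<^bsub>M\<^esub> y) ` T"
  have "K = carrier (dsum M N)" if K: "rsubmodule K (dsum M N)" and G: "?G \<subseteq> K" for K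
  proof -
    note k = D.rsubmoduleD[OF K]
    have "rsubmodule {x \<in> carrier M. pair x \<zero>\<^bsub>N\<^esub> \<in> K} M"
    proof (rule M.rsubmoduleI)
      fix x y assume *: "x \<in> {x \<in> carrier M. pair x \<zero>\<^bsub>N\<^esub> \<in> K}" "y \<in> {x \<in> carrier M. pair x \<zero>\<^bsub>N\<^esub> \<in> K}"
      show "x \<oplus>\<^bsub>M\<^esub> y \<in> {x \<in> carrier M. pair x \<zero>\<^bsub>N\<^esub> \<in> K}"
        using * k(3)[of "pair x \<zero>\<^bsub>N\<^esub>" "pair y \<zero>\<^bsub>N\<^esub>"] by simp
    next
      fix x a assume *: "x \<in> {x \<in> carrier M. pair x \<zero>\<^bsub>N\<^esub> \<in> K}"
      show "a \<odot>\<^bsub>M\<^esub> x \<in> {x \<in> carrier M. pair x \<zero>\<^bsub>N\<^esub> \<in> K}"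
        using * k(4)[of "pair x \<zero>\<^bsub>N\<^esub>" a] by (simp add: N.act_zero M.act_closed)
    qed (use k(2) in auto)
    hence 1: "{x \<in> carrier M. pair x \<zero>\<^bsub>N\<^esub> \<in> K} = carrier M" by (rule genS) (use S G in auto)
    have "rsubmodule {y \<in> carrier N. pair \<zero>\<^bsub>M\<^esub> y \<in> K} N"
    proof (rule N.rsubmoduleI)
      fix x y assume *: "x \<in> {y \<in> carrier N. pair \<zero>\<^bsub>M\<^esub> y \<in> K}" "y \<in> {y \<in> carrier N. pair \<zero>\<^bsub>M\<^esub> y \<in> K}"
      show "x \<oplus>\<^bsub>N\<^esub> y \<in> {y \<in> carrier N. pair \<zero>\<^bsub>M\<^esub> y \<in> K}"
        using * k(3)[of "pair \<zero>\<^bsub>M\<^esub> x" "pair \<zero>\<^bsub>M\<^esub> y"] by simp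
    next
      fix x a assume *: "x \<in> {y \<in> carrier N. pair \<zero>\<^bsub>M\<^esub> y \<in> K}"
      show "a \<odot>\<^bsub>N\<^esub> x \<in> {y \<in> carrier N. pair \<zero>\<^bsub>M\<^esub> y \<in> K}"
        using * k(4)[of "pair \<zero>\<^bsub>M\<^esub> x" a] by (simp add: M.act_zero N.act_closed)
    qed (use k(2) in auto)
    hence 2: "{y \<in> carrier N. pair \<zero>\<^bsub>M\<^esub> y \<in> K} = carrier N" by (rule genT) (use T G in auto)
    have "z \<in> K" if z: "z \<in> carrier (dsum M N)" for z
    proof -
      have "pair (pr1 z) \<zero>\<^bsub>N\<^esub> \<in> K" "pair \<zero>\<^bsub>M\<^esub> (pr2 z) \<in> K" using z 1 2 by auto
      from k(3)[OF this] show ?thesis using z by simp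
    qed
    thus ?thesis using k(1) by blast
  qed
  moreover have "finite ?G" "?G \<subseteq> carrier (dsum M N)" using S T by auto
  ultimately have "fin_gen (dsum M N)" unfolding fin_gen_def by (intro exI[of _ ?G]) blast
  thus ?thesis using D.right_module_axioms by (simp add: mod_cat_def fg_module_def)
qed

lemma projectiveD:
  assumes "projective P" "M \<in> mod_cat" "N \<in> mod_cat" "g \<in> rhom M N" "g ` carrier M = carrier N"
    "f \<in> rhom P N"
  obtains h where "h \<in> rhom P M" "\<And>x. x \<in> carrier P \<Longrightarrow> g (h x) = f x"
proof -
  have "\<exists>h\<in>rhom P M. \<forall>x\<in>carrier P. g (h x) = f x"
    using assms by (simp add: projective_def)
  thus ?thesis using that by blast
qed

lemma projective_dsum:
  assumes P: "projective P" and Q: "projective Q"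
  shows "projective (dsum P Q)"
  unfolding projective_def
proof (intro conjI ballI impI)
  have pq: "P \<in> mod_cat" "Q \<in> mod_cat" using P Q by (auto simp: projective_def)
  note rm = mod_catD(1)[OF pq(1)] mod_catD(1)[OF pq(2)]
  show "dsum P Q \<in> mod_cat" by (rule dsum_mod_cat[OF pq])
  fix M N :: "'a obj" and g f
  assume *: "M \<in> mod_cat" "N \<in> mod_cat" "g \<in> rhom M N" "g ` carrier M = carrier N" "f \<in> rhom (dsum P Q) N"
  note rmM = mod_catD(1)[OF *(1)] mod_catD(1)[OF *(2)]
  obtain h where h: "h \<in> rhom P M" "\<And>x. x \<in> carrier P \<Longrightarrow> g (h x) = f (pair x \<zero>\<^bsub>Q\<^esub>)"
    using projectiveD[OF P *(1-4) rhom_comp[OF rhom_in(1)[OF rm] *(5)]] by blast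
  obtain k where k: "k \<in> rhom Q M" "\<And>y. y \<in> carrier Q \<Longrightarrow> g (k y) = f (pair \<zero>\<^bsub>P\<^esub> y)"
    using projectiveD[OF Q *(1-4) rhom_comp[OF rhom_in(2)[OF rm] *(5)]] by blast
  show "\<exists>h\<in>rhom (dsum P Q) M. \<forall>x\<in>carrier (dsum P Q). g (h x) = f x"
  proof (intro bexI ballI)
    show "(\<lambda>z. h (pr1 z) \<oplus>\<^bsub>M\<^esub> k (pr2 z)) \<in> rhom (dsum P Q) M"
      by (rule rhom_copair[OF rmM(1) h(1) k(1)])
    fix z assume z: "z \<in> carrier (dsum P Q)"
    have "g (h (pr1 z) \<oplus>\<^bsub>M\<^esub> k (pr2 z)) = f (pair (pr1 z) \<zero>\<^bsub>Q\<^esub>) \<oplus>\<^bsub>N\<^esub> f (pair \<zero>\<^bsub>P\<^esub> (pr2 z))"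
      using z h k *(3) by (simp add: rhom_add rhom_closed)
    also have "\<dots> = f (pair (pr1 z) \<zero>\<^bsub>Q\<^esub> \<oplus>\<^bsub>dsum P Q\<^esub> pair \<zero>\<^bsub>P\<^esub> (pr2 z))"
      by (rule rhom_add[OF *(5), symmetric]) (use z rm in \<open>auto simp: ag_closed\<close>)
    also have "\<dots> = f z" using z rm by (simp add: ag_simps)
    finally show "g (h (pr1 z) \<oplus>\<^bsub>M\<^esub> k (pr2 z)) = f z" .
  qed
qed

lemma zero_mod_simps [simp]:
  "carrier zero_mod = {\<lambda>_. 0}" "\<zero>\<^bsub>zero_mod\<^esub> = (\<lambda>_. 0)" "x \<oplus>\<^bsub>zero_mod\<^esub> y = (\<lambda>_. 0)"
  "a \<odot>\<^bsub>zero_mod\<^esub> x = (\<lambda>_. 0)"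
  by (simp_all add: zero_mod_def)

lemma zero_mod_right_module: "right_module zero_mod"
  by (intro right_module.intro right_module_axioms.intro abelian_groupI) auto

lemma zero_mod_cat: "zero_mod \<in> mod_cat"
proof -
  interpret right_module zero_mod by (rule zero_mod_right_module)
  have "fin_gen (zero_mod :: 'a obj)" unfolding fin_gen_def
    using rsubmoduleD(1,2) by (intro exI[of _ "{}"]) fastforce
  thus ?thesis by (simp add: mod_cat_def fg_module_def zero_mod_right_module)
qed

lemma projective_zero_mod: "projective zero_mod"
  unfolding projective_def
proof (intro conjI ballI impI zero_mod_cat)
  fix M N :: "'a obj" and g f
  assume *: "M \<in> mod_cat" "N \<in> mod_cat" "g \<in> rhom M N" "f \<in> rhom zero_mod N"
  note rm = mod_catD(1)[OF *(1)] mod_catD(1)[OF *(2)]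
  show "\<exists>h\<in>rhom zero_mod M. \<forall>x\<in>carrier zero_mod. g (h x) = f x"
    using rhom_zero_fun[OF rm(1)] rhom_zero[OF rm *(3)] rhom_zero[OF zero_mod_right_module rm(2) *(4)]
    by (intro bexI[of _ "\<lambda>_. \<zero>\<^bsub>M\<^esub>"]) auto
qed

lemma mem_a_coset: "z \<in> B +>\<^bsub>M\<^esub> x \<longleftrightarrow> (\<exists>b\<in>B. z = b \<oplus>\<^bsub>M\<^esub> x)"
  by (auto simp: a_r_coset_def')

lemma a_coset_carrier [simp]: "B +>\<^bsub>M\<lparr>carrier := C\<rparr>\<^esub> x = B +>\<^bsub>M\<^esub> x"
  by (auto simp: a_r_coset_def')

context right_module
begin

lemma a_coset_eq_iff:
  assumes B: "rsubmodule B M" and xy: "x \<in> carrier M" "y \<in> carrier M"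
  shows "B +> x = B +> y \<longleftrightarrow> x \<ominus> y \<in> B"
proof
  note b = rsubmoduleD[OF B]
  assume "B +> x = B +> y"
  moreover have "x \<in> B +> x" using b(2) xy by (auto simp: mem_a_coset intro!: bexI[of _ \<zero>])
  ultimately obtain c where "c \<in> B" "x = c \<oplus> y" by (auto simp: mem_a_coset)
  thus "x \<ominus> y \<in> B" using b(1) xy ag_minus_iff[OF right_module_axioms, of x y c] by auto
next
  note b = rsubmoduleD[OF B]
  have *: "B +> x \<subseteq> B +> y" if "x \<ominus> y \<in> B" "x \<in> carrier M" "y \<in> carrier M" for x y
  proof
    fix z assume "z \<in> B +> x"
    then obtain c where c: "c \<in> B" "z = c \<oplus> x" by (auto simp: mem_a_coset)
    hence "z = (c \<oplus> (x \<ominus> y)) \<oplus> y" using that b(1) by (auto simp: minus_eq a_assoc l_neg)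
    thus "z \<in> B +> y" using b(3)[OF c(1) that(1)] by (auto simp: mem_a_coset)
  qed
  assume 1: "x \<ominus> y \<in> B"
  have "\<ominus> (x \<ominus> y) = y \<ominus> x" using xy by (simp add: minus_eq minus_add minus_minus a_comm)
  hence "y \<ominus> x \<in> B" using b(5)[OF 1] by simp
  thus "B +> x = B +> y" using *[OF 1 xy] *[OF _ xy(2,1)] by blast
qed

lemma quot_simps:
  assumes B: "rsubmodule B M"
  shows "carrier (quot_mod M B) = (\<lambda>x. B +> x) ` carrier M"
    "x \<in> carrier M \<Longrightarrow> y \<in> carrier M \<Longrightarrow> (B +> x) \<oplus>\<^bsub>quot_mod M B\<^esub> (B +> y) = B +> (x \<oplus> y)"
    "x \<in> carrier M \<Longrightarrow> a \<odot>\<^bsub>quot_mod M B\<^esub> (B +> x) = B +> (a \<odot> x)"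
    "\<zero>\<^bsub>quot_mod M B\<^esub> = B +> \<zero>"
proof -
  note b = rsubmoduleD[OF B]
  have bM: "c \<in> carrier M" if "c \<in> B" for c using that b(1) by auto
  show "carrier (quot_mod M B) = (\<lambda>x. B +> x) ` carrier M"
    by (auto simp: quot_mod_def A_RCOSETS_def')
  show "(B +> x) \<oplus>\<^bsub>quot_mod M B\<^esub> (B +> y) = B +> (x \<oplus> y)" if xy: "x \<in> carrier M" "y \<in> carrier M"
  proof -
    have "z \<in> (B +> x) <+> (B +> y) \<longleftrightarrow> z \<in> B +> (x \<oplus> y)" for z
    proof
      assume "z \<in> (B +> x) <+> (B +> y)"
      then obtain c d where "c \<in> B" "d \<in> B" "z = (c \<oplus> x) \<oplus> (d \<oplus> y)"
        by (auto simp: set_add_def' mem_a_coset)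
      thus "z \<in> B +> (x \<oplus> y)" using xy b(3)[of c d] bM
        by (auto simp: mem_a_coset a_ac intro!: bexI[of _ "c \<oplus> d"])
    next
      assume "z \<in> B +> (x \<oplus> y)"
      then obtain c where "c \<in> B" "z = c \<oplus> (x \<oplus> y)" by (auto simp: mem_a_coset)
      hence "z = (c \<oplus> x) \<oplus> (\<zero> \<oplus> y)" "c \<oplus> x \<in> B +> x" "\<zero> \<oplus> y \<in> B +> y"
        using xy bM b(2) by (auto simp: mem_a_coset a_ac)
      thus "z \<in> (B +> x) <+> (B +> y)" by (auto simp: set_add_def')
    qed
    thus ?thesis by (auto simp: quot_mod_def)
  qed
  show "a \<odot>\<^bsub>quot_mod M B\<^esub> (B +> x) = B +> (a \<odot> x)" if x: "x \<in> carrier M"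
  proof -
    have "B +> (a \<odot> z) = B +> (a \<odot> x)" if "z \<in> B +> x" for z
    proof -
      from that obtain c where c: "c \<in> B" "z = c \<oplus> x" by (auto simp: mem_a_coset)
      have "a \<odot> z \<ominus> a \<odot> x = a \<odot> c" using c x bM
        by (simp add: act_add ag_minus_iff[OF right_module_axioms] act_closed)
      thus ?thesis using c x b(4)[OF c(1)] bM by (subst a_coset_eq_iff[OF B]) (auto simp: act_closed)
    qed
    moreover have "x \<in> B +> x" using b(2) x by (auto simp: mem_a_coset intro!: bexI[of _ \<zero>])
    ultimately have "(\<Union>z\<in>B +> x. B +> (a \<odot> z)) = B +> (a \<odot> x)" by blast
    thus ?thesis by (simp add: quot_mod_def)
  qed
  show "\<zero>\<^bsub>quot_mod M B\<^esub> = B +> \<zero>" using bM by (auto simp: quot_mod_def mem_a_coset)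
qed

lemma quot_rhom: "rsubmodule B M \<Longrightarrow> (\<lambda>x. B +> x) \<in> rhom M (quot_mod M B)"
  by (auto intro!: rhomI simp: quot_simps)

lemma quot_right_module:
  assumes B: "rsubmodule B M" shows "right_module (quot_mod M B)"
proof (intro right_module.intro right_module_axioms.intro abelian_groupI)
  note q = quot_simps[OF B]
  fix A assume "A \<in> carrier (quot_mod M B)"
  then obtain x where x: "x \<in> carrier M" "A = B +> x" by (auto simp: q)
  show "\<exists>C\<in>carrier (quot_mod M B). C \<oplus>\<^bsub>quot_mod M B\<^esub> A = \<zero>\<^bsub>quot_mod M B\<^esub>"
    using x by (intro bexI[of _ "B +> (\<ominus> x)"]) (auto simp: q l_neg)
qed (auto simp: quot_simps[OF B] a_ac act_closed act_add add_act mult_act one_act)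

end

lemma quot_rhom_factor:
  assumes Z: "right_module Z" and B: "rsubmodule B Z" and M: "right_module M" and f: "f \<in> rhom Z M"
    and fb: "\<And>x. x \<in> B \<Longrightarrow> f x = \<zero>\<^bsub>M\<^esub>"
  obtains g where "g \<in> rhom (quot_mod Z B) M" "\<And>y. y \<in> carrier Z \<Longrightarrow> g (B +>\<^bsub>Z\<^esub> y) = f y"
proof -
  interpret Z: right_module Z by (rule Z)
  note q = Z.quot_simps[OF B]
  define g where "g A = f (SOME y. y \<in> carrier Z \<and> A = B +>\<^bsub>Z\<^esub> y)" for A
  have g: "g (B +>\<^bsub>Z\<^esub> y) = f y" if y: "y \<in> carrier Z" for y
  proof -
    define y' where "y' = (SOME y'. y' \<in> carrier Z \<and> B +>\<^bsub>Z\<^esub> y = B +>\<^bsub>Z\<^esub> y')"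
    have "y' \<in> carrier Z \<and> B +>\<^bsub>Z\<^esub> y = B +>\<^bsub>Z\<^esub> y'"
      unfolding y'_def by (rule someI[of _ y]) (use y in simp)
    hence y': "y' \<in> carrier Z" "y \<ominus>\<^bsub>Z\<^esub> y' \<in> B"
      using Z.a_coset_eq_iff[OF B] y by auto
    have "f y \<ominus>\<^bsub>M\<^esub> f y' = \<zero>\<^bsub>M\<^esub>"
      using fb[OF y'(2)] rhom_minus[OF Z M f y y'(1)] by simp
    hence "f y = f y'" by (rule ag_eq_if_minus_zero[OF M rhom_closed[OF f y] rhom_closed[OF f y'(1)]])
    thus ?thesis by (simp add: g_def y'_def)
  qed
  have "g \<in> rhom (quot_mod Z B) M"
  proof (rule rhomI)
    fix A assume "A \<in> carrier (quot_mod Z B)"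
    then obtain y where y: "y \<in> carrier Z" "A = B +>\<^bsub>Z\<^esub> y" unfolding q(1) by blast
    show "g A \<in> carrier M" using y g rhom_closed[OF f] by simp
    show "g (a \<odot>\<^bsub>quot_mod Z B\<^esub> A) = a \<odot>\<^bsub>M\<^esub> g A" for a
      using y g Z.act_closed[of y a] rhom_act[OF f, of y a] by (simp add: q)
    fix A' assume "A' \<in> carrier (quot_mod Z B)"
    then obtain y' where y': "y' \<in> carrier Z" "A' = B +>\<^bsub>Z\<^esub> y'" unfolding q(1) by blast
    show "g (A \<oplus>\<^bsub>quot_mod Z B\<^esub> A') = g A \<oplus>\<^bsub>M\<^esub> g A'"
      using y y' g rhom_add[OF f, of y y'] by (simp add: q)
  qed
  thus ?thesis using that g by blast
qed


section \<open>Complexes and homotopies\<close>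

lemma cobj_mod_cat: "is_complex X \<Longrightarrow> cobj X i \<in> mod_cat"
  by (simp add: is_complex_def)

lemma cobj_rm: "is_complex X \<Longrightarrow> right_module (cobj X i)"
  by (rule mod_catD(1)[OF cobj_mod_cat])

lemma cdiff_rhom: "is_complex X \<Longrightarrow> cdiff X i \<in> rhom (cobj X i) (cobj X (i + 1))"
  by (simp add: is_complex_def)

lemma cdiff_rhom': "is_complex X \<Longrightarrow> cdiff X (i - 1) \<in> rhom (cobj X (i - 1)) (cobj X i)"
  using cdiff_rhom[of X "i - 1"] by simp

lemma cdiff_closed: "is_complex X \<Longrightarrow> x \<in> carrier (cobj X i) \<Longrightarrow> cdiff X i x \<in> carrier (cobj X (i + 1))"
  by (rule rhom_closed[OF cdiff_rhom])

lemma cdiff_closed': "is_complex X \<Longrightarrow> x \<in> carrier (cobj X (i - 1)) \<Longrightarrow> cdiff X (i - 1) x \<in> carrier (cobj X i)"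
  by (rule rhom_closed[OF cdiff_rhom'])

lemma cdiff_cdiff:
  "is_complex X \<Longrightarrow> x \<in> carrier (cobj X i) \<Longrightarrow> cdiff X (i + 1) (cdiff X i x) = \<zero>\<^bsub>cobj X (i + 2)\<^esub>"
  by (simp add: is_complex_def)

lemma cdiff_cdiff':
  "is_complex X \<Longrightarrow> x \<in> carrier (cobj X (i - 1)) \<Longrightarrow> cdiff X i (cdiff X (i - 1) x) = \<zero>\<^bsub>cobj X (i + 1)\<^esub>"
  using cdiff_cdiff[of X x "i - 1"] by (simp add: add.commute)

lemma cdiff_zero: "is_complex X \<Longrightarrow> cdiff X i \<zero>\<^bsub>cobj X i\<^esub> = \<zero>\<^bsub>cobj X (i + 1)\<^esub>"
  by (rule rhom_zero[OF cobj_rm cobj_rm cdiff_rhom])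

lemma chom_rhom: "f \<in> chom X Y \<Longrightarrow> f i \<in> rhom (cobj X i) (cobj Y i)"
  by (simp add: chom_def)

lemma chom_closed: "f \<in> chom X Y \<Longrightarrow> x \<in> carrier (cobj X i) \<Longrightarrow> f i x \<in> carrier (cobj Y i)"
  by (rule rhom_closed[OF chom_rhom])

lemma chom_d: "f \<in> chom X Y \<Longrightarrow> x \<in> carrier (cobj X i) \<Longrightarrow> f (i + 1) (cdiff X i x) = cdiff Y i (f i x)"
  by (simp add: chom_def)

lemma chom_d': "f \<in> chom X Y \<Longrightarrow> x \<in> carrier (cobj X (i - 1)) \<Longrightarrow> f i (cdiff X (i - 1) x) = cdiff Y (i - 1) (f (i - 1) x)"
  using chom_d[of f X Y x "i - 1"] by simp

lemma chomI:
  "(\<And>i. f i \<in> rhom (cobj X i) (cobj Y i)) \<Longrightarrow>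
   (\<And>i x. x \<in> carrier (cobj X i) \<Longrightarrow> f (i + 1) (cdiff X i x) = cdiff Y i (f i x)) \<Longrightarrow> f \<in> chom X Y"
  by (simp add: chom_def)

lemma comp_map_apply [simp]: "(g \<circ>\<^sub>c f) i x = g i (f i x)"
  by (simp add: comp_map_def)

lemma comp_map_assoc: "h \<circ>\<^sub>c (g \<circ>\<^sub>c f) = h \<circ>\<^sub>c g \<circ>\<^sub>c f"
  by (simp add: comp_map_def)

lemma id_map_apply [simp]: "id_map i x = x"
  by (simp add: id_map_def)

lemma id_comp [simp]: "id_map \<circ>\<^sub>c f = f" "f \<circ>\<^sub>c id_map = f"
  by (simp_all add: comp_map_def id_map_def)

lemma chom_comp: "f \<in> chom X Y \<Longrightarrow> g \<in> chom Y Z \<Longrightarrow> g \<circ>\<^sub>c f \<in> chom X Z"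
  using rhom_comp[OF chom_rhom chom_rhom]
  by (intro chomI) (auto simp: comp_map_def chom_d chom_closed)

lemma chom_id: "id_map \<in> chom X X"
  by (rule chomI) (auto simp: id_map_def rhom_id)

lemma chom_zero: "is_complex Y \<Longrightarrow> zero_map Y \<in> chom X Y"
  by (rule chomI) (auto simp: zero_map_def rhom_zero_fun cobj_rm cdiff_zero)

lemma chom_add:
  assumes "is_complex Y" "f \<in> chom X Y" "g \<in> chom X Y"
  shows "add_map Y f g \<in> chom X Y"
  by (rule chomI)
    (use assms in \<open>auto simp: add_map_def rhom_add_fun cobj_rm chom_rhom chom_d chom_closed
       rhom_add[OF cdiff_rhom]\<close>)

lemma Cb_modD: "X \<in> Cb_mod \<Longrightarrow> is_complex X" "X \<in> Cb_mod \<Longrightarrow> finite {i. \<not> zero_at X i}"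
  by (simp_all add: Cb_mod_def)

lemma Kb_projD: "X \<in> Kb_proj \<Longrightarrow> X \<in> Cb_mod" "X \<in> Kb_proj \<Longrightarrow> is_complex X" "X \<in> Kb_proj \<Longrightarrow> projective (cobj X i)"
  by (simp_all add: Kb_proj_def Cb_mod_def)

lemma homotopicI:
  assumes "is_complex X" "is_complex Y" "f \<in> chom X Y" "g \<in> chom X Y"
    and h: "\<And>i. h i \<in> rhom (cobj X i) (cobj Y (i - 1))"
    and eq: "\<And>i x. x \<in> carrier (cobj X i) \<Longrightarrow>
      f i x = cdiff Y (i - 1) (h i x) \<oplus>\<^bsub>cobj Y i\<^esub> h (i + 1) (cdiff X i x) \<oplus>\<^bsub>cobj Y i\<^esub> g i x"
  shows "homotopic X Y f g"
  unfolding homotopic_def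
proof (intro exI[of _ h] conjI allI ballI h)
  fix i x assume x: "x \<in> carrier (cobj X i)"
  have "h i x \<in> carrier (cobj Y (i - 1))" "h (i + 1) (cdiff X i x) \<in> carrier (cobj Y i)"
    using rhom_closed[OF h x] rhom_closed[OF h cdiff_closed[OF assms(1) x]] by simp_all
  thus "f i x \<ominus>\<^bsub>cobj Y i\<^esub> g i x = cdiff Y (i - 1) (h i x) \<oplus>\<^bsub>cobj Y i\<^esub> h (i + 1) (cdiff X i x)"
    using assms(1-4) x
    by (subst ag_minus_iff[OF cobj_rm[OF assms(2)]]) (auto simp: chom_closed cdiff_closed' ag_closed cobj_rm eq)
qed

text \<open>The condition of \<open>homotopic\<close> with the subtraction moved to the other side, so that computations need
  only associativity and commutativity.\<close>

definition homotopy :: "('a::{ring,monoid_mult}) cpx \<Rightarrow> 'a cpx \<Rightarrow> 'a cmap \<Rightarrow> 'a cmap \<Rightarrow> 'a cmap \<Rightarrow> bool" where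
  "homotopy X Y h f g \<longleftrightarrow> (\<forall>i. h i \<in> rhom (cobj X i) (cobj Y (i - 1))) \<and>
     (\<forall>i. \<forall>x\<in>carrier (cobj X i).
        f i x = cdiff Y (i - 1) (h i x) \<oplus>\<^bsub>cobj Y i\<^esub> h (i + 1) (cdiff X i x) \<oplus>\<^bsub>cobj Y i\<^esub> g i x)"

lemma homotopyD:
  assumes H: "homotopy X Y h f g" and X: "is_complex X" and Y: "is_complex Y"
  shows "h i \<in> rhom (cobj X i) (cobj Y (i - 1))"
    and "x \<in> carrier (cobj X i) \<Longrightarrow> h i x \<in> carrier (cobj Y (i - 1))"
    and "x \<in> carrier (cobj X i) \<Longrightarrow> cdiff Y (i - 1) (h i x) \<in> carrier (cobj Y i)"
    and "x \<in> carrier (cobj X i) \<Longrightarrow> h (i + 1) (cdiff X i x) \<in> carrier (cobj Y i)"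
    and "x \<in> carrier (cobj X i) \<Longrightarrow>
      f i x = cdiff Y (i - 1) (h i x) \<oplus>\<^bsub>cobj Y i\<^esub> h (i + 1) (cdiff X i x) \<oplus>\<^bsub>cobj Y i\<^esub> g i x"
proof -
  have h: "h i \<in> rhom (cobj X i) (cobj Y (i - 1))" for i using H by (simp add: homotopy_def)
  show "h i \<in> rhom (cobj X i) (cobj Y (i - 1))" by (rule h)
  assume x: "x \<in> carrier (cobj X i)"
  show hx: "h i x \<in> carrier (cobj Y (i - 1))" by (rule rhom_closed[OF h x])
  show "cdiff Y (i - 1) (h i x) \<in> carrier (cobj Y i)" by (rule cdiff_closed'[OF Y hx])
  show "h (i + 1) (cdiff X i x) \<in> carrier (cobj Y i)"
    using rhom_closed[OF h cdiff_closed[OF X x]] by simp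
  show "f i x = cdiff Y (i - 1) (h i x) \<oplus>\<^bsub>cobj Y i\<^esub> h (i + 1) (cdiff X i x) \<oplus>\<^bsub>cobj Y i\<^esub> g i x"
    using H x by (simp add: homotopy_def)
qed

lemma homotopicE:
  assumes "homotopic X Y f g" and X: "is_complex X" and Y: "is_complex Y"
    and f: "f \<in> chom X Y" and g: "g \<in> chom X Y"
  obtains h where "homotopy X Y h f g"
proof -
  obtain h where h: "\<And>i. h i \<in> rhom (cobj X i) (cobj Y (i - 1))"
    and eq: "\<And>i x. x \<in> carrier (cobj X i) \<Longrightarrow>
      f i x \<ominus>\<^bsub>cobj Y i\<^esub> g i x = cdiff Y (i - 1) (h i x) \<oplus>\<^bsub>cobj Y i\<^esub> h (i + 1) (cdiff X i x)"
    using assms(1) unfolding homotopic_def by blast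
  have "f i x = cdiff Y (i - 1) (h i x) \<oplus>\<^bsub>cobj Y i\<^esub> h (i + 1) (cdiff X i x) \<oplus>\<^bsub>cobj Y i\<^esub> g i x"
    if x: "x \<in> carrier (cobj X i)" for i x
  proof (subst ag_minus_iff[OF cobj_rm[OF Y], symmetric])
    show "cdiff Y (i - 1) (h i x) \<oplus>\<^bsub>cobj Y i\<^esub> h (i + 1) (cdiff X i x) \<in> carrier (cobj Y i)"
      using cdiff_closed'[OF Y rhom_closed[OF h x]] rhom_closed[OF h cdiff_closed[OF X x]]
      by (simp add: ag_closed cobj_rm[OF Y])
  qed (use x in \<open>simp_all add: eq chom_closed[OF f] chom_closed[OF g]\<close>)
  with h have "homotopy X Y h f g" unfolding homotopy_def by blast
  thus ?thesis by (rule that)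
qed

lemma homotopic_refl: "is_complex X \<Longrightarrow> is_complex Y \<Longrightarrow> f \<in> chom X Y \<Longrightarrow> homotopic X Y f f"
  by (rule homotopicI[where h = "\<lambda>i _. \<zero>\<^bsub>cobj Y (i - 1)\<^esub>"])
    (use cdiff_zero[of Y "i - 1" for i] in \<open>auto simp: rhom_zero_fun cobj_rm chom_closed ag_simps ag_closed\<close>)

lemma homotopic_cong:
  assumes "homotopic X Y f g" "is_complex X" "is_complex Y"
    "\<And>i x. x \<in> carrier (cobj X i) \<Longrightarrow> f' i x = f i x" "\<And>i x. x \<in> carrier (cobj X i) \<Longrightarrow> g' i x = g i x"
  shows "homotopic X Y f' g'"
  using assms unfolding homotopic_def by simp

lemma homotopic_sym:
  assumes "homotopic X Y f g" "is_complex X" "is_complex Y" "f \<in> chom X Y" "g \<in> chom X Y"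
  shows "homotopic X Y g f"
proof -
  obtain h where H: "homotopy X Y h f g" by (rule homotopicE[OF assms])
  note h = homotopyD(1)[OF H assms(2) assms(3)] and c = homotopyD(2-4)[OF H assms(2) assms(3)] and eq = homotopyD(5)[OF H assms(2) assms(3)]
  show ?thesis
  proof (rule homotopicI[OF assms(2,3,5,4), where h = "\<lambda>i x. \<ominus>\<^bsub>cobj Y (i - 1)\<^esub> h i x"])
    show "(\<lambda>x. \<ominus>\<^bsub>cobj Y (i - 1)\<^esub> h i x) \<in> rhom (cobj X i) (cobj Y (i - 1))" for i
      by (intro rhom_neg_fun cobj_rm assms h)
    fix i x assume x: "x \<in> carrier (cobj X i)"
    have "cdiff Y (i - 1) (\<ominus>\<^bsub>cobj Y (i - 1)\<^esub> h i x) = \<ominus>\<^bsub>cobj Y i\<^esub> cdiff Y (i - 1) (h i x)"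
      by (rule rhom_neg[OF cobj_rm cobj_rm cdiff_rhom' c(1)]) (use assms x in auto)
    thus "g i x = cdiff Y (i - 1) (\<ominus>\<^bsub>cobj Y (i - 1)\<^esub> h i x) \<oplus>\<^bsub>cobj Y i\<^esub>
      \<ominus>\<^bsub>cobj Y (i + 1 - 1)\<^esub> h (i + 1) (cdiff X i x) \<oplus>\<^bsub>cobj Y i\<^esub> f i x"
      using x assms c(2,3)[OF x] by (simp add: eq ag_ac ag_simps ag_closed cobj_rm chom_closed)
  qed
qed

lemma homotopic_trans:
  assumes "homotopic X Y f g" "homotopic X Y g k" "is_complex X" "is_complex Y"
    "f \<in> chom X Y" "g \<in> chom X Y" "k \<in> chom X Y"
  shows "homotopic X Y f k"
proof -
  obtain h where H: "homotopy X Y h f g" by (rule homotopicE[OF assms(1,3,4,5,6)])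
  obtain h' where H': "homotopy X Y h' g k" by (rule homotopicE[OF assms(2,3,4,6,7)])
  note h = homotopyD(1)[OF H assms(3) assms(4)] and c = homotopyD(2-4)[OF H assms(3) assms(4)] and eq = homotopyD(5)[OF H assms(3) assms(4)]
  note h' = homotopyD(1)[OF H' assms(3) assms(4)] and c' = homotopyD(2-4)[OF H' assms(3) assms(4)] and eq' = homotopyD(5)[OF H' assms(3) assms(4)]
  show ?thesis
  proof (rule homotopicI[OF assms(3,4,5,7), where h = "\<lambda>i x. h i x \<oplus>\<^bsub>cobj Y (i - 1)\<^esub> h' i x"])
    show "(\<lambda>x. h i x \<oplus>\<^bsub>cobj Y (i - 1)\<^esub> h' i x) \<in> rhom (cobj X i) (cobj Y (i - 1))" for i
      by (intro rhom_add_fun cobj_rm assms h h')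
    fix i x assume x: "x \<in> carrier (cobj X i)"
    show "f i x = cdiff Y (i - 1) (h i x \<oplus>\<^bsub>cobj Y (i - 1)\<^esub> h' i x) \<oplus>\<^bsub>cobj Y i\<^esub>
      (h (i + 1) (cdiff X i x) \<oplus>\<^bsub>cobj Y (i + 1 - 1)\<^esub> h' (i + 1) (cdiff X i x)) \<oplus>\<^bsub>cobj Y i\<^esub> k i x"
      using x assms c[OF x] c'[OF x]
      by (simp add: eq eq' ag_ac ag_closed cobj_rm chom_closed rhom_add[OF cdiff_rhom'])
  qed
qed

lemma homotopic_comp_left:
  assumes "homotopic X Y f g" "p \<in> chom Y W" "is_complex X" "is_complex Y" "is_complex W"
    "f \<in> chom X Y" "g \<in> chom X Y"
  shows "homotopic X W (p \<circ>\<^sub>c f) (p \<circ>\<^sub>c g)"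
proof -
  obtain h where H: "homotopy X Y h f g" by (rule homotopicE[OF assms(1,3,4,6,7)])
  note h = homotopyD(1)[OF H assms(3) assms(4)] and c = homotopyD(2-4)[OF H assms(3) assms(4)] and eq = homotopyD(5)[OF H assms(3) assms(4)]
  show ?thesis
  proof (rule homotopicI[where h = "\<lambda>i x. p (i - 1) (h i x)"])
    show "(\<lambda>x. p (i - 1) (h i x)) \<in> rhom (cobj X i) (cobj W (i - 1))" for i
      by (rule rhom_comp[OF h chom_rhom[OF assms(2)]])
    fix i x assume x: "x \<in> carrier (cobj X i)"
    show "(p \<circ>\<^sub>c f) i x = cdiff W (i - 1) (p (i - 1) (h i x)) \<oplus>\<^bsub>cobj W i\<^esub>
      p (i + 1 - 1) (h (i + 1) (cdiff X i x)) \<oplus>\<^bsub>cobj W i\<^esub> (p \<circ>\<^sub>c g) i x"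
      using x assms c[OF x]
      by (simp add: eq ag_closed cobj_rm chom_closed rhom_add[OF chom_rhom[OF assms(2)]] flip: chom_d')
  qed (use assms in \<open>auto intro: chom_comp\<close>)
qed

lemma homotopic_comp_right:
  assumes "homotopic X Y f g" "p \<in> chom W X" "is_complex X" "is_complex Y" "is_complex W"
    "f \<in> chom X Y" "g \<in> chom X Y"
  shows "homotopic W Y (f \<circ>\<^sub>c p) (g \<circ>\<^sub>c p)"
proof -
  obtain h where H: "homotopy X Y h f g" by (rule homotopicE[OF assms(1,3,4,6,7)])
  note h = homotopyD(1)[OF H assms(3) assms(4)] and c = homotopyD(2-4)[OF H assms(3) assms(4)] and eq = homotopyD(5)[OF H assms(3) assms(4)]
  show ?thesis
  proof (rule homotopicI[where h = "\<lambda>i x. h i (p i x)"])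
    show "(\<lambda>x. h i (p i x)) \<in> rhom (cobj W i) (cobj Y (i - 1))" for i
      by (rule rhom_comp[OF chom_rhom[OF assms(2)] h])
  qed (use assms in \<open>auto simp: eq chom_closed chom_d intro: chom_comp\<close>)
qed

lemma homotopic_add:
  assumes "homotopic X Y f f'" "homotopic X Y g g'" "is_complex X" "is_complex Y"
    "f \<in> chom X Y" "f' \<in> chom X Y" "g \<in> chom X Y" "g' \<in> chom X Y"
  shows "homotopic X Y (add_map Y f g) (add_map Y f' g')"
proof -
  obtain h where H: "homotopy X Y h f f'" by (rule homotopicE[OF assms(1,3,4,5,6)])
  obtain h' where H': "homotopy X Y h' g g'" by (rule homotopicE[OF assms(2,3,4,7,8)])
  note h = homotopyD(1)[OF H assms(3) assms(4)] and c = homotopyD(2-4)[OF H assms(3) assms(4)] and eq = homotopyD(5)[OF H assms(3) assms(4)]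
  note h' = homotopyD(1)[OF H' assms(3) assms(4)] and c' = homotopyD(2-4)[OF H' assms(3) assms(4)] and eq' = homotopyD(5)[OF H' assms(3) assms(4)]
  show ?thesis
  proof (rule homotopicI[where h = "\<lambda>i x. h i x \<oplus>\<^bsub>cobj Y (i - 1)\<^esub> h' i x"])
    show "(\<lambda>x. h i x \<oplus>\<^bsub>cobj Y (i - 1)\<^esub> h' i x) \<in> rhom (cobj X i) (cobj Y (i - 1))" for i
      by (intro rhom_add_fun cobj_rm assms h h')
    fix i x assume x: "x \<in> carrier (cobj X i)"
    show "add_map Y f g i x = cdiff Y (i - 1) (h i x \<oplus>\<^bsub>cobj Y (i - 1)\<^esub> h' i x) \<oplus>\<^bsub>cobj Y i\<^esub>
      (h (i + 1) (cdiff X i x) \<oplus>\<^bsub>cobj Y (i + 1 - 1)\<^esub> h' (i + 1) (cdiff X i x)) \<oplus>\<^bsub>cobj Y i\<^esub> add_map Y f' g' i x"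
      using x assms c[OF x] c'[OF x]
      by (simp add: add_map_def eq eq' ag_ac ag_closed cobj_rm chom_closed rhom_add[OF cdiff_rhom'])
  qed (use assms in \<open>auto intro: chom_add\<close>)
qed

section \<open>Sums, cones, shifts and stalks\<close>

lemma csum_simps [simp]:
  "cobj (csum X Y) i = dsum (cobj X i) (cobj Y i)"
  "cdiff (csum X Y) i z = pair (cdiff X i (pr1 z)) (cdiff Y i (pr2 z))"
  by (simp_all add: csum_def)

lemma csum_complex:
  assumes "is_complex X" "is_complex Y" shows "is_complex (csum X Y)"
  unfolding is_complex_def
proof (intro allI conjI ballI)
  fix i
  show "cobj (csum X Y) i \<in> mod_cat" using assms by (simp add: dsum_mod_cat cobj_mod_cat)
  show "cdiff (csum X Y) i \<in> rhom (cobj (csum X Y) i) (cobj (csum X Y) (i + 1))"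
    by (rule rhomI)
      (use assms in \<open>auto simp: cdiff_closed rhom_add[OF cdiff_rhom] rhom_act[OF cdiff_rhom]\<close>)
  show "cdiff (csum X Y) (i + 1) (cdiff (csum X Y) i z) = \<zero>\<^bsub>cobj (csum X Y) (i + 2)\<^esub>"
    if "z \<in> carrier (cobj (csum X Y) i)" for z
    using that assms by (simp add: cdiff_cdiff)
qed

lemma zero_at_dsum: "zero_at X i \<Longrightarrow> zero_at Y j \<Longrightarrow> carrier (dsum (cobj X i) (cobj Y j)) = {\<zero>\<^bsub>dsum (cobj X i) (cobj Y j)\<^esub>}"
  unfolding zero_at_def by (auto simp: set_eq_iff) (metis pr_pair(3))

lemma csum_Cb_mod:
  assumes "X \<in> Cb_mod" "Y \<in> Cb_mod" shows "csum X Y \<in> Cb_mod"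
proof -
  have "{i. \<not> zero_at (csum X Y) i} \<subseteq> {i. \<not> zero_at X i} \<union> {i. \<not> zero_at Y i}"
  proof
    fix i assume "i \<in> {i. \<not> zero_at (csum X Y) i}"
    thus "i \<in> {i. \<not> zero_at X i} \<union> {i. \<not> zero_at Y i}"
      using zero_at_dsum[of X i Y i] by (auto simp only: zero_at_def[of "csum X Y"] csum_simps Un_iff mem_Collect_eq)
  qed
  thus ?thesis using assms by (auto simp: Cb_mod_def csum_complex intro: finite_subset)
qed

lemma csum_Kb_proj: "X \<in> Kb_proj \<Longrightarrow> Y \<in> Kb_proj \<Longrightarrow> csum X Y \<in> Kb_proj"
  by (simp add: Kb_proj_def csum_Cb_mod projective_dsum)

lemma cone_simps [simp]:
  "cobj (cone X Y f) i = dsum (cobj X (i + 1)) (cobj Y i)"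
  "cdiff (cone X Y f) i z = pair (\<ominus>\<^bsub>cobj X (i + 2)\<^esub> cdiff X (i + 1) (pr1 z))
                        (f (i + 1) (pr1 z) \<oplus>\<^bsub>cobj Y (i + 1)\<^esub> cdiff Y i (pr2 z))"
  by (simp_all add: cone_def)

lemma cone_complex:
  assumes X: "is_complex X" and Y: "is_complex Y" and f: "f \<in> chom X Y"
  shows "is_complex (cone X Y f)"
  unfolding is_complex_def
proof (intro allI conjI ballI)
  fix i
  have dX: "cdiff X (i + 1) x \<in> carrier (cobj X (i + 2))" if "x \<in> carrier (cobj X (i + 1))" for x
    using cdiff_closed[OF X that] by (simp add: add.commute)
  have dXh: "cdiff X (i + 1) \<in> rhom (cobj X (i + 1)) (cobj X (i + 2))"
    using cdiff_rhom[OF X, of "i + 1"] by (simp add: add.commute)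
  show "cobj (cone X Y f) i \<in> mod_cat" using assms by (simp add: dsum_mod_cat cobj_mod_cat)
  show "cdiff (cone X Y f) i \<in> rhom (cobj (cone X Y f) i) (cobj (cone X Y f) (i + 1))"
    by (rule rhomI)
      (use assms dX in \<open>auto simp: ag_closed ag_ac ag_simps cobj_rm cdiff_closed chom_closed
        rhom_add[OF cdiff_rhom] rhom_act[OF cdiff_rhom] rhom_add[OF chom_rhom[OF f]] rhom_act[OF chom_rhom[OF f]]
        rhom_add[OF dXh] rhom_act[OF dXh] right_module.act_neg right_module.act_add add.assoc\<close>)
  fix z assume z: "z \<in> carrier (cobj (cone X Y f) i)"
  have 1: "cdiff X (i + 2) (\<ominus>\<^bsub>cobj X (i + 2)\<^esub> cdiff X (i + 1) (pr1 z)) = \<zero>\<^bsub>cobj X (i + 3)\<^esub>"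
    using z rhom_neg[OF cobj_rm[OF X] cobj_rm[OF X] cdiff_rhom[OF X], of "cdiff X (i + 1) (pr1 z)" "i + 2"]
      cdiff_cdiff[OF X, of "pr1 z" "i + 1"] dX[of "pr1 z"]
    by (simp add: ag_simps cobj_rm[OF X] add.assoc)
  have "f (i + 2) (\<ominus>\<^bsub>cobj X (i + 2)\<^esub> cdiff X (i + 1) (pr1 z)) = \<ominus>\<^bsub>cobj Y (i + 2)\<^esub> cdiff Y (i + 1) (f (i + 1) (pr1 z))"
    using z rhom_neg[OF cobj_rm[OF X] cobj_rm[OF Y] chom_rhom[OF f], of "cdiff X (i + 1) (pr1 z)" "i + 2"]
      chom_d[OF f, of "pr1 z" "i + 1"] dX[of "pr1 z"]
    by (simp add: add.assoc)
  moreover have "cdiff Y (i + 1) (f (i + 1) (pr1 z) \<oplus>\<^bsub>cobj Y (i + 1)\<^esub> cdiff Y i (pr2 z)) = cdiff Y (i + 1) (f (i + 1) (pr1 z))"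
    using z cdiff_closed[OF Y chom_closed[OF f], of "pr1 z" "i + 1"]
    by (simp add: rhom_add[OF cdiff_rhom[OF Y]] chom_closed[OF f] cdiff_closed[OF Y] cdiff_cdiff[OF Y]
        ag_simps cobj_rm[OF Y] add.assoc)
  ultimately show "cdiff (cone X Y f) (i + 1) (cdiff (cone X Y f) i z) = \<zero>\<^bsub>cobj (cone X Y f) (i + 2)\<^esub>"
    using 1 z cdiff_closed[OF Y chom_closed[OF f], of "pr1 z" "i + 1"] X Y
    by (simp add: ag_simps cobj_rm chom_closed[OF f] add.assoc)
qed

lemma shift_simps [simp]:
  "cobj (shift n X) i = cobj X (i + n)"
  "cdiff (shift n X) i x = (if even n then cdiff X (i + n) x else \<ominus>\<^bsub>cobj X (i + n + 1)\<^esub> cdiff X (i + n) x)"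
  by (simp_all add: shift_def)

lemma shift_complex:
  assumes X: "is_complex X" shows "is_complex (shift n X)"
  unfolding is_complex_def
proof (intro allI conjI ballI)
  fix i
  have e: "i + 1 + n = i + n + 1" "i + 2 + n = i + n + 2" "i + n + 1 + 1 = i + n + 2" by simp_all
  show "cobj (shift n X) i \<in> mod_cat" using X by (simp add: cobj_mod_cat)
  have "(\<lambda>x. \<ominus>\<^bsub>cobj X (i + n + 1)\<^esub> cdiff X (i + n) x) \<in> rhom (cobj X (i + n)) (cobj X (i + n + 1))"
    by (intro rhom_neg_fun cobj_rm cdiff_rhom X)
  thus "cdiff (shift n X) i \<in> rhom (cobj (shift n X) i) (cobj (shift n X) (i + 1))"
    using cdiff_rhom[OF X, of "i + n"] by (cases "even n") (simp_all add: shift_def e)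
  fix x assume x: "x \<in> carrier (cobj (shift n X) i)"
  have "cdiff X (i + n + 1) (\<ominus>\<^bsub>cobj X (i + n + 1)\<^esub> cdiff X (i + n) x) = \<zero>\<^bsub>cobj X (i + n + 2)\<^esub>"
    using x rhom_neg[OF cobj_rm[OF X] cobj_rm[OF X] cdiff_rhom[OF X], of "cdiff X (i + n) x" "i + n + 1"]
      cdiff_cdiff[OF X, of x "i + n"] cdiff_closed[OF X, of x "i + n"]
    by (simp add: ag_simps cobj_rm[OF X] add.assoc)
  thus "cdiff (shift n X) (i + 1) (cdiff (shift n X) i x) = \<zero>\<^bsub>cobj (shift n X) (i + 2)\<^esub>"
    using x cdiff_cdiff[OF X, of x "i + n"] by (simp add: e ag_simps cobj_rm[OF X])
qed

lemma stalk_simps [simp]: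
  "cobj (stalk M) i = (if i = 0 then M else zero_mod)"
  "cdiff (stalk M) i x = (if i = -1 then \<zero>\<^bsub>M\<^esub> else (\<lambda>_. 0))"
  by (simp_all add: stalk_def)

lemma stalk_Cb_mod:
  assumes M: "M \<in> mod_cat" shows "stalk M \<in> Cb_mod"
proof -
  note rm = mod_catD(1)[OF M]
  have "is_complex (stalk M)" unfolding is_complex_def
  proof (intro allI conjI ballI)
    fix i
    have "(\<lambda>_. \<lambda>_. 0) \<in> rhom K zero_mod" for K :: "'a obj"
      using rhom_zero_fun[OF zero_mod_right_module] by simp
    thus "cdiff (stalk M) i \<in> rhom (cobj (stalk M) i) (cobj (stalk M) (i + 1))"
      using rhom_zero_fun[OF rm] by (auto simp: stalk_def)
  qed (auto simp: M zero_mod_cat)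
  moreover have "{i. \<not> zero_at (stalk M) i} \<subseteq> {0}" by (auto simp: zero_at_def)
  ultimately show ?thesis by (auto simp: Cb_mod_def intro: finite_subset)
qed

lemma zero_cpx_Kb_proj: "zero_cpx \<in> Kb_proj"
  using stalk_Cb_mod[OF zero_mod_cat] by (simp add: zero_cpx_def Kb_proj_def projective_zero_mod)

lemma zero_cpx_cobj [simp]: "cobj zero_cpx i = zero_mod"
  by (simp add: zero_cpx_def)

section \<open>Complexes of projectives and acyclic complexes\<close>

definition acyclic_cpx :: "('a::{ring,monoid_mult}) cpx \<Rightarrow> bool" where
  "acyclic_cpx C \<longleftrightarrow> (\<forall>i. \<forall>x\<in>cocycles i C. x \<in> coboundaries i C)"

lemma rsubmodule_cocycles: "is_complex X \<Longrightarrow> rsubmodule (cocycles i X) (cobj X i)"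
  unfolding cocycles_def by (intro rsubmodule_kernel cobj_rm cdiff_rhom)

lemma rsubmodule_coboundaries: "is_complex X \<Longrightarrow> rsubmodule (coboundaries i X) (cobj X i)"
  unfolding coboundaries_def
  by (intro rsubmodule_image[where M = "cobj X (i - 1)"] cobj_rm cdiff_rhom' right_module.rsubmodule_carrier)

lemma coboundaries_cocycles: "is_complex X \<Longrightarrow> coboundaries i X \<subseteq> cocycles i X"
  by (auto simp: coboundaries_def cocycles_def cdiff_closed' cdiff_cdiff')

lemma Cb_mod_bounded_above:
  assumes "X \<in> Cb_mod"
  obtains N :: int where "\<And>i. i \<ge> N \<Longrightarrow> zero_at X i"
proof -
  have "finite {i. \<not> zero_at X i}" using assms by (rule Cb_modD)
  then obtain m where m: "\<And>i. \<not> zero_at X i \<Longrightarrow> i \<le> m" by (metis (full_types) bdd_above.E bdd_above_finite mem_Collect_eq)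
  show ?thesis by (rule that[of "m + 1"]) (use m in force)
qed

lemma nat_offset:
  fixes N i :: int
  assumes "i < N" obtains n where "i = N - int n - 1"
  by (rule that[of "nat (N - i - 1)"]) (use assms in simp)

text \<open>The homotopy is built downwards from the degrees in which \<open>X\<close> vanishes.  Once \<open>h\<close> is known in degree
  $j+1$, the map \<open>g - h d\<close> sends $X^j$ to cocycles of \<open>C\<close>, which are coboundaries, and projectivity of $X^j$
  lifts it along the differential of \<open>C\<close>.\<close>

lemma acyclic_null_homotopic:
  assumes X: "X \<in> Kb_proj" and C: "is_complex C" and ac: "acyclic_cpx C" and g: "g \<in> chom X C"
  shows "homotopic X C g (zero_map C)"
proof -
  have cX: "is_complex X" using X by (rule Kb_projD)
  obtain N where N: "\<And>i. i \<ge> N \<Longrightarrow> zero_at X i" using Cb_mod_bounded_above[OF Kb_projD(1)[OF X]] by blast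
  \<comment> \<open>Stage \<open>n\<close> treats degree \<open>N - n\<close>, where \<open>X\<close> vanishes from degree \<open>N\<close> on.\<close>
  define P where "P n h \<longleftrightarrow> h \<in> rhom (cobj X (N - int n)) (cobj C (N - int n - 1)) \<and>
    (\<forall>x\<in>carrier (cobj X (N - int n - 1)).
      g (N - int n - 1) x \<ominus>\<^bsub>cobj C (N - int n - 1)\<^esub> h (cdiff X (N - int n - 1) x) \<in> cocycles (N - int n - 1) C)"
    for n h
  define Q where "Q n h h' \<longleftrightarrow> (\<forall>x\<in>carrier (cobj X (N - int n - 1)).
      cdiff C (N - int n - 2) (h' x) = g (N - int n - 1) x \<ominus>\<^bsub>cobj C (N - int n - 1)\<^esub> h (cdiff X (N - int n - 1) x))"
    for n and h h' :: "(nat \<Rightarrow> 'a) \<Rightarrow> nat \<Rightarrow> 'a"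
  have "\<exists>H. \<forall>n. P n (H n) \<and> Q n (H n) (H (Suc n))"
  proof (rule dependent_nat_choice)
    have "P 0 (\<lambda>_. \<zero>\<^bsub>cobj C (N - 1)\<^esub>)"
    proof -
      have "cdiff X (N - 1) x = \<zero>\<^bsub>cobj X N\<^esub>" if "x \<in> carrier (cobj X (N - 1))" for x
        using cdiff_closed'[OF cX that] N[of N] by (simp add: zero_at_def)
      hence "cdiff C (N - 1) (g (N - 1) x) = \<zero>\<^bsub>cobj C N\<^esub>" if "x \<in> carrier (cobj X (N - 1))" for x
        using chom_d'[OF g that] that rhom_zero[OF cobj_rm[OF cX] cobj_rm[OF C] chom_rhom[OF g]] by simp
      thus ?thesis
        by (auto simp: P_def rhom_zero_fun cobj_rm[OF C] cocycles_def ag_minus_zero chom_closed[OF g])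
    qed
    thus "\<exists>h. P 0 h" by blast
  next
    fix h n assume Ph: "P n h"
    let ?j = "N - int n - 1"
    have j1: "?j + 1 = N - int n" "N - int n - 2 = ?j - 1" "N - int (Suc n) = ?j" by auto
    have h: "h \<in> rhom (cobj X (?j + 1)) (cobj C ?j)"
      and hc: "\<And>x. x \<in> carrier (cobj X ?j) \<Longrightarrow> g ?j x \<ominus>\<^bsub>cobj C ?j\<^esub> h (cdiff X ?j x) \<in> cocycles ?j C"
      using Ph by (auto simp: P_def)
    let ?B = "(cobj C ?j)\<lparr>carrier := coboundaries ?j C\<rparr>"
    note rsB = rsubmodule_coboundaries[OF C, of ?j]
    have kr: "(\<lambda>x. g ?j x \<ominus>\<^bsub>cobj C ?j\<^esub> h (cdiff X ?j x)) \<in> rhom (cobj X ?j) (cobj C ?j)"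
      by (rule rhom_minus_fun[OF cobj_rm[OF C] chom_rhom[OF g] rhom_comp[OF cdiff_rhom[OF cX] h]])
    have k: "(\<lambda>x. g ?j x \<ominus>\<^bsub>cobj C ?j\<^esub> h (cdiff X ?j x)) \<in> rhom (cobj X ?j) ?B"
      by (rule rhom_into_sub[OF kr]) (use hc ac in \<open>auto simp: acyclic_cpx_def\<close>)
    have B: "?B \<in> mod_cat"
    proof -
      have rmB: "right_module ?B" by (rule right_module.right_module_sub[OF cobj_rm[OF C] rsB])
      have "cdiff C (?j - 1) \<in> rhom (cobj C (?j - 1)) ?B"
        by (rule rhom_into_sub[OF cdiff_rhom'[OF C]]) (auto simp: coboundaries_def)
      hence "fin_gen ?B"
        by (rule fin_gen_image[OF cobj_rm[OF C] rmB]) (auto simp: coboundaries_def mod_catD[OF cobj_mod_cat[OF C]])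
      thus ?thesis using rmB by (simp add: mod_cat_def fg_module_def)
    qed
    have dB: "cdiff C (?j - 1) \<in> rhom (cobj C (?j - 1)) ?B"
      by (rule rhom_into_sub[OF cdiff_rhom'[OF C]]) (auto simp: coboundaries_def)
    have sB: "cdiff C (?j - 1) ` carrier (cobj C (?j - 1)) = carrier ?B" by (simp add: coboundaries_def)
    obtain h' where h': "h' \<in> rhom (cobj X ?j) (cobj C (?j - 1))"
      "\<And>x. x \<in> carrier (cobj X ?j) \<Longrightarrow> cdiff C (?j - 1) (h' x) = g ?j x \<ominus>\<^bsub>cobj C ?j\<^esub> h (cdiff X ?j x)"
      by (rule projectiveD[OF Kb_projD(3)[OF X] cobj_mod_cat[OF C] B dB sB k]) blast
    have "P (Suc n) h'" unfolding P_def j1(3)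
    proof (intro conjI ballI h'(1))
      fix x assume x: "x \<in> carrier (cobj X (?j - 1))"
      have dx: "cdiff X (?j - 1) x \<in> carrier (cobj X ?j)" by (rule cdiff_closed'[OF cX x])
      have c: "g (?j - 1) x \<in> carrier (cobj C (?j - 1))" "h' (cdiff X (?j - 1) x) \<in> carrier (cobj C (?j - 1))"
        using chom_closed[OF g x] rhom_closed[OF h'(1) dx] by auto
      have "h (cdiff X ?j (cdiff X (?j - 1) x)) = \<zero>\<^bsub>cobj C ?j\<^esub>"
        using cdiff_cdiff'[OF cX x] rhom_zero[OF cobj_rm[OF cX] cobj_rm[OF C] h] by simp
      hence "cdiff C (?j - 1) (h' (cdiff X (?j - 1) x)) = cdiff C (?j - 1) (g (?j - 1) x)"
        using h'(2)[OF dx] chom_d'[OF g x] chom_closed[OF g dx]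
        by (simp add: ag_minus_zero cobj_rm[OF C])
      thus "g (?j - 1) x \<ominus>\<^bsub>cobj C (?j - 1)\<^esub> h' (cdiff X (?j - 1) x) \<in> cocycles (?j - 1) C"
        unfolding cocycles_def mem_Collect_eq diff_add_cancel
        using c rhom_minus[OF cobj_rm[OF C] cobj_rm[OF C] cdiff_rhom'[OF C] c]
          ag_minus_self[OF cobj_rm[OF C] cdiff_closed'[OF C c(1)]]
        by (simp only: ag_closed cobj_rm[OF C])
    qed
    moreover have "Q n h h'" unfolding Q_def j1(2) using h'(2) by blast
    ultimately show "\<exists>h'. P (Suc n) h' \<and> Q n h h'" by blast
  qed
  then obtain H where H: "\<And>n. P n (H n)" "\<And>n. Q n (H n) (H (Suc n))" by blast
  define h where "h i = (if i > N then (\<lambda>_. \<zero>\<^bsub>cobj C (i - 1)\<^esub>) else H (nat (N - i)))" for i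
  have hr: "h i \<in> rhom (cobj X i) (cobj C (i - 1))" for i
    using H(1)[of "nat (N - i)"] by (auto simp: h_def P_def rhom_zero_fun cobj_rm[OF C])
  show ?thesis
  proof (rule homotopicI[OF cX C g chom_zero[OF C] hr])
    fix i x assume x: "x \<in> carrier (cobj X i)"
    note cl = chom_closed[OF g x] cdiff_closed'[OF C rhom_closed[OF hr x]]
      rhom_closed[OF hr cdiff_closed[OF cX x], simplified]
    show "g i x = cdiff C (i - 1) (h i x) \<oplus>\<^bsub>cobj C i\<^esub> h (i + 1) (cdiff X i x) \<oplus>\<^bsub>cobj C i\<^esub> zero_map C i x"
    proof (cases "i \<ge> N")
      case True
      hence x0: "x = \<zero>\<^bsub>cobj X i\<^esub>" using N x by (auto simp: zero_at_def)
      have "g i x = \<zero>\<^bsub>cobj C i\<^esub>" "h i x = \<zero>\<^bsub>cobj C (i - 1)\<^esub>" "h (i + 1) (cdiff X i x) = \<zero>\<^bsub>cobj C i\<^esub>"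
        using rhom_zero[OF cobj_rm[OF cX] cobj_rm[OF C] chom_rhom[OF g], of i]
          rhom_zero[OF cobj_rm[OF cX] cobj_rm[OF C] hr, of i] rhom_zero[OF cobj_rm[OF cX] cobj_rm[OF C] hr, of "i + 1"]
          cdiff_zero[OF cX, of i] by (simp_all add: x0)
      thus ?thesis using cdiff_zero[OF C, of "i - 1"]
        by (simp add: zero_map_def ag_simps ag_closed cobj_rm[OF C])
    next
      case False
      then obtain n where n: "i = N - int n - 1" using nat_offset[of i N] by force
      have "nat (int n + 1) = Suc n" by (simp add: nat_eq_iff)
      hence hi: "h i = H (Suc n)" "h (i + 1) = H n" by (simp_all add: h_def n)
      have "cdiff C (i - 1) (h i x) = g i x \<ominus>\<^bsub>cobj C i\<^esub> h (i + 1) (cdiff X i x)"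
        using H(2)[of n] x hi unfolding Q_def n by simp
      thus ?thesis using cl x
        by (subst (asm) eq_commute, subst (asm) ag_minus_iff[OF cobj_rm[OF C]])
          (auto simp: zero_map_def ag_simps ag_closed cobj_rm[OF C])
    qed
  qed
qed

section \<open>Quasi-isomorphisms\<close>

lemma cohom_carrier:
  assumes X: "is_complex X"
  shows "carrier (cohom i X) = (\<lambda>x. coboundaries i X +>\<^bsub>cobj X i\<^esub> x) ` cocycles i X"
  by (auto simp: cohom_def quot_mod_def A_RCOSETS_def')

lemma cohom_map_coset:
  assumes X: "is_complex X" and Y: "is_complex Y" and f: "f \<in> chom X Y" and x: "x \<in> cocycles i X"
  shows "cohom_map i Y f (coboundaries i X +>\<^bsub>cobj X i\<^esub> x) = coboundaries i Y +>\<^bsub>cobj Y i\<^esub> f i x"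
proof -
  have xX: "x \<in> carrier (cobj X i)" using x by (simp add: cocycles_def)
  note bY = right_module.rsubmoduleD[OF cobj_rm[OF Y] rsubmodule_coboundaries[OF Y, of i]]
  note bX = right_module.rsubmoduleD[OF cobj_rm[OF X] rsubmodule_coboundaries[OF X, of i]]
  have "coboundaries i Y +>\<^bsub>cobj Y i\<^esub> f i z = coboundaries i Y +>\<^bsub>cobj Y i\<^esub> f i x"
    if z: "z \<in> coboundaries i X +>\<^bsub>cobj X i\<^esub> x" for z
  proof -
    from z obtain b where b: "b \<in> coboundaries i X" "z = b \<oplus>\<^bsub>cobj X i\<^esub> x" by (auto simp: mem_a_coset)
    have bc: "b \<in> carrier (cobj X i)" using b bX(1) by blast
    have fb: "f i b \<in> coboundaries i Y"
      using b(1) chom_d'[OF f] chom_closed[OF f] by (auto simp: coboundaries_def)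
    have fz: "f i z = f i b \<oplus>\<^bsub>cobj Y i\<^esub> f i x" using b xX bc by (simp add: rhom_add[OF chom_rhom[OF f]])
    have "f i z \<ominus>\<^bsub>cobj Y i\<^esub> f i x = f i b"
      unfolding fz using ag_minus_iff[OF cobj_rm[OF Y]] chom_closed[OF f bc] chom_closed[OF f xX]
      by (simp add: ag_closed cobj_rm[OF Y])
    moreover have "f i z \<in> carrier (cobj Y i)" unfolding fz
      using chom_closed[OF f bc] chom_closed[OF f xX] by (simp add: ag_closed cobj_rm[OF Y])
    ultimately show ?thesis
      using right_module.a_coset_eq_iff[OF cobj_rm[OF Y] rsubmodule_coboundaries[OF Y]] fb chom_closed[OF f xX] by simp
  qed
  moreover have "x \<in> coboundaries i X +>\<^bsub>cobj X i\<^esub> x"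
    using bX(2) xX by (auto simp: mem_a_coset ag_simps cobj_rm[OF X] intro!: bexI[of _ "\<zero>\<^bsub>cobj X i\<^esub>"])
  ultimately show ?thesis unfolding cohom_map_def by blast
qed

lemma cocycles_chom:
  assumes "is_complex X" "is_complex Y" "f \<in> chom X Y" "x \<in> cocycles i X" shows "f i x \<in> cocycles i Y"
  using assms chom_d[OF assms(3), of x i] rhom_zero[OF cobj_rm[OF assms(1)] cobj_rm[OF assms(2)] chom_rhom[OF assms(3)], of "i + 1"]
  by (auto simp: cocycles_def chom_closed)

lemma quasi_iso_inj:
  assumes X: "is_complex X" and Y: "is_complex Y" and q: "quasi_iso X Y f"
    and x: "x \<in> cocycles i X" "f i x \<in> coboundaries i Y"
  shows "x \<in> coboundaries i X"
proof -
  have f: "f \<in> chom X Y" using q by (simp add: quasi_iso_def)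
  let ?c = "\<lambda>x. coboundaries i X +>\<^bsub>cobj X i\<^esub> x" and ?z = "\<zero>\<^bsub>cobj X i\<^esub>"
  have z: "?z \<in> cocycles i X" by (rule right_module.rsubmoduleD(2)[OF cobj_rm[OF X] rsubmodule_cocycles[OF X]])
  have xX: "x \<in> carrier (cobj X i)" using x by (simp add: cocycles_def)
  have "cohom_map i Y f (?c x) = cohom_map i Y f (?c ?z)"
    using x rhom_zero[OF cobj_rm[OF X] cobj_rm[OF Y] chom_rhom[OF f]] chom_closed[OF f xX]
    by (simp add: cohom_map_coset[OF X Y f] z right_module.a_coset_eq_iff[OF cobj_rm[OF Y] rsubmodule_coboundaries[OF Y]]
        ag_closed ag_minus_zero cobj_rm[OF Y])
  moreover have "inj_on (cohom_map i Y f) (carrier (cohom i X))" using q by (auto simp: quasi_iso_def bij_betw_def)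
  ultimately have "?c x = ?c ?z" using x z by (auto simp: cohom_carrier[OF X] dest: inj_onD)
  thus ?thesis using xX
    by (simp add: right_module.a_coset_eq_iff[OF cobj_rm[OF X] rsubmodule_coboundaries[OF X]] ag_closed ag_minus_zero cobj_rm[OF X])
qed

lemma quasi_iso_surj:
  assumes X: "is_complex X" and Y: "is_complex Y" and q: "quasi_iso X Y f" and y: "y \<in> cocycles i Y"
  obtains x where "x \<in> cocycles i X" "y \<ominus>\<^bsub>cobj Y i\<^esub> f i x \<in> coboundaries i Y"
proof -
  have f: "f \<in> chom X Y" using q by (simp add: quasi_iso_def)
  have "cohom_map i Y f ` carrier (cohom i X) = carrier (cohom i Y)" using q by (auto simp: quasi_iso_def bij_betw_def)
  then obtain x where x: "x \<in> cocycles i X"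
    "coboundaries i Y +>\<^bsub>cobj Y i\<^esub> y = cohom_map i Y f (coboundaries i X +>\<^bsub>cobj X i\<^esub> x)"
    using y unfolding cohom_carrier[OF X] cohom_carrier[OF Y] by blast
  have "y \<ominus>\<^bsub>cobj Y i\<^esub> f i x \<in> coboundaries i Y"
    using x y cocycles_chom[OF X Y f x(1)]
    by (simp add: cohom_map_coset[OF X Y f] cocycles_def
        right_module.a_coset_eq_iff[OF cobj_rm[OF Y] rsubmodule_coboundaries[OF Y]])
  thus ?thesis using that x by blast
qed

lemma quasi_iso_homotopic_id:
  assumes X: "is_complex X" and f: "f \<in> chom X X" and h: "homotopic X X f id_map"
  shows "quasi_iso X X f"
  unfolding quasi_iso_def
proof (intro conjI allI f)
  fix i
  have "cohom_map i X f A = A" if A: "A \<in> carrier (cohom i X)" for A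
  proof -
    obtain x where x: "x \<in> cocycles i X" "A = coboundaries i X +>\<^bsub>cobj X i\<^esub> x"
      using A by (auto simp: cohom_carrier[OF X])
    have xX: "x \<in> carrier (cobj X i)" "cdiff X i x = \<zero>\<^bsub>cobj X (i + 1)\<^esub>" using x by (auto simp: cocycles_def)
    obtain k where k: "\<And>i. k i \<in> rhom (cobj X i) (cobj X (i - 1))"
      and e: "f i x \<ominus>\<^bsub>cobj X i\<^esub> id_map i x = cdiff X (i - 1) (k i x) \<oplus>\<^bsub>cobj X i\<^esub> k (i + 1) (cdiff X i x)"
      using h xX unfolding homotopic_def by blast
    have kx: "k i x \<in> carrier (cobj X (i - 1))" by (rule rhom_closed[OF k xX(1)])
    have "k (i + 1) (cdiff X i x) = \<zero>\<^bsub>cobj X i\<^esub>"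
      using rhom_zero[OF cobj_rm[OF X] cobj_rm[OF X] k, of "i + 1"] xX by simp
    hence "f i x \<ominus>\<^bsub>cobj X i\<^esub> x = cdiff X (i - 1) (k i x)"
      using e cdiff_closed'[OF X kx] by (simp add: ag_simps cobj_rm[OF X])
    hence "f i x \<ominus>\<^bsub>cobj X i\<^esub> x \<in> coboundaries i X" using kx by (auto simp: coboundaries_def)
    thus ?thesis using x xX chom_closed[OF f xX(1)]
      by (simp add: cohom_map_coset[OF X X f] right_module.a_coset_eq_iff[OF cobj_rm[OF X] rsubmodule_coboundaries[OF X]])
  qed
  thus "bij_betw (cohom_map i X f) (carrier (cohom i X)) (carrier (cohom i X))"
    by (intro bij_betw_imageI) (auto simp: inj_on_def)
qed

text \<open>The long exact cohomology sequence of the cone, followed for one cocycle $(x, y)$: injectivity in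
  degree $i+1$ gives $x = d u$, and surjectivity in degree $i$ corrects the cocycle \<open>f u + y\<close> of \<open>Y\<close> to a
  coboundary.\<close>

lemma cone_acyclic:
  assumes X: "is_complex X" and Y: "is_complex Y" and q: "quasi_iso X Y f"
  shows "acyclic_cpx (cone X Y f)"
  unfolding acyclic_cpx_def
proof (intro allI ballI)
  have f: "f \<in> chom X Y" using q by (simp add: quasi_iso_def)
  note rX = cobj_rm[OF X] and rY = cobj_rm[OF Y]
  fix i z assume z: "z \<in> cocycles i (cone X Y f)"
  define x y where "x = pr1 z" and "y = pr2 z"
  have xc: "x \<in> carrier (cobj X (i + 1))" and yc: "y \<in> carrier (cobj Y i)"
    using z by (auto simp: cocycles_def x_def y_def)
  have dxc: "cdiff X (i + 1) x \<in> carrier (cobj X (i + 2))"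
    using cdiff_closed[OF X xc] by (simp add: add.commute)
  have eq: "\<ominus>\<^bsub>cobj X (i + 2)\<^esub> cdiff X (i + 1) x = \<zero>\<^bsub>cobj X (i + 2)\<^esub>"
    "f (i + 1) x \<oplus>\<^bsub>cobj Y (i + 1)\<^esub> cdiff Y i y = \<zero>\<^bsub>cobj Y (i + 1)\<^esub>"
    using z by (auto simp: cocycles_def x_def y_def add.commute)
  have "cdiff X (i + 1) x = \<zero>\<^bsub>cobj X (i + 2)\<^esub>"
    using arg_cong[OF eq(1), of "\<lambda>u. \<ominus>\<^bsub>cobj X (i + 2)\<^esub> u"] dxc by (simp add: ag_simps rX)
  hence xz: "x \<in> cocycles (i + 1) X" using xc by (simp add: cocycles_def add.commute)
  note fx = chom_closed[OF f xc] and dy = cdiff_closed[OF Y yc]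
  have "f (i + 1) x = \<ominus>\<^bsub>cobj Y (i + 1)\<^esub> cdiff Y i y"
    by (rule abelian_group.minus_equality[OF right_module_abelian_group(1)[OF rY], symmetric])
      (use eq(2) fx dy in \<open>auto simp: ag_ac rY\<close>)
  also have "\<dots> = cdiff Y i (\<ominus>\<^bsub>cobj Y i\<^esub> y)"
    by (rule rhom_neg[OF rY rY cdiff_rhom[OF Y] yc, symmetric])
  finally have "f (i + 1) x \<in> coboundaries (i + 1) Y"
    using yc by (auto simp: coboundaries_def ag_closed rY)
  from quasi_iso_inj[OF X Y q xz this] obtain u where u: "u \<in> carrier (cobj X i)" "x = cdiff X i u"
    by (auto simp: coboundaries_def)
  note fu = chom_closed[OF f u(1)]
  have "cdiff Y i (f i u \<oplus>\<^bsub>cobj Y i\<^esub> y) = \<zero>\<^bsub>cobj Y (i + 1)\<^esub>"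
    using eq(2) fu yc by (simp add: rhom_add[OF cdiff_rhom[OF Y]] u(2) chom_d[OF f u(1)])
  hence "f i u \<oplus>\<^bsub>cobj Y i\<^esub> y \<in> cocycles i Y" using fu yc by (simp add: cocycles_def ag_closed rY)
  then obtain v where v: "v \<in> cocycles i X" "(f i u \<oplus>\<^bsub>cobj Y i\<^esub> y) \<ominus>\<^bsub>cobj Y i\<^esub> f i v \<in> coboundaries i Y"
    using quasi_iso_surj[OF X Y q] by blast
  have vc: "v \<in> carrier (cobj X i)" "cdiff X i v = \<zero>\<^bsub>cobj X (i + 1)\<^esub>" using v(1) by (auto simp: cocycles_def)
  note fv = chom_closed[OF f vc(1)]
  obtain b where b: "b \<in> carrier (cobj Y (i - 1))" "(f i u \<oplus>\<^bsub>cobj Y i\<^esub> y) \<ominus>\<^bsub>cobj Y i\<^esub> f i v = cdiff Y (i - 1) b"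
    using v(2) by (auto simp: coboundaries_def)
  note db = cdiff_closed'[OF Y b(1)]
  have yeq: "f i u \<oplus>\<^bsub>cobj Y i\<^esub> y = cdiff Y (i - 1) b \<oplus>\<^bsub>cobj Y i\<^esub> f i v"
    using b(2) fu yc fv db by (subst (asm) ag_minus_iff[OF rY]) (auto simp: ag_closed rY)
  let ?a = "v \<ominus>\<^bsub>cobj X i\<^esub> u"
  have ac: "?a \<in> carrier (cobj X i)" using vc u by (simp add: ag_closed rX)
  have "cdiff X i ?a = \<ominus>\<^bsub>cobj X (i + 1)\<^esub> x"
    unfolding rhom_minus[OF rX rX cdiff_rhom[OF X] vc(1) u(1)] using xc
    by (simp add: vc(2) u(2)[symmetric] a_minus_def ag_simps ag_closed rX)
  hence da: "\<ominus>\<^bsub>cobj X (i + 1)\<^esub> cdiff X i ?a = x" using xc by (simp add: ag_simps rX)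
  have "f i ?a \<oplus>\<^bsub>cobj Y i\<^esub> cdiff Y (i - 1) b = (\<ominus>\<^bsub>cobj Y i\<^esub> f i u) \<oplus>\<^bsub>cobj Y i\<^esub> (cdiff Y (i - 1) b \<oplus>\<^bsub>cobj Y i\<^esub> f i v)"
    unfolding rhom_minus[OF rX rY chom_rhom[OF f] vc(1) u(1)]
    using fu fv db unfolding a_minus_def by (simp add: ag_ac ag_closed rY)
  also have "\<dots> = y" unfolding yeq[symmetric] using fu yc by (simp add: ag_simps rY)
  finally have fa: "f i ?a \<oplus>\<^bsub>cobj Y i\<^esub> cdiff Y (i - 1) b = y" .
  have i2: "i - 1 + 2 = i + 1" by simp
  have "cdiff (cone X Y f) (i - 1) (pair ?a b) = z"
    unfolding cone_simps i2 using da fa by (simp add: x_def y_def)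
  moreover have "pair ?a b \<in> carrier (cobj (cone X Y f) (i - 1))" using ac b by simp
  ultimately show "z \<in> coboundaries i (cone X Y f)" unfolding coboundaries_def by blast
qed

text \<open>The chain map $x \mapsto (0, f x)$ into the acyclic cone of \<open>s\<close> is null-homotopic; the components of a
  null-homotopy are a chain map \<open>t\<close> from \<open>X\<close> to \<open>Z\<close> and a homotopy from \<open>f\<close> to \<open>s t\<close>.\<close>

lemma quasi_iso_lift:
  assumes X: "X \<in> Kb_proj" and Z: "is_complex Z" and Y: "is_complex Y" and q: "quasi_iso Z Y s"
    and f: "f \<in> chom X Y"
  obtains t where "t \<in> chom X Z" "homotopic X Y f (s \<circ>\<^sub>c t)"
proof -
  have cX: "is_complex X" using X by (rule Kb_projD)
  have s: "s \<in> chom Z Y" using q by (simp add: quasi_iso_def)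
  note rX = cobj_rm[OF cX] and rY = cobj_rm[OF Y] and rZ = cobj_rm[OF Z]
  let ?C = "cone Z Y s"
  have C: "is_complex ?C" by (rule cone_complex[OF Z Y s])
  define g where "g = (\<lambda>i x. pair \<zero>\<^bsub>cobj Z (i + 1)\<^esub> (f i x))"
  have dz: "cdiff Z (i + 1) \<zero>\<^bsub>cobj Z (i + 1)\<^esub> = \<zero>\<^bsub>cobj Z (i + 2)\<^esub>" for i
    using cdiff_zero[OF Z, of "i + 1"] by (simp add: add.commute)
  have g: "g \<in> chom X ?C"
  proof (rule chomI)
    fix i show "g i \<in> rhom (cobj X i) (cobj ?C i)"
      using rhom_comp[OF chom_rhom[OF f] rhom_in(2)[OF rZ rY]] by (simp add: g_def)
    fix x assume x: "x \<in> carrier (cobj X i)"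
    show "g (i + 1) (cdiff X i x) = cdiff ?C i (g i x)"
      using x rhom_zero[OF rZ rY chom_rhom[OF s], of "i + 1"] chom_closed[OF f x]
      by (simp add: g_def dz chom_d[OF f] ag_simps rZ rY cdiff_closed[OF Y] add.assoc)
  qed
  obtain h where H: "homotopy X ?C h g (zero_map ?C)"
    by (rule homotopicE[OF acyclic_null_homotopic[OF X C cone_acyclic[OF Z Y q] g] cX C g chom_zero[OF C]])
  note h = homotopyD(1)[OF H cX C] and hc = homotopyD(2)[OF H cX C] and hd = homotopyD(4)[OF H cX C]
    and eq = homotopyD(5)[OF H cX C]
  define t where "t = (\<lambda>i x. pr1 (h i x))"
  define k where "k = (\<lambda>i x. pr2 (h i x))"
  have tr: "t i \<in> rhom (cobj X i) (cobj Z i)" and kr: "k i \<in> rhom (cobj X i) (cobj Y (i - 1))" for i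
    using rhom_comp[OF h[of i, unfolded cone_simps] rhom_pr(1)] rhom_comp[OF h[of i, unfolded cone_simps] rhom_pr(2)]
    by (simp_all add: t_def k_def)
  have i2: "i - 1 + 2 = i + 1" for i :: int by simp
  have e1: "t (i + 1) (cdiff X i x) = cdiff Z i (t i x)"
    and e2: "f i x = cdiff Y (i - 1) (k i x) \<oplus>\<^bsub>cobj Y i\<^esub> k (i + 1) (cdiff X i x) \<oplus>\<^bsub>cobj Y i\<^esub> (s \<circ>\<^sub>c t) i x"
    if x: "x \<in> carrier (cobj X i)" for i x
  proof -
    have c: "t i x \<in> carrier (cobj Z i)" "k i x \<in> carrier (cobj Y (i - 1))"
      "t (i + 1) (cdiff X i x) \<in> carrier (cobj Z (i + 1))" "k (i + 1) (cdiff X i x) \<in> carrier (cobj Y i)"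
      using hc[OF x] hd[OF x] by (auto simp: t_def k_def)
    note c' = cdiff_closed[OF Z c(1)] cdiff_closed'[OF Y c(2)] chom_closed[OF s c(1)]
    have "pair \<zero>\<^bsub>cobj Z (i + 1)\<^esub> (f i x) =
      pair ((\<ominus>\<^bsub>cobj Z (i + 1)\<^esub> cdiff Z i (t i x) \<oplus>\<^bsub>cobj Z (i + 1)\<^esub> t (i + 1) (cdiff X i x)) \<oplus>\<^bsub>cobj Z (i + 1)\<^esub> \<zero>\<^bsub>cobj Z (i + 1)\<^esub>)
        ((s i (t i x) \<oplus>\<^bsub>cobj Y i\<^esub> cdiff Y (i - 1) (k i x)) \<oplus>\<^bsub>cobj Y i\<^esub> k (i + 1) (cdiff X i x) \<oplus>\<^bsub>cobj Y i\<^esub> \<zero>\<^bsub>cobj Y i\<^esub>)"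
      using eq[OF x] unfolding g_def zero_map_def cone_simps i2 by (simp add: t_def k_def)
    hence *: "\<zero>\<^bsub>cobj Z (i + 1)\<^esub> = \<ominus>\<^bsub>cobj Z (i + 1)\<^esub> cdiff Z i (t i x) \<oplus>\<^bsub>cobj Z (i + 1)\<^esub> t (i + 1) (cdiff X i x)"
      "f i x = (s i (t i x) \<oplus>\<^bsub>cobj Y i\<^esub> cdiff Y (i - 1) (k i x)) \<oplus>\<^bsub>cobj Y i\<^esub> k (i + 1) (cdiff X i x)"
      using c c' by (auto simp: ag_simps ag_closed rZ rY)
    have "t (i + 1) (cdiff X i x) = \<ominus>\<^bsub>cobj Z (i + 1)\<^esub> (\<ominus>\<^bsub>cobj Z (i + 1)\<^esub> cdiff Z i (t i x))"
      by (rule abelian_group.minus_equality[OF right_module_abelian_group(1)[OF rZ], symmetric])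
        (use *(1) c c' in \<open>auto simp: ag_ac ag_closed rZ\<close>)
    thus "t (i + 1) (cdiff X i x) = cdiff Z i (t i x)" using c' by (simp add: ag_simps rZ)
    show "f i x = cdiff Y (i - 1) (k i x) \<oplus>\<^bsub>cobj Y i\<^esub> k (i + 1) (cdiff X i x) \<oplus>\<^bsub>cobj Y i\<^esub> (s \<circ>\<^sub>c t) i x"
      using *(2) c c' by (simp add: ag_ac ag_closed rY)
  qed
  have t: "t \<in> chom X Z" by (rule chomI[OF tr e1])
  have "homotopic X Y f (s \<circ>\<^sub>c t)" by (rule homotopicI[OF cX Y f chom_comp[OF t s] kr e2])
  thus ?thesis using that t by blast
qed

text \<open>A null-homotopy \<open>k\<close> of \<open>s t\<close> turns $x \mapsto (t x, - k x)$ into a chain map from \<open>X\<close> to the cone of \<open>s\<close> shifted by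
  $-1$, which is acyclic too; the first component of a null-homotopy of that map contracts \<open>t\<close>.\<close>

lemma quasi_iso_cancel:
  assumes X: "X \<in> Kb_proj" and Z: "is_complex Z" and Y: "is_complex Y" and q: "quasi_iso Z Y s"
    and t: "t \<in> chom X Z" and st: "homotopic X Y (s \<circ>\<^sub>c t) (zero_map Y)"
  shows "homotopic X Z t (zero_map Z)"
proof -
  have cX: "is_complex X" using X by (rule Kb_projD)
  have s: "s \<in> chom Z Y" using q by (simp add: quasi_iso_def)
  note rX = cobj_rm[OF cX] and rY = cobj_rm[OF Y] and rZ = cobj_rm[OF Z]
  let ?C = "cone Z Y s"
  have C: "is_complex ?C" by (rule cone_complex[OF Z Y s])
  let ?D = "shift (- 1) ?C"
  have D: "is_complex ?D" by (rule shift_complex[OF C])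
  obtain k where H: "homotopy X Y k (s \<circ>\<^sub>c t) (zero_map Y)"
    by (rule homotopicE[OF st cX Y chom_comp[OF t s] chom_zero[OF Y]])
  note k = homotopyD(1)[OF H cX Y] and kc = homotopyD(2)[OF H cX Y] and kd = homotopyD(4)[OF H cX Y]
    and keq = homotopyD(5)[OF H cX Y]
  have i2: "i - 1 + 2 = i + 1" "i + - 1 = i - 1" for i :: int by simp_all
  define g where "g = (\<lambda>i x. pair (t i x) (\<ominus>\<^bsub>cobj Y (i - 1)\<^esub> k i x))"
  have Dobj: "cobj ?D i = dsum (cobj Z i) (cobj Y (i - 1))" for i by simp
  have Dd: "cdiff ?D i z = pair (cdiff Z i (pr1 z)) (\<ominus>\<^bsub>cobj Y i\<^esub> (s i (pr1 z) \<oplus>\<^bsub>cobj Y i\<^esub> cdiff Y (i - 1) (pr2 z)))"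
    if z: "pr1 z \<in> carrier (cobj Z i)" "pr2 z \<in> carrier (cobj Y (i - 1))" for z i
  proof -
    have "cdiff ?D i z = \<ominus>\<^bsub>cobj ?C i\<^esub> cdiff ?C (i - 1) z" by simp
    also have "\<dots> = pair (\<ominus>\<^bsub>cobj Z (i + 1)\<^esub> (\<ominus>\<^bsub>cobj Z (i + 1)\<^esub> cdiff Z i (pr1 z))) (\<ominus>\<^bsub>cobj Y i\<^esub> (s i (pr1 z) \<oplus>\<^bsub>cobj Y i\<^esub> cdiff Y (i - 1) (pr2 z)))"
      unfolding cone_simps i2
      by (subst dsum_neg[OF rZ rY]) (use z in \<open>auto simp: ag_closed rZ rY cdiff_closed[OF Z] cdiff_closed'[OF Y] chom_closed[OF s]\<close>)
    finally show ?thesis using z by (simp add: ag_simps rZ cdiff_closed[OF Z])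
  qed
  have g: "g \<in> chom X ?D"
  proof (rule chomI)
    fix i show "g i \<in> rhom (cobj X i) (cobj ?D i)"
      unfolding Dobj g_def by (rule rhom_pair[OF chom_rhom[OF t] rhom_neg_fun[OF rY k]])
    fix x assume x: "x \<in> carrier (cobj X i)"
    note c = chom_closed[OF t x] kc[OF x] kd[OF x] cdiff_closed'[OF Y kc[OF x]]
    have "cdiff Y (i - 1) (\<ominus>\<^bsub>cobj Y (i - 1)\<^esub> k i x) = \<ominus>\<^bsub>cobj Y i\<^esub> cdiff Y (i - 1) (k i x)"
      by (rule rhom_neg[OF rY rY cdiff_rhom'[OF Y] kc[OF x]])
    moreover have "s i (t i x) = cdiff Y (i - 1) (k i x) \<oplus>\<^bsub>cobj Y i\<^esub> k (i + 1) (cdiff X i x)"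
      using keq[OF x] c by (simp add: zero_map_def ag_simps ag_closed rY)
    ultimately have "s i (t i x) \<oplus>\<^bsub>cobj Y i\<^esub> cdiff Y (i - 1) (\<ominus>\<^bsub>cobj Y (i - 1)\<^esub> k i x) = k (i + 1) (cdiff X i x)"
      using c by (simp add: ag_add_sub rY)
    thus "g (i + 1) (cdiff X i x) = cdiff ?D i (g i x)"
      using c x by (subst Dd) (auto simp: g_def ag_closed rY chom_d[OF t])
  qed
  have "acyclic_cpx ?D" unfolding acyclic_cpx_def
  proof (intro allI ballI)
    fix i z assume z: "z \<in> cocycles i ?D"
    have zC: "z \<in> carrier (cobj ?C (i - 1))" using z by (auto simp: cocycles_def)
    have n0: "\<ominus>\<^bsub>cobj ?C i\<^esub> cdiff ?C (i - 1) z = \<zero>\<^bsub>cobj ?C i\<^esub>" using z unfolding cocycles_def shift_simps by simp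
    have "cdiff ?C (i - 1) z = \<zero>\<^bsub>cobj ?C i\<^esub>"
      using arg_cong[OF n0, of "\<lambda>u. \<ominus>\<^bsub>cobj ?C i\<^esub> u"] 
        cdiff_closed'[OF C zC] by (simp only: ag_simps cobj_rm[OF C])
    hence "z \<in> cocycles (i - 1) ?C" using zC by (simp only: cocycles_def mem_Collect_eq diff_add_cancel)
    hence "z \<in> coboundaries (i - 1) ?C" using cone_acyclic[OF Z Y q] by (simp add: acyclic_cpx_def)
    then obtain w where w: "w \<in> carrier (cobj ?C (i - 1 - 1))" "z = cdiff ?C (i - 1 - 1) w"
      unfolding coboundaries_def by blast
    have e: "cdiff ?D (i - 1) (\<ominus>\<^bsub>cobj ?C (i - 1 - 1)\<^esub> w) = \<ominus>\<^bsub>cobj ?C (i - 1)\<^esub> cdiff ?C (i - 1 - 1) (\<ominus>\<^bsub>cobj ?C (i - 1 - 1)\<^esub> w)"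
      unfolding shift_simps by simp
    have "cdiff ?D (i - 1) (\<ominus>\<^bsub>cobj ?C (i - 1 - 1)\<^esub> w) = z" unfolding e
      using rhom_neg[OF cobj_rm[OF C] cobj_rm[OF C] cdiff_rhom'[OF C] w(1)] zC w(2)
      by (simp only: ag_simps cobj_rm[OF C])
    moreover have "\<ominus>\<^bsub>cobj ?C (i - 1 - 1)\<^esub> w \<in> carrier (cobj ?D (i - 1))"
      using abelian_group.a_inv_closed[OF right_module_abelian_group(1)[OF cobj_rm[OF C]] w(1)] by (simp only: shift_simps i2)
    ultimately show "z \<in> coboundaries i ?D" unfolding coboundaries_def by blast
  qed
  then obtain h where H': "homotopy X ?D h g (zero_map ?D)"
    using homotopicE[OF acyclic_null_homotopic[OF X D _ g] cX D g chom_zero[OF D]] by blast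
  note h = homotopyD(1)[OF H' cX D] and hc = homotopyD(2)[OF H' cX D] and eq = homotopyD(5)[OF H' cX D]
  show ?thesis
  proof (rule homotopicI[OF cX Z t chom_zero[OF Z]])
    show "(\<lambda>x. pr1 (h i x)) \<in> rhom (cobj X i) (cobj Z (i - 1))" for i
      using rhom_comp[OF h[of i, unfolded Dobj] rhom_pr(1)] .
    fix i x assume x: "x \<in> carrier (cobj X i)"
    have c: "pr1 (h i x) \<in> carrier (cobj Z (i - 1))" "pr2 (h i x) \<in> carrier (cobj Y (i - 1 - 1))"
      using hc[OF x] unfolding Dobj by simp_all
    show "t i x = cdiff Z (i - 1) (pr1 (h i x)) \<oplus>\<^bsub>cobj Z i\<^esub> pr1 (h (i + 1) (cdiff X i x)) \<oplus>\<^bsub>cobj Z i\<^esub> zero_map Z i x"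
      using eq[OF x] unfolding Dd[OF c] zero_map_def Dobj by (simp add: g_def)
  qed
qed

section \<open>Morphisms in the derived category out of a complex of projectives\<close>

lemma homotopic_sub_iff:
  assumes "is_complex X" "is_complex Y" "f \<in> chom X Y" "g \<in> chom X Y"
  shows "homotopic X Y f g \<longleftrightarrow> homotopic X Y (\<lambda>i x. f i x \<ominus>\<^bsub>cobj Y i\<^esub> g i x) (zero_map Y)"
  using assms unfolding homotopic_def zero_map_def
  by (simp add: ag_minus_zero cobj_rm chom_closed ag_closed)

lemma chom_sub:
  assumes "is_complex Y" "f \<in> chom X Y" "g \<in> chom X Y"
  shows "(\<lambda>i x. f i x \<ominus>\<^bsub>cobj Y i\<^esub> g i x) \<in> chom X Y"
proof (rule chomI)
  show "(\<lambda>x. f i x \<ominus>\<^bsub>cobj Y i\<^esub> g i x) \<in> rhom (cobj X i) (cobj Y i)" for i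
    by (intro rhom_minus_fun cobj_rm chom_rhom assms)
  fix i x assume x: "x \<in> carrier (cobj X i)"
  show "f (i + 1) (cdiff X i x) \<ominus>\<^bsub>cobj Y (i + 1)\<^esub> g (i + 1) (cdiff X i x) = cdiff Y i (f i x \<ominus>\<^bsub>cobj Y i\<^esub> g i x)"
    unfolding rhom_minus[OF cobj_rm[OF assms(1)] cobj_rm[OF assms(1)] cdiff_rhom[OF assms(1)]
        chom_closed[OF assms(2) x] chom_closed[OF assms(3) x]]
    using assms x by (simp add: chom_d)
qed

lemma quasi_iso_cancel_eq:
  assumes X: "X \<in> Kb_proj" and Z: "is_complex Z" and Y: "is_complex Y" and q: "quasi_iso Z Y s"
    and t: "t \<in> chom X Z" "t' \<in> chom X Z" and st: "homotopic X Y (s \<circ>\<^sub>c t) (s \<circ>\<^sub>c t')"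
  shows "homotopic X Z t t'"
proof -
  have cX: "is_complex X" using X by (rule Kb_projD)
  have s: "s \<in> chom Z Y" using q by (simp add: quasi_iso_def)
  let ?d = "\<lambda>i x. t i x \<ominus>\<^bsub>cobj Z i\<^esub> t' i x"
  have "homotopic X Y (\<lambda>i x. (s \<circ>\<^sub>c t) i x \<ominus>\<^bsub>cobj Y i\<^esub> (s \<circ>\<^sub>c t') i x) (zero_map Y)"
    using st homotopic_sub_iff[OF cX Y chom_comp[OF t(1) s] chom_comp[OF t(2) s]] by simp
  hence "homotopic X Y (s \<circ>\<^sub>c ?d) (zero_map Y)"
  proof (rule homotopic_cong[OF _ cX Y])
    fix i x assume x: "x \<in> carrier (cobj X i)"
    show "(s \<circ>\<^sub>c ?d) i x = (s \<circ>\<^sub>c t) i x \<ominus>\<^bsub>cobj Y i\<^esub> (s \<circ>\<^sub>c t') i x"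
      unfolding comp_map_apply
      by (rule rhom_minus[OF cobj_rm[OF Z] cobj_rm[OF Y] chom_rhom[OF s]]) (use x t in \<open>auto simp: chom_closed\<close>)
  qed simp
  thus ?thesis
    using quasi_iso_cancel[OF X Z Y q chom_sub[OF Z t]] homotopic_sub_iff[OF cX Z t] by simp
qed

text \<open>As \<open>X\<close> will be a complex of projectives, the left leg \<open>s\<close> of a roof has a section \<open>t\<close>, unique up to homotopy,
  and the roof stands for the morphism \<open>f t\<close>.  It is a relation because \<open>f t\<close> is determined only up to
  homotopy.\<close>

definition roof_val :: "('a::{ring,monoid_mult}) cpx \<Rightarrow> 'a cpx \<Rightarrow> 'a roof \<Rightarrow> 'a cmap \<Rightarrow> bool" where
  "roof_val X Y r g \<longleftrightarrow> (case r of (Z, s, f) \<Rightarrow>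
     \<exists>t\<in>chom X Z. homotopic X X id_map (s \<circ>\<^sub>c t) \<and> homotopic X Y (f \<circ>\<^sub>c t) g)"

locale roof_pair =
  fixes X Y :: "('a::{ring,monoid_mult}) cpx"
  assumes X: "X \<in> Kb_proj" and Y: "is_complex Y"
begin

lemma cX: "is_complex X" using X by (rule Kb_projD)

lemma roofsD:
  assumes "(Z, s, f) \<in> roofs X Y"
  shows "is_complex Z" "Z \<in> Cb_mod" "quasi_iso Z X s" "s \<in> chom Z X" "f \<in> chom Z Y"
  using assms by (auto simp: roofs_def quasi_iso_def Cb_modD)

lemma quasi_iso_id: "quasi_iso X X id_map"
  by (rule quasi_iso_homotopic_id[OF cX chom_id homotopic_refl[OF cX cX chom_id]])

lemma section_unique:
  assumes r: "(Z, s, f) \<in> roofs X Y" and t: "t \<in> chom X Z" "homotopic X X id_map (s \<circ>\<^sub>c t)"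
    and t': "t' \<in> chom X Z" "homotopic X X id_map (s \<circ>\<^sub>c t')"
  shows "homotopic X Z t t'"
proof -
  note rd = roofsD[OF r]
  note st = chom_comp[OF t(1) rd(4)] chom_comp[OF t'(1) rd(4)]
  have "homotopic X X (s \<circ>\<^sub>c t) (s \<circ>\<^sub>c t')"
    by (rule homotopic_trans[OF homotopic_sym[OF t(2) cX cX chom_id st(1)] t'(2) cX cX st(1) chom_id st(2)])
  thus ?thesis by (rule quasi_iso_cancel_eq[OF X rd(1) cX rd(3) t(1) t'(1)])
qed

lemma roof_val_any:
  assumes r: "(Z, s, f) \<in> roofs X Y" and v: "roof_val X Y (Z, s, f) g" and g: "g \<in> chom X Y"
    and t: "t \<in> chom X Z" "homotopic X X id_map (s \<circ>\<^sub>c t)"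
  shows "homotopic X Y (f \<circ>\<^sub>c t) g"
proof -
  note rd = roofsD[OF r]
  obtain t' where t': "t' \<in> chom X Z" "homotopic X X id_map (s \<circ>\<^sub>c t')" "homotopic X Y (f \<circ>\<^sub>c t') g"
    using v by (auto simp: roof_val_def)
  have "homotopic X Z t t'" by (rule section_unique[OF r t t'(1,2)])
  hence "homotopic X Y (f \<circ>\<^sub>c t) (f \<circ>\<^sub>c t')" by (rule homotopic_comp_left[OF _ rd(5) cX rd(1) Y t(1) t'(1)])
  thus ?thesis
    by (rule homotopic_trans[OF _ t'(3) cX Y chom_comp[OF t(1) rd(5)] chom_comp[OF t'(1) rd(5)] g])
qed

lemma section_ex:
  assumes r: "(Z, s, f) \<in> roofs X Y"
  obtains t where "t \<in> chom X Z" "homotopic X X id_map (s \<circ>\<^sub>c t)"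
  using quasi_iso_lift[OF X roofsD(1)[OF r] cX roofsD(3)[OF r] chom_id] by blast

lemma roof_val_ex:
  assumes r: "r \<in> roofs X Y" obtains g where "g \<in> chom X Y" "roof_val X Y r g"
proof -
  obtain Z s f where rr: "r = (Z, s, f)" by (cases r)
  note r' = r[unfolded rr]
  obtain t where t: "t \<in> chom X Z" "homotopic X X id_map (s \<circ>\<^sub>c t)" by (rule section_ex[OF r'])
  have ft: "f \<circ>\<^sub>c t \<in> chom X Y" by (rule chom_comp[OF t(1) roofsD(5)[OF r']])
  have "roof_val X Y r (f \<circ>\<^sub>c t)" using t homotopic_refl[OF cX Y ft] by (auto simp: roof_val_def rr)
  thus ?thesis using that ft by blast
qed

lemma roof_val_homotopic:
  assumes "r \<in> roofs X Y" "roof_val X Y r g" "g \<in> chom X Y" "g' \<in> chom X Y"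
  shows "roof_val X Y r g' \<longleftrightarrow> homotopic X Y g g'"
proof -
  obtain Z s f where rr: "r = (Z, s, f)" by (cases r)
  note r = assms(1)[unfolded rr]
  obtain t where t: "t \<in> chom X Z" "homotopic X X id_map (s \<circ>\<^sub>c t)" by (rule section_ex[OF r])
  have ft: "f \<circ>\<^sub>c t \<in> chom X Y" by (rule chom_comp[OF t(1) roofsD(5)[OF r]])
  have 1: "homotopic X Y (f \<circ>\<^sub>c t) g" by (rule roof_val_any[OF r assms(2)[unfolded rr] assms(3) t])
  show ?thesis
  proof
    assume "roof_val X Y r g'"
    hence "homotopic X Y (f \<circ>\<^sub>c t) g'" using roof_val_any[OF r _ assms(4) t] rr by simp
    thus "homotopic X Y g g'" by (rule homotopic_trans[OF homotopic_sym[OF 1 cX Y ft assms(3)] _ cX Y assms(3) ft assms(4)])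
  next
    assume "homotopic X Y g g'"
    hence "homotopic X Y (f \<circ>\<^sub>c t) g'" by (rule homotopic_trans[OF 1 _ cX Y ft assms(3,4)])
    thus "roof_val X Y r g'" using t by (auto simp: roof_val_def rr)
  qed
qed

text \<open>Equivalent roofs are those with the same value.  If \<open>W\<close> dominates two roofs, a section of its map to \<open>X\<close>
  induces sections of both left legs; conversely, \<open>X\<close> with sections of the left legs dominates both.\<close>

lemma roof_rel_iff:
  assumes "r \<in> roofs X Y" "r' \<in> roofs X Y" "g \<in> chom X Y" "roof_val X Y r g"
  shows "(r, r') \<in> roof_rel X Y \<longleftrightarrow> roof_val X Y r' g"
proof -
  obtain Z s f where rr: "r = (Z, s, f)" by (cases r)
  obtain Z' s' f' where rr': "r' = (Z', s', f')" by (cases r')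
  note r = assms(1)[unfolded rr] and r' = assms(2)[unfolded rr']
  note rd = roofsD[OF r] and rd' = roofsD[OF r']
  obtain t where t: "t \<in> chom X Z" "homotopic X X id_map (s \<circ>\<^sub>c t)" by (rule section_ex[OF r])
  obtain t' where t': "t' \<in> chom X Z'" "homotopic X X id_map (s' \<circ>\<^sub>c t')" by (rule section_ex[OF r'])
  note ft = chom_comp[OF t(1) rd(5)] chom_comp[OF t'(1) rd'(5)]
  note st = chom_comp[OF t(1) rd(4)] chom_comp[OF t'(1) rd'(4)]
  have ftg: "homotopic X Y (f \<circ>\<^sub>c t) g" by (rule roof_val_any[OF r assms(4)[unfolded rr] assms(3) t])
  show ?thesis
  proof
    assume "(r, r') \<in> roof_rel X Y"
    then obtain W u v where W: "W \<in> Cb_mod" "u \<in> chom W Z" "v \<in> chom W Z'" "quasi_iso W X (s \<circ>\<^sub>c u)"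
      and hs: "homotopic W X (s \<circ>\<^sub>c u) (s' \<circ>\<^sub>c v)" and hf: "homotopic W Y (f \<circ>\<^sub>c u) (f' \<circ>\<^sub>c v)"
      by (auto simp: roof_rel_def rr rr')
    have cW: "is_complex W" using W(1) by (rule Cb_modD)
    obtain q where q: "q \<in> chom X W" "homotopic X X id_map (s \<circ>\<^sub>c u \<circ>\<^sub>c q)"
      using quasi_iso_lift[OF X cW cX W(4) chom_id] by blast
    note uq = chom_comp[OF q(1) W(2)] chom_comp[OF q(1) W(3)]
    note su = chom_comp[OF W(2) rd(4)] chom_comp[OF W(3) rd'(4)]
    note fu = chom_comp[OF W(2) rd(5)] chom_comp[OF W(3) rd'(5)]
    have s1: "homotopic X X (s \<circ>\<^sub>c u \<circ>\<^sub>c q) (s' \<circ>\<^sub>c v \<circ>\<^sub>c q)"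
      by (rule homotopic_comp_right[OF hs q(1) cW cX cX su])
    have s2: "homotopic X X id_map (s' \<circ>\<^sub>c v \<circ>\<^sub>c q)"
      by (rule homotopic_trans[OF q(2) s1 cX cX chom_id chom_comp[OF q(1) su(1)] chom_comp[OF q(1) su(2)]])
    have f1: "homotopic X Y (f \<circ>\<^sub>c (u \<circ>\<^sub>c q)) g"
      by (rule roof_val_any[OF r assms(4)[unfolded rr] assms(3) uq(1)]) (use q(2) in \<open>simp add: comp_map_assoc\<close>)
    have f2: "homotopic X Y (f \<circ>\<^sub>c u \<circ>\<^sub>c q) (f' \<circ>\<^sub>c v \<circ>\<^sub>c q)"
      by (rule homotopic_comp_right[OF hf q(1) cW Y cX fu])
    have "homotopic X Y (f' \<circ>\<^sub>c (v \<circ>\<^sub>c q)) g"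
      unfolding comp_map_assoc
      by (rule homotopic_trans[OF homotopic_sym[OF f2 cX Y chom_comp[OF q(1) fu(1)] chom_comp[OF q(1) fu(2)]] f1[unfolded comp_map_assoc]
            cX Y chom_comp[OF q(1) fu(2)] chom_comp[OF q(1) fu(1)] assms(3)])
    thus "roof_val X Y r' g" unfolding rr' roof_val_def prod.case using s2 uq(2)
      by (intro bexI[of _ "v \<circ>\<^sub>c q"] conjI) (simp_all add: comp_map_assoc)
  next
    assume v: "roof_val X Y r' g"
    have f'g: "homotopic X Y (f' \<circ>\<^sub>c t') g" by (rule roof_val_any[OF r' v[unfolded rr'] assms(3) t'])
    have "homotopic X Y (f \<circ>\<^sub>c t) (f' \<circ>\<^sub>c t')"
      by (rule homotopic_trans[OF ftg homotopic_sym[OF f'g cX Y ft(2) assms(3)] cX Y ft(1) assms(3) ft(2)])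
    moreover have "homotopic X X (s \<circ>\<^sub>c t) (s' \<circ>\<^sub>c t')"
      by (rule homotopic_trans[OF homotopic_sym[OF t(2) cX cX chom_id st(1)] t'(2) cX cX st(1) chom_id st(2)])
    moreover have "quasi_iso X X (s \<circ>\<^sub>c t)"
      by (rule quasi_iso_homotopic_id[OF cX st(1) homotopic_sym[OF t(2) cX cX chom_id st(1)]])
    ultimately show "(r, r') \<in> roof_rel X Y"
      unfolding rr rr' roof_rel_def using r r' t(1) t'(1) Kb_projD(1)[OF X] by auto
  qed
qed

definition cls :: "'a cmap \<Rightarrow> 'a roof set" where
  "cls f = roof_rel X Y `` {(X, id_map, f)}"

lemma trivial_roof:
  assumes "f \<in> chom X Y" shows "(X, id_map, f) \<in> roofs X Y" "roof_val X Y (X, id_map, f) f"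
proof -
  show "(X, id_map, f) \<in> roofs X Y" using assms quasi_iso_id Kb_projD(1)[OF X] by (simp add: roofs_def)
  show "roof_val X Y (X, id_map, f) f" unfolding roof_val_def prod.case
    using homotopic_refl[OF cX cX chom_id] homotopic_refl[OF cX Y assms]
    by (intro bexI[of _ id_map] conjI chom_id) simp_all
qed

lemma roof_rel_Image:
  assumes "r \<in> roofs X Y" "g \<in> chom X Y" "roof_val X Y r g"
  shows "roof_rel X Y `` {r} = {r' \<in> roofs X Y. roof_val X Y r' g}"
proof -
  have "r' \<in> roofs X Y" if "(r, r') \<in> roof_rel X Y" for r' using that by (auto simp: roof_rel_def)
  thus ?thesis using roof_rel_iff[OF assms(1) _ assms(2,3)] by blast
qed

lemma cls_eq: "f \<in> chom X Y \<Longrightarrow> cls f = {r \<in> roofs X Y. roof_val X Y r f}"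
  unfolding cls_def by (rule roof_rel_Image[OF trivial_roof(1) _ trivial_roof(2)])

lemma roof_rel_cls: "r \<in> roofs X Y \<Longrightarrow> g \<in> chom X Y \<Longrightarrow> roof_val X Y r g \<Longrightarrow> roof_rel X Y `` {r} = cls g"
  by (simp add: roof_rel_Image cls_eq)

lemma cls_eq_iff:
  assumes f: "f \<in> chom X Y" and g: "g \<in> chom X Y"
  shows "cls f = cls g \<longleftrightarrow> homotopic X Y f g"
proof
  assume "cls f = cls g"
  hence "roof_val X Y (X, id_map, f) g" using trivial_roof[OF f] f g by (auto simp: cls_eq)
  thus "homotopic X Y f g"
    using roof_val_homotopic[OF trivial_roof[OF f] f g] by simp
next
  assume h: "homotopic X Y f g"
  have h': "homotopic X Y g f" by (rule homotopic_sym[OF h cX Y f g])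
  have "roof_val X Y r f \<longleftrightarrow> roof_val X Y r g" if r: "r \<in> roofs X Y" for r
    using roof_val_homotopic[OF r _ f g] roof_val_homotopic[OF r _ g f] h h' by blast
  thus "cls f = cls g" using f g by (auto simp: cls_eq)
qed

text \<open>Thus every morphism in the derived category out of \<open>X\<close> is the class of a chain map.\<close>

lemma Hom_D_carrier: "carrier (Hom_D scale X Y) = cls ` chom X Y"
proof -
  have c: "carrier (Hom_D scale X Y) = roofs X Y // roof_rel X Y" by (simp add: Hom_D_def)
  show ?thesis unfolding c
  proof (intro equalityI subsetI)
    fix A assume "A \<in> roofs X Y // roof_rel X Y"
    then obtain r where r: "r \<in> roofs X Y" "A = roof_rel X Y `` {r}" by (rule quotientE)
    obtain g where "g \<in> chom X Y" "roof_val X Y r g" by (rule roof_val_ex[OF r(1)])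
    thus "A \<in> cls ` chom X Y" unfolding r(2) using roof_rel_cls[OF r(1)] by blast
  next
    fix A assume "A \<in> cls ` chom X Y"
    then obtain f where f: "f \<in> chom X Y" "A = cls f" by blast
    show "A \<in> roofs X Y // roof_rel X Y"
      unfolding f(2) cls_def by (rule quotientI[OF trivial_roof(1)[OF f(1)]])
  qed
qed

lemma Hom_D_zero: "\<zero>\<^bsub>Hom_D scale X Y\<^esub> = cls (zero_map Y)"
  by (simp add: Hom_D_def cls_def)

text \<open>Roofs with a common left leg have a common section, so their values add; every pair in the union
  therefore yields one and the same class.\<close>

lemma Hom_D_add:
  assumes f: "f \<in> chom X Y" and g: "g \<in> chom X Y"
  shows "cls f \<oplus>\<^bsub>Hom_D scale X Y\<^esub> cls g = cls (add_map Y f g)"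
proof -
  have fg: "add_map Y f g \<in> chom X Y" by (rule chom_add[OF Y f g])
  have *: "roof_rel X Y `` {(Z, s, add_map Y f1 g1)} = cls (add_map Y f g)"
    if r: "(Z, s, f1) \<in> cls f" "(Z, s, g1) \<in> cls g" for Z s f1 g1
  proof -
    have r1: "(Z, s, f1) \<in> roofs X Y" "roof_val X Y (Z, s, f1) f"
      and r2: "(Z, s, g1) \<in> roofs X Y" "roof_val X Y (Z, s, g1) g"
      using r f g by (auto simp: cls_eq)
    note d1 = roofsD[OF r1(1)] and d2 = roofsD[OF r2(1)]
    have r3: "(Z, s, add_map Y f1 g1) \<in> roofs X Y"
      using d1 d2 chom_add[OF Y d1(5) d2(5)] by (simp add: roofs_def)
    obtain t where t: "t \<in> chom X Z" "homotopic X X id_map (s \<circ>\<^sub>c t)" by (rule section_ex[OF r1(1)])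
    have "homotopic X Y (add_map Y (f1 \<circ>\<^sub>c t) (g1 \<circ>\<^sub>c t)) (add_map Y f g)"
      by (rule homotopic_add[OF roof_val_any[OF r1 f t] roof_val_any[OF r2 g t] cX Y chom_comp[OF t(1) d1(5)] f chom_comp[OF t(1) d2(5)] g])
    moreover have "add_map Y (f1 \<circ>\<^sub>c t) (g1 \<circ>\<^sub>c t) = add_map Y f1 g1 \<circ>\<^sub>c t" by (simp add: add_map_def comp_map_def)
    ultimately have "roof_val X Y (Z, s, add_map Y f1 g1) (add_map Y f g)"
      using t by (auto simp: roof_val_def)
    thus ?thesis by (rule roof_rel_cls[OF r3 fg])
  qed
  have "(X, id_map, f) \<in> cls f" "(X, id_map, g) \<in> cls g" using f g trivial_roof by (auto simp: cls_eq)
  hence "{roof_rel X Y `` {(Z, s, add_map Y f1 g1)} | Z s f1 g1. (Z, s, f1) \<in> cls f \<and> (Z, s, g1) \<in> cls g} = {cls (add_map Y f g)}"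
    using * by blast
  thus ?thesis by (simp add: Hom_D_def)
qed

end

context fd_algebra
begin

lemma chom_scale:
  assumes Y: "is_complex Y" and f: "f \<in> chom X Y" shows "scale_map scale Y c f \<in> chom X Y"
  by (rule chomI)
    (use assms in \<open>auto simp: scale_map_def rhom_scale cobj_rm chom_rhom chom_d chom_closed rhom_act[OF cdiff_rhom]\<close>)

lemma homotopic_scale:
  assumes "homotopic X Y f f'" "is_complex X" and Y: "is_complex Y" and "f \<in> chom X Y" "f' \<in> chom X Y"
  shows "homotopic X Y (scale_map scale Y c f) (scale_map scale Y c f')"
proof -
  obtain h where H: "homotopy X Y h f f'" by (rule homotopicE[OF assms(1-5)])
  note h = homotopyD(1)[OF H assms(2) Y] and c = homotopyD(2-4)[OF H assms(2) Y] and eq = homotopyD(5)[OF H assms(2) Y]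
  show ?thesis
  proof (rule homotopicI[where h = "\<lambda>i x. scale c 1 \<odot>\<^bsub>cobj Y (i - 1)\<^esub> h i x"])
    show "(\<lambda>x. scale c 1 \<odot>\<^bsub>cobj Y (i - 1)\<^esub> h i x) \<in> rhom (cobj X i) (cobj Y (i - 1))" for i
      by (intro rhom_scale cobj_rm Y h)
    fix i x assume x: "x \<in> carrier (cobj X i)"
    show "scale_map scale Y c f i x = cdiff Y (i - 1) (scale c 1 \<odot>\<^bsub>cobj Y (i - 1)\<^esub> h i x) \<oplus>\<^bsub>cobj Y i\<^esub>
      scale c 1 \<odot>\<^bsub>cobj Y (i + 1 - 1)\<^esub> h (i + 1) (cdiff X i x) \<oplus>\<^bsub>cobj Y i\<^esub> scale_map scale Y c f' i x"
      using x assms c[OF x]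
      by (simp add: scale_map_def eq ag_closed cobj_rm chom_closed rhom_act[OF cdiff_rhom'] right_module.act_add)
  qed (use assms in \<open>auto intro: chom_scale\<close>)
qed

lemma Hom_D_smult:
  assumes "roof_pair X Y" and f: "f \<in> chom X Y"
  shows "c \<odot>\<^bsub>Hom_D scale X Y\<^esub> roof_pair.cls X Y f = roof_pair.cls X Y (scale_map scale Y c f)"
proof -
  interpret roof_pair X Y by fact
  have cf: "scale_map scale Y c f \<in> chom X Y" by (rule chom_scale[OF Y f])
  have *: "roof_rel X Y `` {(Z, s, scale_map scale Y c f1)} = cls (scale_map scale Y c f)"
    if r: "(Z, s, f1) \<in> cls f" for Z s f1
  proof -
    have r1: "(Z, s, f1) \<in> roofs X Y" "roof_val X Y (Z, s, f1) f" using r f by (auto simp: cls_eq)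
    note d1 = roofsD[OF r1(1)]
    have r3: "(Z, s, scale_map scale Y c f1) \<in> roofs X Y"
      using d1 chom_scale[OF Y d1(5)] by (simp add: roofs_def)
    obtain t where t: "t \<in> chom X Z" "homotopic X X id_map (s \<circ>\<^sub>c t)" by (rule section_ex[OF r1(1)])
    have "homotopic X Y (scale_map scale Y c (f1 \<circ>\<^sub>c t)) (scale_map scale Y c f)"
      by (rule homotopic_scale[OF roof_val_any[OF r1 f t] cX Y chom_comp[OF t(1) d1(5)] f])
    moreover have "scale_map scale Y c (f1 \<circ>\<^sub>c t) = scale_map scale Y c f1 \<circ>\<^sub>c t"
      by (simp add: scale_map_def comp_map_def)
    ultimately have "roof_val X Y (Z, s, scale_map scale Y c f1) (scale_map scale Y c f)"
      using t by (auto simp: roof_val_def)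
    thus ?thesis by (rule roof_rel_cls[OF r3 cf])
  qed
  have "(X, id_map, f) \<in> cls f" using f trivial_roof by (auto simp: cls_eq)
  hence "{roof_rel X Y `` {(Z, s, scale_map scale Y c f1)} | Z s f1. (Z, s, f1) \<in> cls f} = {cls (scale_map scale Y c f)}"
    using * by blast
  thus ?thesis by (simp add: Hom_D_def)
qed

end

section \<open>Morphisms to shifted modules and the Euler form\<close>

text \<open>This says $\mathrm{Hom}(X, M[-j]) = 0$ in the homotopy category: a chain map to the module \<open>M\<close> placed in
  degree \<open>j\<close> is a map on $X^j$ that kills the incoming differential, and it is null-homotopic if it
  factors through the outgoing one.  The degrees that matter are $j = 0$ and $j = -1$.\<close>

definition hom_vanish :: "('a::{ring,monoid_mult}) cpx \<Rightarrow> 'a obj \<Rightarrow> int \<Rightarrow> bool" where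
  "hom_vanish X M j \<longleftrightarrow> (\<forall>f\<in>rhom (cobj X j) M.
     (\<forall>x\<in>carrier (cobj X (j - 1)). f (cdiff X (j - 1) x) = \<zero>\<^bsub>M\<^esub>) \<longrightarrow>
     (\<exists>g\<in>rhom (cobj X (j + 1)) M. \<forall>x\<in>carrier (cobj X j). f x = g (cdiff X j x)))"

text \<open>Cocycles and coboundaries of the complex $\mathrm{Hom}(X, M)$ at the term $\mathrm{Hom}(X^j, M)$.\<close>

definition hom_cocycles :: "('a::{ring,monoid_mult}) cpx \<Rightarrow> 'a obj \<Rightarrow> int \<Rightarrow> ((nat \<Rightarrow> 'a) \<Rightarrow> nat \<Rightarrow> 'a) set" where
  "hom_cocycles X M j = {f \<in> homs (cobj X j) M. \<forall>x\<in>carrier (cobj X (j - 1)). f (cdiff X (j - 1) x) = \<zero>\<^bsub>M\<^esub>}"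

definition hom_coboundaries :: "('a::{ring,monoid_mult}) cpx \<Rightarrow> 'a obj \<Rightarrow> int \<Rightarrow> ((nat \<Rightarrow> 'a) \<Rightarrow> nat \<Rightarrow> 'a) set" where
  "hom_coboundaries X M j = (\<lambda>g. extend0 (cobj X j) M (\<lambda>x. g (cdiff X j x))) ` homs (cobj X (j + 1)) M"

lemma hom_coboundariesI:
  assumes X: "is_complex X" and f: "f \<in> homs (cobj X j) M" and g: "g \<in> rhom (cobj X (j + 1)) M"
    and fg: "\<And>x. x \<in> carrier (cobj X j) \<Longrightarrow> f x = g (cdiff X j x)"
  shows "f \<in> hom_coboundaries X M j"
proof -
  have "f = extend0 (cobj X j) M (\<lambda>x. extend0 (cobj X (j + 1)) M g (cdiff X j x))"
  proof (rule homs_eqI[OF f extend0_homs[OF cobj_rm[OF X] rhom_comp[OF cdiff_rhom[OF X]]]])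
    show "extend0 (cobj X (j + 1)) M g \<in> rhom (cobj X (j + 1)) M"
      using extend0_homs[OF cobj_rm[OF X] g] by (rule homs_rhom)
  qed (use fg in \<open>auto simp: cdiff_closed[OF X]\<close>)
  thus ?thesis unfolding hom_coboundaries_def using extend0_homs[OF cobj_rm[OF X] g] by blast
qed

lemma hom_vanish_iff:
  assumes X: "is_complex X"
  shows "hom_vanish X M j \<longleftrightarrow> hom_cocycles X M j \<subseteq> hom_coboundaries X M j"
proof
  assume v: "hom_vanish X M j"
  show "hom_cocycles X M j \<subseteq> hom_coboundaries X M j"
  proof
    fix f assume f: "f \<in> hom_cocycles X M j"
    then obtain g where "g \<in> rhom (cobj X (j + 1)) M" "\<forall>x\<in>carrier (cobj X j). f x = g (cdiff X j x)"
      using v homs_rhom unfolding hom_vanish_def hom_cocycles_def by blast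
    thus "f \<in> hom_coboundaries X M j" using f by (intro hom_coboundariesI[OF X]) (auto simp: hom_cocycles_def)
  qed
next
  assume zb: "hom_cocycles X M j \<subseteq> hom_coboundaries X M j"
  show "hom_vanish X M j" unfolding hom_vanish_def
  proof (intro ballI impI)
    fix f assume f: "f \<in> rhom (cobj X j) M"
      and d: "\<forall>x\<in>carrier (cobj X (j - 1)). f (cdiff X (j - 1) x) = \<zero>\<^bsub>M\<^esub>"
    have "extend0 (cobj X j) M f \<in> hom_cocycles X M j"
      using d by (auto simp: hom_cocycles_def cdiff_closed'[OF X] intro: extend0_homs[OF cobj_rm[OF X] f])
    then obtain g where g: "g \<in> homs (cobj X (j + 1)) M"
      "extend0 (cobj X j) M f = extend0 (cobj X j) M (\<lambda>x. g (cdiff X j x))"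
      using zb by (auto simp: hom_coboundaries_def)
    have "f x = g (cdiff X j x)" if "x \<in> carrier (cobj X j)" for x
      using fun_cong[OF g(2), of x] that by simp
    thus "\<exists>g\<in>rhom (cobj X (j + 1)) M. \<forall>x\<in>carrier (cobj X j). f x = g (cdiff X j x)"
      using homs_rhom[OF g(1)] by blast
  qed
qed

lemma hom_vanish_zero_at:
  assumes X: "is_complex X" and M: "right_module M" and z: "zero_at X j"
  shows "hom_vanish X M j"
  unfolding hom_vanish_def
proof (intro ballI impI)
  fix f assume f: "f \<in> rhom (cobj X j) M"
  show "\<exists>g\<in>rhom (cobj X (j + 1)) M. \<forall>x\<in>carrier (cobj X j). f x = g (cdiff X j x)"
    using rhom_zero[OF cobj_rm[OF X] M f] z
    by (intro bexI[of _ "\<lambda>_. \<zero>\<^bsub>M\<^esub>"] rhom_zero_fun M) (auto simp: zero_at_def)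
qed

context fd_algebra
begin

lemma hom_cocycles_subspace:
  assumes X: "is_complex X" and M: "right_module M"
  shows "VectorSpace.subspace class_ring (hom_cocycles X M j) (hom_space (cobj X j) M)"
  by (rule hom_space_subspace[OF M])
    (auto simp: hom_cocycles_def homs_def M rhom_zero_fun rhom_add_fun rhom_scale right_module.act_zero ag_simps ag_closed)

lemma hom_coboundaries_subspace:
  assumes X: "is_complex X" and M: "right_module M"
  shows "VectorSpace.subspace class_ring (hom_coboundaries X M j) (hom_space (cobj X j) M)"
proof (rule hom_space_subspace[OF M])
  note r = cobj_rm[OF X]
  have sub: "f \<in> homs (cobj X j) M" if "f \<in> hom_coboundaries X M j" for f
    using that by (auto simp: hom_coboundaries_def intro!: extend0_homs[OF r rhom_comp[OF cdiff_rhom[OF X] homs_rhom]])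
  thus "hom_coboundaries X M j \<subseteq> homs (cobj X j) M" by blast
  have ex: "\<exists>g\<in>rhom (cobj X (j + 1)) M. \<forall>x\<in>carrier (cobj X j). f x = g (cdiff X j x)" if f: "f \<in> hom_coboundaries X M j" for f
  proof -
    from f obtain g where g: "g \<in> homs (cobj X (j + 1)) M" "f = extend0 (cobj X j) M (\<lambda>x. g (cdiff X j x))"
      by (auto simp: hom_coboundaries_def)
    show ?thesis using homs_rhom[OF g(1)] g(2) by auto
  qed
  show "(\<lambda>_. \<zero>\<^bsub>M\<^esub>) \<in> hom_coboundaries X M j"
    by (rule hom_coboundariesI[OF X _ rhom_zero_fun[OF M]]) (auto simp: homs_def rhom_zero_fun M)
  show "(\<lambda>x. f x \<oplus>\<^bsub>M\<^esub> g x) \<in> hom_coboundaries X M j" if fg: "f \<in> hom_coboundaries X M j" "g \<in> hom_coboundaries X M j" for f g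
  proof -
    obtain f' where f': "f' \<in> rhom (cobj X (j + 1)) M" "\<forall>x\<in>carrier (cobj X j). f x = f' (cdiff X j x)"
      using ex[OF fg(1)] by blast
    obtain g' where g': "g' \<in> rhom (cobj X (j + 1)) M" "\<forall>x\<in>carrier (cobj X j). g x = g' (cdiff X j x)"
      using ex[OF fg(2)] by blast
    note * = f' g'
    show ?thesis
      by (rule hom_coboundariesI[OF X _ rhom_add_fun[OF M *(1,3)]])
        (use * sub[OF fg(1)] sub[OF fg(2)] in \<open>auto simp: homs_def rhom_add_fun M ag_simps ag_closed\<close>)
  qed
  show "(\<lambda>x. scale c 1 \<odot>\<^bsub>M\<^esub> f x) \<in> hom_coboundaries X M j" if f: "f \<in> hom_coboundaries X M j" for c f
  proof -
    obtain f' where *: "f' \<in> rhom (cobj X (j + 1)) M" "\<forall>x\<in>carrier (cobj X j). f x = f' (cdiff X j x)"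
      using ex[OF f] by blast
    show ?thesis
      by (rule hom_coboundariesI[OF X _ rhom_scale[OF M *(1)]])
        (use * sub[OF f] in \<open>auto simp: homs_def rhom_scale M right_module.act_zero\<close>)
  qed
qed

lemma vdim_hom_space_split:
  assumes X: "is_complex X" and M: "M \<in> mod_cat"
  shows "vdim (hom_space (cobj X (j + 1)) M) =
    vdim ((hom_space (cobj X j) M)\<lparr>carrier := hom_coboundaries X M j\<rparr>) + vdim ((hom_space (cobj X (j + 1)) M)\<lparr>carrier := hom_cocycles X M (j + 1)\<rparr>)"
proof -
  note rM = mod_catD(1)[OF M] and r = cobj_rm[OF X]
  let ?F = "\<lambda>g. extend0 (cobj X j) M (\<lambda>x. g (cdiff X j x))"
  let ?V = "hom_space (cobj X (j + 1)) M" and ?W = "(hom_space (cobj X j) M)\<lparr>carrier := hom_coboundaries X M j\<rparr>"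
  have V: "fin_dim_space ?V" using mod_catD[OF M] mod_catD[OF cobj_mod_cat[OF X]] by (intro hom_space_fin_dim) auto
  have W: "vectorspace class_ring ?W" by (rule vectorspace_subspace[OF hom_coboundaries_subspace[OF X rM]])
  have "{g \<in> carrier ?V. ?F g = \<zero>\<^bsub>?W\<^esub>} = hom_cocycles X M (j + 1)"
  proof -
    have "?F g = (\<lambda>_. \<zero>\<^bsub>M\<^esub>) \<longleftrightarrow> (\<forall>x\<in>carrier (cobj X j). g (cdiff X j x) = \<zero>\<^bsub>M\<^esub>)" for g
      by (auto simp: extend0_def fun_eq_iff)
    thus ?thesis by (auto simp: hom_cocycles_def)
  qed
  moreover have "vdim ?V = vdim ?W + vdim (?V\<lparr>carrier := {g \<in> carrier ?V. ?F g = \<zero>\<^bsub>?W\<^esub>}\<rparr>)"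
  proof (rule rank_nullity_sum(2)[OF V W])
    show "?F ` carrier ?V = carrier ?W" by (simp add: hom_coboundaries_def)
    show "?F (f \<oplus>\<^bsub>?V\<^esub> g) = ?F f \<oplus>\<^bsub>?W\<^esub> ?F g" for f g
      by (simp add: fun_eq_iff extend0_def ag_simps ag_closed rM)
    show "?F (c \<odot>\<^bsub>?V\<^esub> f) = c \<odot>\<^bsub>?W\<^esub> ?F f" for c f
      by (simp add: fun_eq_iff extend0_def right_module.act_zero[OF rM])
  qed
  ultimately show ?thesis by simp
qed

text \<open>The space of morphisms from \<open>X\<close> to $M[i]$ is the cohomology of $\mathrm{Hom}(X, M)$ at $X^{-i}$: sending a
  cocycle to the class of the chain map it defines is linear and surjective, and its kernel consists
  of the coboundaries.\<close>

lemma Hom_D_stalk: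
  fixes X :: "'a cpx" and i :: int
  assumes X: "X \<in> Kb_proj" and M: "M \<in> mod_cat"
  defines "H \<equiv> Hom_D scale X (shift i (stalk M))" and "j \<equiv> - i"
  shows "fin_dim_space H"
    and "vdim ((hom_space (cobj X j) M)\<lparr>carrier := hom_cocycles X M j\<rparr>) = vdim H + vdim ((hom_space (cobj X j) M)\<lparr>carrier := hom_coboundaries X M j\<rparr>)"
    and "vdim H = 0 \<longleftrightarrow> hom_vanish X M j"
proof -
  let ?Y = "shift i (stalk M)"
  have cX: "is_complex X" using X by (rule Kb_projD)
  note rM = mod_catD(1)[OF M] and r = cobj_rm[OF cX]
  have cY: "is_complex ?Y" by (rule shift_complex[OF Cb_modD(1)[OF stalk_Cb_mod[OF M]]])
  interpret roof_pair X ?Y by (unfold_locales) (fact X, fact cY)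
  have Yj: "cobj ?Y n = (if n = j then M else zero_mod)" for n by (auto simp: j_def)
  have Yd: "cdiff ?Y n x = \<zero>\<^bsub>cobj ?Y (n + 1)\<^esub>" for n x
    using rM zero_mod_right_module by (auto simp: right_module.neg_zero)
      (use right_module.neg_zero[OF zero_mod_right_module] in \<open>auto simp: fun_eq_iff\<close>)
  define cm where "cm f = (\<lambda>n x. if n = j then f x else (\<lambda>_. 0))" for f :: "(nat \<Rightarrow> 'a) \<Rightarrow> nat \<Rightarrow> 'a"
  have zr: "(\<lambda>_. \<lambda>_. 0) \<in> rhom N zero_mod" for N :: "'a obj"
    using rhom_zero_fun[OF zero_mod_right_module] by simp
  have cm: "cm f \<in> chom X ?Y" if f: "f \<in> hom_cocycles X M j" for f
  proof (rule chomI)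
    fix n
    show "cm f n \<in> rhom (cobj X n) (cobj ?Y n)"
      using f zr by (auto simp: cm_def Yj hom_cocycles_def homs_def simp del: shift_simps)
    fix x assume x: "x \<in> carrier (cobj X n)"
    have "cm f (n + 1) (cdiff X n x) = \<zero>\<^bsub>cobj ?Y (n + 1)\<^esub>"
    proof (cases "n + 1 = j")
      case True
      hence "n = j - 1" by simp
      thus ?thesis using f x by (auto simp: cm_def Yj hom_cocycles_def simp del: shift_simps)
    qed (simp add: cm_def Yj del: shift_simps)
    thus "cm f (n + 1) (cdiff X n x) = cdiff ?Y n (cm f n x)" unfolding Yd .
  qed
  let ?Z = "(hom_space (cobj X j) M)\<lparr>carrier := hom_cocycles X M j\<rparr>"
  have Zk: "fin_dim_space ?Z"
    using mod_catD[OF M] mod_catD[OF cobj_mod_cat[OF cX]]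
    by (intro fin_dim_subspace(1) hom_cocycles_subspace cX hom_space_fin_dim) auto
  let ?\<Phi> = "\<lambda>f. cls (cm f)"
  have cls_cong: "cls f = cls g" if "f \<in> chom X ?Y" "g \<in> chom X ?Y"
    "\<And>n x. x \<in> carrier (cobj X n) \<Longrightarrow> f n x = g n x" for f g
    unfolding cls_eq_iff[OF that(1,2)]
    by (rule homotopic_cong[OF homotopic_refl[OF cX cY that(1)] cX cY]) (use that(3) in auto)
  note Zs = hom_cocycles_subspace[OF cX rM, of j]
  have Zadd: "(\<lambda>x. f x \<oplus>\<^bsub>M\<^esub> g x) \<in> hom_cocycles X M j" if "f \<in> hom_cocycles X M j" "g \<in> hom_cocycles X M j" for f g
    using Zs that by (auto simp: VectorSpace.subspace_def LinearCombinations.submodule_def)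
  have Zsc: "(\<lambda>x. scale c 1 \<odot>\<^bsub>M\<^esub> f x) \<in> hom_cocycles X M j" if "f \<in> hom_cocycles X M j" for f c
    using Zs that by (auto simp: VectorSpace.subspace_def LinearCombinations.submodule_def)
  have Zz: "(\<lambda>_. \<zero>\<^bsub>M\<^esub>) \<in> hom_cocycles X M j" 
    using Zs by (auto simp: VectorSpace.subspace_def LinearCombinations.submodule_def)
  have sur: "?\<Phi> ` carrier ?Z = carrier H"
  proof -
    have "cls g \<in> ?\<Phi> ` hom_cocycles X M j" if g: "g \<in> chom X ?Y" for g
    proof -
      have gj: "g j \<in> rhom (cobj X j) M" using chom_rhom[OF g, of j] by (simp add: Yj del: shift_simps)
      have "g j (cdiff X (j - 1) x) = \<zero>\<^bsub>M\<^esub>" if "x \<in> carrier (cobj X (j - 1))" for x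
        using chom_d'[OF g that] unfolding Yd by (simp add: Yj del: shift_simps)
      hence f: "extend0 (cobj X j) M (g j) \<in> hom_cocycles X M j"
        by (auto simp: hom_cocycles_def cdiff_closed'[OF cX] intro: extend0_homs[OF r gj])
      have "cls g = ?\<Phi> (extend0 (cobj X j) M (g j))"
      proof (rule cls_cong[OF g cm[OF f]])
        fix n x assume x: "x \<in> carrier (cobj X n)"
        show "g n x = cm (extend0 (cobj X j) M (g j)) n x"
          using x chom_closed[OF g x] by (cases "n = j") (auto simp: cm_def Yj simp del: shift_simps)
      qed
      thus ?thesis using f by blast
    qed
    thus ?thesis using cm by (auto simp: H_def Hom_D_carrier)
  qed
  have add: "?\<Phi> (f \<oplus>\<^bsub>?Z\<^esub> g) = ?\<Phi> f \<oplus>\<^bsub>H\<^esub> ?\<Phi> g" if "f \<in> carrier ?Z" "g \<in> carrier ?Z" for f g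
  proof -
    have fg: "f \<in> hom_cocycles X M j" "g \<in> hom_cocycles X M j" using that by simp_all
    have "?\<Phi> (\<lambda>x. f x \<oplus>\<^bsub>M\<^esub> g x) = cls (add_map ?Y (cm f) (cm g))"
      by (rule cls_cong[OF cm[OF Zadd[OF fg]] chom_add[OF cY cm[OF fg(1)] cm[OF fg(2)]]])
        (auto simp: cm_def add_map_def Yj simp del: shift_simps)
    thus ?thesis using Hom_D_add[OF cm[OF fg(1)] cm[OF fg(2)], of scale] by (simp add: H_def)
  qed
  have act: "?\<Phi> (c \<odot>\<^bsub>?Z\<^esub> f) = c \<odot>\<^bsub>H\<^esub> ?\<Phi> f" if "f \<in> carrier ?Z" for f c
  proof -
    have f: "f \<in> hom_cocycles X M j" using that by simp
    have "?\<Phi> (\<lambda>x. scale c 1 \<odot>\<^bsub>M\<^esub> f x) = cls (scale_map scale ?Y c (cm f))"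
      by (rule cls_cong[OF cm[OF Zsc[OF f]] chom_scale[OF cY cm[OF f]]])
        (auto simp: cm_def scale_map_def Yj simp del: shift_simps)
    thus ?thesis using Hom_D_smult[OF roof_pair_axioms cm[OF f]] by (simp add: H_def)
  qed
  have zero: "?\<Phi> \<zero>\<^bsub>?Z\<^esub> = \<zero>\<^bsub>H\<^esub>"
  proof -
    have "?\<Phi> (\<lambda>_. \<zero>\<^bsub>M\<^esub>) = cls (zero_map ?Y)"
      by (rule cls_cong[OF cm[OF Zz] chom_zero[OF cY]]) (auto simp: cm_def zero_map_def Yj simp del: shift_simps)
    thus ?thesis by (simp add: H_def Hom_D_zero)
  qed
  have Zv: "vectorspace class_ring ?Z" using Zk unfolding fin_dim_space_def by blast
  have Hv: "vectorspace class_ring H"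
    by (rule vectorspace_image[OF Zv sur]) (erule (1) add, erule act, rule zero)
  have kern: "?\<Phi> f = \<zero>\<^bsub>H\<^esub> \<longleftrightarrow> f \<in> hom_coboundaries X M j" if f: "f \<in> hom_cocycles X M j" for f
  proof -
    have fh: "f \<in> homs (cobj X j) M" using f by (simp add: hom_cocycles_def)
    have "?\<Phi> f = \<zero>\<^bsub>H\<^esub> \<longleftrightarrow> homotopic X ?Y (cm f) (zero_map ?Y)"
      unfolding H_def Hom_D_zero by (rule cls_eq_iff[OF cm[OF f] chom_zero[OF cY]])
    also have "\<dots> \<longleftrightarrow> f \<in> hom_coboundaries X M j"
    proof
      assume "homotopic X ?Y (cm f) (zero_map ?Y)"
      then obtain h where H: "homotopy X ?Y h (cm f) (zero_map ?Y)"
        by (rule homotopicE[OF _ cX cY cm[OF f] chom_zero[OF cY]])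
      note h = homotopyD(1)[OF H cX cY] and e = homotopyD(5)[OF H cX cY]
      have hj: "h (j + 1) \<in> rhom (cobj X (j + 1)) M" using h[of "j + 1"] by (simp add: Yj del: shift_simps)
      show "f \<in> hom_coboundaries X M j"
      proof (rule hom_coboundariesI[OF cX fh hj])
        fix x assume x: "x \<in> carrier (cobj X j)"
        have "h (j + 1) (cdiff X j x) \<in> carrier M" by (rule rhom_closed[OF hj cdiff_closed[OF cX x]])
        thus "f x = h (j + 1) (cdiff X j x)"
          using e[OF x] unfolding Yd zero_map_def
          by (simp add: cm_def Yj ag_simps ag_closed rM del: shift_simps)
      qed
    next
      assume "f \<in> hom_coboundaries X M j"
      then obtain g where g: "g \<in> rhom (cobj X (j + 1)) M" "\<And>x. x \<in> carrier (cobj X j) \<Longrightarrow> f x = g (cdiff X j x)"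
        by (auto simp: hom_coboundaries_def dest: homs_rhom)
      define h where "h = (\<lambda>n x. if n = j + 1 then g x else (\<lambda>_. 0))"
      show "homotopic X ?Y (cm f) (zero_map ?Y)"
      proof (rule homotopicI[OF cX cY cm[OF f] chom_zero[OF cY]])
        show "h n \<in> rhom (cobj X n) (cobj ?Y (n - 1))" for n
          using g(1) zr by (auto simp: h_def Yj simp del: shift_simps)
        fix n x assume x: "x \<in> carrier (cobj X n)"
        have "g (cdiff X j x) \<in> carrier M" if "n = j" using rhom_closed[OF g(1)] cdiff_closed[OF cX x] that by simp
        thus "cm f n x = cdiff ?Y (n - 1) (h n x) \<oplus>\<^bsub>cobj ?Y n\<^esub> h (n + 1) (cdiff X n x) \<oplus>\<^bsub>cobj ?Y n\<^esub> zero_map ?Y n x"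
          unfolding Yd zero_map_def using x
          by (auto simp: cm_def h_def g(2) Yj ag_simps ag_closed rM simp del: shift_simps)
      qed
    qed
    finally show ?thesis .
  qed
  have BZ: "hom_coboundaries X M j \<subseteq> hom_cocycles X M j"
  proof
    fix f assume "f \<in> hom_coboundaries X M j"
    then obtain g where g: "g \<in> homs (cobj X (j + 1)) M" "f = extend0 (cobj X j) M (\<lambda>x. g (cdiff X j x))"
      by (auto simp: hom_coboundaries_def)
    show "f \<in> hom_cocycles X M j" using rhom_zero[OF r rM homs_rhom[OF g(1)]]
      extend0_homs[OF r rhom_comp[OF cdiff_rhom[OF cX] homs_rhom[OF g(1)]]]
      by (auto simp: hom_cocycles_def g(2) cdiff_closed'[OF cX] cdiff_cdiff'[OF cX])
  qed
  show Hk: "fin_dim_space H" by (rule rank_nullity_sum(1)[OF Zk Hv sur]) (erule (1) add, erule act)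
  have "{f \<in> carrier ?Z. ?\<Phi> f = \<zero>\<^bsub>H\<^esub>} = hom_coboundaries X M j" using kern BZ by auto
  moreover have "vdim ?Z = vdim H + vdim (?Z\<lparr>carrier := {f \<in> carrier ?Z. ?\<Phi> f = \<zero>\<^bsub>H\<^esub>}\<rparr>)"
    by (rule rank_nullity_sum(2)[OF Zk Hv sur]) (erule (1) add, erule act)
  ultimately show "vdim ?Z = vdim H + vdim ((hom_space (cobj X j) M)\<lparr>carrier := hom_coboundaries X M j\<rparr>)"
    by simp
  have "vdim H = 0 \<longleftrightarrow> (\<forall>f\<in>hom_cocycles X M j. ?\<Phi> f = \<zero>\<^bsub>H\<^esub>)"
    unfolding vdim_eq_0[OF Hk] sur[symmetric] using Zz zero by auto
  also have "\<dots> \<longleftrightarrow> hom_vanish X M j" unfolding hom_vanish_iff[OF cX] using kern by auto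
  finally show "vdim H = 0 \<longleftrightarrow> hom_vanish X M j" .
qed

end

lemma sum_shift_alternating:
  fixes b :: "int \<Rightarrow> int" and N :: int
  assumes "0 \<le> N" "b N = 0" "b (- N - 1) = 0"
  shows "(\<Sum>j\<in>{-N..N}. (if even j then 1 else - 1) * b (j - 1)) = - (\<Sum>j\<in>{-N..N}. (if even j then 1 else - 1) * b j)"
proof -
  have "(\<Sum>j\<in>{-N..N}. (if even j then 1 else - 1) * b (j - 1)) = (\<Sum>j\<in>{-N-1..N-1}. - ((if even j then 1 else - 1) * b j))"
    by (rule sum.reindex_bij_witness[of _ "\<lambda>j. j + 1" "\<lambda>j. j - 1"]) auto
  also have "\<dots> = (\<Sum>j\<in>{-N-1..N}. - ((if even j then 1 else - 1) * b j))"
  proof (rule sum.mono_neutral_left)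
    show "\<forall>i\<in>{- N - 1..N} - {- N - 1..N - 1}. - ((if even i then 1 else - 1) * b i) = 0"
    proof
      fix i assume "i \<in> {- N - 1..N} - {- N - 1..N - 1}"
      hence "i = N" by auto
      thus "- ((if even i then 1 else - 1) * b i) = 0" using assms by simp
    qed
  qed auto
  also have "\<dots> = (\<Sum>j\<in>{-N..N}. - ((if even j then 1 else - 1) * b j))"
  proof (rule sum.mono_neutral_right)
    show "\<forall>i\<in>{- N - 1..N} - {- N..N}. - ((if even i then 1 else - 1) * b i) = 0"
    proof
      fix i assume "i \<in> {- N - 1..N} - {- N..N}"
      hence "i = - N - 1" by auto
      thus "- ((if even i then 1 else - 1) * b i) = 0" using assms(3) by simp
    qed
  qed auto
  finally show ?thesis by (simp add: sum_negf)
qed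

context fd_algebra
begin

lemma vdim_zero_at:
  fixes X :: "'a cpx"
  assumes X: "is_complex X" and M: "M \<in> mod_cat" and z: "zero_at X j"
  shows "vdim (hom_space (cobj X j) M) = 0" "vdim ((hom_space (cobj X j) M)\<lparr>carrier := hom_cocycles X M j\<rparr>) = 0"
    "vdim ((hom_space (cobj X j) M)\<lparr>carrier := hom_coboundaries X M j\<rparr>) = 0"
proof -
  note rM = mod_catD(1)[OF M] and r = cobj_rm[OF X]
  have k: "fin_dim_space (hom_space (cobj X j) M)"
    using mod_catD[OF M] mod_catD[OF cobj_mod_cat[OF X]] by (intro hom_space_fin_dim) auto
  have "f = (\<lambda>_. \<zero>\<^bsub>M\<^esub>)" if f: "f \<in> homs (cobj X j) M" for f
    by (rule homs_eqI[OF f]) (use rhom_zero[OF r rM homs_rhom[OF f]] z in \<open>auto simp: zero_at_def homs_def rhom_zero_fun rM\<close>)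
  hence "homs (cobj X j) M = {\<lambda>_. \<zero>\<^bsub>M\<^esub>}" by (auto simp: homs_def rhom_zero_fun rM)
  thus 1: "vdim (hom_space (cobj X j) M) = 0" using vdim_eq_0[OF k] by simp
  show "vdim ((hom_space (cobj X j) M)\<lparr>carrier := hom_cocycles X M j\<rparr>) = 0"
    using fin_dim_subspace(2)[OF k hom_cocycles_subspace[OF X rM]] 1 by simp
  show "vdim ((hom_space (cobj X j) M)\<lparr>carrier := hom_coboundaries X M j\<rparr>) = 0"
    using fin_dim_subspace(2)[OF k hom_coboundaries_subspace[OF X rM]] 1 by simp
qed

text \<open>The alternating sum of the dimensions of the cohomology of a bounded complex equals that of its terms,
  here for the complex $\mathrm{Hom}(X, M)$, whose terms depend additively on \<open>M\<close>.\<close>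

lemma euler_hom_sum:
  fixes X :: "'a cpx"
  assumes X: "X \<in> Kb_proj" and M: "M \<in> mod_cat" and N: "0 \<le> N" "\<And>j. N \<le> \<bar>j\<bar> \<Longrightarrow> zero_at X j"
  shows "euler scale X (stalk M) =
    (\<Sum>j\<in>{-N..N}. (if even j then 1 else - 1) * int (vdim (hom_space (cobj X j) M)))"
proof -
  have cX: "is_complex X" using X by (rule Kb_projD)
  define s :: "int \<Rightarrow> int" where "s j = (if even j then 1 else - 1)" for j
  define D where "D i = int (vdim (Hom_D scale X (shift i (stalk M))))" for i
  define z where "z j = int (vdim ((hom_space (cobj X j) M)\<lparr>carrier := hom_cocycles X M j\<rparr>))" for j
  define b where "b j = int (vdim ((hom_space (cobj X j) M)\<lparr>carrier := hom_coboundaries X M j\<rparr>))" for j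
  have zD: "z (- i) = D i + b (- i)" for i
    using Hom_D_stalk(2)[OF X M, of i] by (simp add: z_def D_def b_def)
  have H: "int (vdim (hom_space (cobj X j) M)) = b (j - 1) + z j" for j
    using vdim_hom_space_split[OF cX M, of "j - 1"] by (simp add: z_def b_def)
  have z0: "z j = 0" and b0: "b j = 0" if "N \<le> \<bar>j\<bar>" for j
    using vdim_zero_at[OF cX M N(2)[OF that]] by (simp_all add: z_def b_def)
  have "euler scale X (stalk M) = Sum_any (\<lambda>i. s i * D i)"
    unfolding euler_def by (simp add: s_def D_def vdim_def)
  also have "\<dots> = (\<Sum>i\<in>{-N..N}. s i * D i)"
  proof (rule Sum_any.expand_superset)
    have "i \<in> {-N..N}" if "s i * D i \<noteq> 0" for i
    proof (rule ccontr)
      assume "i \<notin> {-N..N}"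
      hence "N \<le> \<bar>- i\<bar>" by auto
      hence "D i = 0" using zD[of i] z0[of "- i"] b0[of "- i"] by simp
      thus False using that by simp
    qed
    thus "{i. s i * D i \<noteq> 0} \<subseteq> {-N..N}" by blast
  qed simp
  also have "\<dots> = (\<Sum>j\<in>{-N..N}. s j * (z j - b j))"
    by (rule sum.reindex_bij_witness[of _ uminus uminus]) (auto simp: zD s_def)
  also have "\<dots> = (\<Sum>j\<in>{-N..N}. s j * z j) - (\<Sum>j\<in>{-N..N}. s j * b j)"
    by (simp add: right_diff_distrib sum_subtractf)
  also have "\<dots> = (\<Sum>j\<in>{-N..N}. s j * z j) + (\<Sum>j\<in>{-N..N}. s j * b (j - 1))"
    using sum_shift_alternating[of N b] N(1) b0[of N] b0[of "- N - 1"] by (simp add: s_def)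
  also have "\<dots> = (\<Sum>j\<in>{-N..N}. s j * int (vdim (hom_space (cobj X j) M)))"
    by (simp add: H distrib_left sum.distrib add.commute)
  finally show ?thesis by (simp add: s_def)
qed

lemma euler_exact:
  fixes X :: "'a cpx"
  assumes X: "X \<in> Kb_proj" and e: "short_exact L M N"
  shows "euler scale X (stalk M) = euler scale X (stalk L) + euler scale X (stalk N)"
proof -
  have mc: "L \<in> mod_cat" "M \<in> mod_cat" "N \<in> mod_cat" using e by (auto simp: short_exact_def)
  have "finite {i. \<not> zero_at X i}" by (rule Cb_modD(2)[OF Kb_projD(1)[OF X]])
  hence "finite (abs ` {i. \<not> zero_at X i})" by simp
  then obtain m :: int where m: "\<And>i. \<not> zero_at X i \<Longrightarrow> \<bar>i\<bar> \<le> m"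
    by (metis (mono_tags, lifting) bdd_above.E bdd_above_finite imageI mem_Collect_eq)
  have K: "zero_at X j" if "max 0 (m + 1) \<le> \<bar>j\<bar>" for j using m[of j] that by linarith
  have "vdim (hom_space (cobj X j) M) = vdim (hom_space (cobj X j) L) + vdim (hom_space (cobj X j) N)" for j
    by (rule vdim_hom_space_exact[OF Kb_projD(3)[OF X] e])
  thus ?thesis
    using euler_hom_sum[OF X mc(1), of "max 0 (m + 1)", OF _ K] euler_hom_sum[OF X mc(2), of "max 0 (m + 1)", OF _ K]
      euler_hom_sum[OF X mc(3), of "max 0 (m + 1)", OF _ K]
    by (simp add: distrib_left sum.distrib del: max.bounded_iff)
qed

text \<open>The numbers \<open>p\<close> and \<open>q\<close> are the dimensions of the morphism spaces from \<open>X\<close> to \<open>M\<close> and to $M[1]$.\<close>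

lemma euler_two_term:
  fixes X :: "'a cpx"
  assumes X: "X \<in> Kb_proj" and M: "M \<in> mod_cat"
    and v: "\<And>j. j \<noteq> 0 \<Longrightarrow> j \<noteq> - 1 \<Longrightarrow> hom_vanish X M j"
  obtains p q :: nat where "euler scale X (stalk M) = int p - int q"
    "p = 0 \<longleftrightarrow> hom_vanish X M 0" "q = 0 \<longleftrightarrow> hom_vanish X M (- 1)"
proof -
  define D where "D i = vdim (Hom_D scale X (shift i (stalk M)))" for i
  have D: "D i = 0 \<longleftrightarrow> hom_vanish X M (- i)" for i
    using Hom_D_stalk(3)[OF X M, of i] by (simp add: D_def)
  have "euler scale X (stalk M) = Sum_any (\<lambda>i. (if even i then 1 else - 1) * int (D i))"
    unfolding euler_def by (simp add: D_def vdim_def)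
  also have "\<dots> = (\<Sum>i\<in>{0, 1}. (if even i then 1 else - 1) * int (D i))"
  proof (rule Sum_any.expand_superset)
    have "i \<in> {0, 1}" if "(if even i then 1 else - 1) * int (D i) \<noteq> 0" for i
    proof (rule ccontr)
      assume "i \<notin> {0, 1}"
      hence "D i = 0" unfolding D by (intro v) auto
      thus False using that by simp
    qed
    thus "{i. (if even i then 1 else - 1) * int (D i) \<noteq> 0} \<subseteq> {0, 1}" by blast
  qed simp
  finally have "euler scale X (stalk M) = int (D 0) - int (D 1)" by simp
  thus ?thesis using that[of "D 0" "D 1"] D[of 0] D[of 1] by simp
qed

end

section \<open>The Euler form on the Grothendieck group\<close>

definition lin_ext :: "('b \<Rightarrow> real) \<Rightarrow> ('b \<Rightarrow>\<^sub>0 real) \<Rightarrow> real" where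
  "lin_ext e v = (\<Sum>M\<in>Poly_Mapping.keys v. Poly_Mapping.lookup v M * e M)"

lemma lin_ext_superset:
  "finite A \<Longrightarrow> Poly_Mapping.keys v \<subseteq> A \<Longrightarrow> lin_ext e v = (\<Sum>M\<in>A. Poly_Mapping.lookup v M * e M)"
  unfolding lin_ext_def by (rule sum.mono_neutral_left) (auto simp: in_keys_iff)

lemma lin_ext_add: "lin_ext e (v + w) = lin_ext e v + lin_ext e w"
proof -
  let ?A = "Poly_Mapping.keys v \<union> Poly_Mapping.keys w"
  have "finite ?A" "Poly_Mapping.keys (v + w) \<subseteq> ?A" by (simp_all add: Poly_Mapping.keys_add)
  thus ?thesis
    using lin_ext_superset[of ?A "v + w" e] lin_ext_superset[of ?A v e] lin_ext_superset[of ?A w e]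
    by (simp add: lookup_add distrib_right sum.distrib)
qed

lemma lin_ext_single: "lin_ext e (Poly_Mapping.single M r) = r * e M"
  using lin_ext_superset[of "{M}" "Poly_Mapping.single M r" e] by (simp add: lookup_single)

lemma lin_ext_diff: "lin_ext e (v - w) = lin_ext e v - lin_ext e w"
  using lin_ext_add[of e "v - w" w] by simp

lemma lin_ext_relations:
  assumes "v \<in> K0_relations" and "\<And>L M N. short_exact L M N \<Longrightarrow> e M = e L + e N"
  shows "lin_ext e v = 0"
  using assms(1)
proof induction
  case zero
  show ?case by (simp add: lin_ext_def)
next
  case (step v L M N r)
  thus ?case using assms(2)[OF step(2)] by (simp add: lin_ext_add lin_ext_diff lin_ext_single distrib_left)
qed

lemma K0_class_in_real: "M \<in> mod_cat \<Longrightarrow> K0_class M \<in> K0_real"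
  unfolding K0_class_def K0_real_def by (rule quotientI) simp

context fd_algebra
begin

text \<open>The description in \<open>euler_form\<close> denotes something because additivity of the Euler form makes the sum the
  same for all representatives of a class.\<close>

lemma euler_form_class:
  fixes X :: "'a cpx"
  assumes X: "X \<in> Kb_proj" and M: "M \<in> mod_cat"
  shows "euler_form scale X (K0_class M) = real_of_int (euler scale X (stalk M))"
proof -
  define e where "e M = real_of_int (euler scale X (stalk M))" for M
  have ex: "e M = e L + e N" if "short_exact L M N" for L M N
    using euler_exact[OF X that] by (simp add: e_def)
  have rel: "lin_ext e v = 0" if "v \<in> K0_relations" for v
    by (rule lin_ext_relations[OF that ex])
  have self: "Poly_Mapping.single M 1 \<in> K0_class M"
    using M K0_relations.zero by (simp add: K0_class_def K0_equiv_def)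
  have all: "lin_ext e v = e M" if "v \<in> K0_class M" for v
  proof -
    have "Poly_Mapping.single M 1 - v \<in> K0_relations" using that by (simp add: K0_class_def K0_equiv_def)
    thus ?thesis using rel[of "Poly_Mapping.single M 1 - v"] by (simp add: lin_ext_diff lin_ext_single)
  qed
  have "euler_form scale X (K0_class M) = (THE r. \<forall>v\<in>K0_class M. r = lin_ext e v)"
    by (simp add: euler_form_def lin_ext_def e_def)
  also have "\<dots> = e M" by (rule the_equality) (use self all in auto)
  finally show ?thesis by (simp add: e_def)
qed

end

section \<open>Vanishing of morphisms under homotopy retracts\<close>

text \<open>Being a summand in the homotopy category, with no complement named; vanishing of morphisms passes
  along it, and both inclusions of a sum and isomorphisms are instances.\<close>

definition K_retract :: "('a::{ring,monoid_mult}) cpx \<Rightarrow> 'a cpx \<Rightarrow> bool" where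
  "K_retract X Y \<longleftrightarrow> is_complex X \<and> is_complex Y \<and>
     (\<exists>p\<in>chom X Y. \<exists>q\<in>chom Y X. homotopic X X (q \<circ>\<^sub>c p) id_map)"

lemma K_retractE:
  assumes "K_retract X Y"
  obtains p q k where "is_complex X" "is_complex Y" "p \<in> chom X Y" "q \<in> chom Y X"
    "homotopy X X k id_map (q \<circ>\<^sub>c p)"
proof -
  from assms obtain p q where c: "is_complex X" "is_complex Y" and pq: "p \<in> chom X Y" "q \<in> chom Y X"
    and h: "homotopic X X (q \<circ>\<^sub>c p) id_map" by (auto simp: K_retract_def)
  have qp: "q \<circ>\<^sub>c p \<in> chom X X" by (rule chom_comp[OF pq])
  have "homotopic X X id_map (q \<circ>\<^sub>c p)" by (rule homotopic_sym[OF h c(1,1) qp chom_id])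
  thus thesis by (rule homotopicE[OF _ c(1,1) chom_id qp]) (rule that[OF c pq])
qed

lemma K_iso_retract:
  assumes "K_iso X Y f" "is_complex X" "is_complex Y"
  shows "K_retract X Y" "K_retract Y X"
  using assms unfolding K_iso_def K_retract_def by blast+

lemma K_isomorphic_retract:
  assumes "X \<simeq>\<^sub>K Y" "is_complex X" "is_complex Y"
  shows "K_retract X Y" "K_retract Y X"
  using assms K_iso_retract unfolding K_isomorphic_def by blast+

definition csum_in1 :: "('a::{ring,monoid_mult}) cpx \<Rightarrow> 'a cmap" where
  "csum_in1 Y = (\<lambda>i x. pair x \<zero>\<^bsub>cobj Y i\<^esub>)"
definition csum_in2 :: "('a::{ring,monoid_mult}) cpx \<Rightarrow> 'a cmap" where
  "csum_in2 X = (\<lambda>i y. pair \<zero>\<^bsub>cobj X i\<^esub> y)"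
definition csum_pr1 :: "'a cmap" where "csum_pr1 = (\<lambda>i. pr1)"
definition csum_pr2 :: "'a cmap" where "csum_pr2 = (\<lambda>i. pr2)"

lemma csum_incl_proj:
  assumes X: "is_complex X" and Y: "is_complex Y"
  shows "csum_in1 Y \<in> chom X (csum X Y)" "csum_in2 X \<in> chom Y (csum X Y)"
    "csum_pr1 \<in> chom (csum X Y) X" "csum_pr2 \<in> chom (csum X Y) Y"
    "csum_pr1 \<circ>\<^sub>c csum_in1 Y = id_map" "csum_pr2 \<circ>\<^sub>c csum_in2 X = id_map"
  using assms
  by (auto intro!: chomI simp: csum_in1_def csum_in2_def csum_pr1_def csum_pr2_def comp_map_def id_map_def
      rhom_in cobj_rm rhom_pr cdiff_zero)

lemma csum_retract:
  assumes X: "is_complex X" and Y: "is_complex Y"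
  shows "K_retract X (csum X Y)" "K_retract Y (csum X Y)"
proof -
  note m = csum_incl_proj[OF X Y]
  show "K_retract X (csum X Y)" unfolding K_retract_def
    using m(1,3,5) homotopic_refl[OF X X chom_id] csum_complex[OF X Y] X by (metis)
  show "K_retract Y (csum X Y)" unfolding K_retract_def
    using m(2,4,6) homotopic_refl[OF Y Y chom_id] csum_complex[OF X Y] Y by (metis)
qed

lemma hom_vanishE:
  assumes "hom_vanish X M j" "f \<in> rhom (cobj X j) M"
    and "\<And>x. x \<in> carrier (cobj X (j - 1)) \<Longrightarrow> f (cdiff X (j - 1) x) = \<zero>\<^bsub>M\<^esub>"
  obtains g where "g \<in> rhom (cobj X (j + 1)) M" "\<And>x. x \<in> carrier (cobj X j) \<Longrightarrow> f x = g (cdiff X j x)"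
  using assms unfolding hom_vanish_def by blast

text \<open>Up to homotopy \<open>f\<close> equals \<open>f q p\<close>.  The map \<open>f q\<close> factors through the differential of \<open>Y\<close>, and of the
  homotopy only a part that factors through the differential of \<open>X\<close> survives under \<open>f\<close>.\<close>

lemma hom_vanish_retract:
  assumes r: "K_retract X Y" and M: "right_module M" and v: "hom_vanish Y M j"
  shows "hom_vanish X M j"
proof -
  obtain p q k where X: "is_complex X" and Y: "is_complex Y" and p: "p \<in> chom X Y" and q: "q \<in> chom Y X"
    and H: "homotopy X X k id_map (q \<circ>\<^sub>c p)" by (rule K_retractE[OF r])
  note k = homotopyD(1)[OF H X X] and kc = homotopyD(2)[OF H X X] and kd = homotopyD(3)[OF H X X]
    and ke = homotopyD(4)[OF H X X] and eq = homotopyD(5)[OF H X X, unfolded id_map_apply comp_map_apply]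
  show ?thesis unfolding hom_vanish_def
  proof (intro ballI impI)
    fix f assume f: "f \<in> rhom (cobj X j) M"
      and d: "\<forall>x\<in>carrier (cobj X (j - 1)). f (cdiff X (j - 1) x) = \<zero>\<^bsub>M\<^esub>"
    have dq: "f (q j (cdiff Y (j - 1) y)) = \<zero>\<^bsub>M\<^esub>" if "y \<in> carrier (cobj Y (j - 1))" for y
      using d that by (auto simp: chom_d'[OF q] chom_closed[OF q])
    have fq: "(\<lambda>y. f (q j y)) \<in> rhom (cobj Y j) M" by (rule rhom_comp[OF chom_rhom[OF q] f])
    obtain g where g: "g \<in> rhom (cobj Y (j + 1)) M"
      "\<And>y. y \<in> carrier (cobj Y j) \<Longrightarrow> f (q j y) = g (cdiff Y j y)"
      using hom_vanishE[OF v fq dq] by blast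
    have kj: "k (j + 1) \<in> rhom (cobj X (j + 1)) (cobj X j)" using k[of "j + 1"] by simp
    show "\<exists>g\<in>rhom (cobj X (j + 1)) M. \<forall>x\<in>carrier (cobj X j). f x = g (cdiff X j x)"
    proof (intro bexI ballI)
      show "(\<lambda>y. f (k (j + 1) y) \<oplus>\<^bsub>M\<^esub> g (p (j + 1) y)) \<in> rhom (cobj X (j + 1)) M"
        by (rule rhom_add_fun[OF M rhom_comp[OF kj f] rhom_comp[OF chom_rhom[OF p] g(1)]])
      fix x assume x: "x \<in> carrier (cobj X j)"
      note c = kc[OF x] kd[OF x] ke[OF x] chom_closed[OF p x] chom_closed[OF q chom_closed[OF p x]]
      have fc: "f (k (j + 1) (cdiff X j x)) \<in> carrier M" "f (q j (p j x)) \<in> carrier M"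
        using c by (auto simp: rhom_closed[OF f])
      have "f x = f (cdiff X (j - 1) (k j x) \<oplus>\<^bsub>cobj X j\<^esub> k (j + 1) (cdiff X j x) \<oplus>\<^bsub>cobj X j\<^esub> q j (p j x))"
        using eq[OF x] by simp
      also have "\<dots> = f (k (j + 1) (cdiff X j x)) \<oplus>\<^bsub>M\<^esub> f (q j (p j x))"
        using c d fc by (simp add: rhom_add[OF f] ag_closed cobj_rm[OF X] ag_simps M)
      finally show "f x = f (k (j + 1) (cdiff X j x)) \<oplus>\<^bsub>M\<^esub> g (p (j + 1) (cdiff X j x))"
        using c by (simp add: g(2) chom_d[OF p x])
    qed
  qed
qed

lemma hom_vanish_csum:
  assumes X: "is_complex X" and Y: "is_complex Y" and M: "right_module M"
    and v: "hom_vanish X M j" "hom_vanish Y M j"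
  shows "hom_vanish (csum X Y) M j"
  unfolding hom_vanish_def
proof (intro ballI impI)
  note rX = cobj_rm[OF X] and rY = cobj_rm[OF Y]
  fix f assume f: "f \<in> rhom (cobj (csum X Y) j) M"
    and d: "\<forall>x\<in>carrier (cobj (csum X Y) (j - 1)). f (cdiff (csum X Y) (j - 1) x) = \<zero>\<^bsub>M\<^esub>"
  have f': "f \<in> rhom (dsum (cobj X j) (cobj Y j)) M" using f by simp
  have zX: "cdiff X (j - 1) \<zero>\<^bsub>cobj X (j - 1)\<^esub> = \<zero>\<^bsub>cobj X j\<^esub>"
    and zY: "cdiff Y (j - 1) \<zero>\<^bsub>cobj Y (j - 1)\<^esub> = \<zero>\<^bsub>cobj Y j\<^esub>"
    using cdiff_zero[OF X, of "j - 1"] cdiff_zero[OF Y, of "j - 1"] by simp_all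
  have d1: "f (pair (cdiff X (j - 1) x) \<zero>\<^bsub>cobj Y j\<^esub>) = \<zero>\<^bsub>M\<^esub>" if "x \<in> carrier (cobj X (j - 1))" for x
    using d[THEN bspec, of "pair x \<zero>\<^bsub>cobj Y (j - 1)\<^esub>"] that by (simp add: ag_closed rY zY)
  obtain g where g: "g \<in> rhom (cobj X (j + 1)) M"
    "\<And>x. x \<in> carrier (cobj X j) \<Longrightarrow> f (pair x \<zero>\<^bsub>cobj Y j\<^esub>) = g (cdiff X j x)"
    using hom_vanishE[OF v(1) rhom_comp[OF rhom_in(1)[OF rX rY] f'] d1] by blast
  have d2: "f (pair \<zero>\<^bsub>cobj X j\<^esub> (cdiff Y (j - 1) y)) = \<zero>\<^bsub>M\<^esub>" if "y \<in> carrier (cobj Y (j - 1))" for y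
    using d[THEN bspec, of "pair \<zero>\<^bsub>cobj X (j - 1)\<^esub> y"] that by (simp add: ag_closed rX zX)
  obtain h where h: "h \<in> rhom (cobj Y (j + 1)) M"
    "\<And>y. y \<in> carrier (cobj Y j) \<Longrightarrow> f (pair \<zero>\<^bsub>cobj X j\<^esub> y) = h (cdiff Y j y)"
    using hom_vanishE[OF v(2) rhom_comp[OF rhom_in(2)[OF rX rY] f'] d2] by blast
  show "\<exists>g\<in>rhom (cobj (csum X Y) (j + 1)) M. \<forall>x\<in>carrier (cobj (csum X Y) j). f x = g (cdiff (csum X Y) j x)"
  proof (intro bexI ballI)
    show "(\<lambda>z. g (pr1 z) \<oplus>\<^bsub>M\<^esub> h (pr2 z)) \<in> rhom (cobj (csum X Y) (j + 1)) M"
      using rhom_copair[OF M g(1) h(1)] by simp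
    fix z assume z: "z \<in> carrier (cobj (csum X Y) j)"
    have "f z = f (pair (pr1 z) \<zero>\<^bsub>cobj Y j\<^esub> \<oplus>\<^bsub>dsum (cobj X j) (cobj Y j)\<^esub> pair \<zero>\<^bsub>cobj X j\<^esub> (pr2 z))"
      using z by (simp add: ag_simps rX rY)
    also have "\<dots> = f (pair (pr1 z) \<zero>\<^bsub>cobj Y j\<^esub>) \<oplus>\<^bsub>M\<^esub> f (pair \<zero>\<^bsub>cobj X j\<^esub> (pr2 z))"
      by (rule rhom_add[OF f']) (use z in \<open>auto simp: ag_closed rX rY\<close>)
    also have "\<dots> = g (cdiff X j (pr1 z)) \<oplus>\<^bsub>M\<^esub> h (cdiff Y j (pr2 z))" using z by (simp add: g(2) h(2))
    finally show "f z = g (pr1 (cdiff (csum X Y) j z)) \<oplus>\<^bsub>M\<^esub> h (pr2 (cdiff (csum X Y) j z))" by simp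
  qed
qed

lemma summand_retract:
  assumes "summand X Y" "is_complex Y"
  obtains Z where "is_complex X" "is_complex Z" "K_retract X (csum X Z)" "K_retract (csum X Z) Y"
proof -
  from assms obtain Z where Z: "X \<in> Kb_proj" "Z \<in> Kb_proj" "csum X Z \<simeq>\<^sub>K Y" by (auto simp: summand_def)
  note c = Kb_projD(2)[OF Z(1)] Kb_projD(2)[OF Z(2)]
  show ?thesis
    by (rule that[OF c csum_retract(1)[OF c] K_isomorphic_retract(1)[OF Z(3) csum_complex[OF c] assms(2)]])
qed

lemma hom_vanish_summand:
  assumes "summand X Y" "is_complex Y" "right_module M" "hom_vanish Y M j"
  shows "hom_vanish X M j"
  by (rule summand_retract[OF assms(1,2)]) (use hom_vanish_retract assms(3,4) in blast)

lemma csum_list_replicate_complex: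
  assumes "is_complex Y" shows "is_complex (csum_list (replicate n Y))"
  by (induction n) (auto simp: csum_list_def csum_complex assms Kb_projD(2)[OF zero_cpx_Kb_proj])

lemma hom_vanish_add_cat:
  assumes X: "X \<in> add_cat Y" and Y: "is_complex Y" and M: "right_module M" and v: "hom_vanish Y M j"
  shows "hom_vanish X M j"
proof -
  have z: "is_complex zero_cpx" by (rule Kb_projD(2)[OF zero_cpx_Kb_proj])
  obtain n where n: "summand X (csum_list (replicate n Y))" using X by (auto simp: add_cat_def)
  have "hom_vanish (csum_list (replicate n Y)) M j"
  proof (induction n)
    case 0
    have "zero_at zero_cpx j" by (simp add: zero_at_def)
    thus ?case using hom_vanish_zero_at[OF z M] by (simp add: csum_list_def)
  next
    case (Suc n)
    thus ?case using hom_vanish_csum[OF Y csum_list_replicate_complex[OF Y] M v]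
      by (simp add: csum_list_def)
  qed
  thus ?thesis by (rule hom_vanish_summand[OF n csum_list_replicate_complex[OF Y] M])
qed

lemma K_isomorphic_refl: "is_complex X \<Longrightarrow> X \<simeq>\<^sub>K X"
  unfolding K_isomorphic_def K_iso_def
  by (intro exI[of _ id_map] conjI chom_id bexI[of _ id_map]) (auto intro: homotopic_refl chom_id)

lemma self_in_add_cat:
  assumes X: "X \<in> Kb_proj" shows "X \<in> add_cat X"
proof -
  have "csum_list (replicate 1 X) = csum X zero_cpx" by (simp add: csum_list_def)
  moreover have "csum X zero_cpx \<simeq>\<^sub>K csum X zero_cpx"
    by (rule K_isomorphic_refl[OF csum_complex[OF Kb_projD(2)[OF X] Kb_projD(2)[OF zero_cpx_Kb_proj]]])
  ultimately have "summand X (csum_list (replicate 1 X))" unfolding summand_def using X zero_cpx_Kb_proj by auto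
  thus ?thesis unfolding add_cat_def by blast
qed

section \<open>Complexes split in degree 1\<close>

text \<open>The identity is null-homotopic in degree 1.  This weakens $X^1 = 0$ to a condition that is
  inherited by homotopy retracts: summands of a two-term complex are two-term only up to homotopy.\<close>

definition splits_at_1 :: "('a::{ring,monoid_mult}) cpx \<Rightarrow> bool" where
  "splits_at_1 X \<longleftrightarrow> (\<exists>h\<in>rhom (cobj X 1) (cobj X 0). \<exists>h'\<in>rhom (cobj X 2) (cobj X 1).
     \<forall>x\<in>carrier (cobj X 1). x = cdiff X 0 (h x) \<oplus>\<^bsub>cobj X 1\<^esub> h' (cdiff X 1 x))"

lemma splits_at_1_two_term:
  assumes X: "is_complex X" and t: "two_term X" shows "splits_at_1 X"
proof -
  have z: "zero_at X 1" using t by (simp add: two_term_def)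
  show ?thesis unfolding splits_at_1_def
    using z cdiff_zero[OF X, of 0]
    by (intro bexI[of _ "\<lambda>_. \<zero>\<^bsub>cobj X 0\<^esub>"] bexI[of _ "\<lambda>_. \<zero>\<^bsub>cobj X 1\<^esub>"] rhom_zero_fun cobj_rm X)
      (auto simp: zero_at_def ag_simps ag_closed cobj_rm[OF X])
qed

lemma splits_at_1_retract:
  assumes r: "K_retract X Y" and s: "splits_at_1 Y"
  shows "splits_at_1 X"
proof -
  obtain p q k where X: "is_complex X" and Y: "is_complex Y" and p: "p \<in> chom X Y" and q: "q \<in> chom Y X"
    and H: "homotopy X X k id_map (q \<circ>\<^sub>c p)" by (rule K_retractE[OF r])
  note k = homotopyD(1)[OF H X X] and kc = homotopyD(2)[OF H X X] and kd = homotopyD(3)[OF H X X]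
    and ke = homotopyD(4)[OF H X X] and eq = homotopyD(5)[OF H X X, unfolded id_map_apply comp_map_apply]
  obtain h h' where h: "h \<in> rhom (cobj Y 1) (cobj Y 0)" and h': "h' \<in> rhom (cobj Y 2) (cobj Y 1)"
    and he: "\<And>y. y \<in> carrier (cobj Y 1) \<Longrightarrow> y = cdiff Y 0 (h y) \<oplus>\<^bsub>cobj Y 1\<^esub> h' (cdiff Y 1 y)"
    using s unfolding splits_at_1_def by blast
  note rX = cobj_rm[OF X] and rY = cobj_rm[OF Y]
  have k1: "k 1 \<in> rhom (cobj X 1) (cobj X 0)" and k2: "k 2 \<in> rhom (cobj X 2) (cobj X 1)"
    using k[of 1] k[of 2] by simp_all
  show ?thesis unfolding splits_at_1_def
  proof (intro bexI ballI)
    show "(\<lambda>x. k 1 x \<oplus>\<^bsub>cobj X 0\<^esub> q 0 (h (p 1 x))) \<in> rhom (cobj X 1) (cobj X 0)"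
      by (rule rhom_add_fun[OF rX k1 rhom_comp[OF rhom_comp[OF chom_rhom[OF p] h] chom_rhom[OF q]]])
    show "(\<lambda>x. k 2 x \<oplus>\<^bsub>cobj X 1\<^esub> q 1 (h' (p 2 x))) \<in> rhom (cobj X 2) (cobj X 1)"
      by (rule rhom_add_fun[OF rX k2 rhom_comp[OF rhom_comp[OF chom_rhom[OF p] h'] chom_rhom[OF q]]])
    fix x assume x: "x \<in> carrier (cobj X 1)"
    have px: "p 1 x \<in> carrier (cobj Y 1)" by (rule chom_closed[OF p x])
    have dpx: "cdiff Y 1 (p 1 x) \<in> carrier (cobj Y 2)" using cdiff_closed[OF Y px] by simp
    have dx: "cdiff X 1 x \<in> carrier (cobj X 2)" using cdiff_closed[OF X x] by simp
    note c = rhom_closed[OF h px] rhom_closed[OF h' dpx] rhom_closed[OF k1 x] rhom_closed[OF k2 dx]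
    note c' = cdiff_closed[OF Y c(1)] chom_closed[OF q c(1)] chom_closed[OF q c(2)] cdiff_closed[OF X c(3)]
      cdiff_closed[OF X chom_closed[OF q c(1)]]
    have pd: "p 2 (cdiff X 1 x) = cdiff Y 1 (p 1 x)" using chom_d[OF p x] by simp
    have "q 1 (p 1 x) = q 1 (cdiff Y 0 (h (p 1 x)) \<oplus>\<^bsub>cobj Y 1\<^esub> h' (cdiff Y 1 (p 1 x)))" using he[OF px] by simp
    also have "\<dots> = cdiff X 0 (q 0 (h (p 1 x))) \<oplus>\<^bsub>cobj X 1\<^esub> q 1 (h' (p 2 (cdiff X 1 x)))"
      using c c' chom_d[OF q c(1)] by (simp add: rhom_add[OF chom_rhom[OF q]] pd)
    finally have qp: "q 1 (p 1 x) = cdiff X 0 (q 0 (h (p 1 x))) \<oplus>\<^bsub>cobj X 1\<^esub> q 1 (h' (p 2 (cdiff X 1 x)))" .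
    have da: "cdiff X 0 (k 1 x \<oplus>\<^bsub>cobj X 0\<^esub> q 0 (h (p 1 x))) = cdiff X 0 (k 1 x) \<oplus>\<^bsub>cobj X 1\<^esub> cdiff X 0 (q 0 (h (p 1 x)))"
      using c c' rhom_add[OF cdiff_rhom[OF X], of "k 1 x" 0] by simp
    have "x = cdiff X 0 (k 1 x) \<oplus>\<^bsub>cobj X 1\<^esub> k 2 (cdiff X 1 x) \<oplus>\<^bsub>cobj X 1\<^esub> q 1 (p 1 x)" using eq[OF x] by simp
    also have "\<dots> = cdiff X 0 (k 1 x \<oplus>\<^bsub>cobj X 0\<^esub> q 0 (h (p 1 x))) \<oplus>\<^bsub>cobj X 1\<^esub>
        (k 2 (cdiff X 1 x) \<oplus>\<^bsub>cobj X 1\<^esub> q 1 (h' (p 2 (cdiff X 1 x))))"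
      unfolding da qp using c c' by (simp add: ag_ac ag_closed rX pd)
    finally show "x = cdiff X 0 (k 1 x \<oplus>\<^bsub>cobj X 0\<^esub> q 0 (h (p 1 x))) \<oplus>\<^bsub>cobj X 1\<^esub>
        (k 2 (cdiff X 1 x) \<oplus>\<^bsub>cobj X 1\<^esub> q 1 (h' (p 2 (cdiff X 1 x))))" .
  qed
qed

text \<open>So $x \mapsto x - h d x$ projects $X^0$ onto its cocycles.\<close>

lemma splits_at_1_cocycle_part:
  assumes X: "is_complex X" and s: "splits_at_1 X"
  obtains h where "h \<in> rhom (cobj X 1) (cobj X 0)"
    "\<And>x. x \<in> carrier (cobj X 0) \<Longrightarrow> x \<ominus>\<^bsub>cobj X 0\<^esub> h (cdiff X 0 x) \<in> cocycles 0 X"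
proof -
  obtain h h' where h: "h \<in> rhom (cobj X 1) (cobj X 0)" and h': "h' \<in> rhom (cobj X 2) (cobj X 1)"
    and he: "\<And>x. x \<in> carrier (cobj X 1) \<Longrightarrow> x = cdiff X 0 (h x) \<oplus>\<^bsub>cobj X 1\<^esub> h' (cdiff X 1 x)"
    using s unfolding splits_at_1_def by blast
  note rX = cobj_rm[OF X]
  show ?thesis
  proof (rule that[OF h])
    fix x assume x: "x \<in> carrier (cobj X 0)"
    have dx: "cdiff X 0 x \<in> carrier (cobj X 1)" using cdiff_closed[OF X x] by simp
    note hdx = rhom_closed[OF h dx]
    have dhdx: "cdiff X 0 (h (cdiff X 0 x)) \<in> carrier (cobj X 1)" using cdiff_closed[OF X hdx] by simp
    have "h' (cdiff X 1 (cdiff X 0 x)) = \<zero>\<^bsub>cobj X 1\<^esub>"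
      using cdiff_cdiff[OF X x] rhom_zero[OF rX rX h'] by simp
    hence "cdiff X 0 x = cdiff X 0 (h (cdiff X 0 x))" using he[OF dx] dhdx by (simp add: ag_simps rX)
    hence "cdiff X 0 (x \<ominus>\<^bsub>cobj X 0\<^esub> h (cdiff X 0 x)) = \<zero>\<^bsub>cobj X 1\<^esub>"
      using rhom_minus[OF rX rX cdiff_rhom[OF X] x hdx] ag_minus_self[OF rX dx] by simp
    thus "x \<ominus>\<^bsub>cobj X 0\<^esub> h (cdiff X 0 x) \<in> cocycles 0 X" using x hdx by (simp add: cocycles_def ag_closed rX)
  qed
qed

lemma hom_vanish_0_iff:
  assumes X: "is_complex X" and s: "splits_at_1 X" and M: "right_module M"
  shows "hom_vanish X M 0 \<longleftrightarrow> (\<forall>f\<in>rhom (cobj X 0) M.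
    (\<forall>x\<in>coboundaries 0 X. f x = \<zero>\<^bsub>M\<^esub>) \<longrightarrow> (\<forall>x\<in>cocycles 0 X. f x = \<zero>\<^bsub>M\<^esub>))"
proof -
  note rX = cobj_rm[OF X]
  have cb: "(\<forall>x\<in>coboundaries 0 X. f x = \<zero>\<^bsub>M\<^esub>) \<longleftrightarrow> (\<forall>x\<in>carrier (cobj X (0 - 1)). f (cdiff X (0 - 1) x) = \<zero>\<^bsub>M\<^esub>)" for f
    by (auto simp: coboundaries_def)
  obtain h where h: "h \<in> rhom (cobj X 1) (cobj X 0)"
    and hz: "\<And>x. x \<in> carrier (cobj X 0) \<Longrightarrow> x \<ominus>\<^bsub>cobj X 0\<^esub> h (cdiff X 0 x) \<in> cocycles 0 X"
    using splits_at_1_cocycle_part[OF X s] by blast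
  have "(\<exists>g\<in>rhom (cobj X (0 + 1)) M. \<forall>x\<in>carrier (cobj X 0). f x = g (cdiff X 0 x)) \<longleftrightarrow> (\<forall>x\<in>cocycles 0 X. f x = \<zero>\<^bsub>M\<^esub>)"
    if f: "f \<in> rhom (cobj X 0) M" for f
  proof
    assume "\<exists>g\<in>rhom (cobj X (0 + 1)) M. \<forall>x\<in>carrier (cobj X 0). f x = g (cdiff X 0 x)"
    then obtain g where g: "g \<in> rhom (cobj X 1) M" "\<forall>x\<in>carrier (cobj X 0). f x = g (cdiff X 0 x)" by auto
    thus "\<forall>x\<in>cocycles 0 X. f x = \<zero>\<^bsub>M\<^esub>" using rhom_zero[OF rX M g(1)] by (auto simp: cocycles_def)
  next
    assume z: "\<forall>x\<in>cocycles 0 X. f x = \<zero>\<^bsub>M\<^esub>"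
    show "\<exists>g\<in>rhom (cobj X (0 + 1)) M. \<forall>x\<in>carrier (cobj X 0). f x = g (cdiff X 0 x)"
    proof (intro bexI ballI)
      show "(\<lambda>y. f (h y)) \<in> rhom (cobj X (0 + 1)) M" using rhom_comp[OF h f] by simp
      fix x assume x: "x \<in> carrier (cobj X 0)"
      have hdx: "h (cdiff X 0 x) \<in> carrier (cobj X 0)" using rhom_closed[OF h] cdiff_closed[OF X x] by simp
      have "f x \<ominus>\<^bsub>M\<^esub> f (h (cdiff X 0 x)) = \<zero>\<^bsub>M\<^esub>"
        using z hz[OF x] rhom_minus[OF rX M f x hdx] by simp
      thus "f x = f (h (cdiff X 0 x))"
        by (rule ag_eq_if_minus_zero[OF M rhom_closed[OF f x] rhom_closed[OF f hdx]])
    qed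
  qed
  thus ?thesis unfolding hom_vanish_def cb[symmetric] by blast
qed

text \<open>Left exactness of $\mathrm{Hom}(X, -)$ on modules: by \<open>hom_vanish_0_iff\<close> vanishing means that
  maps are zero on cocycles, and a map into the submodule has the same values in \<open>M\<close>.\<close>

lemma hom_vanish_0_sub:
  assumes X: "is_complex X" and s: "splits_at_1 X" and M: "right_module M" and L: "rsubmodule L M"
    and v: "hom_vanish X M 0"
  shows "hom_vanish X (M\<lparr>carrier := L\<rparr>) 0"
proof -
  have r: "right_module (M\<lparr>carrier := L\<rparr>)" by (rule right_module.right_module_sub[OF M L])
  have "f \<in> rhom (cobj X 0) M" if "f \<in> rhom (cobj X 0) (M\<lparr>carrier := L\<rparr>)" for f
    by (rule rhom_from_sub[OF that right_module.rsubmoduleD(1)[OF M L]])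
  thus ?thesis using v unfolding hom_vanish_0_iff[OF X s M] hom_vanish_0_iff[OF X s r] by simp
qed

text \<open>Homomorphisms from $\mathrm{H}^0(X)$ to \<open>M\<close> are morphisms from \<open>X\<close> to \<open>M\<close>: they extend to $X^0$ along the projection
  onto the cocycles.\<close>

lemma perp_cohom_iff:
  assumes X: "is_complex X" and s: "splits_at_1 X" and M: "M \<in> mod_cat"
  shows "M \<in> perp (cohom 0 X) \<longleftrightarrow> hom_vanish X M 0"
proof -
  note rX = cobj_rm[OF X] and rM = mod_catD(1)[OF M]
  define Zm where "Zm = (cobj X 0)\<lparr>carrier := cocycles 0 X\<rparr>"
  have rZ: "right_module Zm" unfolding Zm_def by (rule right_module.right_module_sub[OF rX rsubmodule_cocycles[OF X]])
  interpret Z: right_module Zm by (rule rZ)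
  have Zs: "carrier Zm = cocycles 0 X" "add Zm = add (cobj X 0)" "smult Zm = smult (cobj X 0)" "\<zero>\<^bsub>Zm\<^esub> = \<zero>\<^bsub>cobj X 0\<^esub>"
    by (simp_all add: Zm_def)
  note b = right_module.rsubmoduleD[OF rX rsubmodule_coboundaries[OF X, of 0]]
  have B: "rsubmodule (coboundaries 0 X) Zm"
    by (rule Z.rsubmoduleI) (use b coboundaries_cocycles[OF X] in \<open>auto simp: Zs\<close>)
  have H: "cohom 0 X = quot_mod Zm (coboundaries 0 X)" by (simp add: cohom_def Zm_def)
  note q = Z.quot_simps[OF B] and pr = Z.quot_rhom[OF B]
  obtain h where h: "h \<in> rhom (cobj X 1) (cobj X 0)"
    and hz: "\<And>x. x \<in> carrier (cobj X 0) \<Longrightarrow> x \<ominus>\<^bsub>cobj X 0\<^esub> h (cdiff X 0 x) \<in> cocycles 0 X"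
    using splits_at_1_cocycle_part[OF X s] by blast
  have cz: "x \<in> carrier (cobj X 0)" if "x \<in> cocycles 0 X" for x using that by (simp add: cocycles_def)
  show ?thesis
  proof
    assume p: "M \<in> perp (cohom 0 X)"
    show "hom_vanish X M 0" unfolding hom_vanish_0_iff[OF X s rM]
    proof (intro ballI impI)
      fix f x assume f: "f \<in> rhom (cobj X 0) M" and fb: "\<forall>x\<in>coboundaries 0 X. f x = \<zero>\<^bsub>M\<^esub>"
        and x: "x \<in> cocycles 0 X"
      have fZ: "f \<in> rhom Zm M" unfolding Zm_def using cz by (intro rhom_restrict f) auto
      obtain g where g: "g \<in> rhom (cohom 0 X) M"
        "\<And>y. y \<in> carrier Zm \<Longrightarrow> g (coboundaries 0 X +>\<^bsub>Zm\<^esub> y) = f y"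
        unfolding H by (rule quot_rhom_factor[OF rZ B rM fZ]) (use fb in blast)+
      have "coboundaries 0 X +>\<^bsub>Zm\<^esub> x \<in> carrier (cohom 0 X)" unfolding H q(1) Zs using x by blast
      hence "g (coboundaries 0 X +>\<^bsub>Zm\<^esub> x) = \<zero>\<^bsub>M\<^esub>" using p g(1) unfolding perp_def by blast
      thus "f x = \<zero>\<^bsub>M\<^esub>" using g(2)[of x] x by (simp add: Zs)
    qed
  next
    assume v: "hom_vanish X M 0"
    have "g A = \<zero>\<^bsub>M\<^esub>" if g: "g \<in> rhom (cohom 0 X) M" and A: "A \<in> carrier (cohom 0 X)" for g A
    proof -
      obtain x where x: "x \<in> cocycles 0 X" "A = coboundaries 0 X +>\<^bsub>Zm\<^esub> x" using A unfolding H q(1) Zs by blast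
      define f where "f y = g (coboundaries 0 X +>\<^bsub>Zm\<^esub> (y \<ominus>\<^bsub>cobj X 0\<^esub> h (cdiff X 0 y)))" for y
      have g0: "(\<lambda>y. g (coboundaries 0 X +>\<^bsub>Zm\<^esub> y)) \<in> rhom Zm M"
        by (rule rhom_comp[OF pr g[unfolded H]])
      have hd: "(\<lambda>y. h (cdiff X 0 y)) \<in> rhom (cobj X 0) (cobj X 0)"
        using rhom_comp[OF cdiff_rhom[OF X, of 0]] h by simp
      have "(\<lambda>y. y \<ominus>\<^bsub>cobj X 0\<^esub> h (cdiff X 0 y)) \<in> rhom (cobj X 0) Zm"
        unfolding Zm_def by (rule rhom_into_sub[OF rhom_minus_fun[OF rX rhom_id hd] hz])
      hence f: "f \<in> rhom (cobj X 0) M" unfolding f_def by (rule rhom_comp[OF _ g0])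
      have fz: "f y = g (coboundaries 0 X +>\<^bsub>Zm\<^esub> y)" if y: "y \<in> cocycles 0 X" for y
      proof -
        have "h (cdiff X 0 y) = \<zero>\<^bsub>cobj X 0\<^esub>" using y rhom_zero[OF rX rX h] by (simp add: cocycles_def)
        thus ?thesis using cz[OF y] by (simp add: f_def ag_minus_zero rX)
      qed
      have "f y = \<zero>\<^bsub>M\<^esub>" if y: "y \<in> coboundaries 0 X" for y
      proof -
        have yz: "y \<in> cocycles 0 X" using y coboundaries_cocycles[OF X] by blast
        have "coboundaries 0 X +>\<^bsub>Zm\<^esub> y = coboundaries 0 X +>\<^bsub>Zm\<^esub> \<zero>\<^bsub>Zm\<^esub>"
          using y yz Z.a_coset_eq_iff[OF B, of y "\<zero>\<^bsub>Zm\<^esub>"] ag_minus_zero[OF rZ, of y] by (simp add: Zs Z.zero_closed[unfolded Zs])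
        thus ?thesis using fz[OF yz] rhom_zero[OF rZ rM g0] by simp
      qed
      hence "f x = \<zero>\<^bsub>M\<^esub>" using v f x unfolding hom_vanish_0_iff[OF X s rM] by blast
      thus ?thesis using fz[OF x(1)] x(2) by simp
    qed
    thus "M \<in> perp (cohom 0 X)" using M by (auto simp: perp_def)
  qed
qed

section \<open>Vanishing along a triangle\<close>

text \<open>Exactness of $\mathrm{Hom}(Y, M) \to \mathrm{Hom}(X, M) \to \mathrm{Hom}(C, M[1])$ for the cone \<open>C\<close> of \<open>f\<close>.  A map \<open>\<phi>\<close> on $X^0$,
  composed with the projection of $C^{-1}$, becomes a boundary \<open>\<psi> d\<close>; the restriction of \<open>\<psi>\<close> to $Y^0$ is
  a morphism from \<open>Y\<close> to \<open>M\<close>, hence factors through the differential, and together they express \<open>\<phi>\<close>.\<close>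

lemma hom_vanish_cone:
  assumes X: "is_complex X" and Y: "is_complex Y" and f: "f \<in> chom X Y" and M: "right_module M"
    and vY: "hom_vanish Y M 0" and vC: "hom_vanish (cone X Y f) M (- 1)"
  shows "hom_vanish X M 0"
  unfolding hom_vanish_def
proof (intro ballI impI)
  note rX = cobj_rm[OF X] and rY = cobj_rm[OF Y]
  fix \<phi> assume \<phi>: "\<phi> \<in> rhom (cobj X 0) M"
    and d: "\<forall>x\<in>carrier (cobj X (0 - 1)). \<phi> (cdiff X (0 - 1) x) = \<zero>\<^bsub>M\<^esub>"
  have C1: "cobj (cone X Y f) (- 1) = dsum (cobj X 0) (cobj Y (- 1))"
    and C0: "cobj (cone X Y f) (- 1 + 1) = dsum (cobj X 1) (cobj Y 0)"
    and C2: "cobj (cone X Y f) (- 1 - 1) = dsum (cobj X (- 1)) (cobj Y (- 2))" by simp_all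
  have d1: "cdiff (cone X Y f) (- 1) z = pair (\<ominus>\<^bsub>cobj X 1\<^esub> cdiff X 0 (pr1 z)) (f 0 (pr1 z) \<oplus>\<^bsub>cobj Y 0\<^esub> cdiff Y (- 1) (pr2 z))"
    and d2: "pr1 (cdiff (cone X Y f) (- 1 - 1) z) = \<ominus>\<^bsub>cobj X 0\<^esub> cdiff X (- 1) (pr1 z)" for z
    by simp_all
  have \<phi>C: "(\<lambda>z. \<phi> (pr1 z)) \<in> rhom (cobj (cone X Y f) (- 1)) M"
    unfolding C1 by (rule rhom_comp[OF rhom_pr(1) \<phi>])
  have \<phi>d: "\<phi> (pr1 (cdiff (cone X Y f) (- 1 - 1) z)) = \<zero>\<^bsub>M\<^esub>" if zc: "z \<in> carrier (cobj (cone X Y f) (- 1 - 1))" for z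
  proof -
    from zc have z: "pr1 z \<in> carrier (cobj X (- 1))" unfolding C2 by simp
    have "\<phi> (\<ominus>\<^bsub>cobj X 0\<^esub> cdiff X (- 1) (pr1 z)) = \<ominus>\<^bsub>M\<^esub> \<phi> (cdiff X (- 1) (pr1 z))"
      using cdiff_closed[OF X z] by (intro rhom_neg[OF rX M \<phi>]) simp
    thus ?thesis
      unfolding d2 using d z by (simp add: ag_simps M)
  qed
  obtain \<psi> where \<psi>: "\<psi> \<in> rhom (cobj (cone X Y f) (- 1 + 1)) M"
    and e: "\<And>z. z \<in> carrier (cobj (cone X Y f) (- 1)) \<Longrightarrow> \<phi> (pr1 z) = \<psi> (cdiff (cone X Y f) (- 1) z)"
    using hom_vanishE[OF vC \<phi>C \<phi>d] by blast
  note \<psi>' = \<psi>[unfolded C0]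
  have \<psi>Y: "(\<lambda>y. \<psi> (pair \<zero>\<^bsub>cobj X 1\<^esub> y)) \<in> rhom (cobj Y 0) M" by (rule rhom_comp[OF rhom_in(2)[OF rX rY] \<psi>'])
  have \<psi>d: "\<psi> (pair \<zero>\<^bsub>cobj X 1\<^esub> (cdiff Y (0 - 1) y)) = \<zero>\<^bsub>M\<^esub>" if y: "y \<in> carrier (cobj Y (0 - 1))" for y
  proof -
    have "\<phi> \<zero>\<^bsub>cobj X 0\<^esub> = \<psi> (cdiff (cone X Y f) (- 1) (pair \<zero>\<^bsub>cobj X 0\<^esub> y))"
      using e[of "pair \<zero>\<^bsub>cobj X 0\<^esub> y"] y by (simp add: ag_closed rX)
    thus ?thesis
      unfolding d1 using y cdiff_zero[OF X, of 0] rhom_zero[OF rX rY chom_rhom[OF f], of 0] rhom_zero[OF rX M \<phi>]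
        cdiff_closed[OF Y, of y "- 1"] by (simp add: ag_simps rX rY)
  qed
  obtain \<chi> where \<chi>: "\<chi> \<in> rhom (cobj Y (0 + 1)) M"
    "\<And>y. y \<in> carrier (cobj Y 0) \<Longrightarrow> \<psi> (pair \<zero>\<^bsub>cobj X 1\<^esub> y) = \<chi> (cdiff Y 0 y)"
    using hom_vanishE[OF vY \<psi>Y \<psi>d] by blast
  have \<chi>1: "\<chi> \<in> rhom (cobj Y 1) M" using \<chi>(1) by simp
  show "\<exists>g\<in>rhom (cobj X (0 + 1)) M. \<forall>x\<in>carrier (cobj X 0). \<phi> x = g (cdiff X 0 x)"
  proof (intro bexI ballI)
    let ?g = "\<lambda>x. \<psi> (pair (\<ominus>\<^bsub>cobj X 1\<^esub> x) \<zero>\<^bsub>cobj Y 0\<^esub>) \<oplus>\<^bsub>M\<^esub> \<chi> (f 1 x)"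
    have "?g \<in> rhom (cobj X 1) M"
      by (rule rhom_add_fun[OF M rhom_comp[OF rhom_comp[OF rhom_neg_fun[OF rX rhom_id] rhom_in(1)[OF rX rY]] \<psi>']
            rhom_comp[OF chom_rhom[OF f] \<chi>1]])
    thus "?g \<in> rhom (cobj X (0 + 1)) M" by simp
    fix x assume x: "x \<in> carrier (cobj X 0)"
    have dx: "cdiff X 0 x \<in> carrier (cobj X 1)" using cdiff_closed[OF X x] by simp
    note fx = chom_closed[OF f x]
    have dz: "cdiff Y (- 1) \<zero>\<^bsub>cobj Y (- 1)\<^esub> = \<zero>\<^bsub>cobj Y 0\<^esub>" using cdiff_zero[OF Y, of "- 1"] by simp
    have "\<phi> x = \<psi> (pair (\<ominus>\<^bsub>cobj X 1\<^esub> cdiff X 0 x) (f 0 x))"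
      using e[of "pair x \<zero>\<^bsub>cobj Y (- 1)\<^esub>"] x fx unfolding d1 by (simp add: dz ag_simps ag_closed rX rY)
    also have "\<dots> = \<psi> (pair (\<ominus>\<^bsub>cobj X 1\<^esub> cdiff X 0 x) \<zero>\<^bsub>cobj Y 0\<^esub> \<oplus>\<^bsub>dsum (cobj X 1) (cobj Y 0)\<^esub> pair \<zero>\<^bsub>cobj X 1\<^esub> (f 0 x))"
      using dx fx by (simp add: ag_simps ag_closed rX rY)
    also have "\<dots> = \<psi> (pair (\<ominus>\<^bsub>cobj X 1\<^esub> cdiff X 0 x) \<zero>\<^bsub>cobj Y 0\<^esub>) \<oplus>\<^bsub>M\<^esub> \<psi> (pair \<zero>\<^bsub>cobj X 1\<^esub> (f 0 x))"
      by (rule rhom_add[OF \<psi>']) (use dx fx in \<open>auto simp: ag_closed rX rY\<close>)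
    also have "\<psi> (pair \<zero>\<^bsub>cobj X 1\<^esub> (f 0 x)) = \<chi> (f 1 (cdiff X 0 x))"
      using \<chi>(2)[OF fx] chom_d[OF f x] by simp
    finally show "\<phi> x = ?g (cdiff X 0 x)" .
  qed
qed

text \<open>An element \<open>x\<close> of \<open>M\<close> is the value at 1 of the homomorphism \<open>r \<mapsto> x \<cdot> r\<close> from the regular module.\<close>

lemma hom_vanish_regular:
  assumes R: "is_complex (stalk (regular :: ('a::{ring,monoid_mult}) obj))" and M: "right_module (M :: 'a obj)"
    and v: "hom_vanish (stalk regular) M 0"
  shows "carrier M = {\<zero>\<^bsub>M\<^esub>}"
proof -
  interpret M: right_module M by (rule M)
  have "x = \<zero>\<^bsub>M\<^esub>" if x: "x \<in> carrier M" for x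
  proof -
    have f: "(\<lambda>r. r 0 \<odot>\<^bsub>M\<^esub> x) \<in> rhom regular M"
      by (rule rhomI) (auto simp: regular_def x M.act_closed M.add_act M.mult_act)
    have d: "cdiff (stalk regular) (0 - 1) r 0 \<odot>\<^bsub>M\<^esub> x = \<zero>\<^bsub>M\<^esub>" for r
      using x by (simp add: regular_def M.zero_act)
    have f': "(\<lambda>r. r 0 \<odot>\<^bsub>M\<^esub> x) \<in> rhom (cobj (stalk regular) 0) M" using f by simp
    obtain g where g: "g \<in> rhom (cobj (stalk regular) (0 + 1)) M"
      "\<And>r. r \<in> carrier (cobj (stalk regular) 0) \<Longrightarrow> r 0 \<odot>\<^bsub>M\<^esub> x = g (cdiff (stalk regular) 0 r)"
      using hom_vanishE[OF v f' d] by blast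
    define u :: "nat \<Rightarrow> 'a" where "u n = (if n = 0 then 1 else 0)" for n
    have "u \<in> carrier (cobj (stalk regular) 0)" by (simp add: regular_def u_def)
    from g(2)[OF this] have "x = g (cdiff (stalk regular) 0 u)" using x by (simp add: u_def M.one_act)
    also have "\<dots> = g \<zero>\<^bsub>cobj (stalk regular) (0 + 1)\<^esub>" by simp
    also have "\<dots> = \<zero>\<^bsub>M\<^esub>" by (rule rhom_zero[OF cobj_rm[OF R] M g(1)])
    finally show ?thesis .
  qed
  thus ?thesis by auto
qed

section \<open>The trace of the zeroth cohomology\<close>

text \<open>Finite sums of images of homomorphisms $T^0 \to M$ that kill the coboundaries.  For a two-term \<open>T\<close> these are
  the images in \<open>M\<close> of powers of $\mathrm{H}^0(T)$; the largest of them is the trace of $\mathrm{H}^0(T)$ in \<open>M\<close>.\<close>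

inductive trace_sub :: "('a::{ring,monoid_mult}) cpx \<Rightarrow> 'a obj \<Rightarrow> (nat \<Rightarrow> 'a) set \<Rightarrow> bool" for T M where
  zero: "trace_sub T M {\<zero>\<^bsub>M\<^esub>}"
| step: "\<lbrakk>trace_sub T M L; g \<in> rhom (cobj T 0) M; \<forall>x\<in>carrier (cobj T (- 1)). g (cdiff T (- 1) x) = \<zero>\<^bsub>M\<^esub>\<rbrakk> \<Longrightarrow>
    trace_sub T M {x \<oplus>\<^bsub>M\<^esub> y | x y. x \<in> L \<and> y \<in> g ` carrier (cobj T 0)}"

lemma trace_sub_rsubmodule:
  assumes "trace_sub T M L" and T: "is_complex T" and M: "right_module M"
  shows "rsubmodule L M"
  using assms(1)
proof induction
  case zero
  show ?case by (rule right_module.rsubmodule_zero[OF M])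
next
  case (step L g)
  have "rsubmodule (g ` carrier (cobj T 0)) M"
    by (rule rsubmodule_image[OF cobj_rm[OF T] M step(2) right_module.rsubmodule_carrier[OF cobj_rm[OF T]]])
  thus ?case by (rule rsubmodule_sum[OF M step.IH])
qed

text \<open>Since \<open>T\<close> is two-term, \<open>f\<close> alone is a chain map from \<open>T\<close> to $T[1]$.  The sign is that of the differential of
  $T[1]$.\<close>

lemma presilting_degree_1:
  assumes T: "presilting T" and t: "two_term T" and f: "f \<in> rhom (cobj T (- 1)) (cobj T 0)"
  obtains h h' where "h \<in> rhom (cobj T 0) (cobj T 0)" "h' \<in> rhom (cobj T (- 1)) (cobj T (- 1))"
    "\<And>x. x \<in> carrier (cobj T (- 1)) \<Longrightarrow>
      f x = \<ominus>\<^bsub>cobj T 0\<^esub> cdiff T (- 1) (h' x) \<oplus>\<^bsub>cobj T 0\<^esub> h (cdiff T (- 1) x)"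
proof -
  have X: "T \<in> Kb_proj" using T by (simp add: presilting_def)
  have c: "is_complex T" by (rule Kb_projD(2)[OF X])
  note r = cobj_rm[OF c]
  have z1: "x = \<zero>\<^bsub>cobj T 1\<^esub>" if "x \<in> carrier (cobj T 1)" for x using t that by (auto simp: two_term_def zero_at_def)
  have z2: "x = \<zero>\<^bsub>cobj T (- 2)\<^esub>" if "x \<in> carrier (cobj T (- 2))" for x using t that by (auto simp: two_term_def zero_at_def)
  define F where "F = (\<lambda>n x. if n = - 1 then f x else \<zero>\<^bsub>cobj T (n + 1)\<^esub>)"
  have F: "F \<in> chom T (shift 1 T)"
  proof (rule chomI)
    show "F n \<in> rhom (cobj T n) (cobj (shift 1 T) n)" for n
      using f by (cases "n = - 1") (auto simp: F_def rhom_zero_fun r)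
    fix n x assume x: "x \<in> carrier (cobj T n)"
    have Fc: "F n x \<in> carrier (cobj T (n + 1))" using rhom_closed[OF f] x by (auto simp: F_def ag_closed r)
    consider "n = - 1" | "n = - 2" | "n \<noteq> - 1" "n \<noteq> - 2" by blast
    thus "F (n + 1) (cdiff T n x) = cdiff (shift 1 T) n (F n x)"
    proof cases
      case 1
      have "cdiff T 0 (f x) = \<zero>\<^bsub>cobj T 1\<^esub>" using z1 cdiff_closed[OF c rhom_closed[OF f]] x 1 by simp
      thus ?thesis using 1 by (simp add: F_def ag_simps r)
    next
      case 2
      have "cdiff T (- 2) x = \<zero>\<^bsub>cobj T (- 1)\<^esub>" using z2[of x] x 2 cdiff_zero[OF c, of "- 2"] by simp
      thus ?thesis using 2 rhom_zero[OF r r f] cdiff_zero[OF c, of "- 1"] by (simp add: F_def ag_simps r)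
    next
      case 3
      thus ?thesis using cdiff_zero[OF c, of "n + 1"] by (auto simp: F_def ag_simps r add.commute)
    qed
  qed
  have "homotopic T (shift 1 T) F (zero_map (shift 1 T))" using T F by (simp add: presilting_def)
  then obtain k where H: "homotopy T (shift 1 T) k F (zero_map (shift 1 T))"
    by (rule homotopicE[OF _ c shift_complex[OF c] F chom_zero[OF shift_complex[OF c]]])
  note k = homotopyD(1)[OF H c shift_complex[OF c]] and e = homotopyD(5)[OF H c shift_complex[OF c]]
  have k0: "k 0 \<in> rhom (cobj T 0) (cobj T 0)" and k1: "k (- 1) \<in> rhom (cobj T (- 1)) (cobj T (- 1))"
    using k[of 0] k[of "- 1"] by simp_all
  show ?thesis
  proof (rule that[OF k0 k1])
    fix x assume x: "x \<in> carrier (cobj T (- 1))"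
    have a: "cdiff T (- 1) (k (- 1) x) \<in> carrier (cobj T 0)" "k 0 (cdiff T (- 1) x) \<in> carrier (cobj T 0)"
      using cdiff_closed[OF c rhom_closed[OF k1 x]] rhom_closed[OF k0] cdiff_closed[OF c x] by simp_all
    show "f x = \<ominus>\<^bsub>cobj T 0\<^esub> cdiff T (- 1) (k (- 1) x) \<oplus>\<^bsub>cobj T 0\<^esub> k 0 (cdiff T (- 1) x)"
      using e[OF x] a by (simp add: F_def zero_map_def ag_simps ag_closed r)
  qed
qed

context fd_algebra
begin

text \<open>Morphisms from \<open>T\<close> to $L[1]$ vanish.  In the step, \<open>f\<close> lifts to $L \oplus T^0$ because $T^{-1}$ is projective.  The
  first component factors through the differential by induction; the second is a chain map from \<open>T\<close> to
  $T[1]$, hence null-homotopic, and the new map \<open>g0\<close> kills the part of the homotopy that consists of coboundaries.\<close>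

lemma trace_sub_lift:
  fixes T :: "'a cpx"
  assumes L: "trace_sub T M L" and T: "presilting T" and t: "two_term T" and M: "M \<in> mod_cat"
    and f: "f \<in> rhom (cobj T (- 1)) M" "\<And>x. x \<in> carrier (cobj T (- 1)) \<Longrightarrow> f x \<in> L"
  obtains g where "g \<in> rhom (cobj T 0) M" "\<And>y. y \<in> carrier (cobj T 0) \<Longrightarrow> g y \<in> L"
    "\<And>x. x \<in> carrier (cobj T (- 1)) \<Longrightarrow> f x = g (cdiff T (- 1) x)"
proof -
  have X: "T \<in> Kb_proj" using T by (simp add: presilting_def)
  have c: "is_complex T" by (rule Kb_projD(2)[OF X])
  note r = cobj_rm[OF c] and rM = mod_catD(1)[OF M]
  have dT: "cdiff T (- 1) x \<in> carrier (cobj T 0)" if "x \<in> carrier (cobj T (- 1))" for x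
    using cdiff_closed[OF c that] by simp
  have "\<exists>g\<in>rhom (cobj T 0) M. (\<forall>y\<in>carrier (cobj T 0). g y \<in> L) \<and>
      (\<forall>x\<in>carrier (cobj T (- 1)). f x = g (cdiff T (- 1) x))"
    using L f
  proof (induction arbitrary: f)
    case zero
    show ?case
      by (intro bexI[of _ "\<lambda>_. \<zero>\<^bsub>M\<^esub>"] rhom_zero_fun rM) (use zero in auto)
  next
    case (step L g0)
    define L' where "L' = {x \<oplus>\<^bsub>M\<^esub> y | x y. x \<in> L \<and> y \<in> g0 ` carrier (cobj T 0)}"
    have rL: "rsubmodule L M" by (rule trace_sub_rsubmodule[OF step(1) c rM])
    have rL': "rsubmodule L' M" unfolding L'_def by (rule trace_sub_rsubmodule[OF trace_sub.step[OF step(1-3)] c rM])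
    note Ls = right_module.rsubmoduleD[OF rM rL]
    have cL: "M\<lparr>carrier := L\<rparr> \<in> mod_cat" by (rule mod_cat_sub[OF M rL])
    have cL': "M\<lparr>carrier := L'\<rparr> \<in> mod_cat" by (rule mod_cat_sub[OF M rL'])
    let ?S = "dsum (M\<lparr>carrier := L\<rparr>) (cobj T 0)"
    have S: "?S \<in> mod_cat" by (rule dsum_mod_cat[OF cL cobj_mod_cat[OF c]])
    have fL': "f \<in> rhom (cobj T (- 1)) (M\<lparr>carrier := L'\<rparr>)"
      by (rule rhom_into_sub[OF step.prems(1)]) (use step.prems(2) in \<open>simp add: L'_def\<close>)
    let ?u = "\<lambda>z. pr1 z \<oplus>\<^bsub>M\<^esub> g0 (pr2 z)"
    have uM: "?u \<in> rhom ?S M"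
      by (rule rhom_add_fun[OF rM rhom_from_sub[OF rhom_pr(1) Ls(1)] rhom_comp[OF rhom_pr(2) step(2)]])
    have uin: "?u z \<in> L'" if "z \<in> carrier ?S" for z
      unfolding L'_def using that by (intro CollectI exI[of _ "pr1 z"] exI[of _ "g0 (pr2 z)"]) simp
    have u: "?u \<in> rhom ?S (M\<lparr>carrier := L'\<rparr>)"
      by (rule rhom_into_sub[OF uM uin])
    have usur: "?u ` carrier ?S = carrier (M\<lparr>carrier := L'\<rparr>)"
    proof (intro equalityI subsetI)
      fix w assume "w \<in> carrier (M\<lparr>carrier := L'\<rparr>)"
      then obtain x y where xy: "x \<in> L" "y \<in> carrier (cobj T 0)" "w = x \<oplus>\<^bsub>M\<^esub> g0 y" by (auto simp: L'_def)
      hence "w = ?u (pair x y)" "pair x y \<in> carrier ?S" by simp_all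
      thus "w \<in> ?u ` carrier ?S" by blast
    qed (use uin in auto)
    obtain \<phi> where \<phi>: "\<phi> \<in> rhom (cobj T (- 1)) ?S" "\<And>x. x \<in> carrier (cobj T (- 1)) \<Longrightarrow> ?u (\<phi> x) = f x"
      using projectiveD[OF Kb_projD(3)[OF X] S cL' u usur fL'] by blast
    have f1: "(\<lambda>x. pr1 (\<phi> x)) \<in> rhom (cobj T (- 1)) (M\<lparr>carrier := L\<rparr>)" by (rule rhom_comp[OF \<phi>(1) rhom_pr(1)])
    have f2: "(\<lambda>x. pr2 (\<phi> x)) \<in> rhom (cobj T (- 1)) (cobj T 0)" by (rule rhom_comp[OF \<phi>(1) rhom_pr(2)])
    have f1L: "pr1 (\<phi> x) \<in> L" if "x \<in> carrier (cobj T (- 1))" for x using rhom_closed[OF f1 that] by simp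
    obtain k where k: "k \<in> rhom (cobj T 0) M" "\<And>y. y \<in> carrier (cobj T 0) \<Longrightarrow> k y \<in> L"
      "\<And>x. x \<in> carrier (cobj T (- 1)) \<Longrightarrow> pr1 (\<phi> x) = k (cdiff T (- 1) x)"
      using step.IH[OF rhom_from_sub[OF f1 Ls(1)] f1L] by blast
    obtain h h' where h: "h \<in> rhom (cobj T 0) (cobj T 0)" and h': "h' \<in> rhom (cobj T (- 1)) (cobj T (- 1))"
      and e: "\<And>x. x \<in> carrier (cobj T (- 1)) \<Longrightarrow>
        pr2 (\<phi> x) = \<ominus>\<^bsub>cobj T 0\<^esub> cdiff T (- 1) (h' x) \<oplus>\<^bsub>cobj T 0\<^esub> h (cdiff T (- 1) x)"
      using presilting_degree_1[OF T t f2] by blast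
    show ?case unfolding L'_def[symmetric]
    proof (intro bexI conjI ballI)
      show "(\<lambda>y. k y \<oplus>\<^bsub>M\<^esub> g0 (h y)) \<in> rhom (cobj T 0) M"
        by (rule rhom_add_fun[OF rM k(1) rhom_comp[OF h step(2)]])
      show "k y \<oplus>\<^bsub>M\<^esub> g0 (h y) \<in> L'" if "y \<in> carrier (cobj T 0)" for y
        using k(2)[OF that] rhom_closed[OF h that] by (auto simp: L'_def)
      fix x assume x: "x \<in> carrier (cobj T (- 1))"
      note hx = rhom_closed[OF h' x] rhom_closed[OF h dT[OF x]] dT[OF rhom_closed[OF h' x]]
      have "g0 (\<ominus>\<^bsub>cobj T 0\<^esub> cdiff T (- 1) (h' x)) = \<zero>\<^bsub>M\<^esub>"
        using rhom_neg[OF r rM step(2) hx(3)] step(3) hx(1) by (simp add: ag_simps rM)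
      hence "g0 (pr2 (\<phi> x)) = g0 (h (cdiff T (- 1) x))"
        using hx rhom_closed[OF step(2) hx(2)] unfolding e[OF x]
        by (simp add: rhom_add[OF step(2)] ag_closed ag_simps r rM)
      thus "f x = k (cdiff T (- 1) x) \<oplus>\<^bsub>M\<^esub> g0 (h (cdiff T (- 1) x))"
        using \<phi>(2)[OF x] k(3)[OF x] by simp
    qed
  qed
  thus ?thesis using that by blast
qed

lemma trace_sub_max:
  fixes T :: "'a cpx"
  assumes T: "is_complex T" and M: "M \<in> mod_cat"
  obtains L where "trace_sub T M L"
    "\<And>g y. g \<in> rhom (cobj T 0) M \<Longrightarrow> (\<And>x. x \<in> carrier (cobj T (- 1)) \<Longrightarrow> g (cdiff T (- 1) x) = \<zero>\<^bsub>M\<^esub>) \<Longrightarrow>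
      y \<in> carrier (cobj T 0) \<Longrightarrow> g y \<in> L"
proof -
  note rM = mod_catD(1)[OF M] and r = cobj_rm[OF T]
  have rs: "rsubmodule L M" if "trace_sub T M L" for L by (rule trace_sub_rsubmodule[OF that T rM])
  have "\<exists>L. trace_sub T M L \<and> (\<forall>L'. trace_sub T M L' \<longrightarrow> subdim M L' \<le> subdim M L)"
  proof (rule ex_has_greatest_nat)
    show "trace_sub T M {\<zero>\<^bsub>M\<^esub>}" by (rule trace_sub.zero)
    have "subdim M L \<le> subdim M (carrier M)" if "trace_sub T M L" for L
      by (rule subdim_mono(1)[OF M right_module.rsubmodule_carrier[OF rM] rs[OF that] right_module.rsubmoduleD(1)[OF rM rs[OF that]]])
    thus "\<forall>L. trace_sub T M L \<longrightarrow> subdim M L < Suc (subdim M (carrier M))" by (simp add: less_Suc_eq_le)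
  qed
  then obtain L where L: "trace_sub T M L" "\<And>L'. trace_sub T M L' \<Longrightarrow> subdim M L' \<le> subdim M L" by blast
  note Ls = right_module.rsubmoduleD[OF rM rs[OF L(1)]]
  show ?thesis
  proof (rule that[OF L(1)])
    fix g y assume g: "g \<in> rhom (cobj T 0) M"
      and gd: "\<And>x. x \<in> carrier (cobj T (- 1)) \<Longrightarrow> g (cdiff T (- 1) x) = \<zero>\<^bsub>M\<^esub>"
      and y: "y \<in> carrier (cobj T 0)"
    define L' where "L' = {x \<oplus>\<^bsub>M\<^esub> y | x y. x \<in> L \<and> y \<in> g ` carrier (cobj T 0)}"
    have L': "trace_sub T M L'" unfolding L'_def by (rule trace_sub.step[OF L(1) g]) (use gd in blast)
    have "x \<in> L'" if "x \<in> L" for x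
    proof -
      have "x = x \<oplus>\<^bsub>M\<^esub> g \<zero>\<^bsub>cobj T 0\<^esub>" using that Ls(1) rhom_zero[OF r rM g] by (auto simp: ag_simps rM)
      moreover have "\<zero>\<^bsub>cobj T 0\<^esub> \<in> carrier (cobj T 0)" by (simp add: ag_closed r)
      ultimately show ?thesis unfolding L'_def using that by blast
    qed
    hence sub: "L \<subseteq> L'" by blast
    have "subdim M L = subdim M L'" using subdim_mono(1)[OF M rs[OF L'] rs[OF L(1)] sub] L(2)[OF L'] by simp
    hence "L = L'" by (rule subdim_mono(2)[OF M rs[OF L'] rs[OF L(1)] sub])
    moreover have "g y = \<zero>\<^bsub>M\<^esub> \<oplus>\<^bsub>M\<^esub> g y" using rhom_closed[OF g y] by (simp add: ag_simps rM)
    hence "g y \<in> L'" unfolding L'_def using y Ls(2) by blast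
    ultimately show "g y \<in> L" by simp
  qed
qed

text \<open>A morphism from \<open>T\<close> to \<open>N = M / L\<close> lifts to a map $T^0 \to M$ that sends coboundaries into \<open>L\<close>.
  By \<open>trace_sub_lift\<close> a map into \<open>L\<close> can be subtracted so that coboundaries are killed, and then the
  image lies in \<open>L\<close> by maximality.\<close>

lemma trace_quotient_vanish:
  fixes T :: "'a cpx"
  assumes T: "presilting T" and t: "two_term T" and M: "M \<in> mod_cat" and N: "N \<in> mod_cat"
    and L: "trace_sub T M L"
    and mx: "\<And>g y. g \<in> rhom (cobj T 0) M \<Longrightarrow> (\<And>x. x \<in> carrier (cobj T (- 1)) \<Longrightarrow> g (cdiff T (- 1) x) = \<zero>\<^bsub>M\<^esub>) \<Longrightarrow>
      y \<in> carrier (cobj T 0) \<Longrightarrow> g y \<in> L"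
    and p: "p \<in> rhom M N" "p ` carrier M = carrier N" "{x \<in> carrier M. p x = \<zero>\<^bsub>N\<^esub>} = L"
  shows "hom_vanish T N 0"
  unfolding hom_vanish_def
proof (intro ballI impI)
  have X: "T \<in> Kb_proj" using T by (simp add: presilting_def)
  have c: "is_complex T" by (rule Kb_projD(2)[OF X])
  note r = cobj_rm[OF c] and rM = mod_catD(1)[OF M] and rN = mod_catD(1)[OF N]
  fix f assume f: "f \<in> rhom (cobj T 0) N"
    and d: "\<forall>x\<in>carrier (cobj T (0 - 1)). f (cdiff T (0 - 1) x) = \<zero>\<^bsub>N\<^esub>"
  have pL: "p y = \<zero>\<^bsub>N\<^esub>" if "y \<in> L" for y using that p(3) by blast
  obtain f' where f': "f' \<in> rhom (cobj T 0) M" "\<And>x. x \<in> carrier (cobj T 0) \<Longrightarrow> p (f' x) = f x"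
    using projectiveD[OF Kb_projD(3)[OF X] M N p(1,2) f] by blast
  have dT: "cdiff T (- 1) x \<in> carrier (cobj T 0)" if "x \<in> carrier (cobj T (- 1))" for x
    using cdiff_closed[OF c that] by simp
  have d1: "cdiff T (- 1) \<in> rhom (cobj T (- 1)) (cobj T 0)" using cdiff_rhom[OF c, of "- 1"] by simp
  have f'L: "f' (cdiff T (- 1) x) \<in> L" if x: "x \<in> carrier (cobj T (- 1))" for x
    using d f'(2)[OF dT[OF x]] rhom_closed[OF f'(1) dT[OF x]] x unfolding p(3)[symmetric] by simp
  obtain g where g: "g \<in> rhom (cobj T 0) M" "\<And>y. y \<in> carrier (cobj T 0) \<Longrightarrow> g y \<in> L"
    "\<And>x. x \<in> carrier (cobj T (- 1)) \<Longrightarrow> f' (cdiff T (- 1) x) = g (cdiff T (- 1) x)"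
    by (rule trace_sub_lift[OF L T t M rhom_comp[OF d1 f'(1)] f'L]) (assumption, rule that)
  have f'': "(\<lambda>y. f' y \<ominus>\<^bsub>M\<^esub> g y) \<in> rhom (cobj T 0) M" by (rule rhom_minus_fun[OF rM f'(1) g(1)])
  have "f y = \<zero>\<^bsub>N\<^esub>" if y: "y \<in> carrier (cobj T 0)" for y
  proof -
    note cl = rhom_closed[OF f'(1) y] rhom_closed[OF g(1) y]
    have "f' y \<ominus>\<^bsub>M\<^esub> g y \<in> L"
      by (rule mx[OF f'' _ y]) (simp add: g(3)[symmetric] ag_minus_self rM rhom_closed[OF f'(1) dT])
    hence "p (f' y) \<ominus>\<^bsub>N\<^esub> p (g y) = \<zero>\<^bsub>N\<^esub>" using pL rhom_minus[OF rM rN p(1) cl] by simp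
    thus ?thesis using f'(2)[OF y] pL[OF g(2)[OF y]] rhom_closed[OF f y] by (simp add: ag_minus_zero rN)
  qed
  thus "\<exists>g\<in>rhom (cobj T (0 + 1)) N. \<forall>x\<in>carrier (cobj T 0). f x = g (cdiff T 0 x)"
    by (intro bexI[of _ "\<lambda>_. \<zero>\<^bsub>N\<^esub>"] rhom_zero_fun rN) simp
qed

text \<open>The case of \<open>trace_sub_lift\<close> in which \<open>L\<close> itself is the target.\<close>

lemma trace_sub_vanish:
  fixes T :: "'a cpx"
  assumes T: "presilting T" and t: "two_term T" and M: "M \<in> mod_cat" and L: "trace_sub T M L"
  shows "hom_vanish T (M\<lparr>carrier := L\<rparr>) (- 1)"
  unfolding hom_vanish_def
proof (intro ballI impI)
  have c: "is_complex T" using T Kb_projD(2) by (auto simp: presilting_def)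
  note rM = mod_catD(1)[OF M]
  note Ls = right_module.rsubmoduleD[OF rM trace_sub_rsubmodule[OF L c rM]]
  fix f assume f: "f \<in> rhom (cobj T (- 1)) (M\<lparr>carrier := L\<rparr>)"
  have fL: "f x \<in> L" if "x \<in> carrier (cobj T (- 1))" for x using rhom_closed[OF f that] by simp
  obtain g where g: "g \<in> rhom (cobj T 0) M" "\<And>y. y \<in> carrier (cobj T 0) \<Longrightarrow> g y \<in> L"
    "\<And>x. x \<in> carrier (cobj T (- 1)) \<Longrightarrow> f x = g (cdiff T (- 1) x)"
    by (rule trace_sub_lift[OF L T t M rhom_from_sub[OF f Ls(1)] fL]) (assumption, rule that)
  show "\<exists>g\<in>rhom (cobj T (- 1 + 1)) (M\<lparr>carrier := L\<rparr>). \<forall>x\<in>carrier (cobj T (- 1)). f x = g (cdiff T (- 1) x)"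
    using rhom_into_sub[OF g(1,2)] g(3) by auto
qed

end

lemma mpow_simps [simp]:
  "z \<in> carrier (mpow n H) \<longleftrightarrow> (\<forall>i<n. z i \<in> carrier H) \<and> (\<forall>i\<ge>n. z i = \<zero>\<^bsub>H\<^esub>)"
  "\<zero>\<^bsub>mpow n H\<^esub> = (\<lambda>_. \<zero>\<^bsub>H\<^esub>)"
  "z \<oplus>\<^bsub>mpow n H\<^esub> w = (\<lambda>i. if i < n then z i \<oplus>\<^bsub>H\<^esub> w i else \<zero>\<^bsub>H\<^esub>)"
  "a \<odot>\<^bsub>mpow n H\<^esub> z = (\<lambda>i. if i < n then a \<odot>\<^bsub>H\<^esub> z i else \<zero>\<^bsub>H\<^esub>)"
  by (simp_all add: mpow_def)

lemma mpow_right_module: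
  assumes H: "right_module H" shows "right_module (mpow n H)"
proof -
  interpret H: right_module H by (rule H)
  show ?thesis
  proof (intro right_module.intro right_module_axioms.intro abelian_groupI)
    fix z assume "z \<in> carrier (mpow n H)"
    thus "\<exists>w\<in>carrier (mpow n H). w \<oplus>\<^bsub>mpow n H\<^esub> z = \<zero>\<^bsub>mpow n H\<^esub>"
      by (intro bexI[of _ "\<lambda>i. if i < n then \<ominus>\<^bsub>H\<^esub> z i else \<zero>\<^bsub>H\<^esub>"]) (auto simp: H.l_neg fun_eq_iff)
  qed (auto simp: fun_eq_iff H.a_ac H.act_closed H.act_add H.add_act H.mult_act H.one_act)
qed

text \<open>As $T^1 = 0$, every element of $T^0$ is a cocycle and $\mathrm{H}^0(T)$ is the cokernel of the differential.\<close>

lemma cohom_0_two_term: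
  assumes T: "is_complex T" and t: "two_term T"
  shows "right_module (cohom 0 T)"
    and "(\<lambda>y. coboundaries 0 T +>\<^bsub>cobj T 0\<^esub> y) \<in> rhom (cobj T 0) (cohom 0 T)"
    and "(\<lambda>y. coboundaries 0 T +>\<^bsub>cobj T 0\<^esub> y) ` carrier (cobj T 0) = carrier (cohom 0 T)"
    and "x \<in> carrier (cobj T (- 1)) \<Longrightarrow> coboundaries 0 T +>\<^bsub>cobj T 0\<^esub> cdiff T (- 1) x = \<zero>\<^bsub>cohom 0 T\<^esub>"
    and "right_module M \<Longrightarrow> g \<in> rhom (cobj T 0) M \<Longrightarrow>
      (\<And>x. x \<in> carrier (cobj T (- 1)) \<Longrightarrow> g (cdiff T (- 1) x) = \<zero>\<^bsub>M\<^esub>) \<Longrightarrow>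
      \<exists>g'\<in>rhom (cohom 0 T) M. \<forall>y\<in>carrier (cobj T 0). g' (coboundaries 0 T +>\<^bsub>cobj T 0\<^esub> y) = g y"
proof -
  note r = cobj_rm[OF T] and B = rsubmodule_coboundaries[OF T, of 0]
  interpret Z: right_module "cobj T 0" by (rule r)
  have "cdiff T 0 y = \<zero>\<^bsub>cobj T 1\<^esub>" if "y \<in> carrier (cobj T 0)" for y
    using cdiff_closed[OF T that] t by (auto simp: two_term_def zero_at_def)
  hence "cocycles 0 T = carrier (cobj T 0)" by (auto simp: cocycles_def)
  hence H: "cohom 0 T = quot_mod (cobj T 0) (coboundaries 0 T)" by (simp add: cohom_def)
  note q = Z.quot_simps[OF B]
  show "right_module (cohom 0 T)" unfolding H by (rule Z.quot_right_module[OF B])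
  show "(\<lambda>y. coboundaries 0 T +>\<^bsub>cobj T 0\<^esub> y) \<in> rhom (cobj T 0) (cohom 0 T)" unfolding H by (rule Z.quot_rhom[OF B])
  show "(\<lambda>y. coboundaries 0 T +>\<^bsub>cobj T 0\<^esub> y) ` carrier (cobj T 0) = carrier (cohom 0 T)" unfolding H q(1) ..
  show "coboundaries 0 T +>\<^bsub>cobj T 0\<^esub> cdiff T (- 1) x = \<zero>\<^bsub>cohom 0 T\<^esub>" if x: "x \<in> carrier (cobj T (- 1))"
  proof -
    have "cdiff T (- 1) x \<in> coboundaries 0 T" using x by (simp add: coboundaries_def)
    moreover have "cdiff T (- 1) x \<in> carrier (cobj T 0)" using cdiff_closed[OF T x] by simp
    ultimately show ?thesis unfolding H q(4)
      by (subst Z.a_coset_eq_iff[OF B]) (auto simp: ag_minus_zero r)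
  qed
  assume M: "right_module M" and g: "g \<in> rhom (cobj T 0) M"
    and gd: "\<And>x. x \<in> carrier (cobj T (- 1)) \<Longrightarrow> g (cdiff T (- 1) x) = \<zero>\<^bsub>M\<^esub>"
  have gb: "g y = \<zero>\<^bsub>M\<^esub>" if "y \<in> coboundaries 0 T" for y using that gd by (auto simp: coboundaries_def)
  show "\<exists>g'\<in>rhom (cohom 0 T) M. \<forall>y\<in>carrier (cobj T 0). g' (coboundaries 0 T +>\<^bsub>cobj T 0\<^esub> y) = g y"
    unfolding H by (rule quot_rhom_factor[OF r B M g gb]) blast+
qed

text \<open>Each step of the induction contributes one further copy of $\mathrm{H}^0(T)$, in the last coordinate.\<close>

lemma trace_sub_image:
  assumes L: "trace_sub T M L" and T: "is_complex T" and t: "two_term T" and M: "right_module M"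
  shows "\<exists>n. \<exists>f\<in>rhom (mpow n (cohom 0 T)) M. f ` carrier (mpow n (cohom 0 T)) = L"
  using L
proof induction
  case zero
  have "(\<lambda>_. \<zero>\<^bsub>M\<^esub>) ` carrier (mpow 0 (cohom 0 T)) = {\<zero>\<^bsub>M\<^esub>}" by (auto simp: image_iff)
  thus ?case using rhom_zero_fun[OF M] by blast
next
  case (step L g)
  let ?H = "cohom 0 T"
  note H = cohom_0_two_term[OF T t]
  interpret H: right_module ?H by (rule H(1))
  obtain n f where f: "f \<in> rhom (mpow n ?H) M" "f ` carrier (mpow n ?H) = L" using step.IH by blast
  obtain g' where g': "g' \<in> rhom ?H M" "\<forall>y\<in>carrier (cobj T 0). g' (coboundaries 0 T +>\<^bsub>cobj T 0\<^esub> y) = g y"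
    using H(5)[OF M step(2)] step(3) by blast
  have g'im: "g' ` carrier ?H = g ` carrier (cobj T 0)"
    unfolding H(3)[symmetric] image_image using g'(2) by (intro image_cong) auto
  define cut where "cut z = (\<lambda>i. if i < n then z i else \<zero>\<^bsub>?H\<^esub>)" for z :: "nat \<Rightarrow> (nat \<Rightarrow> 'a) set"
  have cut: "cut \<in> rhom (mpow (Suc n) ?H) (mpow n ?H)"
    by (rule rhomI) (auto simp: cut_def fun_eq_iff)
  have ev: "(\<lambda>z. z n) \<in> rhom (mpow (Suc n) ?H) ?H" by (rule rhomI) auto
  let ?f = "\<lambda>z. f (cut z) \<oplus>\<^bsub>M\<^esub> g' (z n)"
  have "?f \<in> rhom (mpow (Suc n) ?H) M"
    by (rule rhom_add_fun[OF M rhom_comp[OF cut f(1)] rhom_comp[OF ev g'(1)]])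
  moreover have "?f ` carrier (mpow (Suc n) ?H) = {x \<oplus>\<^bsub>M\<^esub> y | x y. x \<in> L \<and> y \<in> g ` carrier (cobj T 0)}"
  proof (intro equalityI subsetI)
    fix w assume "w \<in> ?f ` carrier (mpow (Suc n) ?H)"
    then obtain z where z: "z \<in> carrier (mpow (Suc n) ?H)" "w = ?f z" by blast
    have "f (cut z) \<in> L" using rhom_closed[OF cut z(1)] f(2) by blast
    moreover have "g' (z n) \<in> g ` carrier (cobj T 0)" using rhom_closed[OF ev z(1)] g'im by blast
    ultimately show "w \<in> {x \<oplus>\<^bsub>M\<^esub> y | x y. x \<in> L \<and> y \<in> g ` carrier (cobj T 0)}" using z(2) by blast
  next
    fix w assume "w \<in> {x \<oplus>\<^bsub>M\<^esub> y | x y. x \<in> L \<and> y \<in> g ` carrier (cobj T 0)}"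
    then obtain x y where xy: "x \<in> L" "y \<in> g ` carrier (cobj T 0)" "w = x \<oplus>\<^bsub>M\<^esub> y" by blast
    obtain z where z: "z \<in> carrier (mpow n ?H)" "x = f z" using xy(1) f(2) by blast
    obtain h where h: "h \<in> carrier ?H" "y = g' h" using xy(2) g'im by blast
    let ?z = "\<lambda>i. if i = n then h else z i"
    have "cut ?z = z" using z(1) by (auto simp: cut_def fun_eq_iff)
    hence "w = ?f ?z" using z h xy by simp
    moreover have "?z \<in> carrier (mpow (Suc n) ?H)" using z h by auto
    ultimately show "w \<in> ?f ` carrier (mpow (Suc n) ?H)" by blast
  qed
  ultimately show ?case by blast
qed

text \<open>The tuples supported in the first \<open>k\<close> coordinates have an image that grows with \<open>k\<close> by the image of one
  copy of $\mathrm{H}^0(T)$.\<close>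

lemma image_trace_sub:
  assumes T: "is_complex T" and t: "two_term T" and M: "right_module M"
    and f: "f \<in> rhom (mpow n (cohom 0 T)) M"
  shows "trace_sub T M (f ` carrier (mpow n (cohom 0 T)))"
proof -
  let ?H = "cohom 0 T"
  note H = cohom_0_two_term[OF T t]
  interpret H: right_module ?H by (rule H(1))
  note rP = mpow_right_module[OF H(1), of n]
  define V where "V k = {z \<in> carrier (mpow n ?H). \<forall>i\<ge>k. z i = \<zero>\<^bsub>?H\<^esub>}" for k
  have "trace_sub T M (f ` V k)" if "k \<le> n" for k
    using that
  proof (induction k)
    case 0
    have "V 0 = {\<zero>\<^bsub>mpow n ?H\<^esub>}" by (auto simp: V_def)
    hence "f ` V 0 = {\<zero>\<^bsub>M\<^esub>}" using rhom_zero[OF rP M f] by simp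
    thus ?case by (simp add: trace_sub.zero)
  next
    case (Suc k)
    hence k: "k < n" by simp
    define e where "e y = (\<lambda>i. if i = k then y else \<zero>\<^bsub>?H\<^esub>)" for y
    have e: "e \<in> rhom ?H (mpow n ?H)" by (rule rhomI) (use k in \<open>auto simp: e_def fun_eq_iff H.act_zero\<close>)
    let ?g = "\<lambda>y. f (e (coboundaries 0 T +>\<^bsub>cobj T 0\<^esub> y))"
    have g: "?g \<in> rhom (cobj T 0) M" by (rule rhom_comp[OF rhom_comp[OF H(2) e] f])
    have gd: "\<forall>x\<in>carrier (cobj T (- 1)). ?g (cdiff T (- 1) x) = \<zero>\<^bsub>M\<^esub>"
      using H(4) rhom_zero[OF H(1) rP e] rhom_zero[OF rP M f] by simp
    have "?g ` carrier (cobj T 0) = (\<lambda>y. f (e y)) ` carrier ?H" unfolding H(3)[symmetric] image_image ..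
    note step = trace_sub.step[OF Suc.IH[OF less_imp_le[OF k]] g gd, unfolded this]
    have "{x \<oplus>\<^bsub>M\<^esub> y | x y. x \<in> f ` V k \<and> y \<in> (\<lambda>y. f (e y)) ` carrier ?H} = f ` V (Suc k)"
    proof (intro equalityI subsetI)
      fix w assume "w \<in> {x \<oplus>\<^bsub>M\<^esub> y | x y. x \<in> f ` V k \<and> y \<in> (\<lambda>y. f (e y)) ` carrier ?H}"
      then obtain z y where zy: "z \<in> V k" "y \<in> carrier ?H" "w = f z \<oplus>\<^bsub>M\<^esub> f (e y)" by blast
      have zc: "z \<in> carrier (mpow n ?H)" using zy(1) by (simp add: V_def)
      have "w = f (z \<oplus>\<^bsub>mpow n ?H\<^esub> e y)" using zy(3) rhom_add[OF f zc rhom_closed[OF e zy(2)]] by simp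
      moreover have "z \<oplus>\<^bsub>mpow n ?H\<^esub> e y \<in> V (Suc k)"
        using zy(1,2) k by (auto simp: V_def e_def)
      ultimately show "w \<in> f ` V (Suc k)" by blast
    next
      fix w assume "w \<in> f ` V (Suc k)"
      then obtain z where z: "z \<in> V (Suc k)" "w = f z" by blast
      have zk: "z k \<in> carrier ?H" using z(1) k by (simp add: V_def)
      let ?z = "z(k := \<zero>\<^bsub>?H\<^esub>)"
      have z': "?z \<in> V k" using z(1) by (auto simp: V_def)
      have "z = ?z \<oplus>\<^bsub>mpow n ?H\<^esub> e (z k)" using z(1) by (auto simp: V_def e_def fun_eq_iff)
      hence "w = f ?z \<oplus>\<^bsub>M\<^esub> f (e (z k))"
        using z(2) rhom_add[OF f _ rhom_closed[OF e zk], of ?z] z' by (simp add: V_def)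
      thus "w \<in> {x \<oplus>\<^bsub>M\<^esub> y | x y. x \<in> f ` V k \<and> y \<in> (\<lambda>y. f (e y)) ` carrier ?H}" using z' zk by blast
    qed
    thus ?case using step by simp
  qed
  moreover have "V n = carrier (mpow n ?H)" by (auto simp: V_def)
  ultimately show ?thesis by (metis order_refl)
qed

lemma Fac_cohom_iff:
  assumes T: "is_complex T" and t: "two_term T" and M: "M \<in> mod_cat"
  shows "M \<in> Fac (cohom 0 T) \<longleftrightarrow> trace_sub T M (carrier M)"
proof
  assume "M \<in> Fac (cohom 0 T)"
  then obtain n f where "f \<in> rhom (mpow n (cohom 0 T)) M" "f ` carrier (mpow n (cohom 0 T)) = carrier M"
    unfolding Fac_def by blast
  thus "trace_sub T M (carrier M)" using image_trace_sub[OF T t mod_catD(1)[OF M]] by metis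
next
  assume "trace_sub T M (carrier M)"
  thus "M \<in> Fac (cohom 0 T)" unfolding Fac_def using trace_sub_image[OF _ T t mod_catD(1)[OF M]] M by blast
qed

section \<open>Existence of indecomposable summands\<close>

lemma K_iso_chom: "K_iso X Y f \<Longrightarrow> f \<in> chom X Y"
  by (simp add: K_iso_def)

lemma K_iso_comp:
  assumes f: "K_iso X Y f" and g: "K_iso Y Z g"
    and c: "is_complex X" "is_complex Y" "is_complex Z"
  shows "K_iso X Z (g \<circ>\<^sub>c f)"
proof -
  obtain f' where f': "f \<in> chom X Y" "f' \<in> chom Y X" "homotopic X X (f' \<circ>\<^sub>c f) id_map" "homotopic Y Y (f \<circ>\<^sub>c f') id_map"
    using f by (auto simp: K_iso_def)
  obtain g' where g': "g \<in> chom Y Z" "g' \<in> chom Z Y" "homotopic Y Y (g' \<circ>\<^sub>c g) id_map" "homotopic Z Z (g \<circ>\<^sub>c g') id_map"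
    using g by (auto simp: K_iso_def)
  note ff = chom_comp[OF f'(1,2)] chom_comp[OF f'(2,1)] and gg = chom_comp[OF g'(1,2)] chom_comp[OF g'(2,1)]
  have "homotopic X Y (g' \<circ>\<^sub>c g \<circ>\<^sub>c f) (id_map \<circ>\<^sub>c f)"
    by (rule homotopic_comp_right[OF g'(3) f'(1) c(2) c(2) c(1) gg(1) chom_id])
  hence "homotopic X X (f' \<circ>\<^sub>c (g' \<circ>\<^sub>c g \<circ>\<^sub>c f)) (f' \<circ>\<^sub>c (id_map \<circ>\<^sub>c f))"
    by (rule homotopic_comp_left[OF _ f'(2) c(1,2,1) chom_comp[OF f'(1) gg(1)] chom_comp[OF f'(1) chom_id]])
  hence 1: "homotopic X X (f' \<circ>\<^sub>c g' \<circ>\<^sub>c (g \<circ>\<^sub>c f)) (f' \<circ>\<^sub>c f)" by (simp add: comp_map_assoc)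
  have "homotopic Z Y (f \<circ>\<^sub>c f' \<circ>\<^sub>c g') (id_map \<circ>\<^sub>c g')"
    by (rule homotopic_comp_right[OF f'(4) g'(2) c(2) c(2) c(3) ff(2) chom_id])
  hence "homotopic Z Z (g \<circ>\<^sub>c (f \<circ>\<^sub>c f' \<circ>\<^sub>c g')) (g \<circ>\<^sub>c (id_map \<circ>\<^sub>c g'))"
    by (rule homotopic_comp_left[OF _ g'(1) c(3,2,3) chom_comp[OF g'(2) ff(2)] chom_comp[OF g'(2) chom_id]])
  hence 2: "homotopic Z Z (g \<circ>\<^sub>c f \<circ>\<^sub>c (f' \<circ>\<^sub>c g')) (g \<circ>\<^sub>c g')" by (simp add: comp_map_assoc)
  note gf = chom_comp[OF f'(1) g'(1)] and fg' = chom_comp[OF g'(2) f'(2)]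
  have "homotopic X X (f' \<circ>\<^sub>c g' \<circ>\<^sub>c (g \<circ>\<^sub>c f)) id_map"
    by (rule homotopic_trans[OF 1 f'(3) c(1,1) chom_comp[OF gf fg'] ff(1) chom_id])
  moreover have "homotopic Z Z (g \<circ>\<^sub>c f \<circ>\<^sub>c (f' \<circ>\<^sub>c g')) id_map"
    by (rule homotopic_trans[OF 2 g'(4) c(3,3) chom_comp[OF fg' gf] gg(2) chom_id])
  ultimately show ?thesis unfolding K_iso_def using gf fg' by blast
qed

lemma K_iso_inverse:
  assumes f: "K_iso X Y f" obtains g where "K_iso Y X g"
  using assms unfolding K_iso_def by blast

lemma K_iso_strict:
  assumes X: "is_complex X" and Y: "is_complex Y" and f: "f \<in> chom X Y" and g: "g \<in> chom Y X"
    and gf: "\<And>i x. x \<in> carrier (cobj X i) \<Longrightarrow> g i (f i x) = x"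
    and fg: "\<And>i y. y \<in> carrier (cobj Y i) \<Longrightarrow> f i (g i y) = y"
  shows "K_iso X Y f"
  unfolding K_iso_def
proof (intro conjI bexI)
  show "homotopic X X (g \<circ>\<^sub>c f) id_map"
    by (rule homotopic_cong[OF homotopic_refl[OF X X chom_id] X X]) (simp_all add: gf)
  show "homotopic Y Y (f \<circ>\<^sub>c g) id_map"
    by (rule homotopic_cong[OF homotopic_refl[OF Y Y chom_id] Y Y]) (simp_all add: fg)
qed (fact f, fact g)

lemma K_isomorphic_trans:
  assumes "X \<simeq>\<^sub>K Y" "Y \<simeq>\<^sub>K Z" "is_complex X" "is_complex Y" "is_complex Z" shows "X \<simeq>\<^sub>K Z"
  using assms K_iso_comp unfolding K_isomorphic_def by blast

definition cmap_sum :: "'a cmap \<Rightarrow> 'a cmap \<Rightarrow> 'a cmap" where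
  "cmap_sum f g = (\<lambda>i z. pair (f i (pr1 z)) (g i (pr2 z)))"

lemma chom_cmap_sum:
  assumes "f \<in> chom X X'" "g \<in> chom Y Y'"
  shows "cmap_sum f g \<in> chom (csum X Y) (csum X' Y')"
proof (rule chomI)
  show "cmap_sum f g i \<in> rhom (cobj (csum X Y) i) (cobj (csum X' Y') i)" for i
    using rhom_pair[OF rhom_comp[OF rhom_pr(1) chom_rhom[OF assms(1)]] rhom_comp[OF rhom_pr(2) chom_rhom[OF assms(2)]]]
    by (simp add: cmap_sum_def)
qed (use assms in \<open>simp add: cmap_sum_def chom_d\<close>)

lemma homotopic_cmap_sum_id:
  assumes h: "homotopic X X f id_map" and X: "is_complex X" and Y: "is_complex Y" and f: "f \<in> chom X X"
  shows "homotopic (csum X Y) (csum X Y) (cmap_sum f id_map) id_map"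
proof -
  obtain k where H: "homotopy X X k f id_map" by (rule homotopicE[OF h X X f chom_id])
  note k = homotopyD(1)[OF H X X] and kc = homotopyD(2-4)[OF H X X] and eq = homotopyD(5)[OF H X X]
  note rX = cobj_rm[OF X] and rY = cobj_rm[OF Y]
  show ?thesis
  proof (rule homotopicI[OF csum_complex[OF X Y] csum_complex[OF X Y] chom_cmap_sum[OF f chom_id] chom_id,
        where h = "\<lambda>i z. pair (k i (pr1 z)) \<zero>\<^bsub>cobj Y (i - 1)\<^esub>"])
    show "(\<lambda>z. pair (k i (pr1 z)) \<zero>\<^bsub>cobj Y (i - 1)\<^esub>) \<in> rhom (cobj (csum X Y) i) (cobj (csum X Y) (i - 1))" for i
      using rhom_comp[OF rhom_comp[OF rhom_pr(1) k] rhom_in(1)[OF rX rY]] by simp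
    fix i z assume z: "z \<in> carrier (cobj (csum X Y) i)"
    have "cdiff Y (i - 1) \<zero>\<^bsub>cobj Y (i - 1)\<^esub> = \<zero>\<^bsub>cobj Y i\<^esub>" using cdiff_zero[OF Y, of "i - 1"] by simp
    thus "cmap_sum f id_map i z = cdiff (csum X Y) (i - 1) (pair (k i (pr1 z)) \<zero>\<^bsub>cobj Y (i - 1)\<^esub>) \<oplus>\<^bsub>cobj (csum X Y) i\<^esub>
      pair (k (i + 1) (pr1 (cdiff (csum X Y) i z))) \<zero>\<^bsub>cobj Y (i + 1 - 1)\<^esub> \<oplus>\<^bsub>cobj (csum X Y) i\<^esub> id_map i z"
      using z eq[of "pr1 z" i] by (simp add: cmap_sum_def ag_simps ag_closed rY)
  qed
qed

lemma cmap_sum_comp: "cmap_sum f g \<circ>\<^sub>c cmap_sum f' g' = cmap_sum (f \<circ>\<^sub>c f') (g \<circ>\<^sub>c g')"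
  by (simp add: cmap_sum_def comp_map_def)

lemma K_iso_cmap_sum_id:
  assumes f: "K_iso X X' f" and c: "is_complex X" "is_complex X'" "is_complex Y"
  shows "K_iso (csum X Y) (csum X' Y) (cmap_sum f id_map)"
proof -
  obtain g where g: "f \<in> chom X X'" "g \<in> chom X' X" "homotopic X X (g \<circ>\<^sub>c f) id_map" "homotopic X' X' (f \<circ>\<^sub>c g) id_map"
    using f by (auto simp: K_iso_def)
  show ?thesis unfolding K_iso_def
  proof (intro conjI bexI)
    show "homotopic (csum X Y) (csum X Y) (cmap_sum g id_map \<circ>\<^sub>c cmap_sum f id_map) id_map"
      unfolding cmap_sum_comp id_comp by (rule homotopic_cmap_sum_id[OF g(3) c(1,3) chom_comp[OF g(1,2)]])
    show "homotopic (csum X' Y) (csum X' Y) (cmap_sum f id_map \<circ>\<^sub>c cmap_sum g id_map) id_map"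
      unfolding cmap_sum_comp id_comp by (rule homotopic_cmap_sum_id[OF g(4) c(2,3) chom_comp[OF g(2,1)]])
  qed (rule chom_cmap_sum[OF g(1) chom_id], rule chom_cmap_sum[OF g(2) chom_id])
qed

definition csum_assoc :: "'a cmap" where
  "csum_assoc = (\<lambda>i z. pair (pair (pr1 z) (pr1 (pr2 z))) (pr2 (pr2 z)))"

lemma K_iso_csum_assoc:
  assumes "is_complex A" "is_complex B" "is_complex C"
  shows "K_iso (csum A (csum B C)) (csum (csum A B) C) csum_assoc"
proof (rule K_iso_strict)
  show "csum_assoc \<in> chom (csum A (csum B C)) (csum (csum A B) C)"
    by (rule chomI) (auto intro!: rhomI simp: csum_assoc_def)
  show "(\<lambda>i z. pair (pr1 (pr1 z)) (pair (pr2 (pr1 z)) (pr2 z))) \<in> chom (csum (csum A B) C) (csum A (csum B C))"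
    by (rule chomI) (auto intro!: rhomI)
qed (use assms in \<open>auto simp: csum_assoc_def csum_complex\<close>)

lemma csum_comm:
  assumes "is_complex A" "is_complex B"
  shows "csum A B \<simeq>\<^sub>K csum B A"
  unfolding K_isomorphic_def
proof (intro exI K_iso_strict)
  show "(\<lambda>i z. pair (pr2 z) (pr1 z)) \<in> chom (csum A B) (csum B A)"
    by (rule chomI) (auto intro!: rhomI)
  show "(\<lambda>i z. pair (pr2 z) (pr1 z)) \<in> chom (csum B A) (csum A B)"
    by (rule chomI) (auto intro!: rhomI)
qed (use assms in \<open>auto simp: csum_complex\<close>)

lemma acyclic_contractible:
  assumes B: "B \<in> Kb_proj" and ac: "acyclic_cpx B"
  shows "B \<simeq>\<^sub>K zero_cpx"
proof -
  have c: "is_complex B" and z: "is_complex zero_cpx" using Kb_projD(2) B zero_cpx_Kb_proj by blast+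
  have 1: "homotopic B B id_map (zero_map B)" by (rule acyclic_null_homotopic[OF B c ac chom_id])
  have "homotopic B B (zero_map B) id_map" by (rule homotopic_sym[OF 1 c c chom_id chom_zero[OF c]])
  hence h1: "homotopic B B (zero_map B \<circ>\<^sub>c zero_map zero_cpx) id_map"
    by (rule homotopic_cong[OF _ c c]) (auto simp: zero_map_def)
  have h2: "homotopic zero_cpx zero_cpx (zero_map zero_cpx \<circ>\<^sub>c zero_map B) id_map"
    by (rule homotopic_cong[OF homotopic_refl[OF z z chom_id] z z]) (auto simp: zero_map_def)
  show ?thesis unfolding K_isomorphic_def K_iso_def
    using chom_zero[OF z, of B] chom_zero[OF c, of zero_cpx] h1 h2 by blast
qed

lemma K_iso_coboundary:
  assumes f: "K_iso X Y f" and X: "is_complex X" and Y: "is_complex Y"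
    and x: "x \<in> cocycles i X" "f i x \<in> coboundaries i Y"
  shows "x \<in> coboundaries i X"
proof -
  obtain g where g: "f \<in> chom X Y" "g \<in> chom Y X" "homotopic X X (g \<circ>\<^sub>c f) id_map"
    using f by (auto simp: K_iso_def)
  have q: "quasi_iso X X (g \<circ>\<^sub>c f)" by (rule quasi_iso_homotopic_id[OF X chom_comp[OF g(1,2)] g(3)])
  have "(g \<circ>\<^sub>c f) i x \<in> coboundaries i X"
    using x(2) chom_d'[OF g(2)] chom_closed[OF g(2)] by (auto simp: coboundaries_def)
  thus ?thesis by (rule quasi_iso_inj[OF X X q x(1)])
qed

text \<open>The preimage in the cocycles of \<open>X\<close> of the image of $\mathrm{H}^i(Y)$ in $\mathrm{H}^i(X)$.  Summands of \<open>X\<close> are compared through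
  submodules of the fixed modules $X^i$, whose dimensions are at hand.\<close>

definition cocycle_image :: "('a::{ring,monoid_mult}) cpx \<Rightarrow> 'a cpx \<Rightarrow> 'a cmap \<Rightarrow> int \<Rightarrow> (nat \<Rightarrow> 'a) set" where
  "cocycle_image Y X f i = {x \<oplus>\<^bsub>cobj X i\<^esub> y | x y. x \<in> f i ` cocycles i Y \<and> y \<in> coboundaries i X}"

lemma cocycle_image_rsubmodule:
  assumes "is_complex Y" "is_complex X" "f \<in> chom Y X"
  shows "rsubmodule (cocycle_image Y X f i) (cobj X i)"
  unfolding cocycle_image_def
  by (intro rsubmodule_sum rsubmodule_image[where M = "cobj Y i"] rsubmodule_coboundaries rsubmodule_cocycles
      cobj_rm chom_rhom assms)

context fd_algebra
begin

definition summand_size :: "'a cpx \<Rightarrow> 'a cpx \<Rightarrow> 'a cmap \<Rightarrow> nat" where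
  "summand_size Y X f = (\<Sum>i | \<not> zero_at X i. subdim (cobj X i) (cocycle_image Y X f i))"

lemma summand_size_less:
  assumes X: "X \<in> Cb_mod" and Y: "is_complex Y" "f \<in> chom Y X" and Y': "is_complex Y'" "f' \<in> chom Y' X"
    and le: "\<And>i. cocycle_image Y' X f' i \<subseteq> cocycle_image Y X f i"
    and neq: "cocycle_image Y' X f' i \<noteq> cocycle_image Y X f i"
  shows "summand_size Y' X f' < summand_size Y X f"
proof -
  have c: "is_complex X" and fin: "finite {i. \<not> zero_at X i}" using Cb_modD[OF X] by auto
  note m = cobj_mod_cat[OF c]
  note s = cocycle_image_rsubmodule[OF Y(1) c Y(2)] and s' = cocycle_image_rsubmodule[OF Y'(1) c Y'(2)]
  note mono = subdim_mono[OF m s s' le]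
  have nz: "\<not> zero_at X i"
  proof
    assume "zero_at X i"
    hence z: "carrier (cobj X i) = {\<zero>\<^bsub>cobj X i\<^esub>}" by (simp add: zero_at_def)
    have "cocycle_image Y X f i = {\<zero>\<^bsub>cobj X i\<^esub>}" "cocycle_image Y' X f' i = {\<zero>\<^bsub>cobj X i\<^esub>}"
      using right_module.rsubmoduleD(1,2)[OF cobj_rm[OF c] s, of i] right_module.rsubmoduleD(1,2)[OF cobj_rm[OF c] s', of i] z by auto
    thus False using neq by simp
  qed
  have "subdim (cobj X i) (cocycle_image Y' X f' i) < subdim (cobj X i) (cocycle_image Y X f i)"
    using mono(1)[of i] mono(2)[of i] neq by (meson le_neq_implies_less)
  thus ?thesis unfolding summand_size_def using nz mono(1) fin by (intro sum_strict_mono_ex1) auto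
qed

text \<open>The cocycle images of \<open>A\<close> lie in those of \<open>Y\<close>, a sum of \<open>A\<close> and \<open>B\<close>.  If they agreed in all degrees, each
  cocycle of \<open>B\<close> would differ from a cocycle of \<open>A\<close> by a coboundary inside \<open>X\<close>, hence inside
  \<open>A \<oplus> (B \<oplus> Z)\<close>; so \<open>B\<close> would be acyclic, and contractible as a complex of projectives.\<close>

lemma summand_shrink:
  fixes X :: "'a cpx"
  assumes X: "X \<in> Kb_proj" and Y: "Y \<in> Kb_proj" and Z: "Z \<in> Kb_proj" and c: "K_iso (csum Y Z) X c"
    and A: "A \<in> Kb_proj" and B: "B \<in> Kb_proj" and YAB: "Y \<simeq>\<^sub>K csum A B" and nB: "\<not> B \<simeq>\<^sub>K zero_cpx"
  obtains Z' c' where "Z' \<in> Kb_proj" "K_iso (csum A Z') X c'"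
    "summand_size A X (c' \<circ>\<^sub>c csum_in1 Z') < summand_size Y X (c \<circ>\<^sub>c csum_in1 Z)"
proof -
  note cc = Kb_projD(2)[OF X] Kb_projD(2)[OF Y] Kb_projD(2)[OF Z] Kb_projD(2)[OF A] Kb_projD(2)[OF B]
  have cBZ: "is_complex (csum B Z)" and cAB: "is_complex (csum A B)" and cYZ: "is_complex (csum Y Z)"
    using cc csum_complex by blast+
  obtain b where b: "K_iso (csum A B) Y b"
    using YAB K_iso_inverse unfolding K_isomorphic_def by metis
  note bc = K_iso_chom[OF b] and ch = K_iso_chom[OF c]
  define c' where "c' = c \<circ>\<^sub>c (cmap_sum b id_map \<circ>\<^sub>c csum_assoc)"
  have c'eq: "c' i z = c i (pair (b i (pair (pr1 z) (pr1 (pr2 z)))) (pr2 (pr2 z)))" for i z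
    by (simp add: c'_def cmap_sum_def csum_assoc_def)
  have c'iso: "K_iso (csum A (csum B Z)) X c'"
    unfolding c'_def
    by (intro K_iso_comp[OF K_iso_comp[OF K_iso_csum_assoc K_iso_cmap_sum_id[OF b]] c] cc csum_complex)
  note c'h = K_iso_chom[OF c'iso]
  have in1: "csum_in1 Z \<in> chom Y (csum Y Z)" "csum_in1 (csum B Z) \<in> chom A (csum A (csum B Z))" "csum_in1 B \<in> chom A (csum A B)"
    "csum_in2 A \<in> chom B (csum A B)"
    using csum_incl_proj cc cBZ by blast+
  note f = chom_comp[OF in1(1) ch] and f' = chom_comp[OF in1(2) c'h]
  note rX = cobj_rm[OF cc(1)] and rY = cobj_rm[OF cc(2)] and rZ = cobj_rm[OF cc(3)] and rA = cobj_rm[OF cc(4)]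
    and rB = cobj_rm[OF cc(5)]
  have f'f: "(c' \<circ>\<^sub>c csum_in1 (csum B Z)) i u = (c \<circ>\<^sub>c csum_in1 Z) i (b i (csum_in1 B i u))" for i u
    by (simp add: c'eq csum_in1_def)
  have bA: "b i (csum_in1 B i u) \<in> cocycles i Y" if "u \<in> cocycles i A" for i u
    using cocycles_chom[OF cAB cc(2) bc cocycles_chom[OF cc(4) cAB in1(3) that]] .
  have bB: "b i (csum_in2 A i v) \<in> cocycles i Y" if "v \<in> cocycles i B" for i v
    using cocycles_chom[OF cAB cc(2) bc cocycles_chom[OF cc(5) cAB in1(4) that]] .
  have le: "cocycle_image A X (c' \<circ>\<^sub>c csum_in1 (csum B Z)) i \<subseteq> cocycle_image Y X (c \<circ>\<^sub>c csum_in1 Z) i" for i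
    unfolding cocycle_image_def using f'f bA by blast
  have "\<exists>i. cocycle_image A X (c' \<circ>\<^sub>c csum_in1 (csum B Z)) i \<noteq> cocycle_image Y X (c \<circ>\<^sub>c csum_in1 Z) i"
  proof (rule ccontr)
    assume "\<not> (\<exists>i. cocycle_image A X (c' \<circ>\<^sub>c csum_in1 (csum B Z)) i \<noteq> cocycle_image Y X (c \<circ>\<^sub>c csum_in1 Z) i)"
    hence eq: "cocycle_image Y X (c \<circ>\<^sub>c csum_in1 Z) i = cocycle_image A X (c' \<circ>\<^sub>c csum_in1 (csum B Z)) i" for i by simp
    have "acyclic_cpx B" unfolding acyclic_cpx_def
    proof (intro allI ballI)
      fix i v assume v: "v \<in> cocycles i B"
      have vc: "v \<in> carrier (cobj B i)" "cdiff B i v = \<zero>\<^bsub>cobj B (i + 1)\<^esub>" using v by (auto simp: cocycles_def)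
      let ?y = "b i (csum_in2 A i v)"
      define w where "w = (c \<circ>\<^sub>c csum_in1 Z) i ?y"
      have wX: "w \<in> carrier (cobj X i)"
        unfolding w_def using chom_closed[OF f] bB[OF v] by (simp add: cocycles_def)
      have "w = w \<oplus>\<^bsub>cobj X i\<^esub> \<zero>\<^bsub>cobj X i\<^esub>" using wX by (simp add: ag_simps rX)
      moreover have "\<zero>\<^bsub>cobj X i\<^esub> \<in> coboundaries i X"
        by (rule right_module.rsubmoduleD(2)[OF rX rsubmodule_coboundaries[OF cc(1)]])
      ultimately have "w \<in> cocycle_image Y X (c \<circ>\<^sub>c csum_in1 Z) i"
        unfolding cocycle_image_def using bB[OF v] by (auto simp: w_def)
      hence "w \<in> cocycle_image A X (c' \<circ>\<^sub>c csum_in1 (csum B Z)) i" by (simp only: eq)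
      then obtain u \<beta> where u: "u \<in> cocycles i A" "\<beta> \<in> coboundaries i X"
        "w = (c' \<circ>\<^sub>c csum_in1 (csum B Z)) i u \<oplus>\<^bsub>cobj X i\<^esub> \<beta>"
        unfolding cocycle_image_def by blast
      have uc: "u \<in> carrier (cobj A i)" "cdiff A i u = \<zero>\<^bsub>cobj A (i + 1)\<^esub>" using u by (auto simp: cocycles_def)
      define ev where "ev = pair \<zero>\<^bsub>cobj A i\<^esub> (pair v \<zero>\<^bsub>cobj Z i\<^esub>)"
      define eu where "eu = pair u (pair \<zero>\<^bsub>cobj B i\<^esub> \<zero>\<^bsub>cobj Z i\<^esub>)"
      have evc: "ev \<in> carrier (cobj (csum A (csum B Z)) i)" and euc: "eu \<in> carrier (cobj (csum A (csum B Z)) i)"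
        using vc uc by (auto simp: ev_def eu_def ag_closed rA rB rZ)
      have cev: "c' i ev = w" by (simp add: c'eq ev_def w_def csum_in1_def csum_in2_def)
      have ceu: "c' i eu = (c' \<circ>\<^sub>c csum_in1 (csum B Z)) i u" by (simp add: eu_def csum_in1_def)
      note rS = cobj_rm[OF csum_complex[OF cc(4) cBZ]]
      have \<beta>c: "\<beta> \<in> carrier (cobj X i)" using right_module.rsubmoduleD(1)[OF rX rsubmodule_coboundaries[OF cc(1)]] u(2) by blast
      have "c' i (ev \<ominus>\<^bsub>cobj (csum A (csum B Z)) i\<^esub> eu) = c' i ev \<ominus>\<^bsub>cobj X i\<^esub> c' i eu"
        by (rule rhom_minus[OF rS rX chom_rhom[OF c'h] evc euc])
      also have "\<dots> = \<beta>"
        unfolding cev using u(3) ceu chom_closed[OF c'h euc] \<beta>c wX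
        by (subst ag_minus_iff[OF rX]) (auto simp: ag_ac rX)
      finally have "c' i (ev \<ominus>\<^bsub>cobj (csum A (csum B Z)) i\<^esub> eu) \<in> coboundaries i X" using u(2) by simp
      moreover have "ev \<in> cocycles i (csum A (csum B Z))" "eu \<in> cocycles i (csum A (csum B Z))"
        using evc euc vc uc cdiff_zero[OF cc(3)] cdiff_zero[OF cc(4)] cdiff_zero[OF cc(5)]
        by (auto simp: cocycles_def ev_def eu_def)
      hence "ev \<ominus>\<^bsub>cobj (csum A (csum B Z)) i\<^esub> eu \<in> cocycles i (csum A (csum B Z))"
        by (rule right_module.rsubmoduleD(6)[OF rS rsubmodule_cocycles[OF csum_complex[OF cc(4) cBZ]]])
      ultimately have "ev \<ominus>\<^bsub>cobj (csum A (csum B Z)) i\<^esub> eu \<in> coboundaries i (csum A (csum B Z))"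
        using K_iso_coboundary[OF c'iso csum_complex[OF cc(4) cBZ] cc(1)] by blast
      then obtain t where t: "t \<in> carrier (cobj (csum A (csum B Z)) (i - 1))"
        "ev \<ominus>\<^bsub>cobj (csum A (csum B Z)) i\<^esub> eu = cdiff (csum A (csum B Z)) (i - 1) t"
        by (auto simp: coboundaries_def)
      have "pr1 (pr2 (ev \<ominus>\<^bsub>cobj (csum A (csum B Z)) i\<^esub> eu)) = v \<ominus>\<^bsub>cobj B i\<^esub> \<zero>\<^bsub>cobj B i\<^esub>"
        unfolding csum_simps using vc uc
        by (subst dsum_minus[OF rA dsum_right_module[OF rB rZ]], (simp_all add: ev_def eu_def ag_closed rA rB rZ)[2])
          (subst pr_pair, subst dsum_minus[OF rB rZ], (simp_all add: ev_def eu_def ag_closed rA rB rZ))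
      hence "v = cdiff B (i - 1) (pr1 (pr2 t))" using t(2) vc by (simp add: ag_minus_zero rB)
      thus "v \<in> coboundaries i B" using t(1) by (auto simp: coboundaries_def)
    qed
    thus False using acyclic_contractible[OF B] nB by blast
  qed
  then obtain i where "cocycle_image A X (c' \<circ>\<^sub>c csum_in1 (csum B Z)) i \<noteq> cocycle_image Y X (c \<circ>\<^sub>c csum_in1 Z) i" by blast
  hence "summand_size A X (c' \<circ>\<^sub>c csum_in1 (csum B Z)) < summand_size Y X (c \<circ>\<^sub>c csum_in1 Z)"
    by (rule summand_size_less[OF Kb_projD(1)[OF X] cc(2) f cc(4) f' le])
  thus ?thesis using that[OF csum_Kb_proj[OF B Z] c'iso] by blast
qed

text \<open>The part of the Krull-Schmidt theorem that vanishing needs: among the summands of \<open>X\<close> with a nonzero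
  morphism to $M[-j]$, one of least size is indecomposable, since a proper decomposition would have a
  smaller summand of the same kind.\<close>

lemma indecomposable_not_vanish:
  fixes X :: "'a cpx"
  assumes X: "X \<in> Kb_proj" and M: "right_module M" and nv: "\<not> hom_vanish X M j"
  obtains Y where "indecomposable Y" "summand Y X" "\<not> hom_vanish Y M j"
proof -
  define P where "P = (\<lambda>(Y, Z, c). Y \<in> Kb_proj \<and> Z \<in> Kb_proj \<and> K_iso (csum Y Z) X c \<and> \<not> hom_vanish Y M j)"
  define \<mu> where "\<mu> = (\<lambda>(Y, Z, c). summand_size Y X (c \<circ>\<^sub>c csum_in1 Z))"
  note cX = Kb_projD(2)[OF X] and cz = Kb_projD(2)[OF zero_cpx_Kb_proj]
  have "K_iso (csum X zero_cpx) X csum_pr1"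
    by (rule K_iso_strict[OF csum_complex[OF cX cz] cX csum_incl_proj(3)[OF cX cz] csum_incl_proj(1)[OF cX cz]])
      (auto simp: csum_pr1_def csum_in1_def, metis pr_pair(3))
  hence "P (X, zero_cpx, csum_pr1)" using X zero_cpx_Kb_proj nv by (simp add: P_def)
  then obtain t where t: "P t" "\<And>t'. P t' \<Longrightarrow> \<mu> t \<le> \<mu> t'"
    using ex_has_least_nat[of P "(X, zero_cpx, csum_pr1)" \<mu>] by blast
  obtain Y Z c where tt: "t = (Y, Z, c)" by (cases t)
  have YZ: "Y \<in> Kb_proj" "Z \<in> Kb_proj" "K_iso (csum Y Z) X c" and nY: "\<not> hom_vanish Y M j"
    using t(1) by (auto simp: P_def tt)
  note cY = Kb_projD(2)[OF YZ(1)]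
  have minimal: "hom_vanish A M j \<or> B \<simeq>\<^sub>K zero_cpx"
    if AB: "A \<in> Kb_proj" "B \<in> Kb_proj" "Y \<simeq>\<^sub>K csum A B" for A B
  proof (rule ccontr)
    assume n: "\<not> (hom_vanish A M j \<or> B \<simeq>\<^sub>K zero_cpx)"
    obtain Z' c' where Z': "Z' \<in> Kb_proj" "K_iso (csum A Z') X c'"
      "summand_size A X (c' \<circ>\<^sub>c csum_in1 Z') < summand_size Y X (c \<circ>\<^sub>c csum_in1 Z)"
      using summand_shrink[OF X YZ AB] n by blast
    have "P (A, Z', c')" using Z' AB n by (simp add: P_def)
    from t(2)[OF this] show False using Z'(3) by (simp add: tt \<mu>_def)
  qed
  have "indecomposable Y" unfolding indecomposable_def
  proof (intro conjI ballI impI YZ(1) notI)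
    assume "Y \<simeq>\<^sub>K zero_cpx"
    hence "K_retract Y zero_cpx" by (rule K_isomorphic_retract(1)[OF _ cY cz])
    moreover have "hom_vanish zero_cpx M j" by (rule hom_vanish_zero_at[OF cz M]) (simp add: zero_at_def)
    ultimately show False using hom_vanish_retract[OF _ M] nY by blast
  next
    fix A B assume AB: "A \<in> Kb_proj" "B \<in> Kb_proj" "Y \<simeq>\<^sub>K csum A B"
    note cA = Kb_projD(2)[OF AB(1)] and cB = Kb_projD(2)[OF AB(2)]
    have "Y \<simeq>\<^sub>K csum B A"
      by (rule K_isomorphic_trans[OF AB(3) csum_comm[OF cA cB] cY csum_complex[OF cA cB] csum_complex[OF cB cA]])
    moreover have "\<not> (hom_vanish A M j \<and> hom_vanish B M j)"
      using hom_vanish_csum[OF cA cB M] hom_vanish_retract[OF K_isomorphic_retract(1)[OF AB(3) cY csum_complex[OF cA cB]] M] nY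
      by blast
    ultimately show "A \<simeq>\<^sub>K zero_cpx \<or> B \<simeq>\<^sub>K zero_cpx"
      using minimal[OF AB] minimal[OF AB(2,1)] by blast
  qed
  moreover have "summand Y X" unfolding summand_def K_isomorphic_def using YZ by blast
  ultimately show ?thesis using that nY by blast
qed

lemma hom_vanish_indec_summands:
  fixes X :: "'a cpx"
  assumes X: "X \<in> Kb_proj" and M: "right_module M" and I: "indec_summands X I"
  shows "hom_vanish X M j \<longleftrightarrow> (\<forall>Y\<in>I. hom_vanish Y M j)"
proof
  assume "hom_vanish X M j"
  thus "\<forall>Y\<in>I. hom_vanish Y M j"
    using I hom_vanish_summand[OF _ Kb_projD(2)[OF X] M] by (auto simp: indec_summands_def)
next
  assume v: "\<forall>Y\<in>I. hom_vanish Y M j"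
  show "hom_vanish X M j"
  proof (rule ccontr)
    assume "\<not> hom_vanish X M j"
    then obtain Y where Y: "indecomposable Y" "summand Y X" "\<not> hom_vanish Y M j"
      using indecomposable_not_vanish[OF X M] by blast
    then obtain Z where Z: "Z \<in> I" "Y \<simeq>\<^sub>K Z" using I unfolding indec_summands_def by blast
    have c: "is_complex Y" "is_complex Z"
      using Y(1) Z(1) I Kb_projD(2) by (auto simp: indec_summands_def indecomposable_def)
    have "hom_vanish Y M j"
      by (rule hom_vanish_retract[OF K_isomorphic_retract(1)[OF Z(2) c] M]) (use v Z(1) in blast)
    thus False using Y(3) by simp
  qed
qed

end

section \<open>The semistable subcategory\<close>

text \<open>The elements of \<open>quot_mod\<close> are cosets; \<open>mod_cat_universal\<close> replaces them by sequences.\<close>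

lemma quotient_object:
  fixes M :: "('a::{ring,monoid_mult}) obj"
  assumes M: "M \<in> mod_cat" and L: "rsubmodule L M"
  obtains N p where "N \<in> mod_cat" "p \<in> rhom M N" "p ` carrier M = carrier N"
    "{x \<in> carrier M. p x = \<zero>\<^bsub>N\<^esub>} = L"
proof -
  interpret M: right_module M by (rule mod_catD(1)[OF M])
  let ?Q = "quot_mod M L"
  note q = M.quot_simps[OF L]
  have rQ: "right_module ?Q" by (rule M.quot_right_module[OF L])
  have pQ: "(\<lambda>x. L +>\<^bsub>M\<^esub> x) \<in> rhom M ?Q" by (rule M.quot_rhom[OF L])
  have "fin_gen ?Q" by (rule fin_gen_image[OF M.right_module_axioms rQ pQ q(1)[symmetric] mod_catD(2)[OF M]])
  hence "fg_module ?Q" using rQ by (simp add: fg_module_def)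
  then obtain N f where N: "N \<in> mod_cat" "f \<in> rhom ?Q N" "bij_betw f (carrier ?Q) (carrier N)"
    using mod_cat_universal by blast
  note rN = mod_catD(1)[OF N(1)]
  have p: "(\<lambda>x. f (L +>\<^bsub>M\<^esub> x)) \<in> rhom M N" by (rule rhom_comp[OF pQ N(2)])
  have im: "(\<lambda>x. f (L +>\<^bsub>M\<^esub> x)) ` carrier M = carrier N"
    using N(3) unfolding bij_betw_def q(1) image_image by blast
  have "f (L +>\<^bsub>M\<^esub> x) = \<zero>\<^bsub>N\<^esub> \<longleftrightarrow> x \<in> L" if x: "x \<in> carrier M" for x
  proof -
    have "f (L +>\<^bsub>M\<^esub> x) = \<zero>\<^bsub>N\<^esub> \<longleftrightarrow> f (L +>\<^bsub>M\<^esub> x) = f (L +>\<^bsub>M\<^esub> \<zero>\<^bsub>M\<^esub>)"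
      using rhom_zero[OF M.right_module_axioms rN p] by simp
    also have "\<dots> \<longleftrightarrow> L +>\<^bsub>M\<^esub> x = L +>\<^bsub>M\<^esub> \<zero>\<^bsub>M\<^esub>"
      using N(3) x M.zero_closed by (auto simp: bij_betw_def q(1) dest: inj_onD)
    also have "\<dots> \<longleftrightarrow> x \<in> L"
      using x ag_minus_zero[OF M.right_module_axioms x] by (simp add: M.a_coset_eq_iff[OF L])
    finally show ?thesis .
  qed
  hence "{x \<in> carrier M. f (L +>\<^bsub>M\<^esub> x) = \<zero>\<^bsub>N\<^esub>} = L" using M.rsubmoduleD(1)[OF L] by blast
  thus ?thesis using that[OF N(1) p im] by blast
qed

theorem theorem1p3:
  fixes scale :: "'k::field \<Rightarrow> 'a::{ring,monoid_mult} \<Rightarrow> 'a"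
    and T Tl Tr T' T'' :: "'a cpx"
    and u v w :: "'a cmap"
    and I :: "'a cpx set"
    and a :: "'a cpx \<Rightarrow> real"
    and \<theta> :: "'a K0_elem \<Rightarrow> real"
  assumes "fd_algebra scale"
    and "silting T" and "two_term T" and "basic T"
    and "Tl \<in> Kb_proj" and "Tr \<in> Kb_proj" and "T \<simeq>\<^sub>K csum Tl Tr"
    and "dist_triangle (stalk regular) T' T'' u v w"
    and "add_cat T' = add_cat Tl" and "add_cat T'' = add_cat Tr"
    and "indec_summands Tr I"
    and "\<forall>X\<in>I. 0 < a X"
    and "\<forall>c\<in>K0_real. \<theta> c = (\<Sum>X\<in>I. a X * euler_form scale X c)"
  shows "W_cat T Tr = semistable \<theta>"
proof -
  interpret fd_algebra scale by fact
  have ps: "presilting T" using assms(2) by (simp add: silting_def)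
  have TK: "T \<in> Kb_proj" using ps by (simp add: presilting_def)
  note two = assms(3) and Tl = assms(5) and Tr = assms(6) and I = assms(11)
  note cT = Kb_projD(2)[OF TK] and cTl = Kb_projD(2)[OF Tl] and cTr = Kb_projD(2)[OF Tr]
  have cS: "is_complex (csum Tl Tr)" by (rule csum_complex[OF cTl cTr])
  have rS: "K_retract (csum Tl Tr) T" by (rule K_isomorphic_retract(2)[OF assms(7) cT cS])
  have Tl_T: "hom_vanish Tl M j" and Tr_T: "hom_vanish Tr M j" if "hom_vanish T M j" "right_module M" for M j
    using hom_vanish_retract[OF csum_retract(1)[OF cTl cTr] that(2)] hom_vanish_retract[OF csum_retract(2)[OF cTl cTr] that(2)]
      hom_vanish_retract[OF rS that(2,1)] by blast+
  have sT: "splits_at_1 T" by (rule splits_at_1_two_term[OF cT two])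
  have sTr: "splits_at_1 Tr" by (rule splits_at_1_retract[OF csum_retract(2)[OF cTl cTr] splits_at_1_retract[OF rS sT]])
  have fI: "finite I" and XK: "\<And>X. X \<in> I \<Longrightarrow> X \<in> Kb_proj" and apos: "\<And>X. X \<in> I \<Longrightarrow> 0 < a X"
    using I assms(12) by (auto simp: indec_summands_def indecomposable_def)
  note Tr_I = hom_vanish_indec_summands[OF Tr _ I]
  define e where "e X M = real_of_int (euler scale X (stalk M))" for X M
  have \<theta>: "\<theta> (K0_class M) = (\<Sum>X\<in>I. a X * e X M)" if M: "M \<in> mod_cat" for M
    using assms(13) K0_class_in_real[OF M] euler_form_class[OF XK M] by (simp add: e_def)
  \<comment> \<open>\<open>p\<close> and \<open>q\<close> are the dimensions of $\mathrm{Hom}(X, M)$ and $\mathrm{Hom}(X, M[1])$.\<close>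
  have ep: "\<exists>p q :: nat. e X M = real p - real q \<and> (p = 0 \<longleftrightarrow> hom_vanish X M 0) \<and> (q = 0 \<longleftrightarrow> hom_vanish X M (- 1))"
    if X: "X \<in> I" and M: "M \<in> mod_cat" for X M
  proof -
    have "hom_vanish X M j" if j: "j \<noteq> 0" "j \<noteq> - 1" for j
    proof -
      have "hom_vanish T M j"
        by (rule hom_vanish_zero_at[OF cT mod_catD(1)[OF M]]) (use two j in \<open>simp add: two_term_def\<close>)
      hence "hom_vanish Tr M j" by (rule Tr_T[OF _ mod_catD(1)[OF M]])
      thus ?thesis using X Tr_I[OF mod_catD(1)[OF M]] by blast
    qed
    then obtain p q :: nat where "euler scale X (stalk M) = int p - int q"
      "p = 0 \<longleftrightarrow> hom_vanish X M 0" "q = 0 \<longleftrightarrow> hom_vanish X M (- 1)"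
      using euler_two_term[OF XK[OF X] M] by blast
    thus ?thesis by (intro exI[of _ p] exI[of _ q]) (simp add: e_def)
  qed
  have nonneg: "0 \<le> e X M" "e X M = 0 \<longleftrightarrow> hom_vanish X M 0"
    if "X \<in> I" "M \<in> mod_cat" "hom_vanish X M (- 1)" for X M
    using ep[OF that(1,2)] that(3) by auto
  have nonpos: "e X M \<le> 0" "e X M = 0 \<longleftrightarrow> hom_vanish X M (- 1)"
    if "X \<in> I" "M \<in> mod_cat" "hom_vanish X M 0" for X M
    using ep[OF that(1,2)] that(3) by auto
  have sub: "M\<lparr>carrier := L\<rparr> \<in> mod_cat" if "M \<in> mod_cat" "rsubmodule L M" for M :: "'a obj" and L
    by (rule mod_cat_sub[OF that])
  show ?thesis
  proof (intro equalityI subsetI)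
    fix M assume "M \<in> W_cat T Tr"
    hence Fac: "M \<in> Fac (cohom 0 T)" and perp: "M \<in> perp (cohom 0 Tr)" by (auto simp: W_cat_def)
    have M: "M \<in> mod_cat" using Fac by (simp add: Fac_def)
    note rM = mod_catD(1)[OF M]
    have "trace_sub T M (carrier M)" using Fac Fac_cohom_iff[OF cT two M] by simp
    from trace_sub_vanish[OF ps two M this] have vT: "hom_vanish T M (- 1)" by simp
    have v0: "hom_vanish Tr M 0" using perp perp_cohom_iff[OF cTr sTr M] by simp
    have "e X M = 0" if X: "X \<in> I" for X
      using nonneg(2)[OF X M] X v0 Tr_T[OF vT rM] Tr_I[OF rM] by blast
    hence 1: "\<theta> (K0_class M) = 0" by (simp add: \<theta>[OF M])
    have 2: "\<theta> (K0_class (M\<lparr>carrier := L\<rparr>)) \<le> 0" if L: "rsubmodule L M" for L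
    proof -
      note N = sub[OF M L]
      have "hom_vanish Tr (M\<lparr>carrier := L\<rparr>) 0" by (rule hom_vanish_0_sub[OF cTr sTr rM L v0])
      hence "e X (M\<lparr>carrier := L\<rparr>) \<le> 0" if X: "X \<in> I" for X
        using nonpos(1)[OF X N] X Tr_I[OF mod_catD(1)[OF N]] by blast
      thus ?thesis unfolding \<theta>[OF N] using apos by (intro sum_nonpos mult_nonneg_nonpos) (auto intro: less_imp_le)
    qed
    show "M \<in> semistable \<theta>" using M 1 2 by (simp add: semistable_def)
  next
    fix M assume "M \<in> semistable \<theta>"
    hence M: "M \<in> mod_cat" and \<theta>M: "\<theta> (K0_class M) = 0"
      and \<theta>L: "\<And>L. rsubmodule L M \<Longrightarrow> \<theta> (K0_class (M\<lparr>carrier := L\<rparr>)) \<le> 0"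
      by (auto simp: semistable_def)
    note rM = mod_catD(1)[OF M]
    obtain L where L: "trace_sub T M L"
      and mx: "\<And>g y. g \<in> rhom (cobj T 0) M \<Longrightarrow> (\<And>x. x \<in> carrier (cobj T (- 1)) \<Longrightarrow> g (cdiff T (- 1) x) = \<zero>\<^bsub>M\<^esub>) \<Longrightarrow>
        y \<in> carrier (cobj T 0) \<Longrightarrow> g y \<in> L"
      using trace_sub_max[OF cT M] by blast
    have rL: "rsubmodule L M" by (rule trace_sub_rsubmodule[OF L cT rM])
    let ?L = "M\<lparr>carrier := L\<rparr>"
    note cL = sub[OF M rL]
    note rmL = mod_catD(1)[OF cL]
    obtain N p where N: "N \<in> mod_cat" "p \<in> rhom M N" "p ` carrier M = carrier N"
      "{x \<in> carrier M. p x = \<zero>\<^bsub>N\<^esub>} = L"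
      using quotient_object[OF M rL] by blast
    note rN = mod_catD(1)[OF N(1)]
    note Ls = right_module.rsubmoduleD[OF rM rL]
    have ex: "short_exact ?L M N" unfolding short_exact_def
    proof (intro conjI cL M N(1) bexI)
      show "(\<lambda>x. x) \<in> rhom ?L M" by (rule rhom_restrict[OF rhom_id Ls(1)])
      show "(\<lambda>x. x) ` carrier ?L = {x \<in> carrier M. p x = \<zero>\<^bsub>N\<^esub>}" using N(4) by simp
    qed (use N in auto)
    have eM: "e X M = e X ?L + e X N" if "X \<in> I" for X
      using euler_exact[OF XK[OF that] ex] by (simp add: e_def)
    \<comment> \<open>\<open>\<theta>\<close> is a sum of nonnegative terms on the trace \<open>L\<close>, and of nonpositive ones on \<open>N = M / L\<close>.\<close>
    have vL: "hom_vanish X ?L (- 1)" if "X \<in> I" for X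
      using Tr_T[OF trace_sub_vanish[OF ps two M L] rmL] that Tr_I[OF rmL] by blast
    have vT: "hom_vanish T N 0" 
      by (rule trace_quotient_vanish[OF ps two M N(1) L _ N(2-4)]) (erule mx)
    have vN: "hom_vanish X N 0" if "X \<in> I" for X
      using Tr_T[OF vT rN] that Tr_I[OF rN] by blast
    have L0: "0 \<le> a X * e X ?L" if "X \<in> I" for X
      using nonneg(1)[OF that cL vL[OF that]] apos[OF that] by simp
    have "\<theta> (K0_class ?L) = 0"
      using \<theta>L[OF rL] sum_nonneg[of I "\<lambda>X. a X * e X ?L"] L0 unfolding \<theta>[OF cL] by (intro antisym) auto
    hence eL: "e X ?L = 0" if "X \<in> I" for X
      using sum_nonneg_eq_0_iff[OF fI, of "\<lambda>X. a X * e X ?L"] L0 that apos[OF that] unfolding \<theta>[OF cL] by auto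
    have N0: "0 \<le> a X * - e X N" if "X \<in> I" for X
      using nonpos(1)[OF that N(1) vN[OF that]] apos[OF that] by (simp add: mult_nonneg_nonpos)
    have "(\<Sum>X\<in>I. a X * - e X N) = 0"
      using \<theta>M unfolding \<theta>[OF M] by (simp add: eM eL sum_negf)
    hence eN: "e X N = 0" if "X \<in> I" for X
      using sum_nonneg_eq_0_iff[OF fI, of "\<lambda>X. a X * - e X N"] N0 that apos[OF that] by auto
    \<comment> \<open>Now $\mathrm{Hom}(\Lambda, N)$ sits between $\mathrm{Hom}(T', N) = 0$ and $\mathrm{Hom}(T'', N[1]) = 0$ in the triangle.\<close>
    have vTr: "hom_vanish Tr N (- 1)"
      unfolding Tr_I[OF rN] using nonpos(2)[OF _ N(1) vN] eN by blast
    have K: "stalk (regular :: 'a obj) \<in> Kb_proj" "T' \<in> Kb_proj" "T'' \<in> Kb_proj"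
      using assms(8) by (auto simp: dist_triangle_def)
    obtain X' Y' f \<alpha> \<beta> \<gamma> where t: "X' \<in> Kb_proj" "Y' \<in> Kb_proj" "f \<in> chom X' Y'"
      "K_iso (stalk regular) X' \<alpha>" "K_iso T' Y' \<beta>" "K_iso T'' (cone X' Y' f) \<gamma>"
      using assms(8) unfolding dist_triangle_def by blast
    note cK = Kb_projD(2)[OF K(1)] Kb_projD(2)[OF K(2)] Kb_projD(2)[OF K(3)] Kb_projD(2)[OF t(1)] Kb_projD(2)[OF t(2)]
    have cC: "is_complex (cone X' Y' f)" by (rule cone_complex[OF cK(4,5) t(3)])
    have "T'' \<in> add_cat Tr" using self_in_add_cat[OF K(3)] assms(10) by simp
    hence "hom_vanish T'' N (- 1)" by (rule hom_vanish_add_cat[OF _ cTr rN vTr])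
    hence vC: "hom_vanish (cone X' Y' f) N (- 1)"
      by (rule hom_vanish_retract[OF K_iso_retract(2)[OF t(6) cK(3) cC] rN])
    have "T' \<in> add_cat Tl" using self_in_add_cat[OF K(2)] assms(9) by simp
    hence "hom_vanish T' N 0" by (rule hom_vanish_add_cat[OF _ cTl rN Tl_T[OF vT rN]])
    hence vY: "hom_vanish Y' N 0" by (rule hom_vanish_retract[OF K_iso_retract(2)[OF t(5) cK(2,5)] rN])
    have "hom_vanish X' N 0" by (rule hom_vanish_cone[OF cK(4,5) t(3) rN vY vC])
    hence "hom_vanish (stalk regular) N 0" by (rule hom_vanish_retract[OF K_iso_retract(1)[OF t(4) cK(1,4)] rN])
    hence "carrier N = {\<zero>\<^bsub>N\<^esub>}" by (rule hom_vanish_regular[OF cK(1) rN])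
    hence LM: "L = carrier M" using N(3,4) by blast
    have "M \<in> Fac (cohom 0 T)" using L LM Fac_cohom_iff[OF cT two M] by simp
    moreover have "hom_vanish X M 0" if "X \<in> I" for X
      using nonneg(2)[OF that cL vL[OF that]] eL[OF that] LM by simp
    hence "M \<in> perp (cohom 0 Tr)"
      using perp_cohom_iff[OF cTr sTr M] Tr_I[OF rM] by blast
    ultimately show "M \<in> W_cat T Tr" by (simp add: W_cat_def)
  qed
qed

end
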